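(* Let $\mathcal{C}$ be a finitely complete $(\infty,1)$-category and $\Phi$ a product closed filter on $\mathcal{C}$. Then a map $f$ in $\mathcal{C}_\Phi$ is an equivalence if and only if there exists $U\in\Phi$ such that $f\times\mathrm{id}_U$ is an equivalence in $\mathcal{C}$.
   Context: An $(\infty,1)$-category means a quasi-category, Kan enriched category or complete Segal space (CSS). A product closed filter on $\mathcal{C}$ is a subset $\Phi$ of the poset $\mathrm{Sub}(1)$ of subobjects of the final object $1$ that contains $1$, is closed under finite products and is upward closed. Filter quotient $\mathcal{C}_\Phi$: for a finitely complete CSS $\mathcal{W}$, $\mathcal{W}_\Phi=\mathrm{colim}_{V\in\Phi^{op}}\mathcal{W}_{/V}$, the level-wise colimit of bisimplicial sets with transition maps $-\times U:\mathcal{W}_{/V}\to\mathcal{W}_{/U}$ for $U\leq V$; for quasi-categories analogously; for a Kan enriched category $\mathcal{K}$, $\mathcal{K}_\Phi$ has the objects of $\mathcal{K}$ and $\mathrm{Map}_{\mathcal{K}_\Phi}(X,Y)=\mathrm{colim}_{V\in\Phi^{op}}\mathrm{Map}_{\mathcal{K}}(X\times V,Y)$, with composition $[g]\circ[f]=[g(f\times\mathrm{id}_V)]$. Objects $X$ of $\mathcal{C}$ are regarded as objects of $\mathcal{C}_\Phi$ via the canonical functor $P_\Phi:\mathcal{C}\to\mathcal{C}_\Phi$, and $\mathrm{Map}_{\mathcal{C}_\Phi}(X,Y)=\mathrm{colim}_{V\in\Phi^{op}}\mathrm{Map}_{\mathcal{C}}(X\times V,Y\times V)$. Thus a map $f:X\to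 Y$ in $\mathcal{C}_\Phi$ is represented by a map $X\times V\to Y\times V$ in $\mathcal{C}$ for some $V\in\Phi$ (with $V=1$ for maps coming from $\mathcal{C}$), and $f\times\mathrm{id}_U$ denotes the product of such a representative with $\mathrm{id}_U$. *)

theory Defs
  imports Main "HOL-Library.FuncSet"
begin

section \<open>Simplicial sets\<close>

text \<open>A monotone map from \<open>[m]\<close> to \<open>[n]\<close> is the sorted list of its \<open>m + 1\<close> values. Thus
  \<open>Act X n \<alpha> x\<close> is the pullback of the \<open>n\<close>-simplex \<open>x\<close> along \<open>\<alpha>\<close>; for instance the edge from vertex
  0 to vertex 2 of a 2-simplex \<open>\<sigma>\<close> is \<open>Act X 2 [0,2] \<sigma>\<close>, and the degenerate edge at a vertex \<open>x\<close> is
  \<open>Act X 0 [0,0] x\<close>. The dimension of \<open>Act X n \<alpha> x\<close> is \<open>length \<alpha> - 1\<close>.\<close>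

definition ord :: "nat \<Rightarrow> nat \<Rightarrow> nat list set" where
  "ord m n = {\<alpha>. length \<alpha> = Suc m \<and> sorted \<alpha> \<and> set \<alpha> \<subseteq> {..n}}"

definition idl :: "nat \<Rightarrow> nat list" where
  "idl n = [0..<Suc n]"

definition ocomp :: "nat list \<Rightarrow> nat list \<Rightarrow> nat list" where
  "ocomp \<alpha> \<beta> = map ((!) \<alpha>) \<beta>"

definition const_op :: "nat \<Rightarrow> nat \<Rightarrow> nat list" where
  "const_op n i = replicate (Suc n) i"

record 'a sset =
  Smp :: "nat \<Rightarrow> 'a set"
  Act :: "nat \<Rightarrow> nat list \<Rightarrow> 'a \<Rightarrow> 'a"

definition simplicial_set :: "'a sset \<Rightarrow> bool" where
  "simplicial_set X \<longleftrightarrow>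
    (\<forall>m n. \<forall>\<alpha>\<in>ord m n. \<forall>x\<in>Smp X n. Act X n \<alpha> x \<in> Smp X m) \<and>
    (\<forall>n. \<forall>x\<in>Smp X n. Act X n (idl n) x = x) \<and>
    (\<forall>k m n. \<forall>\<alpha>\<in>ord m n. \<forall>\<beta>\<in>ord k m. \<forall>x\<in>Smp X n.
       Act X m \<beta> (Act X n \<alpha> x) = Act X n (ocomp \<alpha> \<beta>) x)"

definition simplicial_map :: "'a sset \<Rightarrow> 'b sset \<Rightarrow> (nat \<Rightarrow> 'a \<Rightarrow> 'b) \<Rightarrow> bool" where
  "simplicial_map X Y f \<longleftrightarrow>
    (\<forall>n. \<forall>x\<in>Smp X n. f n x \<in> Smp Y n) \<and>
    (\<forall>m n. \<forall>\<alpha>\<in>ord m n. \<forall>x\<in>Smp X n. f m (Act X n \<alpha> x) = Act Y n \<alpha> (f n x))"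

definition Delta :: "nat \<Rightarrow> nat list sset" where
  "Delta n = \<lparr>Smp = (\<lambda>m. ord m n), Act = (\<lambda>m \<alpha> x. ocomp x \<alpha>)\<rparr>"

definition sprod :: "'a sset \<Rightarrow> 'b sset \<Rightarrow> ('a \<times> 'b) sset" where
  "sprod X Y = \<lparr>Smp = (\<lambda>n. Smp X n \<times> Smp Y n),
                Act = (\<lambda>n \<alpha> (x, y). (Act X n \<alpha> x, Act Y n \<alpha> y))\<rparr>"

text \<open>The totally degenerate \<open>n\<close>-simplex on a vertex.\<close>

definition degs :: "'a sset \<Rightarrow> nat \<Rightarrow> 'a \<Rightarrow> 'a" where
  "degs X n x = Act X 0 (const_op n 0) x"

definition edge :: "'a sset \<Rightarrow> 'a \<Rightarrow> 'a \<Rightarrow> 'a \<Rightarrow> bool" where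
  "edge C f x y \<longleftrightarrow> f \<in> Smp C 1 \<and> Act C 1 [0] f = x \<and> Act C 1 [1] f = y"

definition boundary :: "nat \<Rightarrow> nat list set" where
  "boundary n = {\<alpha>. \<exists>m. \<alpha> \<in> ord m n \<and> set \<alpha> \<noteq> {..n}}"

definition horn :: "nat \<Rightarrow> nat \<Rightarrow> nat list set" where
  "horn n k = {\<alpha>. \<exists>m. \<alpha> \<in> ord m n \<and> insert k (set \<alpha>) \<noteq> {..n}}"

text \<open>Simplicial maps into \<open>X\<close> from a simplicial subset \<open>A\<close> of the standard \<open>n\<close>-simplex, and their
  extensions to the whole simplex.\<close>

definition partial_simplex :: "'a sset \<Rightarrow> nat \<Rightarrow> nat list set \<Rightarrow> (nat list \<Rightarrow> 'a) \<Rightarrow> bool" where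
  "partial_simplex X n A g \<longleftrightarrow>
    (\<forall>m. \<forall>\<alpha>\<in>A \<inter> ord m n. g \<alpha> \<in> Smp X m \<and>
       (\<forall>k. \<forall>\<beta>\<in>ord k m. g (ocomp \<alpha> \<beta>) = Act X m \<beta> (g \<alpha>)))"

definition fills :: "'a sset \<Rightarrow> nat \<Rightarrow> nat list set \<Rightarrow> (nat list \<Rightarrow> 'a) \<Rightarrow> 'a \<Rightarrow> bool" where
  "fills X n A g x \<longleftrightarrow> x \<in> Smp X n \<and> (\<forall>\<alpha>\<in>A. Act X n \<alpha> x = g \<alpha>)"

definition kan_complex :: "'a sset \<Rightarrow> bool" where
  "kan_complex X \<longleftrightarrow> simplicial_set X \<and>
    (\<forall>n k g. 1 \<le> n \<and> k \<le> n \<and> partial_simplex X n (horn n k) g \<longrightarrow> (\<exists>x. fills X n (horn n k) g x))"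

text \<open>Contractibility of Kan complexes: every sphere, including the empty one, has a filler.\<close>

definition contractible :: "'a sset \<Rightarrow> bool" where
  "contractible X \<longleftrightarrow>
    (\<forall>n g. partial_simplex X n (boundary n) g \<longrightarrow> (\<exists>x. fills X n (boundary n) g x))"

definition homotopic :: "'a sset \<Rightarrow> 'b sset \<Rightarrow> (nat \<Rightarrow> 'a \<Rightarrow> 'b) \<Rightarrow> (nat \<Rightarrow> 'a \<Rightarrow> 'b) \<Rightarrow> bool" where
  "homotopic X Y f g \<longleftrightarrow>
    (\<exists>H. simplicial_map (sprod X (Delta 1)) Y H \<and>
      (\<forall>n. \<forall>x\<in>Smp X n. H n (x, const_op n 0) = f n x \<and> H n (x, const_op n 1) = g n x))"

text \<open>Only used between Kan complexes, where weak equivalences are homotopy equivalences.\<close>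

definition kan_equivalence :: "'a sset \<Rightarrow> 'b sset \<Rightarrow> (nat \<Rightarrow> 'a \<Rightarrow> 'b) \<Rightarrow> bool" where
  "kan_equivalence X Y f \<longleftrightarrow> simplicial_map X Y f \<and>
    (\<exists>g. simplicial_map Y X g \<and>
      homotopic X X (\<lambda>n x. g n (f n x)) (\<lambda>n x. x) \<and>
      homotopic Y Y (\<lambda>n y. f n (g n y)) (\<lambda>n y. y))"

text \<open>The function complex of maps from the 1-simplex to \<open>X\<close>: its \<open>n\<close>-simplices are the simplicial maps
  from the product of the standard \<open>n\<close>-simplex with the standard 1-simplex to \<open>X\<close>.\<close>

definition prism :: "nat \<Rightarrow> (nat list \<times> nat list) set" where
  "prism n = {(\<alpha>, \<beta>). \<exists>k. \<alpha> \<in> ord k n \<and> \<beta> \<in> ord k 1}"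

definition prism_maps :: "'a sset \<Rightarrow> nat \<Rightarrow> (nat list \<times> nat list \<Rightarrow> 'a) set" where
  "prism_maps X n = {\<phi> \<in> extensional (prism n).
     \<forall>k. \<forall>\<alpha>\<in>ord k n. \<forall>\<beta>\<in>ord k 1. \<phi> (\<alpha>, \<beta>) \<in> Smp X k \<and>
       (\<forall>m. \<forall>\<theta>\<in>ord m k. \<phi> (ocomp \<alpha> \<theta>, ocomp \<beta> \<theta>) = Act X k \<theta> (\<phi> (\<alpha>, \<beta>)))}"

definition prism_act :: "nat list \<Rightarrow> (nat list \<times> nat list \<Rightarrow> 'a) \<Rightarrow> (nat list \<times> nat list \<Rightarrow> 'a)" where
  "prism_act \<theta> \<phi> = restrict (\<lambda>(\<alpha>, \<beta>). \<phi> (ocomp \<theta> \<alpha>, \<beta>)) (prism (length \<theta> - 1))"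


section \<open>Subobjects of the final object and product closed filters\<close>

text \<open>Since maps into the final object are essentially unique, a subobject of it is given by its
  domain. Below \<open>S\<close> is the set of objects whose map to the final object is a monomorphism and \<open>R U V\<close>
  says that there is a map from \<open>U\<close> to \<open>V\<close> (necessarily over the final object). The poset of
  subobjects consists of the classes of \<open>S\<close> modulo mutual \<open>R\<close>.\<close>

definition sub_class :: "'o set \<Rightarrow> ('o \<Rightarrow> 'o \<Rightarrow> bool) \<Rightarrow> 'o \<Rightarrow> 'o set" where
  "sub_class S R U = {V \<in> S. R U V \<and> R V U}"

definition sub_poset :: "'o set \<Rightarrow> ('o \<Rightarrow> 'o \<Rightarrow> bool) \<Rightarrow> 'o set set" where
  "sub_poset S R = sub_class S R ` S"

definition sub_le :: "('o \<Rightarrow> 'o \<Rightarrow> bool) \<Rightarrow> 'o set \<Rightarrow> 'o set \<Rightarrow> bool" where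
  "sub_le R u v \<longleftrightarrow> (\<exists>U\<in>u. \<exists>V\<in>v. R U V)"

text \<open>\<open>IsFinal e\<close>: \<open>e\<close> is a final object; \<open>IsProd P U V\<close>: \<open>P\<close> is a product of \<open>U\<close> and \<open>V\<close>.\<close>

definition product_closed_filter ::
  "'o set \<Rightarrow> ('o \<Rightarrow> 'o \<Rightarrow> bool) \<Rightarrow> ('o \<Rightarrow> bool) \<Rightarrow> ('o \<Rightarrow> 'o \<Rightarrow> 'o \<Rightarrow> bool) \<Rightarrow> 'o set set \<Rightarrow> bool" where
  "product_closed_filter S R IsFinal IsProd \<Phi> \<longleftrightarrow>
    \<Phi> \<subseteq> sub_poset S R \<and>
    (\<forall>e. IsFinal e \<longrightarrow> sub_class S R e \<in> \<Phi>) \<and>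
    (\<forall>u\<in>\<Phi>. \<forall>v\<in>\<Phi>. \<forall>U\<in>u. \<forall>V\<in>v. \<forall>P. IsProd P U V \<longrightarrow> sub_class S R P \<in> \<Phi>) \<and>
    (\<forall>u\<in>\<Phi>. \<forall>v\<in>sub_poset S R. sub_le R u v \<longrightarrow> v \<in> \<Phi>)"


section \<open>Filtered colimits\<close>

text \<open>Colimit of the sets \<open>D v\<close> along maps \<open>t v w\<close> for \<open>w \<le> v\<close>. The index poset is downward directed
  (a filter closed under products), so two elements are identified iff they agree at a common later
  stage. The class of \<open>a \<in> D v\<close> is the set of its representatives.\<close>

definition colim_class ::
  "'i set \<Rightarrow> ('i \<Rightarrow> 'i \<Rightarrow> bool) \<Rightarrow> ('i \<Rightarrow> 'a set) \<Rightarrow> ('i \<Rightarrow> 'i \<Rightarrow> 'a \<Rightarrow> 'a) \<Rightarrow> 'i \<Rightarrow> 'a \<Rightarrow> ('i \<times> 'a) set" where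
  "colim_class I le D t v a =
     {(u, b). u \<in> I \<and> b \<in> D u \<and> (\<exists>w\<in>I. le w v \<and> le w u \<and> t v w a = t u w b)}"

definition colim_sset ::
  "'i set \<Rightarrow> ('i \<Rightarrow> 'i \<Rightarrow> bool) \<Rightarrow> ('i \<Rightarrow> 'a sset) \<Rightarrow> ('i \<Rightarrow> 'i \<Rightarrow> nat \<Rightarrow> 'a \<Rightarrow> 'a) \<Rightarrow> ('i \<times> 'a) set sset" where
  "colim_sset I le D t =
    (let cls = (\<lambda>n. colim_class I le (\<lambda>v. Smp (D v) n) (\<lambda>v w. t v w n)) in
     \<lparr>Smp = (\<lambda>n. {cls n v a | v a. v \<in> I \<and> a \<in> Smp (D v) n}),
      Act = (\<lambda>n \<alpha> c. let (v, a) = SOME p. p \<in> c in cls (length \<alpha> - 1) v (Act (D v) n \<alpha> a))\<rparr>)"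


section \<open>Quasi-categories\<close>

definition quasi_category :: "'a sset \<Rightarrow> bool" where
  "quasi_category C \<longleftrightarrow> simplicial_set C \<and>
    (\<forall>n k g. 0 < k \<and> k < n \<and> partial_simplex C n (horn n k) g \<longrightarrow> (\<exists>x. fills C n (horn n k) g x))"

definition qc_id :: "'a sset \<Rightarrow> 'a \<Rightarrow> 'a" where
  "qc_id C x = Act C 0 [0,0] x"

text \<open>\<open>h\<close> is a composite of \<open>f\<close> followed by \<open>g\<close>.\<close>

definition qc_composite :: "'a sset \<Rightarrow> 'a \<Rightarrow> 'a \<Rightarrow> 'a \<Rightarrow> bool" where
  "qc_composite C f g h \<longleftrightarrow>
    (\<exists>\<sigma>\<in>Smp C 2. Act C 2 [0,1] \<sigma> = f \<and> Act C 2 [1,2] \<sigma> = g \<and> Act C 2 [0,2] \<sigma> = h)"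

definition qc_equiv :: "'a sset \<Rightarrow> 'a \<Rightarrow> bool" where
  "qc_equiv C f \<longleftrightarrow> (\<exists>x y g. edge C f x y \<and> edge C g y x \<and>
     qc_composite C f g (qc_id C x) \<and> qc_composite C g f (qc_id C y))"

definition qc_slice :: "'a sset \<Rightarrow> 'a \<Rightarrow> 'a sset" where
  "qc_slice C c = \<lparr>Smp = (\<lambda>n. {\<sigma> \<in> Smp C (Suc n). Act C (Suc n) [Suc n] \<sigma> = c}),
                   Act = (\<lambda>n \<alpha> \<sigma>. Act C (Suc n) (\<alpha> @ [Suc n]) \<sigma>)\<rparr>"

definition qc_forget :: "'a sset \<Rightarrow> nat \<Rightarrow> 'a \<Rightarrow> 'a" where
  "qc_forget C n \<sigma> = Act C (Suc n) (idl n) \<sigma>"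

definition qc_final :: "'a sset \<Rightarrow> 'a \<Rightarrow> bool" where
  "qc_final C e \<longleftrightarrow> e \<in> Smp C 0 \<and>
    (\<forall>n g. 1 \<le> n \<and> partial_simplex C n (boundary n) g \<and> g [n] = e \<longrightarrow>
      (\<exists>x. fills C n (boundary n) g x))"

text \<open>The slice of \<open>C\<close> over the diagram consisting of the two objects \<open>a\<close> and \<open>b\<close>.\<close>

definition qc_cone :: "'a sset \<Rightarrow> 'a \<Rightarrow> 'a \<Rightarrow> ('a \<times> 'a) sset" where
  "qc_cone C a b =
    \<lparr>Smp = (\<lambda>n. {(\<sigma>, \<tau>). \<sigma> \<in> Smp (qc_slice C a) n \<and> \<tau> \<in> Smp (qc_slice C b) n \<and>
                   qc_forget C n \<sigma> = qc_forget C n \<tau>}),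
     Act = (\<lambda>n \<alpha> (\<sigma>, \<tau>). (Act (qc_slice C a) n \<alpha> \<sigma>, Act (qc_slice C b) n \<alpha> \<tau>))\<rparr>"

definition qc_product :: "'a sset \<Rightarrow> 'a \<Rightarrow> 'a \<Rightarrow> 'a \<Rightarrow> 'a \<Rightarrow> 'a \<Rightarrow> bool" where
  "qc_product C P p q a b \<longleftrightarrow> edge C p P a \<and> edge C q P b \<and> qc_final (qc_cone C a b) (p, q)"

text \<open>Finitely complete means having a final object and pullbacks. Pullbacks of edges \<open>f\<close>, \<open>g\<close> with target \<open>c\<close> are products in the slice over \<open>c\<close>; the cone
  construction in the slice is literally the slice of \<open>C\<close> over the cospan \<open>(f, g)\<close>.\<close>

definition qc_finitely_complete :: "'a sset \<Rightarrow> bool" where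
  "qc_finitely_complete C \<longleftrightarrow> (\<exists>e. qc_final C e) \<and>
    (\<forall>c\<in>Smp C 0. \<forall>f\<in>Smp (qc_slice C c) 0. \<forall>g\<in>Smp (qc_slice C c) 0.
       \<exists>P p q. qc_product (qc_slice C c) P p q f g)"

text \<open>An edge is a monomorphism, that is (-1)-truncated, iff its diagonal is an equivalence, that is,
  iff its domain with identity projections is a pullback of the edge along itself.\<close>

definition qc_mono :: "'a sset \<Rightarrow> 'a \<Rightarrow> bool" where
  "qc_mono C m \<longleftrightarrow> m \<in> Smp C 1 \<and>
    (let S = qc_slice C (Act C 1 [1] m) in qc_product S m (qc_id S m) (qc_id S m) m m)"

definition qc_subobjects :: "'a sset \<Rightarrow> 'a set" where
  "qc_subobjects C = {U. \<exists>e m. qc_final C e \<and> edge C m U e \<and> qc_mono C m}"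

definition qc_map_exists :: "'a sset \<Rightarrow> 'a \<Rightarrow> 'a \<Rightarrow> bool" where
  "qc_map_exists C U V \<longleftrightarrow> (\<exists>i. edge C i U V)"

definition qc_filter :: "'a sset \<Rightarrow> 'a set set \<Rightarrow> bool" where
  "qc_filter C = product_closed_filter (qc_subobjects C) (qc_map_exists C) (qc_final C)
     (\<lambda>P U V. \<exists>p q. qc_product C P p q U V)"

text \<open>\<open>t\<close> is a functor of the form \<open>- \<times> U\<close> from the slice over \<open>V\<close> to the slice over \<open>U\<close>: there is a
  natural transformation from \<open>t\<close> to the identity (after forgetting to \<open>C\<close>) whose component at
  an object \<open>A \<rightarrow> V\<close>, together with the structure map of \<open>t A\<close>, is a product of \<open>A\<close> and \<open>U\<close>.\<close>

definition qc_product_functor :: "'a sset \<Rightarrow> 'a \<Rightarrow> 'a \<Rightarrow> (nat \<Rightarrow> 'a \<Rightarrow> 'a) \<Rightarrow> bool" where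
  "qc_product_functor C V U t \<longleftrightarrow>
    simplicial_map (qc_slice C V) (qc_slice C U) t \<and>
    (\<exists>H. simplicial_map (sprod (qc_slice C V) (Delta 1)) C H \<and>
      (\<forall>n. \<forall>\<sigma>\<in>Smp (qc_slice C V) n. H n (\<sigma>, const_op n 0) = qc_forget C n (t n \<sigma>) \<and>
                                       H n (\<sigma>, const_op n 1) = qc_forget C n \<sigma>) \<and>
      (\<forall>\<sigma>\<in>Smp (qc_slice C V) 0.
         qc_product C (qc_forget C 0 (t 0 \<sigma>)) (H 1 (qc_id (qc_slice C V) \<sigma>, [0,1])) (t 0 \<sigma>)
           (qc_forget C 0 \<sigma>) U))"

text \<open>The diagram whose colimit is the filter quotient: a representing object \<open>rep v\<close> of every
  \<open>v \<in> \<Phi>\<close> and strictly functorial product functors between the slices.\<close>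

definition qc_diagram ::
  "'a sset \<Rightarrow> 'a set set \<Rightarrow> ('a set \<Rightarrow> 'a) \<Rightarrow> ('a set \<Rightarrow> 'a set \<Rightarrow> nat \<Rightarrow> 'a \<Rightarrow> 'a) \<Rightarrow> bool" where
  "qc_diagram C \<Phi> rep t \<longleftrightarrow>
    (\<forall>v\<in>\<Phi>. rep v \<in> v) \<and>
    (\<forall>v\<in>\<Phi>. \<forall>u\<in>\<Phi>. sub_le (qc_map_exists C) u v \<longrightarrow> qc_product_functor C (rep v) (rep u) (t v u)) \<and>
    (\<forall>v\<in>\<Phi>. \<forall>n. \<forall>\<sigma>\<in>Smp (qc_slice C (rep v)) n. t v v n \<sigma> = \<sigma>) \<and>
    (\<forall>v\<in>\<Phi>. \<forall>u\<in>\<Phi>. \<forall>w\<in>\<Phi>. sub_le (qc_map_exists C) u v \<and> sub_le (qc_map_exists C) w u \<longrightarrow>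
       (\<forall>n. \<forall>\<sigma>\<in>Smp (qc_slice C (rep v)) n. t u w n (t v u n \<sigma>) = t v w n \<sigma>))"

definition qc_quotient ::
  "'a sset \<Rightarrow> 'a set set \<Rightarrow> ('a set \<Rightarrow> 'a) \<Rightarrow> ('a set \<Rightarrow> 'a set \<Rightarrow> nat \<Rightarrow> 'a \<Rightarrow> 'a) \<Rightarrow> ('a set \<times> 'a) set sset" where
  "qc_quotient C \<Phi> rep t = colim_sset \<Phi> (sub_le (qc_map_exists C)) (\<lambda>v. qc_slice C (rep v)) t"

text \<open>The edge \<open>h\<close> is a product of the edge \<open>f\<close> with the identity of \<open>U\<close>: its domain and codomain are
  products with \<open>U\<close>, and it is compatible with the projections to \<open>f\<close> and to \<open>U\<close>. Such an \<open>h\<close> is unique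
  up to equivalence.\<close>

definition qc_times_id :: "'a sset \<Rightarrow> 'a \<Rightarrow> 'a \<Rightarrow> 'a \<Rightarrow> bool" where
  "qc_times_id C f U h \<longleftrightarrow>
    (\<exists>A B P Q p q p' q' k. edge C f A B \<and> edge C h P Q \<and>
      qc_product C P p q A U \<and> qc_product C Q p' q' B U \<and>
      qc_composite C p f k \<and> qc_composite C h p' k \<and> qc_composite C h q' q)"


section \<open>Kan enriched categories\<close>

text \<open>\<open>Comp K X Y Z n g f\<close> is the composite of the \<open>n\<close>-simplices \<open>g\<close> of \<open>Hom K Y Z\<close> and \<open>f\<close> of
  \<open>Hom K X Y\<close>.\<close>

record ('o, 'm) ecat =
  Objs :: "'o set"
  Hom :: "'o \<Rightarrow> 'o \<Rightarrow> 'm sset"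
  Comp :: "'o \<Rightarrow> 'o \<Rightarrow> 'o \<Rightarrow> nat \<Rightarrow> 'm \<Rightarrow> 'm \<Rightarrow> 'm"
  Ident :: "'o \<Rightarrow> 'm"

definition kan_enriched :: "('o, 'm) ecat \<Rightarrow> bool" where
  "kan_enriched K \<longleftrightarrow>
    (\<forall>X\<in>Objs K. \<forall>Y\<in>Objs K. kan_complex (Hom K X Y)) \<and>
    (\<forall>X\<in>Objs K. Ident K X \<in> Smp (Hom K X X) 0) \<and>
    (\<forall>X\<in>Objs K. \<forall>Y\<in>Objs K. \<forall>Z\<in>Objs K.
       simplicial_map (sprod (Hom K Y Z) (Hom K X Y)) (Hom K X Z) (\<lambda>n (g, f). Comp K X Y Z n g f)) \<and>
    (\<forall>W\<in>Objs K. \<forall>X\<in>Objs K. \<forall>Y\<in>Objs K. \<forall>Z\<in>Objs K. \<forall>n.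
       \<forall>h\<in>Smp (Hom K Y Z) n. \<forall>g\<in>Smp (Hom K X Y) n. \<forall>f\<in>Smp (Hom K W X) n.
         Comp K W X Z n (Comp K X Y Z n h g) f = Comp K W Y Z n h (Comp K W X Y n g f)) \<and>
    (\<forall>X\<in>Objs K. \<forall>Y\<in>Objs K. \<forall>n. \<forall>f\<in>Smp (Hom K X Y) n.
       Comp K X X Y n f (degs (Hom K X X) n (Ident K X)) = f \<and>
       Comp K X Y Y n (degs (Hom K Y Y) n (Ident K Y)) f = f)"

definition ec_equiv :: "('o, 'm) ecat \<Rightarrow> 'o \<Rightarrow> 'o \<Rightarrow> 'm \<Rightarrow> bool" where
  "ec_equiv K X Y f \<longleftrightarrow> f \<in> Smp (Hom K X Y) 0 \<and>
    (\<exists>g\<in>Smp (Hom K Y X) 0.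
      (\<exists>s. edge (Hom K X X) s (Comp K X Y X 0 g f) (Ident K X)) \<and>
      (\<exists>s. edge (Hom K Y Y) s (Comp K Y X Y 0 f g) (Ident K Y)))"

definition ec_post :: "('o, 'm) ecat \<Rightarrow> 'o \<Rightarrow> 'o \<Rightarrow> 'o \<Rightarrow> 'm \<Rightarrow> nat \<Rightarrow> 'm \<Rightarrow> 'm" where
  "ec_post K T A B f n x = Comp K T A B n (degs (Hom K A B) n f) x"

definition ec_final :: "('o, 'm) ecat \<Rightarrow> 'o \<Rightarrow> bool" where
  "ec_final K e \<longleftrightarrow> e \<in> Objs K \<and> (\<forall>X\<in>Objs K. contractible (Hom K X e))"

definition ec_product :: "('o, 'm) ecat \<Rightarrow> 'o \<Rightarrow> 'm \<Rightarrow> 'm \<Rightarrow> 'o \<Rightarrow> 'o \<Rightarrow> bool" where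
  "ec_product K P p q A B \<longleftrightarrow> P \<in> Objs K \<and> p \<in> Smp (Hom K P A) 0 \<and> q \<in> Smp (Hom K P B) 0 \<and>
    (\<forall>T\<in>Objs K. kan_equivalence (Hom K T P) (sprod (Hom K T A) (Hom K T B))
       (\<lambda>n x. (ec_post K T P A p n x, ec_post K T P B q n x)))"

text \<open>The homotopy pullback of \<open>Hom(T,A) \<rightarrow> Hom(T,C) \<leftarrow> Hom(T,B)\<close>: triples of a simplex of \<open>Hom(T,A)\<close>,
  a simplex of the path object of \<open>Hom(T,C)\<close> and a simplex of \<open>Hom(T,B)\<close> with matching ends.\<close>

definition ec_hpb :: "('o, 'm) ecat \<Rightarrow> 'o \<Rightarrow> 'o \<Rightarrow> 'o \<Rightarrow> 'o \<Rightarrow> 'm \<Rightarrow> 'm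
    \<Rightarrow> ('m \<times> (nat list \<times> nat list \<Rightarrow> 'm) \<times> 'm) sset" where
  "ec_hpb K T A B C f g =
    \<lparr>Smp = (\<lambda>n. {(a, \<gamma>, b). a \<in> Smp (Hom K T A) n \<and> b \<in> Smp (Hom K T B) n \<and>
        \<gamma> \<in> prism_maps (Hom K T C) n \<and>
        \<gamma> (idl n, const_op n 0) = ec_post K T A C f n a \<and>
        \<gamma> (idl n, const_op n 1) = ec_post K T B C g n b}),
     Act = (\<lambda>n \<alpha> (a, \<gamma>, b). (Act (Hom K T A) n \<alpha> a, prism_act \<alpha> \<gamma>, Act (Hom K T B) n \<alpha> b))\<rparr>"

text \<open>\<open>\<eta>\<close> is a homotopy from \<open>f p\<close> to \<open>g q\<close> exhibiting \<open>P\<close> as a homotopy pullback of \<open>f\<close> and \<open>g\<close>.\<close>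

definition ec_pullback ::
  "('o, 'm) ecat \<Rightarrow> 'o \<Rightarrow> 'm \<Rightarrow> 'm \<Rightarrow> 'm \<Rightarrow> 'o \<Rightarrow> 'o \<Rightarrow> 'o \<Rightarrow> 'm \<Rightarrow> 'm \<Rightarrow> bool" where
  "ec_pullback K P p q \<eta> A B C f g \<longleftrightarrow>
    P \<in> Objs K \<and> p \<in> Smp (Hom K P A) 0 \<and> q \<in> Smp (Hom K P B) 0 \<and>
    edge (Hom K P C) \<eta> (Comp K P A C 0 f p) (Comp K P B C 0 g q) \<and>
    (\<forall>T\<in>Objs K. kan_equivalence (Hom K T P) (ec_hpb K T A B C f g)
      (\<lambda>n x. (ec_post K T P A p n x,
              restrict (\<lambda>(\<alpha>, \<beta>). Comp K T P C (length \<alpha> - 1)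
                 (Act (Hom K P C) 1 \<beta> \<eta>) (Act (Hom K T P) n \<alpha> x)) (prism n),
              ec_post K T P B q n x)))"

definition ec_finitely_complete :: "('o, 'm) ecat \<Rightarrow> bool" where
  "ec_finitely_complete K \<longleftrightarrow> (\<exists>e. ec_final K e) \<and>
    (\<forall>A\<in>Objs K. \<forall>B\<in>Objs K. \<forall>C\<in>Objs K. \<forall>f\<in>Smp (Hom K A C) 0. \<forall>g\<in>Smp (Hom K B C) 0.
       \<exists>P p q \<eta>. ec_pullback K P p q \<eta> A B C f g)"

definition ec_mono :: "('o, 'm) ecat \<Rightarrow> 'o \<Rightarrow> 'o \<Rightarrow> 'm \<Rightarrow> bool" where
  "ec_mono K A B m \<longleftrightarrow> A \<in> Objs K \<and> B \<in> Objs K \<and> m \<in> Smp (Hom K A B) 0 \<and>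
    ec_pullback K A (Ident K A) (Ident K A) (degs (Hom K A B) 1 m) A A B m m"

definition ec_subobjects :: "('o, 'm) ecat \<Rightarrow> 'o set" where
  "ec_subobjects K = {U. \<exists>e m. ec_final K e \<and> ec_mono K U e m}"

definition ec_map_exists :: "('o, 'm) ecat \<Rightarrow> 'o \<Rightarrow> 'o \<Rightarrow> bool" where
  "ec_map_exists K U V \<longleftrightarrow> Smp (Hom K U V) 0 \<noteq> {}"

definition ec_filter :: "('o, 'm) ecat \<Rightarrow> 'o set set \<Rightarrow> bool" where
  "ec_filter K = product_closed_filter (ec_subobjects K) (ec_map_exists K) (ec_final K)
     (\<lambda>P U V. \<exists>p q. ec_product K P p q U V)"

text \<open>The data used in the formulas for the filter quotient. For \<open>g (f \<times> id)\<close> to be an enriched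
  composition, the products \<open>X \<times> V\<close> with \<open>V \<in> \<Phi>\<close> have to be strict (enriched) products, and for
  the mapping spaces \<open>Hom(X \<times> V, Y)\<close> to form a diagram, the inclusions between the
  representing objects of the elements of \<open>\<Phi>\<close> have to compose strictly.\<close>

record ('o, 'm) ec_choice =
  erep :: "'o set \<Rightarrow> 'o"
  etimes :: "'o \<Rightarrow> 'o set \<Rightarrow> 'o"
  pr1 :: "'o \<Rightarrow> 'o set \<Rightarrow> 'm"
  pr2 :: "'o \<Rightarrow> 'o set \<Rightarrow> 'm"
  incl :: "'o set \<Rightarrow> 'o set \<Rightarrow> 'm"

definition ec_strict_product :: "('o, 'm) ecat \<Rightarrow> 'o \<Rightarrow> 'm \<Rightarrow> 'm \<Rightarrow> 'o \<Rightarrow> 'o \<Rightarrow> bool" where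
  "ec_strict_product K P p q A B \<longleftrightarrow>
    P \<in> Objs K \<and> p \<in> Smp (Hom K P A) 0 \<and> q \<in> Smp (Hom K P B) 0 \<and>
    (\<forall>T\<in>Objs K. \<forall>n. bij_betw (\<lambda>x. (ec_post K T P A p n x, ec_post K T P B q n x))
       (Smp (Hom K T P) n) (Smp (Hom K T A) n \<times> Smp (Hom K T B) n))"

definition ec_diagram :: "('o, 'm) ecat \<Rightarrow> 'o set set \<Rightarrow> ('o, 'm) ec_choice \<Rightarrow> bool" where
  "ec_diagram K \<Phi> c \<longleftrightarrow>
    (\<forall>v\<in>\<Phi>. erep c v \<in> v) \<and>
    (\<forall>X\<in>Objs K. \<forall>v\<in>\<Phi>. ec_strict_product K (etimes c X v) (pr1 c X v) (pr2 c X v) X (erep c v)) \<and>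
    (\<forall>u\<in>\<Phi>. \<forall>v\<in>\<Phi>. sub_le (ec_map_exists K) u v \<longrightarrow> incl c u v \<in> Smp (Hom K (erep c u) (erep c v)) 0) \<and>
    (\<forall>v\<in>\<Phi>. incl c v v = Ident K (erep c v)) \<and>
    (\<forall>u\<in>\<Phi>. \<forall>v\<in>\<Phi>. \<forall>w\<in>\<Phi>. sub_le (ec_map_exists K) u v \<and> sub_le (ec_map_exists K) w u \<longrightarrow>
       Comp K (erep c w) (erep c u) (erep c v) 0 (incl c u v) (incl c w u) = incl c w v)"

text \<open>The simplex of \<open>Hom(T, X \<times> V)\<close> with components \<open>a\<close> and \<open>b\<close>.\<close>

definition ec_pair :: "('o, 'm) ecat \<Rightarrow> ('o, 'm) ec_choice \<Rightarrow> 'o \<Rightarrow> 'o \<Rightarrow> 'o set \<Rightarrow> nat \<Rightarrow> 'm \<Rightarrow> 'm \<Rightarrow> 'm" where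
  "ec_pair K c T X v n a b = (THE x. x \<in> Smp (Hom K T (etimes c X v)) n \<and>
     ec_post K T (etimes c X v) X (pr1 c X v) n x = a \<and>
     ec_post K T (etimes c X v) (erep c v) (pr2 c X v) n x = b)"

text \<open>For an \<open>n\<close>-simplex \<open>f\<close> of \<open>Hom(X \<times> V, Y)\<close>: the simplex \<open>f \<times> id\<close> of \<open>Hom(X \<times> V, Y \<times> V)\<close>, whose
  second component is the projection to \<open>V\<close>.\<close>

definition ec_over :: "('o, 'm) ecat \<Rightarrow> ('o, 'm) ec_choice \<Rightarrow> 'o \<Rightarrow> 'o \<Rightarrow> 'o set \<Rightarrow> nat \<Rightarrow> 'm \<Rightarrow> 'm" where
  "ec_over K c X Y v n f = ec_pair K c (etimes c X v) Y v n f
     (degs (Hom K (etimes c X v) (erep c v)) n (pr2 c X v))"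

text \<open>For a map \<open>f\<close> from \<open>A\<close> to \<open>B\<close>: the product map from \<open>A \<times> U\<close> to \<open>B \<times> U\<close>.\<close>

definition ec_times_id :: "('o, 'm) ecat \<Rightarrow> ('o, 'm) ec_choice \<Rightarrow> 'o \<Rightarrow> 'o \<Rightarrow> 'm \<Rightarrow> 'o set \<Rightarrow> 'm" where
  "ec_times_id K c A B f u = ec_pair K c (etimes c A u) B u 0
     (Comp K (etimes c A u) A B 0 f (pr1 c A u)) (pr2 c A u)"

text \<open>Restriction along \<open>X \<times> W \<rightarrow> X \<times> V\<close> for \<open>W \<le> V\<close>.\<close>

definition ec_restrict ::
  "('o, 'm) ecat \<Rightarrow> ('o, 'm) ec_choice \<Rightarrow> 'o \<Rightarrow> 'o \<Rightarrow> 'o set \<Rightarrow> 'o set \<Rightarrow> nat \<Rightarrow> 'm \<Rightarrow> 'm" where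
  "ec_restrict K c X Y v w n f =
    (let XW = etimes c X w; XV = etimes c X v;
         i = ec_pair K c XW X v 0 (pr1 c X w)
               (Comp K XW (erep c w) (erep c v) 0 (incl c w v) (pr2 c X w))
     in Comp K XW XV Y n f (degs (Hom K XW XV) n i))"

definition ec_class :: "('o, 'm) ecat \<Rightarrow> 'o set set \<Rightarrow> ('o, 'm) ec_choice \<Rightarrow> 'o \<Rightarrow> 'o \<Rightarrow> nat
    \<Rightarrow> 'o set \<Rightarrow> 'm \<Rightarrow> ('o set \<times> 'm) set" where
  "ec_class K \<Phi> c X Y n = colim_class \<Phi> (sub_le (ec_map_exists K))
     (\<lambda>v. Smp (Hom K (etimes c X v) Y) n) (\<lambda>v w. ec_restrict K c X Y v w n)"

definition ec_quotient :: "('o, 'm) ecat \<Rightarrow> 'o set set \<Rightarrow> ('o, 'm) ec_choice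
    \<Rightarrow> ('o, ('o set \<times> 'm) set) ecat" where
  "ec_quotient K \<Phi> c =
    \<lparr>Objs = Objs K,
     Hom = (\<lambda>X Y. colim_sset \<Phi> (sub_le (ec_map_exists K))
              (\<lambda>v. Hom K (etimes c X v) Y) (ec_restrict K c X Y)),
     Comp = (\<lambda>X Y Z n \<gamma> \<phi>. THE \<psi>. \<exists>v f g. (v, f) \<in> \<phi> \<and> (v, g) \<in> \<gamma> \<and>
              \<psi> = ec_class K \<Phi> c X Z n v
                    (Comp K (etimes c X v) (etimes c Y v) Z n g (ec_over K c X Y v n f))),
     Ident = (\<lambda>X. THE \<psi>. \<exists>v\<in>\<Phi>. \<psi> = ec_class K \<Phi> c X X 0 v (pr1 c X v))\<rparr>"


section \<open>Complete Segal spaces\<close>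

text \<open>Bisimplicial sets: the first index is the categorical and the second the spatial direction;
  \<open>BAct W n l \<alpha> \<gamma>\<close> acts in both directions simultaneously.\<close>

record 'a bsset =
  BSmp :: "nat \<Rightarrow> nat \<Rightarrow> 'a set"
  BAct :: "nat \<Rightarrow> nat \<Rightarrow> nat list \<Rightarrow> nat list \<Rightarrow> 'a \<Rightarrow> 'a"

definition bisimplicial_set :: "'a bsset \<Rightarrow> bool" where
  "bisimplicial_set W \<longleftrightarrow>
    (\<forall>m n j l. \<forall>\<alpha>\<in>ord m n. \<forall>\<gamma>\<in>ord j l. \<forall>x\<in>BSmp W n l. BAct W n l \<alpha> \<gamma> x \<in> BSmp W m j) \<and>
    (\<forall>n l. \<forall>x\<in>BSmp W n l. BAct W n l (idl n) (idl l) x = x) \<and>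
    (\<forall>k m n i j l. \<forall>\<alpha>\<in>ord m n. \<forall>\<beta>\<in>ord k m. \<forall>\<gamma>\<in>ord j l. \<forall>\<delta>\<in>ord i j. \<forall>x\<in>BSmp W n l.
       BAct W m j \<beta> \<delta> (BAct W n l \<alpha> \<gamma> x) = BAct W n l (ocomp \<alpha> \<beta>) (ocomp \<gamma> \<delta>) x)"

definition bisimplicial_map :: "'a bsset \<Rightarrow> 'b bsset \<Rightarrow> (nat \<Rightarrow> nat \<Rightarrow> 'a \<Rightarrow> 'b) \<Rightarrow> bool" where
  "bisimplicial_map X Y f \<longleftrightarrow>
    (\<forall>n l. \<forall>x\<in>BSmp X n l. f n l x \<in> BSmp Y n l) \<and>
    (\<forall>m n j l. \<forall>\<alpha>\<in>ord m n. \<forall>\<gamma>\<in>ord j l. \<forall>x\<in>BSmp X n l.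
       f m j (BAct X n l \<alpha> \<gamma> x) = BAct Y n l \<alpha> \<gamma> (f n l x))"

definition level :: "'a bsset \<Rightarrow> nat \<Rightarrow> 'a sset" where
  "level W n = \<lparr>Smp = BSmp W n, Act = (\<lambda>l \<gamma>. BAct W n l (idl n) \<gamma>)\<rparr>"

definition row :: "'a bsset \<Rightarrow> nat \<Rightarrow> 'a sset" where
  "row W l = \<lparr>Smp = (\<lambda>n. BSmp W n l), Act = (\<lambda>n \<alpha>. BAct W n l \<alpha> (idl l))\<rparr>"

definition bdegs :: "'a bsset \<Rightarrow> nat \<Rightarrow> nat \<Rightarrow> 'a \<Rightarrow> 'a" where
  "bdegs W n l x = BAct W 0 0 (const_op n 0) (const_op l 0) x"

text \<open>Every matching map \<open>W\<^sub>n \<rightarrow> M\<^sub>n W\<close> is a Kan fibration. A lifting problem of a horn inclusion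
  against it is a map \<open>g\<close> into \<open>W\<close> from the union of (boundary \<open>\<times>\<close> simplex) and (simplex \<open>\<times>\<close> horn).\<close>

definition reedy_fibrant :: "'a bsset \<Rightarrow> bool" where
  "reedy_fibrant W \<longleftrightarrow> (\<forall>n l i g. 1 \<le> l \<and> i \<le> l \<and>
     (\<forall>m j. \<forall>\<alpha>\<in>ord m n. \<forall>\<gamma>\<in>ord j l. \<alpha> \<in> boundary n \<or> \<gamma> \<in> horn l i \<longrightarrow>
        g \<alpha> \<gamma> \<in> BSmp W m j \<and>
        (\<forall>m' j'. \<forall>\<beta>\<in>ord m' m. \<forall>\<delta>\<in>ord j' j. g (ocomp \<alpha> \<beta>) (ocomp \<gamma> \<delta>) = BAct W m j \<beta> \<delta> (g \<alpha> \<gamma>)))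
     \<longrightarrow> (\<exists>w\<in>BSmp W n l. \<forall>m j. \<forall>\<alpha>\<in>ord m n. \<forall>\<gamma>\<in>ord j l. \<alpha> \<in> boundary n \<or> \<gamma> \<in> horn l i \<longrightarrow>
           BAct W n l \<alpha> \<gamma> w = g \<alpha> \<gamma>))"

text \<open>The iterated fibre product \<open>W\<^sub>1 \<times> ... \<times> W\<^sub>1\<close> over \<open>W\<^sub>0\<close> with \<open>n\<close> factors, as a space of
  composable lists.\<close>

definition spine_space :: "'a bsset \<Rightarrow> nat \<Rightarrow> 'a list sset" where
  "spine_space W n =
    \<lparr>Smp = (\<lambda>l. {xs. length xs = n \<and> set xs \<subseteq> BSmp W 1 l \<and>
        (\<forall>i. Suc i < n \<longrightarrow> BAct W 1 l [1] (idl l) (xs ! i) = BAct W 1 l [0] (idl l) (xs ! Suc i))}),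
     Act = (\<lambda>l \<gamma> xs. map (BAct W 1 l (idl 1) \<gamma>) xs)\<rparr>"

definition segal_space :: "'a bsset \<Rightarrow> bool" where
  "segal_space W \<longleftrightarrow> bisimplicial_set W \<and> reedy_fibrant W \<and>
    (\<forall>n\<ge>2. kan_equivalence (level W n) (spine_space W n)
       (\<lambda>l x. map (\<lambda>i. BAct W n l [i, Suc i] (idl l) x) [0..<n]))"

definition css_edge :: "'a bsset \<Rightarrow> 'a \<Rightarrow> 'a \<Rightarrow> 'a \<Rightarrow> bool" where
  "css_edge W f x y \<longleftrightarrow> f \<in> BSmp W 1 0 \<and> BAct W 1 0 [0] [0] f = x \<and> BAct W 1 0 [1] [0] f = y"

definition css_id :: "'a bsset \<Rightarrow> 'a \<Rightarrow> 'a" where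
  "css_id W x = bdegs W 1 0 x"

definition map_space :: "'a bsset \<Rightarrow> 'a \<Rightarrow> 'a \<Rightarrow> 'a sset" where
  "map_space W x y =
    \<lparr>Smp = (\<lambda>l. {w \<in> BSmp W 1 l. BAct W 1 l [0] (idl l) w = bdegs W 0 l x \<and>
                                 BAct W 1 l [1] (idl l) w = bdegs W 0 l y}),
     Act = (\<lambda>l \<gamma>. BAct W 1 l (idl 1) \<gamma>)\<rparr>"

text \<open>Some composite of \<open>f\<close> followed by \<open>g\<close>, obtained from a 2-simplex with these edges, lies in the
  same component of the mapping space as \<open>h\<close>.\<close>

definition css_composite :: "'a bsset \<Rightarrow> 'a \<Rightarrow> 'a \<Rightarrow> 'a \<Rightarrow> bool" where
  "css_composite W f g h \<longleftrightarrow>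
    (\<exists>\<sigma>\<in>BSmp W 2 0. BAct W 2 0 [0,1] [0] \<sigma> = f \<and> BAct W 2 0 [1,2] [0] \<sigma> = g \<and>
      (\<exists>s. edge (map_space W (BAct W 2 0 [0] [0] \<sigma>) (BAct W 2 0 [2] [0] \<sigma>)) s
             (BAct W 2 0 [0,2] [0] \<sigma>) h))"

definition css_equiv :: "'a bsset \<Rightarrow> 'a \<Rightarrow> bool" where
  "css_equiv W f \<longleftrightarrow> (\<exists>x y g h. css_edge W f x y \<and> css_edge W g y x \<and> css_edge W h y x \<and>
     css_composite W f g (css_id W x) \<and> css_composite W h f (css_id W y))"

text \<open>The subspace of \<open>W\<^sub>1\<close> of those components that consist of equivalences.\<close>

definition hoequiv_space :: "'a bsset \<Rightarrow> 'a sset" where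
  "hoequiv_space W =
    \<lparr>Smp = (\<lambda>l. {w \<in> BSmp W 1 l. \<forall>i\<le>l. css_equiv W (BAct W 1 l (idl 1) [i] w)}),
     Act = (\<lambda>l \<gamma>. BAct W 1 l (idl 1) \<gamma>)\<rparr>"

definition complete_segal_space :: "'a bsset \<Rightarrow> bool" where
  "complete_segal_space W \<longleftrightarrow> segal_space W \<and>
    kan_equivalence (level W 0) (hoequiv_space W) (\<lambda>l x. BAct W 0 l [0,0] (idl l) x)"

text \<open>The slice over an object \<open>c\<close>: its \<open>(n,l)\<close>-simplices are the maps from \<open>F(n) \<times> \<Delta>[l] \<times> F(1)\<close> to \<open>W\<close>
  (equivalently, from \<open>F(n) \<times> F(1)\<close> to the \<open>l\<close>-th row of \<open>W\<close>) that are constant at \<open>c\<close> over the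
  vertex 1 of \<open>F(1)\<close>.\<close>

definition css_slice :: "'a bsset \<Rightarrow> 'a \<Rightarrow> (nat list \<times> nat list \<Rightarrow> 'a) bsset" where
  "css_slice W c =
    \<lparr>BSmp = (\<lambda>n l. {\<phi> \<in> prism_maps (row W l) n.
               \<forall>k. \<forall>\<alpha>\<in>ord k n. \<phi> (\<alpha>, const_op k 1) = bdegs W k l c}),
     BAct = (\<lambda>n l \<theta> \<gamma> \<phi>. restrict (\<lambda>(\<alpha>, \<beta>).
               BAct W (length \<alpha> - 1) l (idl (length \<alpha> - 1)) \<gamma> (prism_act \<theta> \<phi> (\<alpha>, \<beta>)))
             (prism (length \<theta> - 1)))\<rparr>"

definition css_forget :: "nat \<Rightarrow> (nat list \<times> nat list \<Rightarrow> 'a) \<Rightarrow> 'a" where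
  "css_forget n \<phi> = \<phi> (idl n, const_op n 0)"

text \<open>Objects of a slice correspond to edges of \<open>W\<close>, since \<open>F(0) \<times> F(1) = F(1)\<close>.\<close>

definition slice_obj :: "'a bsset \<Rightarrow> 'a \<Rightarrow> (nat list \<times> nat list \<Rightarrow> 'a)" where
  "slice_obj W f = restrict (\<lambda>(\<alpha>, \<beta>). BAct W 1 0 \<beta> [0] f) (prism 0)"

definition slice_edge :: "(nat list \<times> nat list \<Rightarrow> 'a) \<Rightarrow> 'a" where
  "slice_edge \<phi> = \<phi> ([0,0], [0,1])"

definition css_final :: "'a bsset \<Rightarrow> 'a \<Rightarrow> bool" where
  "css_final W e \<longleftrightarrow> e \<in> BSmp W 0 0 \<and> (\<forall>x\<in>BSmp W 0 0. contractible (map_space W x e))"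

text \<open>The slice over the diagram consisting of the two objects \<open>a\<close> and \<open>b\<close>.\<close>

definition css_cone :: "'a bsset \<Rightarrow> 'a \<Rightarrow> 'a
    \<Rightarrow> ((nat list \<times> nat list \<Rightarrow> 'a) \<times> (nat list \<times> nat list \<Rightarrow> 'a)) bsset" where
  "css_cone W a b =
    \<lparr>BSmp = (\<lambda>n l. {(\<phi>, \<psi>). \<phi> \<in> BSmp (css_slice W a) n l \<and> \<psi> \<in> BSmp (css_slice W b) n l \<and>
                         css_forget n \<phi> = css_forget n \<psi>}),
     BAct = (\<lambda>n l \<theta> \<gamma> (\<phi>, \<psi>).
               (BAct (css_slice W a) n l \<theta> \<gamma> \<phi>, BAct (css_slice W b) n l \<theta> \<gamma> \<psi>))\<rparr>"

definition css_product :: "'a bsset \<Rightarrow> 'a \<Rightarrow> 'a \<Rightarrow> 'a \<Rightarrow> 'a \<Rightarrow> 'a \<Rightarrow> bool" where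
  "css_product W P p q a b \<longleftrightarrow> css_edge W p P a \<and> css_edge W q P b \<and>
     css_final (css_cone W a b) (slice_obj W p, slice_obj W q)"

text \<open>As for quasi-categories, pullbacks over \<open>c\<close> are products in the slice over \<open>c\<close>, and a map is a
  monomorphism iff its domain with identity projections is a pullback of it along itself.\<close>

definition css_finitely_complete :: "'a bsset \<Rightarrow> bool" where
  "css_finitely_complete W \<longleftrightarrow> (\<exists>e. css_final W e) \<and>
    (\<forall>c\<in>BSmp W 0 0. \<forall>f\<in>BSmp (css_slice W c) 0 0. \<forall>g\<in>BSmp (css_slice W c) 0 0.
       \<exists>P p q. css_product (css_slice W c) P p q f g)"

definition css_mono :: "'a bsset \<Rightarrow> 'a \<Rightarrow> bool" where
  "css_mono W m \<longleftrightarrow> m \<in> BSmp W 1 0 \<and>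
    (let S = css_slice W (BAct W 1 0 [1] [0] m); z = slice_obj W m
     in css_product S z (css_id S z) (css_id S z) z z)"

definition css_subobjects :: "'a bsset \<Rightarrow> 'a set" where
  "css_subobjects W = {U. \<exists>e m. css_final W e \<and> css_edge W m U e \<and> css_mono W m}"

definition css_map_exists :: "'a bsset \<Rightarrow> 'a \<Rightarrow> 'a \<Rightarrow> bool" where
  "css_map_exists W U V \<longleftrightarrow> (\<exists>i. css_edge W i U V)"

definition css_filter :: "'a bsset \<Rightarrow> 'a set set \<Rightarrow> bool" where
  "css_filter W = product_closed_filter (css_subobjects W) (css_map_exists W) (css_final W)
     (\<lambda>P U V. \<exists>p q. css_product W P p q U V)"

definition bF :: "nat \<Rightarrow> nat list bsset" where
  "bF k = \<lparr>BSmp = (\<lambda>n l. ord n k), BAct = (\<lambda>n l \<alpha> \<gamma> x. ocomp x \<alpha>)\<rparr>"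

definition bsprod :: "'a bsset \<Rightarrow> 'b bsset \<Rightarrow> ('a \<times> 'b) bsset" where
  "bsprod X Y = \<lparr>BSmp = (\<lambda>n l. BSmp X n l \<times> BSmp Y n l),
                 BAct = (\<lambda>n l \<alpha> \<gamma> (x, y). (BAct X n l \<alpha> \<gamma> x, BAct Y n l \<alpha> \<gamma> y))\<rparr>"

text \<open>Functors of the form \<open>- \<times> U\<close> between slices, characterized as for quasi-categories.\<close>

definition css_product_functor :: "'a bsset \<Rightarrow> 'a \<Rightarrow> 'a
    \<Rightarrow> (nat \<Rightarrow> nat \<Rightarrow> (nat list \<times> nat list \<Rightarrow> 'a) \<Rightarrow> (nat list \<times> nat list \<Rightarrow> 'a)) \<Rightarrow> bool" where
  "css_product_functor W V U t \<longleftrightarrow>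
    bisimplicial_map (css_slice W V) (css_slice W U) t \<and>
    (\<exists>H. bisimplicial_map (bsprod (css_slice W V) (bF 1)) W H \<and>
      (\<forall>n l. \<forall>\<phi>\<in>BSmp (css_slice W V) n l. H n l (\<phi>, const_op n 0) = css_forget n (t n l \<phi>) \<and>
                                          H n l (\<phi>, const_op n 1) = css_forget n \<phi>) \<and>
      (\<forall>\<phi>\<in>BSmp (css_slice W V) 0 0.
         css_product W (css_forget 0 (t 0 0 \<phi>)) (H 1 0 (css_id (css_slice W V) \<phi>, [0,1]))
           (slice_edge (t 0 0 \<phi>)) (css_forget 0 \<phi>) U))"

definition css_diagram :: "'a bsset \<Rightarrow> 'a set set \<Rightarrow> ('a set \<Rightarrow> 'a) \<Rightarrow>
    ('a set \<Rightarrow> 'a set \<Rightarrow> nat \<Rightarrow> nat \<Rightarrow> (nat list \<times> nat list \<Rightarrow> 'a) \<Rightarrow> (nat list \<times> nat list \<Rightarrow> 'a)) \<Rightarrow> bool" where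
  "css_diagram W \<Phi> rep t \<longleftrightarrow>
    (\<forall>v\<in>\<Phi>. rep v \<in> v) \<and>
    (\<forall>v\<in>\<Phi>. \<forall>u\<in>\<Phi>. sub_le (css_map_exists W) u v \<longrightarrow> css_product_functor W (rep v) (rep u) (t v u)) \<and>
    (\<forall>v\<in>\<Phi>. \<forall>n l. \<forall>\<phi>\<in>BSmp (css_slice W (rep v)) n l. t v v n l \<phi> = \<phi>) \<and>
    (\<forall>v\<in>\<Phi>. \<forall>u\<in>\<Phi>. \<forall>w\<in>\<Phi>. sub_le (css_map_exists W) u v \<and> sub_le (css_map_exists W) w u \<longrightarrow>
       (\<forall>n l. \<forall>\<phi>\<in>BSmp (css_slice W (rep v)) n l. t u w n l (t v u n l \<phi>) = t v w n l \<phi>))"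

definition colim_bsset :: "'i set \<Rightarrow> ('i \<Rightarrow> 'i \<Rightarrow> bool) \<Rightarrow> ('i \<Rightarrow> 'a bsset)
    \<Rightarrow> ('i \<Rightarrow> 'i \<Rightarrow> nat \<Rightarrow> nat \<Rightarrow> 'a \<Rightarrow> 'a) \<Rightarrow> ('i \<times> 'a) set bsset" where
  "colim_bsset I le D t =
    (let cls = (\<lambda>n l. colim_class I le (\<lambda>v. BSmp (D v) n l) (\<lambda>v w. t v w n l)) in
     \<lparr>BSmp = (\<lambda>n l. {cls n l v a | v a. v \<in> I \<and> a \<in> BSmp (D v) n l}),
      BAct = (\<lambda>n l \<alpha> \<gamma> c. let (v, a) = SOME p. p \<in> c
                in cls (length \<alpha> - 1) (length \<gamma> - 1) v (BAct (D v) n l \<alpha> \<gamma> a))\<rparr>)"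

definition css_quotient :: "'a bsset \<Rightarrow> 'a set set \<Rightarrow> ('a set \<Rightarrow> 'a) \<Rightarrow>
    ('a set \<Rightarrow> 'a set \<Rightarrow> nat \<Rightarrow> nat \<Rightarrow> (nat list \<times> nat list \<Rightarrow> 'a) \<Rightarrow> (nat list \<times> nat list \<Rightarrow> 'a)) \<Rightarrow>
    ('a set \<times> (nat list \<times> nat list \<Rightarrow> 'a)) set bsset" where
  "css_quotient W \<Phi> rep t =
     colim_bsset \<Phi> (sub_le (css_map_exists W)) (\<lambda>v. css_slice W (rep v)) t"

text \<open>The edge \<open>h\<close> is a product of \<open>f\<close> with the identity of \<open>U\<close>. Compatibility with the projections to
  \<open>f\<close> is a map \<open>s\<close> from the square \<open>F(1) \<times> F(1)\<close>; compatibility with those to \<open>U\<close> means that \<open>h\<close>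
  underlies an edge \<open>r\<close> of the slice over \<open>U\<close>.\<close>

definition css_times_id :: "'a bsset \<Rightarrow> 'a \<Rightarrow> 'a \<Rightarrow> 'a \<Rightarrow> bool" where
  "css_times_id W f U h \<longleftrightarrow>
    (\<exists>A B P Q p q p' q'. css_edge W f A B \<and> css_edge W h P Q \<and>
      css_product W P p q A U \<and> css_product W Q p' q' B U \<and>
      (\<exists>s\<in>prism_maps (row W 0) 1.
         s ([0,1], [0,0]) = h \<and> s ([0,1], [1,1]) = f \<and> s ([0,0], [0,1]) = p \<and> s ([1,1], [0,1]) = p') \<and>
      (\<exists>r\<in>BSmp (css_slice W U) 1 0.
         css_forget 1 r = h \<and> r ([0,0], [0,1]) = q \<and> r ([1,1], [0,1]) = q'))"

end

theory Submission
  imports Defs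
begin

text \<open>In each model, objects, maps up to homotopy and their composition form a category, and a map is an
  equivalence iff it is invertible there; products become products in this category. Since the
  quotient is a filtered colimit, a homotopy inverse of a map \<open>f\<close> represented at stage \<open>V\<close> together
  with the two homotopies is defined at some stage \<open>W \<le> V\<close>, so \<open>f\<close> is an equivalence in the quotient
  iff its restriction \<open>f\<^sub>W\<close> is one over some \<open>W\<close>. It remains to compare \<open>f\<^sub>W\<close> with \<open>f \<times> id\<close>. In the
  slice models \<open>f\<^sub>W\<close> forgets to \<open>f \<times> id\<^bsub>W\<^esub>\<close>, and an inverse of \<open>f \<times> id\<^bsub>U\<^esub>\<close> restricts to one of \<open>f\<^sub>W\<close> over
  every \<open>W \<le> U\<close>: invertibility of \<open>f \<times> id\<^bsub>U\<^esub>\<close> says that composition with \<open>f\<close> is bijective on maps from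
  any object that maps to \<open>U\<close>. For Kan enriched categories one uses moreover that any two maps to a
  subobject \<open>V\<close> of the final object are homotopic, so that \<open>(X \<times> V) \<times> W\<close> is \<open>X \<times> W\<close>.\<close>

section \<open>Simplicial sets\<close>

text \<open>Three obstacles shape the argument. In the slice models composition is a relation and
  not a function, so homotopy categories are axiomatized by a ternary relation and turned into
  classes afterwards. For Segal spaces the Segal maps are only homotopy equivalences: a simplex with
  a given spine exists up to a path. Reedy fibrancy, stated for boundaries and extended here to
  unions of faces, moves simplices along paths; this gives the zeroth row its inner horn fillers in
  dimensions 2 and 3, which is all that a homotopy category requires. Finally, a map of a slice that
  becomes invertible after forgetting the base is not at once invertible in the slice, since the
  homotopies must lie over the base; there the universal property of the product cone enters a
  second time. The quotient itself is handled without any fibrancy of its own: an equivalence is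
  finitely many simplices with equations between their faces, so it descends to a stage as it
  stands.\<close>

lemma ord_length: "\<alpha> \<in> ord m n \<Longrightarrow> length \<alpha> = Suc m"
  by (simp add: ord_def)

lemma ord_le: "\<alpha> \<in> ord m n \<Longrightarrow> i \<in> set \<alpha> \<Longrightarrow> i \<le> n"
  by (auto simp: ord_def)

lemma ord_nth_le: "\<alpha> \<in> ord m n \<Longrightarrow> i \<le> m \<Longrightarrow> \<alpha> ! i \<le> n"
  by (rule ord_le) (auto simp: ord_def)

lemma ord_nth_mono: "\<alpha> \<in> ord m n \<Longrightarrow> i \<le> j \<Longrightarrow> j \<le> m \<Longrightarrow> \<alpha> ! i \<le> \<alpha> ! j"
  by (simp add: ord_def sorted_nth_mono)

lemma ordI:
  assumes "length \<alpha> = Suc m" "\<And>i j. i \<le> j \<Longrightarrow> j \<le> m \<Longrightarrow> \<alpha> ! i \<le> \<alpha> ! j" "\<And>i. i \<le> m \<Longrightarrow> \<alpha> ! i \<le> n"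
  shows "\<alpha> \<in> ord m n"
  using assms by (force simp: ord_def sorted_iff_nth_mono in_set_conv_nth)

lemma ord_list_simps [simp]:
  "[] \<notin> ord m n"
  "[a] \<in> ord m n \<longleftrightarrow> m = 0 \<and> a \<le> n"
  "[a, b] \<in> ord m n \<longleftrightarrow> m = Suc 0 \<and> a \<le> b \<and> b \<le> n"
  "[a, b, c] \<in> ord m n \<longleftrightarrow> m = 2 \<and> a \<le> b \<and> b \<le> c \<and> c \<le> n"
  "[a, b, c, d] \<in> ord m n \<longleftrightarrow> m = 3 \<and> a \<le> b \<and> b \<le> c \<and> c \<le> d \<and> d \<le> n"
  by (auto simp: ord_def)

lemma length_ocomp [simp]: "length (ocomp \<alpha> \<beta>) = length \<beta>"
  by (simp add: ocomp_def)

lemma nth_ocomp [simp]: "i < length \<beta> \<Longrightarrow> ocomp \<alpha> \<beta> ! i = \<alpha> ! (\<beta> ! i)"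
  by (simp add: ocomp_def)

lemma ocomp_list_simps [simp]:
  "ocomp \<alpha> [] = []" "ocomp \<alpha> (i # \<beta>) = \<alpha> ! i # ocomp \<alpha> \<beta>"
  by (simp_all add: ocomp_def)

lemma ocomp_in_ord: "\<alpha> \<in> ord m n \<Longrightarrow> \<beta> \<in> ord k m \<Longrightarrow> ocomp \<alpha> \<beta> \<in> ord k n"
  by (rule ordI) (simp_all add: ord_length ord_nth_mono ord_nth_le)

lemma set_ocomp: "set (ocomp \<alpha> \<beta>) = (!) \<alpha> ` set \<beta>"
  by (simp add: ocomp_def)

lemma set_ocomp_subset: "length \<alpha> = Suc m \<Longrightarrow> \<beta> \<in> ord k m \<Longrightarrow> set (ocomp \<alpha> \<beta>) \<subseteq> set \<alpha>"
  by (auto simp: set_ocomp dest: ord_le)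

lemma ocomp_assoc: "length \<beta> = Suc m \<Longrightarrow> \<gamma> \<in> ord k m \<Longrightarrow> ocomp (ocomp \<alpha> \<beta>) \<gamma> = ocomp \<alpha> (ocomp \<beta> \<gamma>)"
  by (auto simp: ocomp_def dest: ord_le)

lemma idl_in_ord [simp]: "idl n \<in> ord m n \<longleftrightarrow> m = n"
  by (auto simp: ord_def idl_def simp del: upt_Suc)

lemma length_idl [simp]: "length (idl n) = Suc n"
  by (simp add: idl_def)

lemma nth_idl [simp]: "i \<le> n \<Longrightarrow> idl n ! i = i"
  by (simp add: idl_def del: upt_Suc)

lemma ocomp_idl_left: "\<alpha> \<in> ord m n \<Longrightarrow> ocomp (idl n) \<alpha> = \<alpha>"
  by (rule nth_equalityI) (simp_all add: ord_nth_le ord_length)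

lemma ocomp_idl_right: "length \<alpha> = Suc m \<Longrightarrow> ocomp \<alpha> (idl m) = \<alpha>"
  by (rule nth_equalityI) simp_all

lemma idl_simps: "idl 0 = [0]" "idl (Suc 0) = [0,1]" "idl 1 = [0,1]" "idl 2 = [0,1,2]" "idl 3 = [0,1,2,3]"
  by (simp_all add: idl_def numeral_eq_Suc)

lemma const_op_in_ord [simp]: "const_op m i \<in> ord k n \<longleftrightarrow> m = k \<and> i \<le> n"
  by (auto simp: ord_def const_op_def)

lemma const_op_simps:
  "const_op 0 i = [i]" "const_op (Suc 0) i = [i,i]" "const_op 1 i = [i,i]" "const_op 2 i = [i,i,i]"
  "const_op 3 i = [i,i,i,i]"
  by (simp_all add: const_op_def numeral_eq_Suc)

lemma length_const_op [simp]: "length (const_op n i) = Suc n"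
  by (simp add: const_op_def)

lemma nth_const_op [simp]: "j \<le> n \<Longrightarrow> const_op n i ! j = i"
  by (simp add: const_op_def del: replicate_Suc)

lemma ocomp_const_left: "\<alpha> \<in> ord m n \<Longrightarrow> ocomp (const_op n i) \<alpha> = const_op m i"
  by (rule nth_equalityI) (simp_all add: ord_length ord_nth_le)

lemma ocomp_const_right: "ocomp \<alpha> (const_op m i) = const_op m (\<alpha> ! i)"
  by (rule nth_equalityI) simp_all

lemma sset_act_in: "simplicial_set X \<Longrightarrow> x \<in> Smp X n \<Longrightarrow> \<alpha> \<in> ord m n \<Longrightarrow> Act X n \<alpha> x \<in> Smp X m"
  by (simp add: simplicial_set_def)

lemma sset_act_id: "simplicial_set X \<Longrightarrow> x \<in> Smp X n \<Longrightarrow> Act X n (idl n) x = x"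
  by (simp add: simplicial_set_def)

lemma sset_act_act: "simplicial_set X \<Longrightarrow> x \<in> Smp X n \<Longrightarrow> \<alpha> \<in> ord m n \<Longrightarrow> \<beta> \<in> ord k m \<Longrightarrow>
    Act X m \<beta> (Act X n \<alpha> x) = Act X n (ocomp \<alpha> \<beta>) x"
  by (simp add: simplicial_set_def)

lemma simplicial_map_in: "simplicial_map X Y f \<Longrightarrow> x \<in> Smp X n \<Longrightarrow> f n x \<in> Smp Y n"
  by (simp add: simplicial_map_def)

lemma simplicial_map_act: "simplicial_map X Y f \<Longrightarrow> x \<in> Smp X n \<Longrightarrow> \<alpha> \<in> ord m n \<Longrightarrow>
    f m (Act X n \<alpha> x) = Act Y n \<alpha> (f n x)"
  by (simp add: simplicial_map_def)

section \<open>Faces of a simplex and gluing along facets\<close>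

definition face :: "nat \<Rightarrow> nat \<Rightarrow> nat list" where
  "face n i = map (\<lambda>k. if k < i then k else Suc k) [0..<n]"

text \<open>The factorization of \<open>\<alpha>\<close> through the face opposite to
  \<open>i\<close>; it is meaningful when \<open>i\<close> is not a value of
  \<open>\<alpha>\<close>.\<close>

definition squeeze :: "nat \<Rightarrow> nat list \<Rightarrow> nat list" where
  "squeeze i \<alpha> = map (\<lambda>a. if i < a then a - 1 else a) \<alpha>"

lemma face_simps:
  "face (Suc 0) 0 = [1]" "face (Suc 0) (Suc 0) = [0]"
  "face 2 0 = [1,2]" "face 2 (Suc 0) = [0,2]" "face 2 2 = [0,1]"
  "face 3 0 = [1,2,3]" "face 3 (Suc 0) = [0,2,3]" "face 3 2 = [0,1,3]" "face 3 3 = [0,1,2]"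
  by (simp_all add: face_def numeral_eq_Suc)

lemma length_face [simp]: "length (face n i) = n"
  by (simp add: face_def)

lemma nth_face: "k < n \<Longrightarrow> face n i ! k = (if k < i then k else Suc k)"
  by (simp add: face_def)

lemma face_in_ord: "0 < n \<Longrightarrow> face n i \<in> ord (n - 1) n"
  by (rule ordI) (auto simp: nth_face)

lemma notin_set_face [simp]: "i \<notin> set (face n i)"
  by (auto simp: face_def)

lemma length_squeeze [simp]: "length (squeeze i \<alpha>) = length \<alpha>"
  by (simp add: squeeze_def)

lemma nth_squeeze: "k < length \<alpha> \<Longrightarrow> squeeze i \<alpha> ! k = (if i < \<alpha> ! k then \<alpha> ! k - 1 else \<alpha> ! k)"
  by (simp add: squeeze_def)

lemma squeeze_in_ord:
  assumes "\<alpha> \<in> ord m n" "i \<notin> set \<alpha>" "i \<le> n" "0 < n"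
  shows "squeeze i \<alpha> \<in> ord m (n - 1)"
proof (rule ordI)
  fix k assume k: "k \<le> m"
  hence "\<alpha> ! k \<noteq> i" using assms ord_length nth_mem by (metis le_imp_less_Suc)
  thus "squeeze i \<alpha> ! k \<le> n - 1" using k assms ord_nth_le[OF assms(1) k]
    by (auto simp: nth_squeeze ord_length)
next
  fix k l assume kl: "k \<le> l" "l \<le> m"
  show "squeeze i \<alpha> ! k \<le> squeeze i \<alpha> ! l"
    using kl ord_nth_mono[OF assms(1) kl] by (auto simp: nth_squeeze ord_length[OF assms(1)])
qed (simp add: ord_length[OF assms(1)])

lemma face_squeeze:
  assumes "\<alpha> \<in> ord m n" "i \<notin> set \<alpha>" "i \<le> n"
  shows "ocomp (face n i) (squeeze i \<alpha>) = \<alpha>"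
proof (rule nth_equalityI)
  fix k assume "k < length (ocomp (face n i) (squeeze i \<alpha>))"
  hence k: "k < length \<alpha>" by simp
  hence "\<alpha> ! k \<noteq> i" using assms nth_mem by metis
  moreover have "\<alpha> ! k \<le> n" using k assms by (simp add: ord_nth_le ord_length)
  ultimately show "ocomp (face n i) (squeeze i \<alpha>) ! k = \<alpha> ! k"
    using k assms(3) by (auto simp: nth_squeeze nth_face)
qed simp

lemma squeeze_ocomp: "length \<alpha> = Suc m \<Longrightarrow> \<beta> \<in> ord k m \<Longrightarrow> squeeze i (ocomp \<alpha> \<beta>) = ocomp (squeeze i \<alpha>) \<beta>"
  by (rule nth_equalityI) (simp_all add: nth_squeeze ord_length ord_nth_le le_imp_less_Suc)

lemma squeeze_face: "squeeze i (face (Suc n) i) = idl n"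
  by (rule nth_equalityI) (auto simp: nth_squeeze nth_face idl_def simp del: upt_Suc)

text \<open>Dropping the smaller vertex \<open>i\<close> first shifts \<open>j\<close> to
  \<open>j - 1\<close>. This is the source of the \<open>j - 1\<close> in all compatibility
  conditions between faces below.\<close>

lemma squeeze_squeeze:
  assumes "i < j" "i \<notin> set \<alpha>" "j \<notin> set \<alpha>"
  shows "squeeze (j - 1) (squeeze i \<alpha>) = squeeze i (squeeze j \<alpha>)"
  using assms by (auto simp: squeeze_def)

text \<open>The union of the faces opposite to the vertices in \<open>I\<close>. Horns and
  boundaries are both of this form, so one gluing lemma serves for all of them.\<close>

definition facets :: "nat \<Rightarrow> nat set \<Rightarrow> nat list set" where
  "facets n I = {\<alpha>. \<exists>m. \<alpha> \<in> ord m n \<and> (\<exists>i\<in>I. i \<notin> set \<alpha>)}"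

lemma face_in_facets: "0 < n \<Longrightarrow> i \<in> I \<Longrightarrow> face n i \<in> facets n I"
  unfolding facets_def using face_in_ord[of n i] notin_set_face[of i n] by blast

lemma horn_facets: "k \<le> n \<Longrightarrow> horn n k = facets n ({..n} - {k})"
  by (auto simp: horn_def facets_def dest: ord_le)

lemma boundary_facets: "boundary n = facets n {..n}"
  by (auto simp: boundary_def facets_def dest: ord_le)

lemma partial_simplexD:
  assumes "partial_simplex X n A g" "\<alpha> \<in> A" "\<alpha> \<in> ord m n"
  shows "g \<alpha> \<in> Smp X m" "\<beta> \<in> ord k m \<Longrightarrow> g (ocomp \<alpha> \<beta>) = Act X m \<beta> (g \<alpha>)"
  using assms unfolding partial_simplex_def by blast+

text \<open>A simplex of the union factors through every facet whose vertex it misses, and two such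
  factorizations agree because both pass through the common face of codimension two, where
  \<open>compat\<close> applies. The two facets of an edge are disjoint, hence the restriction to
  \<open>2 \<le> n\<close>.\<close>

lemma glue_facets:
  assumes X: "simplicial_set X" and n: "0 < n" and I: "I \<subseteq> {..n}"
    and x: "\<And>i. i \<in> I \<Longrightarrow> x i \<in> Smp X (n - 1)"
    and compat: "\<And>i j. 2 \<le> n \<Longrightarrow> i \<in> I \<Longrightarrow> j \<in> I \<Longrightarrow> i < j \<Longrightarrow>
      Act X (n - 1) (face (n - 1) i) (x j) = Act X (n - 1) (face (n - 1) (j - 1)) (x i)"
  obtains g where "partial_simplex X n (facets n I) g" "\<And>i. i \<in> I \<Longrightarrow> g (face n i) = x i"
    "\<And>i \<alpha> m. i \<in> I \<Longrightarrow> \<alpha> \<in> ord m n \<Longrightarrow> i \<notin> set \<alpha> \<Longrightarrow> g \<alpha> = Act X (n - 1) (squeeze i \<alpha>) (x i)"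
proof -
  define h where "h i \<alpha> = Act X (n - 1) (squeeze i \<alpha>) (x i)" for i \<alpha>
  have lt: "h i \<alpha> = h j \<alpha>"
    if a: "\<alpha> \<in> ord m n" and ij: "i \<in> I" "j \<in> I" "i \<notin> set \<alpha>" "j \<notin> set \<alpha>" "i < j" for i j \<alpha> m
  proof -
    have le: "i \<le> n" "j \<le> n" using I ij by auto
    \<comment> \<open>No simplex of an edge misses both vertices, so a conflict between two facets
      presupposes dimension at least two.\<close>
    have n2: "2 \<le> n"
    proof (rule ccontr)
      assume "\<not> 2 \<le> n"
      hence "n = 1" using n by simp
      hence "i = 0" "j = 1" using le ij by auto
      moreover have "\<alpha> ! 0 \<in> set \<alpha>" by (simp add: ord_length[OF a])
      moreover have "\<alpha> ! 0 = 0 \<or> \<alpha> ! 0 = 1" using ord_nth_le[OF a, of 0] \<open>n = 1\<close> by auto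
      ultimately show False using ij by auto
    qed
    have sj: "squeeze j \<alpha> \<in> ord m (n - 1)" and si: "squeeze i \<alpha> \<in> ord m (n - 1)"
      using squeeze_in_ord[OF a] ij le n by auto
    have ni: "i \<notin> set (squeeze j \<alpha>)" using ij by (auto simp: squeeze_def)
    have nj: "j - 1 \<notin> set (squeeze i \<alpha>)"
    proof
      assume "j - 1 \<in> set (squeeze i \<alpha>)"
      then obtain a where "a \<in> set \<alpha>" "j - 1 = (if i < a then a - 1 else a)" by (auto simp: squeeze_def)
      moreover have "a \<noteq> i" "a \<noteq> j" using calculation ij by auto
      ultimately show False using \<open>i < j\<close> by (auto split: if_splits)
    qed
    \<comment> \<open>The simplex \<open>\<alpha>\<close> seen inside the intersection of the two
      facets; both squeezed lists factor through it.\<close>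
    define \<beta> where "\<beta> = squeeze i (squeeze j \<alpha>)"
    have b: "\<beta> \<in> ord m (n - 1 - 1)" unfolding \<beta>_def
      using squeeze_in_ord[OF sj ni] le ij n2 by simp
    have f: "face (n - 1) k \<in> ord (n - 1 - 1) (n - 1)" for k by (rule face_in_ord) (use n2 in simp)
    have e1: "squeeze j \<alpha> = ocomp (face (n - 1) i) \<beta>"
      unfolding \<beta>_def using face_squeeze[OF sj ni] ij le by simp
    have e2: "squeeze i \<alpha> = ocomp (face (n - 1) (j - 1)) \<beta>"
      unfolding \<beta>_def squeeze_squeeze[OF \<open>i < j\<close> ij(3,4), symmetric]
      by (rule face_squeeze[OF si nj, symmetric]) (use le in simp)
    have "h i \<alpha> = Act X (n - 1 - 1) \<beta> (Act X (n - 1) (face (n - 1) (j - 1)) (x i))"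
      unfolding h_def e2 by (rule sset_act_act[OF X x[OF ij(1)] f b, symmetric])
    also have "\<dots> = Act X (n - 1 - 1) \<beta> (Act X (n - 1) (face (n - 1) i) (x j))"
      by (simp only: compat[OF n2 ij(1,2,5)])
    also have "\<dots> = h j \<alpha>"
      unfolding h_def e1 by (rule sset_act_act[OF X x[OF ij(2)] f b])
    finally show ?thesis .
  qed
  have wd: "h i \<alpha> = h j \<alpha>"
    if a: "\<alpha> \<in> ord m n" and ij: "i \<in> I" "j \<in> I" "i \<notin> set \<alpha>" "j \<notin> set \<alpha>" for i j \<alpha> m
  proof (cases i j rule: linorder_cases)
    case less
    show ?thesis by (rule lt[OF a ij less])
  next
    case greater
    show ?thesis by (rule lt[OF a ij(2,1,4,3) greater, symmetric])
  qed simp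
  define g where "g \<alpha> = h (SOME i. i \<in> I \<and> i \<notin> set \<alpha>) \<alpha>" for \<alpha>
  have g: "g \<alpha> = h i \<alpha>" if "\<alpha> \<in> ord m n" "i \<in> I" "i \<notin> set \<alpha>" for i \<alpha> m
  proof -
    have "(SOME i. i \<in> I \<and> i \<notin> set \<alpha>) \<in> I \<and> (SOME i. i \<in> I \<and> i \<notin> set \<alpha>) \<notin> set \<alpha>"
      by (rule someI_ex) (use that in blast)
    thus ?thesis unfolding g_def by (intro wd[OF that(1) _ that(2) _ that(3)]) simp_all
  qed
  have sq: "squeeze i \<alpha> \<in> ord m (n - 1)" if "\<alpha> \<in> ord m n" "i \<in> I" "i \<notin> set \<alpha>" for i \<alpha> m
    using squeeze_in_ord[OF that(1,3)] I that n by auto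
  have "partial_simplex X n (facets n I) g"
    unfolding partial_simplex_def
  proof (intro allI ballI conjI)
    fix m \<alpha> assume "\<alpha> \<in> facets n I \<inter> ord m n"
    then obtain i where a: "\<alpha> \<in> ord m n" and i: "i \<in> I" "i \<notin> set \<alpha>" by (auto simp: facets_def)
    show "g \<alpha> \<in> Smp X m" unfolding g[OF a i] h_def using sset_act_in[OF X x[OF i(1)] sq[OF a i]] .
    fix k \<beta> assume b: "\<beta> \<in> ord k m"
    have ab: "ocomp \<alpha> \<beta> \<in> ord k n" by (rule ocomp_in_ord[OF a b])
    have i': "i \<notin> set (ocomp \<alpha> \<beta>)" using set_ocomp_subset[OF ord_length[OF a] b] i by blast
    show "g (ocomp \<alpha> \<beta>) = Act X m \<beta> (g \<alpha>)"
      unfolding g[OF ab i(1) i'] g[OF a i] h_def squeeze_ocomp[OF ord_length[OF a] b]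
      by (rule sset_act_act[OF X x[OF i(1)] sq[OF a i] b, symmetric])
  qed
  moreover have "g (face n i) = x i" if "i \<in> I" for i
  proof -
    obtain k where k: "n = Suc k" using n by (cases n) auto
    show ?thesis unfolding g[OF face_in_ord[OF n] that notin_set_face] h_def unfolding k squeeze_face
      using sset_act_id[OF X x[OF that]] k by simp
  qed
  moreover have "g \<alpha> = Act X (n - 1) (squeeze i \<alpha>) (x i)" if "i \<in> I" "\<alpha> \<in> ord m n" "i \<notin> set \<alpha>" for i \<alpha> m
    using g[OF that(2,1,3)] by (simp add: h_def)
  ultimately show ?thesis by (rule that)
qed

lemma fills_face:
  assumes "fills X n A g z" "facets n I \<subseteq> A" "i \<in> I" "0 < n"
  shows "Act X n (face n i) z = g (face n i)"
  using assms face_in_facets[OF assms(4,3)] by (auto simp: fills_def)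

section \<open>Homotopy categories\<close>

text \<open>\<open>T f g h\<close> says that \<open>h\<close> is a composite of \<open>f\<close> followed by \<open>g\<close>. Composites are unique only up to
  the relation \<open>eqv\<close>; the morphisms of the homotopy category are the classes \<open>cl f\<close>, and \<open>cmp\<close> is
  their composition in diagrammatic order.\<close>

locale hocat =
  fixes arr :: "'o \<Rightarrow> 'o \<Rightarrow> 'a \<Rightarrow> bool" and T :: "'a \<Rightarrow> 'a \<Rightarrow> 'a \<Rightarrow> bool" and idt :: "'o \<Rightarrow> 'a"
  assumes arr_unique: "arr x y f \<Longrightarrow> arr x' y' f \<Longrightarrow> x = x' \<and> y = y'"
    and T_arr: "T f g h \<Longrightarrow> \<exists>x y z. arr x y f \<and> arr y z g \<and> arr x z h"
    and T_ex: "arr x y f \<Longrightarrow> arr y z g \<Longrightarrow> \<exists>h. T f g h"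
    and id_arr: "arr x y f \<Longrightarrow> arr x x (idt x) \<and> arr y y (idt y)"
    and T_idl: "arr x y f \<Longrightarrow> T (idt x) f f"
    and T_idr: "arr x y f \<Longrightarrow> T f (idt y) f"
    and T_assoc: "T f g h \<Longrightarrow> T g k l \<Longrightarrow> T f l m \<longleftrightarrow> T h k m"
begin

text \<open>For edges of a simplicial set this is the homotopy relation witnessed by a triangle
  whose second edge is degenerate.\<close>

definition eqv :: "'a \<Rightarrow> 'a \<Rightarrow> bool" where
  "eqv f g \<longleftrightarrow> (\<exists>x y. arr x y f \<and> T f (idt y) g)"

lemma T_arrs:
  assumes "T f g h" "arr x y f" "arr y' z g"
  shows "y' = y" "arr x z h"
proof -
  obtain x1 y1 z1 where "arr x1 y1 f" "arr y1 z1 g" "arr x1 z1 h" using T_arr[OF assms(1)] by blast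
  thus "y' = y" "arr x z h"
    using arr_unique[OF assms(2), of x1 y1] arr_unique[OF assms(3), of y1 z1] by simp_all
qed

lemma eqv_iff: "arr x y f \<Longrightarrow> eqv f g \<longleftrightarrow> T f (idt y) g"
  unfolding eqv_def using arr_unique by blast

lemma eqv_arr: "eqv f g \<Longrightarrow> arr x y f \<Longrightarrow> arr x y g"
  using eqv_iff id_arr T_arrs(2) by blast

text \<open>This is \<open>T_assoc\<close> with an identity as third factor, because
  \<open>g\<close> followed by that identity has composite \<open>g\<close> again.\<close>

lemma T_unique:
  assumes "T f g h"
  shows "T f g h' \<longleftrightarrow> eqv h h'"
proof -
  obtain x y z where a: "arr x y f" "arr y z g" "arr x z h" using T_arr[OF assms] by blast
  show ?thesis unfolding eqv_iff[OF a(3)] by (rule T_assoc[OF assms T_idr[OF a(2)]])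
qed

lemma eqv_refl: "arr x y f \<Longrightarrow> eqv f f"
  by (simp add: eqv_iff T_idr)

lemma eqv_sym:
  assumes "eqv f g" shows "eqv g f"
proof -
  obtain x y where "arr x y f" "T f (idt y) g" using assms eqv_def by blast
  thus ?thesis using T_unique T_idr by blast
qed

lemma eqv_trans:
  assumes "eqv f g" "eqv g h" shows "eqv f h"
proof -
  obtain x y where a: "arr x y f" "T f (idt y) g" using assms eqv_def by blast
  hence "T f (idt y) h" using T_unique assms(2) by blast
  thus ?thesis using eqv_iff a by blast
qed

lemma T_cong_left:
  assumes "eqv f f'" shows "T f g m \<longleftrightarrow> T f' g m"
proof -
  have *: "T f g m \<longrightarrow> T f' g m" if "eqv f f'" for f f'
  proof
    assume m: "T f g m"
    obtain x y z where a: "arr x y f" "arr y z g" using T_arr[OF m] by blast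
    have "T f (idt y) f'" using that eqv_iff[OF a(1)] by blast
    thus "T f' g m" using T_assoc[of f "idt y" f' g g m] T_idl[OF a(2)] m by blast
  qed
  show ?thesis using *[OF assms] *[OF eqv_sym[OF assms]] by blast
qed

lemma T_cong_right:
  assumes "eqv g g'" shows "T f g m \<longleftrightarrow> T f g' m"
proof -
  have *: "T f g' m" if e: "eqv g g'" and m: "T f g m" for g g'
  proof -
    obtain x y z where a: "arr x y f" "arr y z g" "arr x z m" using T_arr[OF m] by blast
    have "T g (idt z) g'" using e eqv_iff[OF a(2)] by blast
    hence "T f g' m \<longleftrightarrow> T m (idt z) m" using T_assoc[OF m] by blast
    thus ?thesis using T_idr[OF a(3)] by blast
  qed
  show ?thesis using *[OF assms] *[OF eqv_sym[OF assms]] by blast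
qed

definition cl :: "'a \<Rightarrow> 'a set" where
  "cl f = {g. eqv f g}"

definition hm :: "'o \<Rightarrow> 'o \<Rightarrow> 'a set \<Rightarrow> bool" where
  "hm x y A \<longleftrightarrow> (\<exists>f. arr x y f \<and> A = cl f)"

definition hid :: "'o \<Rightarrow> 'a set" where
  "hid x = cl (idt x)"

definition cmp :: "'a set \<Rightarrow> 'a set \<Rightarrow> 'a set" where
  "cmp A B = {h. \<exists>f\<in>A. \<exists>g\<in>B. T f g h}"

lemma hmI: "arr x y f \<Longrightarrow> hm x y (cl f)"
  by (auto simp: hm_def)

lemma cl_eq_iff: "arr x y f \<Longrightarrow> cl f = cl g \<longleftrightarrow> eqv f g"
  unfolding cl_def using eqv_refl eqv_sym eqv_trans eqv_arr by blast

text \<open>\<open>cmp\<close> collects all composites of all representatives and so avoids choices;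
  the congruence of \<open>T\<close> in both arguments makes the resulting set a single
  class.\<close>

lemma cmp_cl:
  assumes "T f g h"
  shows "cmp (cl f) (cl g) = cl h"
proof -
  obtain x y z where a: "arr x y f" "arr y z g" "arr x z h" using T_arr[OF assms] by blast
  have "T f' g' m \<longleftrightarrow> T f g m" if "eqv f f'" "eqv g g'" for f' g' m
    using T_cong_left[OF that(1)] T_cong_right[OF that(2)] by blast
  hence "cmp (cl f) (cl g) = {m. T f g m}"
    unfolding cmp_def cl_def using eqv_refl a by blast
  thus ?thesis unfolding T_unique[OF assms] cl_def .
qed

lemma T_iff:
  assumes "arr x y f" "arr y z g" "arr x z h"
  shows "T f g h \<longleftrightarrow> cmp (cl f) (cl g) = cl h"
proof
  assume e: "cmp (cl f) (cl g) = cl h"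
  obtain h' where h': "T f g h'" using T_ex[OF assms(1,2)] by blast
  have "cl h = cl h'" using e cmp_cl[OF h'] by simp
  hence "eqv h' h" using cl_eq_iff[OF assms(3)] eqv_sym by blast
  thus "T f g h" using T_unique[OF h'] by blast
qed (rule cmp_cl)

lemma hm_cmp:
  assumes "hm x y A" "hm y z B"
  shows "hm x z (cmp A B)"
proof -
  obtain f g where f: "arr x y f" "A = cl f" and g: "arr y z g" "B = cl g"
    using assms unfolding hm_def by blast
  obtain h where h: "T f g h" using T_ex[OF f(1) g(1)] by blast
  show ?thesis unfolding f g cmp_cl[OF h] by (rule hmI[OF T_arrs(2)[OF h f(1) g(1)]])
qed

lemma cmp_assoc:
  assumes "hm w x A" "hm x y B" "hm y z C"
  shows "cmp (cmp A B) C = cmp A (cmp B C)"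
proof -
  obtain f g k where a: "arr w x f" "A = cl f" "arr x y g" "B = cl g" "arr y z k" "C = cl k"
    using assms unfolding hm_def by blast
  obtain h l where hl: "T f g h" "T g k l" using T_ex a by blast
  have "arr w y h" by (rule T_arrs(2)[OF hl(1) a(1,3)])
  then obtain m where m: "T h k m" using T_ex a(5) by blast
  hence m': "T f l m" using T_assoc[OF hl] by blast
  show ?thesis unfolding a cmp_cl[OF hl(1)] cmp_cl[OF hl(2)] cmp_cl[OF m] cmp_cl[OF m'] ..
qed

lemma hid_hm: "hm x y A \<Longrightarrow> hm x x (hid x)" "hm x y A \<Longrightarrow> hm y y (hid y)"
  unfolding hm_def hid_def using id_arr by blast+

lemma cmp_id: "hm x y A \<Longrightarrow> cmp (hid x) A = A" "hm x y A \<Longrightarrow> cmp A (hid y) = A"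
  unfolding hm_def hid_def using cmp_cl T_idl T_idr by blast+

definition hiso :: "'o \<Rightarrow> 'o \<Rightarrow> 'a set \<Rightarrow> bool" where
  "hiso x y A \<longleftrightarrow> hm x y A \<and> (\<exists>B. hm y x B \<and> cmp A B = hid x \<and> cmp B A = hid y)"

text \<open>A left and a right inverse coincide. The separate inverses are there because
  \<open>css_equiv\<close> provides two unrelated ones.\<close>

lemma hiso_left_right:
  assumes "hm x y A" "hm y x B" "hm y x C" "cmp A B = hid x" "cmp C A = hid y"
  shows "hiso x y A"
proof -
  have "C = cmp C (cmp A B)" using assms cmp_id by simp
  also have "\<dots> = B" using cmp_assoc[OF assms(3,1,2)] assms cmp_id by simp
  finally show ?thesis using assms unfolding hiso_def by blast
qed

definition hprod :: "'o \<Rightarrow> 'a set \<Rightarrow> 'a set \<Rightarrow> 'o \<Rightarrow> 'o \<Rightarrow> bool" where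
  "hprod P p q A U \<longleftrightarrow> hm P A p \<and> hm P U q \<and>
    (\<forall>Z a c. hm Z A a \<and> hm Z U c \<longrightarrow> (\<exists>k. hm Z P k \<and> cmp k p = a \<and> cmp k q = c)) \<and>
    (\<forall>Z k k'. hm Z P k \<and> hm Z P k' \<and> cmp k p = cmp k' p \<and> cmp k q = cmp k' q \<longrightarrow> k = k')"

text \<open>Pairing with the fixed map \<open>c\<close> identifies maps from \<open>Z\<close> to
  \<open>A\<close> or \<open>B\<close> with maps to \<open>P\<close> or \<open>Q\<close> whose
  second component is \<open>c\<close>. By \<open>hq\<close> the map \<open>h\<close> preserves that
  component and by \<open>hp\<close> it induces \<open>f\<close> on the first, so composition with
  \<open>f\<close> becomes composition with the invertible \<open>h\<close>.\<close>

lemma times_iso_bij: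
  assumes P: "hprod P p q A U" and Q: "hprod Q p' q' B U" and f: "hm A B f" and h: "hiso P Q h"
    and hp: "cmp h p' = cmp p f" and hq: "cmp h q' = q" and c: "hm Z U c"
  shows "hm Z B b \<Longrightarrow> \<exists>a. hm Z A a \<and> cmp a f = b"
    and "hm Z A a \<Longrightarrow> hm Z A a' \<Longrightarrow> cmp a f = cmp a' f \<Longrightarrow> a = a'"
proof -
  obtain k where k: "hm Q P k" "cmp h k = hid P" "cmp k h = hid Q" and h: "hm P Q h"
    using h unfolding hiso_def by blast
  have pA: "hm P A p" and pU: "hm P U q" and p'B: "hm Q B p'" and q'U: "hm Q U q'"
    using P Q unfolding hprod_def by blast+
  have pex: "\<exists>k. hm Z P k \<and> cmp k p = a \<and> cmp k q = c" if "hm Z A a" "hm Z U c" for Z a c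
    using P that unfolding hprod_def by blast
  have qex: "\<exists>k. hm Z Q k \<and> cmp k p' = a \<and> cmp k q' = c" if "hm Z B a" "hm Z U c" for Z a c
    using Q that unfolding hprod_def by blast
  have quniq: "k = k'" if "hm Z Q k" "hm Z Q k'" "cmp k p' = cmp k' p'" "cmp k q' = cmp k' q'" for Z k k'
    using Q that unfolding hprod_def by blast
  show "\<exists>a. hm Z A a \<and> cmp a f = b" if b: "hm Z B b"
  proof -
    obtain l where l: "hm Z Q l" "cmp l p' = b" "cmp l q' = c" using qex[OF b c] by blast
    have lk: "hm Z P (cmp l k)" by (rule hm_cmp[OF l(1) k(1)])
    have "cmp (cmp (cmp l k) p) f = cmp (cmp l k) (cmp h p')"
      using cmp_assoc[OF lk pA f] hp by simp
    also have "\<dots> = cmp (cmp (cmp l k) h) p'" using cmp_assoc[OF lk h p'B] by simp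
    also have "cmp (cmp l k) h = l" using cmp_assoc[OF l(1) k(1) h] k(3) cmp_id(2)[OF l(1)] by simp
    finally show ?thesis using hm_cmp[OF lk pA] l by auto
  qed
  show "a = a'" if a: "hm Z A a" "hm Z A a'" "cmp a f = cmp a' f"
  proof -
    obtain l where l: "hm Z P l" "cmp l p = a" "cmp l q = c" using pex[OF a(1) c] by blast
    obtain l' where l': "hm Z P l'" "cmp l' p = a'" "cmp l' q = c" using pex[OF a(2) c] by blast
    have "cmp (cmp l h) p' = cmp (cmp l' h) p'"
      using cmp_assoc[OF l(1) h p'B] cmp_assoc[OF l'(1) h p'B] hp
        cmp_assoc[OF l(1) pA f] cmp_assoc[OF l'(1) pA f] l l' a by simp
    moreover have "cmp (cmp l h) q' = cmp (cmp l' h) q'"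
      using cmp_assoc[OF l(1) h q'U] cmp_assoc[OF l'(1) h q'U] hq l l' by simp
    ultimately have e: "cmp l h = cmp l' h" by (rule quniq[OF hm_cmp[OF l(1) h] hm_cmp[OF l'(1) h]])
    have "l = cmp (cmp l h) k" using cmp_assoc[OF l(1) h k(1)] k(2) cmp_id(2)[OF l(1)] by simp
    also have "\<dots> = l'" unfolding e using cmp_assoc[OF l'(1) h k(1)] k(2) cmp_id(2)[OF l'(1)] by simp
    finally show "a = a'" using l l' by simp
  qed
qed

text \<open>A diagonal in the square from \<open>s\<close> to \<open>t\<close>: surjectivity of
  composition with \<open>f\<close> on maps from \<open>R\<close> gives \<open>a\<close> and the
  triangle at \<open>t\<close>, injectivity on maps from \<open>S\<close> gives the other triangle.
  In the applications \<open>F\<close> is the transported map over a smaller subobject,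
  \<open>s\<close> and \<open>t\<close> are product projections, and \<open>a\<close> will be the
  first component of the inverse.\<close>

lemma lift_inverse:
  assumes P: "hprod P p q A U" and Q: "hprod Q p' q' B U" and f: "hm A B f" and h: "hiso P Q h"
    and hp: "cmp h p' = cmp p f" and hq: "cmp h q' = q"
    and s: "hm S A s" and t: "hm R B t" and F: "hm S R F" and sq: "cmp F t = cmp s f"
    and cS: "hm S U cS" and cR: "hm R U cR"
  shows "\<exists>a. hm R A a \<and> cmp a f = t \<and> cmp F a = s"
proof -
  have bij: "hm Z U c \<Longrightarrow> hm Z B b \<Longrightarrow> \<exists>a. hm Z A a \<and> cmp a f = b"
    "hm Z U c \<Longrightarrow> hm Z A a \<Longrightarrow> hm Z A a' \<Longrightarrow> cmp a f = cmp a' f \<Longrightarrow> a = a'" for Z a a' b c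
    using times_iso_bij[OF P Q f h hp hq] by blast+
  obtain a where a: "hm R A a" "cmp a f = t" using bij(1)[OF cR t] by blast
  have "cmp (cmp F a) f = cmp s f" unfolding cmp_assoc[OF F a(1) f] a(2) sq ..
  hence "cmp F a = s" by (rule bij(2)[OF cS hm_cmp[OF F a(1)] s])
  thus ?thesis using a by blast
qed

end

section \<open>Inner horns and the homotopy category of a simplicial set\<close>

text \<open>Inner horn filling in dimensions 2 and 3 alone, spelled out by faces. This much suffices
  for a homotopy category, and it is what can be shown directly for the zeroth row of a Segal
  space.\<close>

definition inner3 :: "'a sset \<Rightarrow> bool" where
  "inner3 X \<longleftrightarrow> simplicial_set X \<and>
    (\<forall>f g. f \<in> Smp X 1 \<and> g \<in> Smp X 1 \<and> Act X 1 [1] f = Act X 1 [0] g \<longrightarrow>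
       (\<exists>\<sigma>\<in>Smp X 2. Act X 2 [0,1] \<sigma> = f \<and> Act X 2 [1,2] \<sigma> = g)) \<and>
    (\<forall>a b c. a \<in> Smp X 2 \<and> b \<in> Smp X 2 \<and> c \<in> Smp X 2 \<and> Act X 2 [1,2] a = Act X 2 [0,1] b \<and>
       Act X 2 [0,1] c = Act X 2 [0,1] a \<and> Act X 2 [1,2] c = Act X 2 [0,2] b \<longrightarrow>
       (\<exists>\<rho>\<in>Smp X 3. Act X 3 [0,1,2] \<rho> = a \<and> Act X 3 [1,2,3] \<rho> = b \<and> Act X 3 [0,1,3] \<rho> = c)) \<and>
    (\<forall>a b c. a \<in> Smp X 2 \<and> b \<in> Smp X 2 \<and> c \<in> Smp X 2 \<and> Act X 2 [1,2] a = Act X 2 [0,1] b \<and>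
       Act X 2 [0,1] c = Act X 2 [0,2] a \<and> Act X 2 [1,2] c = Act X 2 [1,2] b \<longrightarrow>
       (\<exists>\<rho>\<in>Smp X 3. Act X 3 [0,1,2] \<rho> = a \<and> Act X 3 [1,2,3] \<rho> = b \<and> Act X 3 [0,2,3] \<rho> = c))"

lemma glue_fill:
  assumes X: "simplicial_set X" and n: "0 < n" and I: "I \<subseteq> {..n}"
    and x: "\<And>i. i \<in> I \<Longrightarrow> x i \<in> Smp X (n - 1)"
    and compat: "\<And>i j. 2 \<le> n \<Longrightarrow> i \<in> I \<Longrightarrow> j \<in> I \<Longrightarrow> i < j \<Longrightarrow>
      Act X (n - 1) (face (n - 1) i) (x j) = Act X (n - 1) (face (n - 1) (j - 1)) (x i)"
    and fill: "\<And>g. partial_simplex X n (facets n I) g \<Longrightarrow> \<exists>z. fills X n (facets n I) g z"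
  shows "\<exists>z\<in>Smp X n. \<forall>i\<in>I. Act X n (face n i) z = x i"
proof (rule glue_facets[where X=X and n=n and I=I and x=x])
  fix g assume g: "partial_simplex X n (facets n I) g" "\<And>i. i \<in> I \<Longrightarrow> g (face n i) = x i"
  obtain z where z: "fills X n (facets n I) g z" using fill[OF g(1)] by blast
  have "Act X n (face n i) z = x i" if "i \<in> I" for i
    using fills_face[OF z order_refl that n] g(2)[OF that] by simp
  thus ?thesis using z by (auto simp: fills_def)
qed (fact X n I x compat)+

lemma fill2:
  assumes X: "simplicial_set X" and ij: "{i, j} \<subseteq> {..2}" "i < j" and x: "x \<in> Smp X 1" "y \<in> Smp X 1"
    and compat: "Act X 1 (face 1 i) y = Act X 1 (face 1 (j - 1)) x"
    and fill: "\<And>g. partial_simplex X 2 (facets 2 {i, j}) g \<Longrightarrow> \<exists>z. fills X 2 (facets 2 {i, j}) g z"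
  shows "\<exists>z\<in>Smp X 2. Act X 2 (face 2 i) z = x \<and> Act X 2 (face 2 j) z = y"
proof -
  have "\<exists>z\<in>Smp X 2. \<forall>k\<in>{i, j}. Act X 2 (face 2 k) z = (if k = i then x else y)"
  proof (rule glue_fill[OF X _ ij(1) _ _ fill])
    fix k l assume "k \<in> {i, j}" "l \<in> {i, j}" "k < l"
    hence "k = i" "l = j" using ij by auto
    thus "Act X (2 - 1) (face (2 - 1) k) (if l = i then x else y) =
      Act X (2 - 1) (face (2 - 1) (l - 1)) (if k = i then x else y)"
      using compat ij by simp
  qed (use x in auto)
  thus ?thesis using ij(2) by auto
qed

lemma fill3:
  assumes X: "simplicial_set X" and ijk: "{i, j, k} \<subseteq> {..3}" "i < j" "j < k"
    and x: "x \<in> Smp X 2" "y \<in> Smp X 2" "z \<in> Smp X 2"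
    and compat: "Act X 2 (face 2 i) y = Act X 2 (face 2 (j - 1)) x"
      "Act X 2 (face 2 i) z = Act X 2 (face 2 (k - 1)) x"
      "Act X 2 (face 2 j) z = Act X 2 (face 2 (k - 1)) y"
    and fill: "\<And>g. partial_simplex X 3 (facets 3 {i, j, k}) g \<Longrightarrow> \<exists>z. fills X 3 (facets 3 {i, j, k}) g z"
  shows "\<exists>w\<in>Smp X 3. Act X 3 (face 3 i) w = x \<and> Act X 3 (face 3 j) w = y \<and> Act X 3 (face 3 k) w = z"
proof -
  have "\<exists>w\<in>Smp X 3. \<forall>l\<in>{i, j, k}. Act X 3 (face 3 l) w = (if l = i then x else if l = j then y else z)"
  proof (rule glue_fill[OF X _ ijk(1) _ _ fill])
    fix a b assume "a \<in> {i, j, k}" "b \<in> {i, j, k}" "a < b"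
    hence "a = i \<and> b = j \<or> a = i \<and> b = k \<or> a = j \<and> b = k" using ijk by auto
    thus "Act X (3 - 1) (face (3 - 1) a) (if b = i then x else if b = j then y else z) =
      Act X (3 - 1) (face (3 - 1) (b - 1)) (if a = i then x else if a = j then y else z)"
      using compat ijk by auto
  qed (use x in auto)
  thus ?thesis using ijk(2,3) by auto
qed

lemma inner3I:
  assumes X: "simplicial_set X"
    and fill: "\<And>n k g. 0 < k \<Longrightarrow> k < n \<Longrightarrow> partial_simplex X n (horn n k) g \<Longrightarrow> \<exists>x. fills X n (horn n k) g x"
  shows "inner3 X"
proof -
  have h21: "horn 2 1 = facets 2 {0,2}"
    by (subst horn_facets, simp, rule arg_cong[of _ _ "facets 2"]) auto
  have h31: "horn 3 1 = facets 3 {0,2,3}"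
    by (subst horn_facets, simp, rule arg_cong[of _ _ "facets 3"]) auto
  have h32: "horn 3 2 = facets 3 {0,1,3}"
    by (subst horn_facets, simp, rule arg_cong[of _ _ "facets 3"]) auto
  have f21: "\<exists>x. fills X 2 (facets 2 {0,2}) g x" if "partial_simplex X 2 (facets 2 {0,2}) g" for g
    using fill[of 1 2 g] that unfolding h21 by simp
  have f31: "\<exists>x. fills X 3 (facets 3 {0,2,3}) g x" if "partial_simplex X 3 (facets 3 {0,2,3}) g" for g
    using fill[of 1 3 g] that unfolding h31 by simp
  have f32: "\<exists>x. fills X 3 (facets 3 {0,1,3}) g x" if "partial_simplex X 3 (facets 3 {0,1,3}) g" for g
    using fill[of 2 3 g] that unfolding h32 by simp
  show ?thesis unfolding inner3_def
  proof (intro conjI allI impI X; elim conjE)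
    fix f g assume "f \<in> Smp X 1" "g \<in> Smp X 1" "Act X 1 [1] f = Act X 1 [0] g"
    thus "\<exists>\<sigma>\<in>Smp X 2. Act X 2 [0,1] \<sigma> = f \<and> Act X 2 [1,2] \<sigma> = g"
      using fill2[OF X _ _ _ _ _ f21, of g f] by (auto simp: face_simps)
  next
    fix a b c assume "a \<in> Smp X 2" "b \<in> Smp X 2" "c \<in> Smp X 2" "Act X 2 [1,2] a = Act X 2 [0,1] b"
      "Act X 2 [0,1] c = Act X 2 [0,1] a" "Act X 2 [1,2] c = Act X 2 [0,2] b"
    thus "\<exists>\<rho>\<in>Smp X 3. Act X 3 [0,1,2] \<rho> = a \<and> Act X 3 [1,2,3] \<rho> = b \<and> Act X 3 [0,1,3] \<rho> = c"
      using fill3[OF X _ _ _ _ _ _ _ _ _ f31, of b c a] by (auto simp: face_simps)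
  next
    fix a b c assume "a \<in> Smp X 2" "b \<in> Smp X 2" "c \<in> Smp X 2" "Act X 2 [1,2] a = Act X 2 [0,1] b"
      "Act X 2 [0,1] c = Act X 2 [0,2] a" "Act X 2 [1,2] c = Act X 2 [1,2] b"
    thus "\<exists>\<rho>\<in>Smp X 3. Act X 3 [0,1,2] \<rho> = a \<and> Act X 3 [1,2,3] \<rho> = b \<and> Act X 3 [0,2,3] \<rho> = c"
      using fill3[OF X _ _ _ _ _ _ _ _ _ f32, of b c a] by (auto simp: face_simps)
  qed
qed

lemma quasi_category_inner3: "quasi_category X \<Longrightarrow> inner3 X"
  by (rule inner3I) (auto simp: quasi_category_def)

lemma kan_complex_inner3: "kan_complex X \<Longrightarrow> inner3 X"
  by (rule inner3I) (auto simp: kan_complex_def)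

text \<open>Composites are witnessed by triangles. The two directions of \<open>T_assoc\<close> are
  the two inner horns of the tetrahedron with spine \<open>f\<close>, \<open>g\<close>,
  \<open>k\<close>: the faces 012 and 123 are given together with 013 or 023, and the filler
  supplies the remaining one.\<close>

lemma hocat_sset:
  assumes X: "inner3 X"
  shows "hocat (\<lambda>x y f. edge X f x y) (qc_composite X) (qc_id X)"
proof -
  have S: "simplicial_set X" using X by (simp add: inner3_def)
  note act = sset_act_in[OF S] sset_act_act[OF S]
  show ?thesis
  proof
    show "\<exists>x y z. edge X f x y \<and> edge X g y z \<and> edge X h x z" if T: "qc_composite X f g h" for f g h
    proof -
      obtain \<sigma> where s: "\<sigma> \<in> Smp X 2" and e: "Act X 2 [0,1] \<sigma> = f" "Act X 2 [1,2] \<sigma> = g" "Act X 2 [0,2] \<sigma> = h"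
        using T by (auto simp: qc_composite_def)
      have "edge X f (Act X 2 [0] \<sigma>) (Act X 2 [1] \<sigma>)" "edge X g (Act X 2 [1] \<sigma>) (Act X 2 [2] \<sigma>)"
        "edge X h (Act X 2 [0] \<sigma>) (Act X 2 [2] \<sigma>)"
        unfolding edge_def e[symmetric] using act[OF s] by auto
      thus ?thesis by blast
    qed
    show "\<exists>h. qc_composite X f g h" if "edge X f x y" "edge X g y z" for x y z f g
      using X that unfolding inner3_def edge_def qc_composite_def by metis
    show "edge X (qc_id X x) x x \<and> edge X (qc_id X y) y y" if f: "edge X f x y" for x y f
    proof -
      have *: "edge X (qc_id X v) v v" if v: "v \<in> Smp X 0" for v
        unfolding edge_def qc_id_def using act[OF v] sset_act_id[OF S v] by (simp add: idl_simps)
      have "x \<in> Smp X 0" "y \<in> Smp X 0" using f act(1)[of f 1 _ 0] by (auto simp: edge_def)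
      thus ?thesis using * by blast
    qed
    show "qc_composite X (qc_id X x) f f" if f: "edge X f x y" for x y f
      unfolding qc_composite_def
    proof
      have f1: "f \<in> Smp X 1" and x: "x = Act X 1 [0] f" using f by (auto simp: edge_def)
      show "Act X 1 [0,0,1] f \<in> Smp X 2" by (rule act(1)[OF f1]) simp
      show "Act X 2 [0,1] (Act X 1 [0,0,1] f) = qc_id X x \<and> Act X 2 [1,2] (Act X 1 [0,0,1] f) = f \<and>
        Act X 2 [0,2] (Act X 1 [0,0,1] f) = f"
        unfolding qc_id_def x using act(2)[OF f1] sset_act_id[OF S f1] by (simp add: idl_simps)
    qed
    show "qc_composite X f (qc_id X y) f" if f: "edge X f x y" for x y f
      unfolding qc_composite_def
    proof
      have f1: "f \<in> Smp X 1" and y: "y = Act X 1 [1] f" using f by (auto simp: edge_def)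
      show "Act X 1 [0,1,1] f \<in> Smp X 2" by (rule act(1)[OF f1]) simp
      show "Act X 2 [0,1] (Act X 1 [0,1,1] f) = f \<and> Act X 2 [1,2] (Act X 1 [0,1,1] f) = qc_id X y \<and>
        Act X 2 [0,2] (Act X 1 [0,1,1] f) = f"
        unfolding qc_id_def y using act(2)[OF f1] sset_act_id[OF S f1] by (simp add: idl_simps)
    qed
    show "qc_composite X f l m \<longleftrightarrow> qc_composite X h k m"
      if T: "qc_composite X f g h" "qc_composite X g k l" for f g h k l m
    proof -
      obtain a where a: "a \<in> Smp X 2" "Act X 2 [0,1] a = f" "Act X 2 [1,2] a = g" "Act X 2 [0,2] a = h"
        using T by (auto simp: qc_composite_def)
      obtain b where b: "b \<in> Smp X 2" "Act X 2 [0,1] b = g" "Act X 2 [1,2] b = k" "Act X 2 [0,2] b = l"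
        using T by (auto simp: qc_composite_def)
      have face: "Act X 2 \<beta> (Act X 3 \<alpha> \<rho>) = Act X 3 (ocomp \<alpha> \<beta>) \<rho>"
        if "\<rho> \<in> Smp X 3" "\<alpha> \<in> ord 2 3" "\<beta> \<in> ord 1 2" for \<alpha> \<beta> \<rho>
        using act(2)[OF that] .
      show ?thesis
      proof
        assume "qc_composite X f l m"
        then obtain c where c: "c \<in> Smp X 2" "Act X 2 [0,1] c = f" "Act X 2 [1,2] c = l" "Act X 2 [0,2] c = m"
          by (auto simp: qc_composite_def)
        have "\<exists>\<rho>\<in>Smp X 3. Act X 3 [0,1,2] \<rho> = a \<and> Act X 3 [1,2,3] \<rho> = b \<and> Act X 3 [0,1,3] \<rho> = c"
          using X a b c unfolding inner3_def by simp
        then obtain \<rho> where r: "\<rho> \<in> Smp X 3" "Act X 3 [0,1,2] \<rho> = a" "Act X 3 [1,2,3] \<rho> = b" "Act X 3 [0,1,3] \<rho> = c"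
          by blast
        have "Act X 3 [0,2,3] \<rho> \<in> Smp X 2" by (rule act(1)[OF r(1)]) simp
        moreover have "Act X 2 [0,1] (Act X 3 [0,2,3] \<rho>) = h" using face[OF r(1)] a(4) r(2) by auto
        moreover have "Act X 2 [1,2] (Act X 3 [0,2,3] \<rho>) = k" using face[OF r(1)] b(3) r(3) by auto
        moreover have "Act X 2 [0,2] (Act X 3 [0,2,3] \<rho>) = m" using face[OF r(1)] c(4) r(4) by auto
        ultimately show "qc_composite X h k m" unfolding qc_composite_def by blast
      next
        assume "qc_composite X h k m"
        then obtain c where c: "c \<in> Smp X 2" "Act X 2 [0,1] c = h" "Act X 2 [1,2] c = k" "Act X 2 [0,2] c = m"
          by (auto simp: qc_composite_def)
        have "\<exists>\<rho>\<in>Smp X 3. Act X 3 [0,1,2] \<rho> = a \<and> Act X 3 [1,2,3] \<rho> = b \<and> Act X 3 [0,2,3] \<rho> = c"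
          using X a b c unfolding inner3_def by simp
        then obtain \<rho> where r: "\<rho> \<in> Smp X 3" "Act X 3 [0,1,2] \<rho> = a" "Act X 3 [1,2,3] \<rho> = b" "Act X 3 [0,2,3] \<rho> = c"
          by blast
        have "Act X 3 [0,1,3] \<rho> \<in> Smp X 2" by (rule act(1)[OF r(1)]) simp
        moreover have "Act X 2 [0,1] (Act X 3 [0,1,3] \<rho>) = f" using face[OF r(1)] a(2) r(2) by auto
        moreover have "Act X 2 [1,2] (Act X 3 [0,1,3] \<rho>) = l" using face[OF r(1)] b(4) r(3) by auto
        moreover have "Act X 2 [0,2] (Act X 3 [0,1,3] \<rho>) = m" using face[OF r(1)] c(4) r(4) by auto
        ultimately show "qc_composite X f l m" unfolding qc_composite_def by blast
      qed
    qed
  qed (auto simp: edge_def)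
qed

section \<open>Trivial fibrations and Reedy fibrant bisimplicial sets\<close>

text \<open>A simplicial subset of the standard simplex. The extension argument below pulls such
  subsets back along a face and adjoins faces to them, and both operations stay within this
  class.\<close>

definition sieve :: "nat \<Rightarrow> nat list set \<Rightarrow> bool" where
  "sieve n A \<longleftrightarrow> (\<forall>\<alpha>\<in>A. \<exists>m. \<alpha> \<in> ord m n) \<and>
    (\<forall>m k. \<forall>\<alpha>\<in>A \<inter> ord m n. \<forall>\<beta>\<in>ord k m. ocomp \<alpha> \<beta> \<in> A)"

text \<open>Lifting is required only against boundary inclusions; the lifts against all simplicial
  subsets are derived in \<open>triv_fib_extend\<close>.\<close>

definition triv_fib :: "'a sset \<Rightarrow> 'b sset \<Rightarrow> (nat \<Rightarrow> 'a \<Rightarrow> 'b) \<Rightarrow> bool" where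
  "triv_fib X Y e \<longleftrightarrow> simplicial_set X \<and> simplicial_set Y \<and> simplicial_map X Y e \<and>
    (\<forall>n g y. partial_simplex X n (boundary n) g \<and> y \<in> Smp Y n \<and>
       (\<forall>m. \<forall>\<alpha>\<in>boundary n \<inter> ord m n. e m (g \<alpha>) = Act Y n \<alpha> y) \<longrightarrow>
       (\<exists>x. fills X n (boundary n) g x \<and> e n x = y))"

lemma facets_sieve: "sieve n (facets n I)"
  unfolding sieve_def
proof (intro conjI ballI allI)
  fix m k \<alpha> \<beta> assume a: "\<alpha> \<in> facets n I \<inter> ord m n" and b: "\<beta> \<in> ord k m"
  then obtain i where "i \<in> I" "i \<notin> set \<alpha>" by (auto simp: facets_def)
  moreover have "set (ocomp \<alpha> \<beta>) \<subseteq> set \<alpha>" using a by (intro set_ocomp_subset[OF _ b]) (auto simp: ord_length)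
  moreover have "ocomp \<alpha> \<beta> \<in> ord k n" using a b ocomp_in_ord by blast
  ultimately show "ocomp \<alpha> \<beta> \<in> facets n I" unfolding facets_def by blast
qed (auto simp: facets_def)

text \<open>Any choice of preimages works: monotonicity of \<open>\<alpha>\<close> forces preimages
  of distinct values into the right order. It follows that a sieve containing a surjection contains
  the whole simplex.\<close>

lemma onto_section:
  assumes a: "\<alpha> \<in> ord m n" and s: "set \<alpha> = {..n}"
  obtains \<beta> where "\<beta> \<in> ord n m" "ocomp \<alpha> \<beta> = idl n"
proof -
  have ex: "\<exists>i\<le>m. \<alpha> ! i = k" if "k \<le> n" for k
  proof -
    have "k \<in> set \<alpha>" using s that by simp
    thus ?thesis using ord_length[OF a] by (auto simp: in_set_conv_nth less_Suc_eq_le)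
  qed
  define r where "r k = (SOME i. i \<le> m \<and> \<alpha> ! i = k)" for k
  have r: "r k \<le> m \<and> \<alpha> ! r k = k" if "k \<le> n" for k
    unfolding r_def by (rule someI_ex) (use ex[OF that] in blast)
  have nth: "map r [0..<Suc n] ! k = r k" if "k \<le> n" for k
    using that by (simp del: upt_Suc)
  have "map r [0..<Suc n] \<in> ord n m"
  proof (rule ordI)
    fix k l assume kl: "k \<le> l" "l \<le> n"
    hence k: "k \<le> n" by simp
    have "r k \<le> r l"
    proof (rule ccontr)
      assume "\<not> r k \<le> r l"
      hence "\<alpha> ! r l \<le> \<alpha> ! r k" using ord_nth_mono[OF a, of "r l" "r k"] r[OF k] by simp
      hence "k = l" using r[OF k] r[OF kl(2)] kl by simp
      thus False using \<open>\<not> r k \<le> r l\<close> by simp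
    qed
    thus "map r [0..<Suc n] ! k \<le> map r [0..<Suc n] ! l" by (simp only: nth[OF k] nth[OF kl(2)])
  next
    fix k assume "k \<le> n"
    thus "map r [0..<Suc n] ! k \<le> m" using nth r by simp
  qed simp
  moreover have "ocomp \<alpha> (map r [0..<Suc n]) = idl n"
    by (rule nth_equalityI) (use nth r in \<open>simp_all del: upt_Suc add: less_Suc_eq_le\<close>)
  ultimately show ?thesis by (rule that)
qed

lemma sieve_onto:
  assumes "sieve n A" "\<alpha> \<in> A" "\<alpha> \<in> ord m n" "set \<alpha> = {..n}"
  shows "idl n \<in> A"
proof (rule onto_section[OF assms(3,4)])
  fix \<beta> assume b: "\<beta> \<in> ord n m" "ocomp \<alpha> \<beta> = idl n"
  have "ocomp \<alpha> \<beta> \<in> A" using assms(1,2,3) b(1) unfolding sieve_def by blast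
  thus ?thesis using b by simp
qed

text \<open>Cells are attached one face at a time. If a facet is missing from \<open>A\<close>, the
  lift is extended over it by the hypothesis in lower dimension and the facet is added; once all
  facets are present, \<open>A\<close> is either the boundary, where the defining lifting property
  applies, or the full simplex.\<close>

lemma triv_fib_extend:
  assumes TF: "triv_fib X Y e"
  shows "sieve n A \<Longrightarrow> partial_simplex X n A g \<Longrightarrow> y \<in> Smp Y n \<Longrightarrow>
    (\<And>m \<alpha>. \<alpha> \<in> A \<Longrightarrow> \<alpha> \<in> ord m n \<Longrightarrow> e m (g \<alpha>) = Act Y n \<alpha> y) \<Longrightarrow>
    \<exists>x. fills X n A g x \<and> e n x = y"
proof (induction n arbitrary: A g y rule: less_induct)
  case (less n)
  note IH = less.IH
  have X: "simplicial_set X" and Y: "simplicial_set Y" and e: "simplicial_map X Y e"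
    using TF by (simp_all add: triv_fib_def)
  have lift: "\<exists>x. fills X n (boundary n) g x \<and> e n x = y" if "partial_simplex X n (boundary n) g"
    "\<And>m \<alpha>. \<alpha> \<in> boundary n \<Longrightarrow> \<alpha> \<in> ord m n \<Longrightarrow> e m (g \<alpha>) = Act Y n \<alpha> y" for g
    using TF less.prems(3) that unfolding triv_fib_def by blast
  show ?case
    using less.prems(1,2,4)
  \<comment> \<open>The inner induction counts the missing facets; the outer one on the dimension
    has been kept as \<open>IH\<close>.\<close>
  proof (induction "card {j. j \<le> n \<and> face n j \<notin> A}" arbitrary: A g rule: less_induct)
    case (less A g)
    have sv: "ocomp \<alpha> \<beta> \<in> A" if "\<alpha> \<in> A" "\<alpha> \<in> ord m n" "\<beta> \<in> ord k m" for \<alpha> \<beta> m k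
      using less.prems(1) that unfolding sieve_def by blast
    have inord: "\<exists>m. \<alpha> \<in> ord m n" if "\<alpha> \<in> A" for \<alpha>
      using less.prems(1) that unfolding sieve_def by blast
    note g = partial_simplexD[OF less.prems(2)]
    consider "idl n \<in> A" | "idl n \<notin> A" "A = boundary n" | j where "j \<le> n" "0 < n" "face n j \<notin> A"
    proof (cases "idl n \<notin> A \<and> (\<forall>j\<le>n. 0 < n \<longrightarrow> face n j \<in> A)")
      case True
      have "A = boundary n"
      proof (intro set_eqI iffI)
        fix \<alpha> assume a: "\<alpha> \<in> A"
        then obtain m where m: "\<alpha> \<in> ord m n" using inord by blast
        have "set \<alpha> \<noteq> {..n}" using sieve_onto[OF less.prems(1) a m] True by blast
        thus "\<alpha> \<in> boundary n" using m unfolding boundary_def by blast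
      next
        fix \<alpha> assume "\<alpha> \<in> boundary n"
        then obtain m j where m: "\<alpha> \<in> ord m n" "j \<le> n" "j \<notin> set \<alpha>"
          unfolding boundary_facets facets_def by blast
        have n: "0 < n"
        proof (rule ccontr)
          assume "\<not> 0 < n"
          moreover have "\<alpha> ! 0 \<in> set \<alpha>" using ord_length[OF m(1)] by simp
          ultimately show False using m ord_nth_le[OF m(1), of 0] by simp
        qed
        hence "face n j \<in> A" using True m by blast
        from sv[OF this face_in_ord[OF n] squeeze_in_ord[OF m(1,3,2) n]]
        show "\<alpha> \<in> A" unfolding face_squeeze[OF m(1,3,2)] .
      qed
      thus ?thesis using that(2) True by blast
    qed (use that in blast)
    thus ?case
    proof cases
      case 1
      have i: "idl n \<in> ord n n" by simp
      have x: "g (idl n) \<in> Smp X n" by (rule g(1)[OF 1 i])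
      have "Act X n \<alpha> (g (idl n)) = g \<alpha>" if a: "\<alpha> \<in> A" for \<alpha>
      proof -
        obtain m where m: "\<alpha> \<in> ord m n" using inord[OF a] by blast
        show ?thesis using g(2)[OF 1 i m] ocomp_idl_left[OF m] by simp
      qed
      hence "fills X n A g (g (idl n))" using x by (simp add: fills_def)
      moreover have "e n (g (idl n)) = y"
        using less.prems(3)[OF 1 i] sset_act_id[OF Y \<open>y \<in> Smp Y n\<close>] by simp
      ultimately show ?thesis by blast
    next
      case 2
      show ?thesis unfolding 2 by (rule lift) (use less.prems 2 in auto)
    next
      case (3 j)
      define k where "k = n - 1"
      have k: "k < n" "n - 1 = k" using 3 by (auto simp: k_def)
      have f: "face n j \<in> ord k n" using face_in_ord[OF 3(2)] k by simp
      \<comment> \<open>The trace of \<open>A\<close> on the missing facet, as a sieve on a simplex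
        of one dimension less.\<close>
      define A' where "A' = {\<beta>. \<exists>m. \<beta> \<in> ord m k \<and> ocomp (face n j) \<beta> \<in> A}"
      define g' where "g' \<beta> = g (ocomp (face n j) \<beta>)" for \<beta>
      have fb: "ocomp (face n j) \<beta> \<in> ord m n" if "\<beta> \<in> ord m k" for \<beta> m by (rule ocomp_in_ord[OF f that])
      have as: "ocomp (face n j) (ocomp \<beta> \<gamma>) = ocomp (ocomp (face n j) \<beta>) \<gamma>"
        if "\<beta> \<in> ord m k" "\<gamma> \<in> ord l m" for \<beta> \<gamma> m l
        by (rule ocomp_assoc[OF ord_length[OF that(1)] that(2), symmetric])
      have A'D: "ocomp (face n j) \<beta> \<in> A" if "\<beta> \<in> A'" for \<beta> using that by (simp add: A'_def)
      have sA': "sieve k A'" unfolding sieve_def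
      proof (intro conjI ballI allI)
        fix m l \<beta> \<gamma> assume b: "\<beta> \<in> A' \<inter> ord m k" and c: "\<gamma> \<in> ord l m"
        hence "ocomp (face n j) (ocomp \<beta> \<gamma>) \<in> A" using as[OF _ c] sv[OF A'D fb c] by auto
        thus "ocomp \<beta> \<gamma> \<in> A'" unfolding A'_def using ocomp_in_ord b c by blast
      qed (auto simp: A'_def)
      have gA': "partial_simplex X k A' g'" unfolding partial_simplex_def g'_def
      proof (intro allI ballI conjI)
        fix m \<beta> assume b: "\<beta> \<in> A' \<inter> ord m k"
        hence b1: "ocomp (face n j) \<beta> \<in> A" and b2: "\<beta> \<in> ord m k" using A'D by auto
        show "g (ocomp (face n j) \<beta>) \<in> Smp X m" by (rule g(1)[OF b1 fb[OF b2]])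
        fix l \<gamma> assume c: "\<gamma> \<in> ord l m"
        show "g (ocomp (face n j) (ocomp \<beta> \<gamma>)) = Act X m \<gamma> (g (ocomp (face n j) \<beta>))"
          unfolding as[OF b2 c] by (rule g(2)[OF b1 fb[OF b2] c])
      qed
      have y': "Act Y n (face n j) y \<in> Smp Y k" by (rule sset_act_in[OF Y \<open>y \<in> Smp Y n\<close> f])
      have eA': "e m (g' \<beta>) = Act Y k \<beta> (Act Y n (face n j) y)" if "\<beta> \<in> A'" "\<beta> \<in> ord m k" for m \<beta>
        unfolding g'_def sset_act_act[OF Y \<open>y \<in> Smp Y n\<close> f that(2)]
        by (rule less.prems(3)[OF A'D[OF that(1)] fb[OF that(2)]])
      obtain x' where x': "fills X k A' g' x'" "e k x' = Act Y n (face n j) y"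
        using IH[OF k(1) sA' gA' y' eA'] by blast
      have x'k: "x' \<in> Smp X k" using x'(1) by (simp add: fills_def)
      define B where "B = A \<union> facets n {j}"
      \<comment> \<open>Old values take precedence on \<open>A\<close>. On the overlap with the new
        facet both clauses agree because \<open>x'\<close> extends \<open>g'\<close>.\<close>
      define h where "h \<alpha> = (if \<alpha> \<in> A then g \<alpha> else Act X k (squeeze j \<alpha>) x')" for \<alpha>
      have jB: "j \<notin> set \<alpha>" if "\<alpha> \<in> B" "\<alpha> \<notin> A" for \<alpha> using that by (auto simp: B_def facets_def)
      have sq: "squeeze j \<alpha> \<in> ord m k" if "\<alpha> \<in> ord m n" "j \<notin> set \<alpha>" for \<alpha> m
        using squeeze_in_ord[OF that 3(1,2)] k by simp
      have sB: "sieve n B" using less.prems(1) facets_sieve[of n "{j}"] unfolding sieve_def B_def by blast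
      have hB: "partial_simplex X n B h" unfolding partial_simplex_def
      proof (intro allI ballI conjI)
        fix m \<alpha> assume "\<alpha> \<in> B \<inter> ord m n"
        hence aB: "\<alpha> \<in> B" and a: "\<alpha> \<in> ord m n" by auto
        show "h \<alpha> \<in> Smp X m"
          using g(1)[OF _ a] sset_act_in[OF X x'k sq[OF a jB[OF aB]]] by (simp add: h_def)
        fix l \<beta> assume b: "\<beta> \<in> ord l m"
        show "h (ocomp \<alpha> \<beta>) = Act X m \<beta> (h \<alpha>)"
        proof (cases "\<alpha> \<in> A")
          case True
          thus ?thesis using sv[OF True a b] g(2)[OF True a b] by (simp add: h_def)
        next
          case False
          have j: "j \<notin> set \<alpha>" by (rule jB[OF aB False])
          have e: "Act X m \<beta> (h \<alpha>) = Act X k (ocomp (squeeze j \<alpha>) \<beta>) x'"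
            using False sset_act_act[OF X x'k sq[OF a j] b] by (simp add: h_def)
          have sb: "ocomp (squeeze j \<alpha>) \<beta> \<in> ord l k" by (rule ocomp_in_ord[OF sq[OF a j] b])
          show ?thesis
          proof (cases "ocomp \<alpha> \<beta> \<in> A")
            case True
            have oc: "ocomp (face n j) (ocomp (squeeze j \<alpha>) \<beta>) = ocomp \<alpha> \<beta>"
              unfolding as[OF sq[OF a j] b] face_squeeze[OF a j 3(1)] ..
            have "ocomp (squeeze j \<alpha>) \<beta> \<in> A'"
              unfolding A'_def using sb oc True by auto
            hence "Act X k (ocomp (squeeze j \<alpha>) \<beta>) x' = g' (ocomp (squeeze j \<alpha>) \<beta>)"
              using x'(1) by (simp add: fills_def)
            thus ?thesis unfolding e g'_def oc using True by (simp add: h_def)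
          next
            case F2: False
            thus ?thesis unfolding e using squeeze_ocomp[OF ord_length[OF a] b] by (simp add: h_def)
          qed
        qed
      qed
      have eB: "e m (h \<alpha>) = Act Y n \<alpha> y" if aB: "\<alpha> \<in> B" and a: "\<alpha> \<in> ord m n" for m \<alpha>
      proof (cases "\<alpha> \<in> A")
        case True
        thus ?thesis using less.prems(3)[OF True a] by (simp add: h_def)
      next
        case False
        have j: "j \<notin> set \<alpha>" by (rule jB[OF aB False])
        show ?thesis
          using False simplicial_map_act[OF e x'k sq[OF a j]] x'(2)
            sset_act_act[OF Y \<open>y \<in> Smp Y n\<close> f sq[OF a j]] face_squeeze[OF a j 3(1)] by (simp add: h_def)
      qed
      have jB': "face n j \<in> B" unfolding B_def using face_in_facets[OF 3(2), of j "{j}"] by simp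
      have "card {i. i \<le> n \<and> face n i \<notin> B} < card {i. i \<le> n \<and> face n i \<notin> A}"
      proof (rule psubset_card_mono)
        have "{i. i \<le> n \<and> face n i \<notin> B} \<subseteq> {i. i \<le> n \<and> face n i \<notin> A}" by (auto simp: B_def)
        moreover have "j \<notin> {i. i \<le> n \<and> face n i \<notin> B}" "j \<in> {i. i \<le> n \<and> face n i \<notin> A}" using jB' 3 by auto
        ultimately show "{i. i \<le> n \<and> face n i \<notin> B} \<subset> {i. i \<le> n \<and> face n i \<notin> A}" by blast
      qed simp
      then obtain x where x: "fills X n B h x" "e n x = y" using less.hyps[OF _ sB hB eB] by blast
      have "fills X n A g x" using x(1) unfolding fills_def B_def h_def by simp
      thus ?thesis using x(2) by blast
    qed
  qed
qed

section \<open>Bisimplicial sets, their rows and levels\<close>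

lemma idl_ord: "idl n \<in> ord n n"
  by simp

lemma bs_act_in: "bisimplicial_set W \<Longrightarrow> x \<in> BSmp W n l \<Longrightarrow> \<alpha> \<in> ord m n \<Longrightarrow> \<gamma> \<in> ord j l \<Longrightarrow>
    BAct W n l \<alpha> \<gamma> x \<in> BSmp W m j"
  by (simp add: bisimplicial_set_def)

lemma bs_act_id: "bisimplicial_set W \<Longrightarrow> x \<in> BSmp W n l \<Longrightarrow> BAct W n l (idl n) (idl l) x = x"
  by (simp add: bisimplicial_set_def)

lemma bs_act_act: "bisimplicial_set W \<Longrightarrow> x \<in> BSmp W n l \<Longrightarrow> \<alpha> \<in> ord m n \<Longrightarrow> \<gamma> \<in> ord j l \<Longrightarrow>
    \<beta> \<in> ord k m \<Longrightarrow> \<delta> \<in> ord i j \<Longrightarrow>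
    BAct W m j \<beta> \<delta> (BAct W n l \<alpha> \<gamma> x) = BAct W n l (ocomp \<alpha> \<beta>) (ocomp \<gamma> \<delta>) x"
  by (simp add: bisimplicial_set_def)

lemma row_simps [simp]: "Smp (row W l) n = BSmp W n l" "Act (row W l) n \<alpha> x = BAct W n l \<alpha> (idl l) x"
  by (simp_all add: row_def)

lemma level_simps [simp]: "Smp (level W n) l = BSmp W n l" "Act (level W n) l \<gamma> x = BAct W n l (idl n) \<gamma> x"
  by (simp_all add: level_def)

lemma ocomp_idl_idl [simp]: "ocomp (idl n) (idl n) = idl n"
  by (simp add: ocomp_idl_right)

lemma row_simplicial: "bisimplicial_set W \<Longrightarrow> simplicial_set (row W l)"
  unfolding simplicial_set_def by (simp add: bs_act_in bs_act_id bs_act_act)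

lemma level_simplicial: "bisimplicial_set W \<Longrightarrow> simplicial_set (level W n)"
  unfolding simplicial_set_def by (simp add: bs_act_in bs_act_id bs_act_act)

text \<open>Horns in the spatial direction form a simplicial set in the categorical direction, and Reedy
  fibrancy says that restriction to horns is a trivial fibration onto it.\<close>

definition horn_maps :: "'a bsset \<Rightarrow> nat \<Rightarrow> nat \<Rightarrow> (nat list \<Rightarrow> 'a) sset" where
  "horn_maps W l i =
    \<lparr>Smp = (\<lambda>n. {g \<in> extensional (horn l i). partial_simplex (level W n) l (horn l i) g}),
     Act = (\<lambda>n \<alpha> g. restrict (\<lambda>\<gamma>. BAct W n (length \<gamma> - 1) \<alpha> (idl (length \<gamma> - 1)) (g \<gamma>)) (horn l i))\<rparr>"

lemma hornD: "\<gamma> \<in> horn l i \<Longrightarrow> \<gamma> \<in> ord (length \<gamma> - 1) l"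
  by (auto simp: horn_def ord_def)

lemma horn_sieve: "i \<le> l \<Longrightarrow> sieve l (horn l i)"
  by (simp add: horn_facets facets_sieve)

lemma sieveD: "sieve n A \<Longrightarrow> \<alpha> \<in> A \<Longrightarrow> \<alpha> \<in> ord m n \<Longrightarrow> \<beta> \<in> ord k m \<Longrightarrow> ocomp \<alpha> \<beta> \<in> A"
  by (auto simp: sieve_def)

lemma horn_maps_act:
  assumes W: "bisimplicial_set W" and i: "i \<le> l" and g: "g \<in> Smp (horn_maps W l i) n" and a: "\<alpha> \<in> ord m n"
  shows "Act (horn_maps W l i) n \<alpha> g \<in> Smp (horn_maps W l i) m"
    and "\<gamma> \<in> horn l i \<Longrightarrow> \<gamma> \<in> ord j l \<Longrightarrow> Act (horn_maps W l i) n \<alpha> g \<gamma> = BAct W n j \<alpha> (idl j) (g \<gamma>)"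
proof -
  let ?g = "Act (horn_maps W l i) n \<alpha> g"
  have *: "?g \<gamma> = BAct W n j \<alpha> (idl j) (g \<gamma>)" if "\<gamma> \<in> horn l i" "\<gamma> \<in> ord j l" for \<gamma> j
    using that by (simp add: horn_maps_def ord_length)
  show "\<gamma> \<in> horn l i \<Longrightarrow> \<gamma> \<in> ord j l \<Longrightarrow> ?g \<gamma> = BAct W n j \<alpha> (idl j) (g \<gamma>)" by (rule *)
  have ps: "partial_simplex (level W n) l (horn l i) g" using g by (simp add: horn_maps_def)
  have "partial_simplex (level W m) l (horn l i) ?g"
    unfolding partial_simplex_def
  proof (intro allI ballI conjI)
    fix j \<gamma> assume "\<gamma> \<in> horn l i \<inter> ord j l"
    hence c: "\<gamma> \<in> horn l i" "\<gamma> \<in> ord j l" by auto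
    have gc: "g \<gamma> \<in> BSmp W n j" using partial_simplexD(1)[OF ps c] by simp
    show "?g \<gamma> \<in> Smp (level W m) j" unfolding *[OF c] using bs_act_in[OF W gc a] by simp
    fix k \<delta> assume d: "\<delta> \<in> ord k j"
    have "?g (ocomp \<gamma> \<delta>) = BAct W n k \<alpha> (idl k) (BAct W n j (idl n) \<delta> (g \<gamma>))"
      unfolding *[OF sieveD[OF horn_sieve[OF i] c d] ocomp_in_ord[OF c(2) d]]
      using partial_simplexD(2)[OF ps c d] by simp
    also have "\<dots> = BAct W n j \<alpha> \<delta> (g \<gamma>)"
      using bs_act_act[OF W gc idl_ord d a idl_ord] by (simp add: ocomp_idl_left[OF a] ocomp_idl_right[OF ord_length[OF d]])
    also have "\<dots> = BAct W m j (idl m) \<delta> (BAct W n j \<alpha> (idl j) (g \<gamma>))"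
      using bs_act_act[OF W gc a idl_ord idl_ord d] by (simp add: ocomp_idl_left[OF d] ocomp_idl_right[OF ord_length[OF a]])
    finally show "?g (ocomp \<gamma> \<delta>) = Act (level W m) j \<delta> (?g \<gamma>)" unfolding *[OF c] by simp
  qed
  thus "?g \<in> Smp (horn_maps W l i) m" by (simp add: horn_maps_def)
qed

lemma horn_maps_simplicial:
  assumes W: "bisimplicial_set W" and i: "i \<le> l"
  shows "simplicial_set (horn_maps W l i)"
  unfolding simplicial_set_def
proof (intro conjI allI ballI)
  let ?M = "horn_maps W l i"
  have ext: "g \<in> extensional (horn l i)" if "g \<in> Smp ?M n" for g n using that by (simp add: horn_maps_def)
  have val: "g \<gamma> \<in> BSmp W n j" if "g \<in> Smp ?M n" "\<gamma> \<in> horn l i" "\<gamma> \<in> ord j l" for g n \<gamma> j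
    using that partial_simplexD(1)[of "level W n" l "horn l i" g \<gamma> j] by (simp add: horn_maps_def)
  note M = horn_maps_act[OF W i]
  show "Act ?M n \<alpha> x \<in> Smp ?M m" if "\<alpha> \<in> ord m n" "x \<in> Smp ?M n" for m n \<alpha> x using M(1) that by blast
  show "Act ?M n (idl n) x = x" if x: "x \<in> Smp ?M n" for n x
  proof (rule extensionalityI[of _ "horn l i"])
    fix \<gamma> assume c: "\<gamma> \<in> horn l i"
    show "Act ?M n (idl n) x \<gamma> = x \<gamma>"
      using M(2)[OF x _ c hornD[OF c]] bs_act_id[OF W val[OF x c hornD[OF c]]] by simp
  qed (use x M(1)[OF x, of "idl n" n] ext in auto)
  show "Act ?M m \<beta> (Act ?M n \<alpha> x) = Act ?M n (ocomp \<alpha> \<beta>) x"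
    if a: "\<alpha> \<in> ord m n" and b: "\<beta> \<in> ord k m" and x: "x \<in> Smp ?M n" for k m n \<alpha> \<beta> x
  proof (rule extensionalityI[of _ "horn l i"])
    fix \<gamma> assume c: "\<gamma> \<in> horn l i"
    note d = hornD[OF c]
    show "Act ?M m \<beta> (Act ?M n \<alpha> x) \<gamma> = Act ?M n (ocomp \<alpha> \<beta>) x \<gamma>"
      unfolding M(2)[OF M(1)[OF x a] b c d] M(2)[OF x a c d] M(2)[OF x ocomp_in_ord[OF a b] c d]
      using bs_act_act[OF W val[OF x c d] a idl_ord b idl_ord] by simp
  qed (use M(1)[OF M(1)[OF x a] b] M(1)[OF x ocomp_in_ord[OF a b]] ext in auto)
qed

text \<open>Both lifting problems are maps out of the same union of boundary times simplex and
  simplex times horn: lifting a spatial horn against a matching map is the same as lifting a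
  categorical boundary against restriction to horns.\<close>

lemma row_triv_fib:
  assumes W: "bisimplicial_set W" and R: "reedy_fibrant W" and i: "1 \<le> l" "i \<le> l"
  shows "triv_fib (row W l) (horn_maps W l i) (\<lambda>n w. restrict (\<lambda>\<gamma>. BAct W n l (idl n) \<gamma> w) (horn l i))"
    (is "triv_fib _ ?M ?e")
  unfolding triv_fib_def
proof (intro conjI allI impI row_simplicial[OF W] horn_maps_simplicial[OF W i(2)]; (elim conjE)?)
  have e_in: "?e n w \<in> Smp ?M n" if w: "w \<in> BSmp W n l" for n w
  proof -
    have "partial_simplex (level W n) l (horn l i) (?e n w)" unfolding partial_simplex_def
    proof (intro allI ballI conjI)
      fix j \<gamma> assume "\<gamma> \<in> horn l i \<inter> ord j l"
      hence c: "\<gamma> \<in> horn l i" "\<gamma> \<in> ord j l" by auto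
      show "?e n w \<gamma> \<in> Smp (level W n) j" using c bs_act_in[OF W w _ c(2)] by simp
      fix k \<delta> assume d: "\<delta> \<in> ord k j"
      show "?e n w (ocomp \<gamma> \<delta>) = Act (level W n) j \<delta> (?e n w \<gamma>)"
        using c sieveD[OF horn_sieve[OF i(2)] c d] bs_act_act[OF W w idl_ord c(2) idl_ord d] by simp
    qed
    thus ?thesis by (simp add: horn_maps_def)
  qed
  show "simplicial_map (row W l) ?M ?e" unfolding simplicial_map_def
  proof (intro conjI allI ballI)
    show "?e n x \<in> Smp ?M n" if "x \<in> Smp (row W l) n" for n x using e_in that by simp
    fix m n \<alpha> x assume a: "\<alpha> \<in> ord m n" and "x \<in> Smp (row W l) n"
    hence x: "x \<in> BSmp W n l" by simp
    show "?e m (Act (row W l) n \<alpha> x) = Act ?M n \<alpha> (?e n x)"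
    proof (rule extensionalityI[of _ "horn l i"])
      fix \<gamma> assume c: "\<gamma> \<in> horn l i"
      note d = hornD[OF c]
      have oc: "ocomp \<gamma> (idl (length \<gamma> - 1)) = \<gamma>" by (rule ocomp_idl_right[OF ord_length[OF d]])
      show "?e m (Act (row W l) n \<alpha> x) \<gamma> = Act ?M n \<alpha> (?e n x) \<gamma>"
        unfolding horn_maps_act(2)[OF W i(2) e_in[OF x] a c d]
        using c bs_act_act[OF W x a idl_ord idl_ord d] bs_act_act[OF W x idl_ord d a idl_ord]
        by (simp add: ocomp_idl_left[OF a] ocomp_idl_left[OF d] ocomp_idl_right[OF ord_length[OF a]]
            oc[simplified])
    qed (simp_all add: horn_maps_def)
  qed
  fix n g y assume g: "partial_simplex (row W l) n (boundary n) g" and y: "y \<in> Smp ?M n"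
    and gy: "\<forall>m. \<forall>\<alpha>\<in>boundary n \<inter> ord m n. ?e m (g \<alpha>) = Act ?M n \<alpha> y"
  have yps: "partial_simplex (level W n) l (horn l i) y" using y by (simp add: horn_maps_def)
  \<comment> \<open>The map on the union. The boundary clause is preferred, and \<open>G2\<close>
    shows that the horn clause holds on the overlap too.\<close>
  define G where "G \<alpha> \<gamma> = (if \<alpha> \<in> boundary n then BAct W (length \<alpha> - 1) l (idl (length \<alpha> - 1)) \<gamma> (g \<alpha>)
    else BAct W n (length \<gamma> - 1) \<alpha> (idl (length \<gamma> - 1)) (y \<gamma>))" for \<alpha> \<gamma>
  have G1: "G \<alpha> \<gamma> = BAct W m l (idl m) \<gamma> (g \<alpha>)" if "\<alpha> \<in> ord m n" "\<alpha> \<in> boundary n" for \<alpha> \<gamma> m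
    using that by (simp add: G_def ord_length)
  have G2: "G \<alpha> \<gamma> = BAct W n j \<alpha> (idl j) (y \<gamma>)"
    if a: "\<alpha> \<in> ord m n" and c: "\<gamma> \<in> ord j l" "\<gamma> \<in> horn l i" for \<alpha> \<gamma> m j
  proof (cases "\<alpha> \<in> boundary n")
    case True
    hence "?e m (g \<alpha>) \<gamma> = Act ?M n \<alpha> y \<gamma>" using gy a by auto
    thus ?thesis unfolding G1[OF a True] horn_maps_act(2)[OF W i(2) y a c(2,1)] using c by simp
  qed (use c in \<open>simp add: G_def ord_length\<close>)
  have bs: "sieve n (boundary n)" unfolding boundary_facets by (rule facets_sieve)
  have "\<exists>w\<in>BSmp W n l. \<forall>m j. \<forall>\<alpha>\<in>ord m n. \<forall>\<gamma>\<in>ord j l. \<alpha> \<in> boundary n \<or> \<gamma> \<in> horn l i \<longrightarrow>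
           BAct W n l \<alpha> \<gamma> w = G \<alpha> \<gamma>"
  proof (rule R[unfolded reedy_fibrant_def, rule_format], intro conjI allI ballI impI i)
    fix m j \<alpha> \<gamma> assume a: "\<alpha> \<in> ord m n" and c: "\<gamma> \<in> ord j l" and or: "\<alpha> \<in> boundary n \<or> \<gamma> \<in> horn l i"
    have "G \<alpha> \<gamma> \<in> BSmp W m j \<and> (\<forall>\<beta> m' \<delta> j'. \<beta> \<in> ord m' m \<longrightarrow> \<delta> \<in> ord j' j \<longrightarrow>
      G (ocomp \<alpha> \<beta>) (ocomp \<gamma> \<delta>) = BAct W m j \<beta> \<delta> (G \<alpha> \<gamma>))"
    proof (cases "\<alpha> \<in> boundary n")
      case True
      have ga: "g \<alpha> \<in> BSmp W m l" using partial_simplexD(1)[OF g True a] by simp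
      have "G (ocomp \<alpha> \<beta>) (ocomp \<gamma> \<delta>) = BAct W m j \<beta> \<delta> (G \<alpha> \<gamma>)"
        if b: "\<beta> \<in> ord m' m" and d: "\<delta> \<in> ord j' j" for \<beta> m' \<delta> j'
      proof -
        have "G (ocomp \<alpha> \<beta>) (ocomp \<gamma> \<delta>) = BAct W m' l (idl m') (ocomp \<gamma> \<delta>) (BAct W m l \<beta> (idl l) (g \<alpha>))"
          unfolding G1[OF ocomp_in_ord[OF a b] sieveD[OF bs True a b]]
          using partial_simplexD(2)[OF g True a b] by simp
        also have "\<dots> = BAct W m l \<beta> (ocomp \<gamma> \<delta>) (g \<alpha>)"
          using bs_act_act[OF W ga b idl_ord idl_ord ocomp_in_ord[OF c d]]
          by (simp add: ocomp_idl_right[OF ord_length[OF b]] ocomp_idl_left[OF ocomp_in_ord[OF c d]])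
        also have "\<dots> = BAct W m j \<beta> \<delta> (BAct W m l (idl m) \<gamma> (g \<alpha>))"
          using bs_act_act[OF W ga idl_ord c b d] by (simp add: ocomp_idl_left[OF b])
        finally show ?thesis unfolding G1[OF a True] .
      qed
      thus ?thesis using bs_act_in[OF W ga _ c] G1[OF a True] by simp
    next
      case False
      hence ch: "\<gamma> \<in> horn l i" using or by simp
      have yc: "y \<gamma> \<in> BSmp W n j" using partial_simplexD(1)[OF yps ch c] by simp
      have "G (ocomp \<alpha> \<beta>) (ocomp \<gamma> \<delta>) = BAct W m j \<beta> \<delta> (G \<alpha> \<gamma>)"
        if b: "\<beta> \<in> ord m' m" and d: "\<delta> \<in> ord j' j" for \<beta> m' \<delta> j'
      proof -
        have "G (ocomp \<alpha> \<beta>) (ocomp \<gamma> \<delta>) = BAct W n j' (ocomp \<alpha> \<beta>) (idl j') (BAct W n j (idl n) \<delta> (y \<gamma>))"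
          unfolding G2[OF ocomp_in_ord[OF a b] ocomp_in_ord[OF c d] sieveD[OF horn_sieve[OF i(2)] ch c d]]
          using partial_simplexD(2)[OF yps ch c d] by simp
        also have "\<dots> = BAct W n j (ocomp \<alpha> \<beta>) \<delta> (y \<gamma>)"
          using bs_act_act[OF W yc idl_ord d ocomp_in_ord[OF a b] idl_ord]
          by (simp add: ocomp_idl_right[OF ord_length[OF d]] ocomp_idl_left[OF ocomp_in_ord[OF a b]])
        also have "\<dots> = BAct W m j \<beta> \<delta> (BAct W n j \<alpha> (idl j) (y \<gamma>))"
          using bs_act_act[OF W yc a idl_ord b d] by (simp add: ocomp_idl_left[OF d])
        finally show ?thesis unfolding G2[OF a c ch] .
      qed
      thus ?thesis using bs_act_in[OF W yc a] G2[OF a c ch] by simp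
    qed
    thus "G \<alpha> \<gamma> \<in> BSmp W m j" and
      "\<And>m' j' \<beta> \<delta>. \<beta> \<in> ord m' m \<Longrightarrow> \<delta> \<in> ord j' j \<Longrightarrow> G (ocomp \<alpha> \<beta>) (ocomp \<gamma> \<delta>) = BAct W m j \<beta> \<delta> (G \<alpha> \<gamma>)"
      by blast+
  qed
  then obtain w where w: "w \<in> BSmp W n l"
    and wG: "\<And>m j \<alpha> \<gamma>. \<alpha> \<in> ord m n \<Longrightarrow> \<gamma> \<in> ord j l \<Longrightarrow> \<alpha> \<in> boundary n \<or> \<gamma> \<in> horn l i \<Longrightarrow> BAct W n l \<alpha> \<gamma> w = G \<alpha> \<gamma>"
    by blast
  have "fills (row W l) n (boundary n) g w" unfolding fills_def
  proof (intro conjI ballI)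
    fix \<alpha> assume b: "\<alpha> \<in> boundary n"
    then obtain m where a: "\<alpha> \<in> ord m n" by (auto simp: boundary_def)
    have "BAct W n l \<alpha> (idl l) w = G \<alpha> (idl l)" by (rule wG[OF a]) (use b in simp_all)
    also have "\<dots> = g \<alpha>"
      unfolding G1[OF a b] using bs_act_id[OF W] partial_simplexD(1)[OF g b a] by simp
    finally show "Act (row W l) n \<alpha> w = g \<alpha>" by simp
  qed (use w in simp)
  moreover have "?e n w = y"
  proof (rule extensionalityI[of _ "horn l i"])
    fix \<gamma> assume c: "\<gamma> \<in> horn l i"
    note d = hornD[OF c]
    have "BAct W n l (idl n) \<gamma> w = G (idl n) \<gamma>" by (rule wG[OF _ d]) (use c in simp_all)
    also have "\<dots> = y \<gamma>"
      unfolding G2[OF _ d c, of "idl n" n, simplified] using bs_act_id[OF W] partial_simplexD(1)[OF yps c d] by simp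
    finally show "?e n w \<gamma> = y \<gamma>" using c by simp
  qed (use y in \<open>simp_all add: horn_maps_def\<close>)
  ultimately show "\<exists>x. fills (row W l) n (boundary n) g x \<and> ?e n x = y" by blast
qed

text \<open>Reedy fibrancy speaks about boundaries in the categorical direction. Reading it as a
  trivial fibration replaces the boundary by any simplicial subset \<open>A\<close>, such as a spine
  made of two faces or a single face.\<close>

lemma reedy_extend:
  assumes W: "bisimplicial_set W" and R: "reedy_fibrant W" and i: "1 \<le> l" "i \<le> l"
    and A: "sieve n A" and g: "partial_simplex (row W l) n A g"
    and y: "partial_simplex (level W n) l (horn l i) y"
    and gy: "\<And>m j \<alpha> \<gamma>. \<alpha> \<in> A \<Longrightarrow> \<alpha> \<in> ord m n \<Longrightarrow> \<gamma> \<in> horn l i \<Longrightarrow> \<gamma> \<in> ord j l \<Longrightarrow>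
      BAct W m l (idl m) \<gamma> (g \<alpha>) = BAct W n j \<alpha> (idl j) (y \<gamma>)"
  obtains w where "w \<in> BSmp W n l" "\<And>\<alpha>. \<alpha> \<in> A \<Longrightarrow> BAct W n l \<alpha> (idl l) w = g \<alpha>"
    "\<And>\<gamma>. \<gamma> \<in> horn l i \<Longrightarrow> BAct W n l (idl n) \<gamma> w = y \<gamma>"
proof -
  let ?M = "horn_maps W l i" and ?e = "\<lambda>n w. restrict (\<lambda>\<gamma>. BAct W n l (idl n) \<gamma> w) (horn l i)"
  let ?y = "restrict y (horn l i)"
  have "partial_simplex (level W n) l (horn l i) ?y"
    using y sieveD[OF horn_sieve[OF i(2)]] unfolding partial_simplex_def by auto
  hence y': "?y \<in> Smp ?M n" by (simp add: horn_maps_def)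
  have e: "?e m (g \<alpha>) = Act ?M n \<alpha> ?y" if a: "\<alpha> \<in> A" "\<alpha> \<in> ord m n" for m \<alpha>
  proof (rule extensionalityI[of _ "horn l i"])
    fix \<gamma> assume c: "\<gamma> \<in> horn l i"
    show "?e m (g \<alpha>) \<gamma> = Act ?M n \<alpha> ?y \<gamma>"
      unfolding horn_maps_act(2)[OF W i(2) y' a(2) c hornD[OF c]] using gy[OF a c hornD[OF c]] c by simp
  qed (simp_all add: horn_maps_def)
  obtain w where w: "fills (row W l) n A g w" "?e n w = ?y"
    using triv_fib_extend[OF row_triv_fib[OF W R i] A g y' e] by blast
  have "BAct W n l (idl n) \<gamma> w = y \<gamma>" if c: "\<gamma> \<in> horn l i" for \<gamma>
    using fun_cong[OF w(2), of \<gamma>] c by simp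
  thus ?thesis using that[of w] w(1) by (simp add: fills_def)
qed

text \<open>The subset is a union of facets here, so the data reduce to one simplex per facet with
  pairwise compatibility, plus agreement with the horn \<open>y\<close> on each facet.\<close>

lemma reedy_extend_faces:
  assumes W: "bisimplicial_set W" and R: "reedy_fibrant W" and l: "1 \<le> l" "i \<le> l"
    and n: "0 < n" and I: "I \<subseteq> {..n}" and x: "\<And>k. k \<in> I \<Longrightarrow> x k \<in> BSmp W (n - 1) l"
    and compat: "\<And>k j. 2 \<le> n \<Longrightarrow> k \<in> I \<Longrightarrow> j \<in> I \<Longrightarrow> k < j \<Longrightarrow>
      BAct W (n - 1) l (face (n - 1) k) (idl l) (x j) = BAct W (n - 1) l (face (n - 1) (j - 1)) (idl l) (x k)"
    and y: "partial_simplex (level W n) l (horn l i) y"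
    and xy: "\<And>k j \<gamma>. k \<in> I \<Longrightarrow> \<gamma> \<in> horn l i \<Longrightarrow> \<gamma> \<in> ord j l \<Longrightarrow>
      BAct W (n - 1) l (idl (n - 1)) \<gamma> (x k) = BAct W n j (face n k) (idl j) (y \<gamma>)"
  obtains w where "w \<in> BSmp W n l" "\<And>k. k \<in> I \<Longrightarrow> BAct W n l (face n k) (idl l) w = x k"
    "\<And>\<gamma>. \<gamma> \<in> horn l i \<Longrightarrow> BAct W n l (idl n) \<gamma> w = y \<gamma>"
proof (rule glue_facets[where X = "row W l" and n = n and I = I and x = x])
  fix g assume g: "partial_simplex (row W l) n (facets n I) g" "\<And>i. i \<in> I \<Longrightarrow> g (face n i) = x i"
    "\<And>i \<alpha> m. i \<in> I \<Longrightarrow> \<alpha> \<in> ord m n \<Longrightarrow> i \<notin> set \<alpha> \<Longrightarrow> g \<alpha> = Act (row W l) (n - 1) (squeeze i \<alpha>) (x i)"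
  show ?thesis
  proof (rule reedy_extend[OF W R l facets_sieve g(1) y])
    fix m j \<alpha> \<gamma> assume a: "\<alpha> \<in> facets n I" "\<alpha> \<in> ord m n" and c: "\<gamma> \<in> horn l i" "\<gamma> \<in> ord j l"
    then obtain k where k: "k \<in> I" "k \<notin> set \<alpha>" by (auto simp: facets_def)
    have s: "squeeze k \<alpha> \<in> ord m (n - 1)" using squeeze_in_ord[OF a(2) k(2) _ n] k(1) I by auto
    have yc: "y \<gamma> \<in> BSmp W n j" using partial_simplexD(1)[OF y c] by simp
    have "BAct W m l (idl m) \<gamma> (g \<alpha>) = BAct W (n - 1) l (squeeze k \<alpha>) \<gamma> (x k)"
      unfolding g(3)[OF k(1) a(2) k(2)]
      using bs_act_act[OF W x[OF k(1)] s idl_ord idl_ord c(2)]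
      by (simp add: ocomp_idl_left[OF c(2)] ocomp_idl_right[OF ord_length[OF s]])
    also have "\<dots> = BAct W (n - 1) j (squeeze k \<alpha>) (idl j) (BAct W (n - 1) l (idl (n - 1)) \<gamma> (x k))"
      using bs_act_act[OF W x[OF k(1)] idl_ord c(2) s idl_ord]
      by (simp only: ocomp_idl_left[OF s] ocomp_idl_right[OF ord_length[OF c(2)]])
    also have "\<dots> = BAct W n j \<alpha> (idl j) (y \<gamma>)"
      unfolding xy[OF k(1) c]
      using bs_act_act[OF W yc face_in_ord[OF n] idl_ord s idl_ord] face_squeeze[OF a(2) k(2)] k(1) I by auto
    finally show "BAct W m l (idl m) \<gamma> (g \<alpha>) = BAct W n j \<alpha> (idl j) (y \<gamma>)" .
  next
    fix w assume w: "w \<in> BSmp W n l" "\<And>\<alpha>. \<alpha> \<in> facets n I \<Longrightarrow> BAct W n l \<alpha> (idl l) w = g \<alpha>"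
      "\<And>\<gamma>. \<gamma> \<in> horn l i \<Longrightarrow> BAct W n l (idl n) \<gamma> w = y \<gamma>"
    show ?thesis
      by (rule that[OF w(1) _ w(3)]) (use w(2) face_in_facets[OF n] g(2) in simp_all)
  qed
qed ((unfold row_simps)?, rule row_simplicial[OF W] n I x compat; assumption)+

text \<open>With empty categorical part, \<open>reedy_extend\<close> leaves only a spatial horn to
  be filled.\<close>

lemma level_kan:
  assumes W: "bisimplicial_set W" and R: "reedy_fibrant W"
  shows "kan_complex (level W n)"
  unfolding kan_complex_def
proof (intro conjI allI impI level_simplicial[OF W]; elim conjE)
  fix l i g assume l: "1 \<le> l" "i \<le> l" and g: "partial_simplex (level W n) l (horn l i) g"
  show "\<exists>x. fills (level W n) l (horn l i) g x"
    by (rule reedy_extend[OF W R l, of n "{}" "\<lambda>_. undefined" g])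
      (use g in \<open>auto simp: sieve_def partial_simplex_def fills_def\<close>)
qed

text \<open>This horn is the single vertex 0 with its degeneracies, so horn lifting for
  \<open>l = 1\<close> is the lifting of paths with given start.\<close>

lemma horn1: "\<gamma> \<in> horn (Suc 0) 0 \<longleftrightarrow> (\<exists>j. \<gamma> = const_op j 0)"
proof
  assume "\<gamma> \<in> horn (Suc 0) 0"
  then obtain j where j: "\<gamma> \<in> ord j (Suc 0)" "insert 0 (set \<gamma>) \<noteq> {..Suc 0}" by (auto simp: horn_def)
  have "set \<gamma> \<subseteq> {..Suc 0}" using ord_le[OF j(1)] by auto
  moreover have "{..Suc 0} = {0, Suc 0}" by auto
  ultimately have "Suc 0 \<notin> set \<gamma>" using j(2) by auto
  hence "\<gamma> = replicate (length \<gamma>) 0"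
    using \<open>set \<gamma> \<subseteq> {..Suc 0}\<close> by (intro replicate_eqI) (auto simp: le_Suc_eq)
  thus "\<exists>j. \<gamma> = const_op j 0" using ord_length[OF j(1)] unfolding const_op_def by auto
next
  assume "\<exists>j. \<gamma> = const_op j 0"
  then obtain j where j: "\<gamma> = const_op j 0" by blast
  have "insert 0 (set \<gamma>) = {0}" unfolding j const_op_def by auto
  moreover have "\<gamma> \<in> ord j (Suc 0)" by (simp add: j)
  moreover have "{0} \<noteq> {..Suc 0}" by auto
  ultimately show "\<gamma> \<in> horn (Suc 0) 0" unfolding horn_def by auto
qed

text \<open>Path lifting: if some faces of \<open>\<rho>\<close> are moved along compatible paths,
  the whole simplex can be moved along with them. All later corrections of simplices go through this
  lemma.\<close>

lemma path_extend:
  assumes W: "bisimplicial_set W" and R: "reedy_fibrant W"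
    and n: "0 < n" and I: "I \<subseteq> {..n}" and r: "\<rho> \<in> BSmp W n 0"
    and x: "\<And>k. k \<in> I \<Longrightarrow> x k \<in> BSmp W (n - 1) 1"
    and compat: "\<And>k j. 2 \<le> n \<Longrightarrow> k \<in> I \<Longrightarrow> j \<in> I \<Longrightarrow> k < j \<Longrightarrow>
      BAct W (n - 1) 1 (face (n - 1) k) [0,1] (x j) = BAct W (n - 1) 1 (face (n - 1) (j - 1)) [0,1] (x k)"
    and start: "\<And>k. k \<in> I \<Longrightarrow> BAct W (n - 1) 1 (idl (n - 1)) [0] (x k) = BAct W n 0 (face n k) [0] \<rho>"
  obtains w where "w \<in> BSmp W n 1" "BAct W n 1 (idl n) [0] w = \<rho>"
    "\<And>k. k \<in> I \<Longrightarrow> BAct W n 1 (face n k) [0,1] w = x k"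
proof -
  \<comment> \<open>The degenerate horn on the start \<open>\<rho>\<close>. Only the length of
    \<open>\<gamma>\<close> matters, as the horn consists of lists constant at 0.\<close>
  define y where "y \<gamma> = BAct W n 0 (idl n) (replicate (length \<gamma>) 0) \<rho>" for \<gamma> :: "nat list"
  have yc: "y (const_op j 0) = BAct W n 0 (idl n) (const_op j 0) \<rho>" for j
    by (simp only: y_def const_op_def length_replicate)
  have y: "partial_simplex (level W n) 1 (horn 1 0) y"
    unfolding partial_simplex_def
  proof (intro allI ballI conjI)
    fix j \<gamma> assume "\<gamma> \<in> horn 1 0 \<inter> ord j 1"
    then obtain j' where "\<gamma> = const_op j' 0" "\<gamma> \<in> ord j 1" using horn1 by auto
    hence g: "\<gamma> = const_op j 0" by simp
    show "y \<gamma> \<in> Smp (level W n) j" unfolding g yc using bs_act_in[OF W r idl_ord, of "const_op j 0" j] by simp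
    fix k \<delta> assume d: "\<delta> \<in> ord k j"
    show "y (ocomp \<gamma> \<delta>) = Act (level W n) j \<delta> (y \<gamma>)"
      unfolding g ocomp_const_left[OF d] yc
      using bs_act_act[OF W r idl_ord _ idl_ord d, of "const_op j 0"] by (simp add: ocomp_const_left[OF d])
  qed
  show ?thesis
  proof (rule reedy_extend_faces[OF W R _ _ n I x _ y])
    fix k j \<gamma> assume k: "k \<in> I" and c: "\<gamma> \<in> horn 1 0" "\<gamma> \<in> ord j 1"
    then obtain j' where "\<gamma> = const_op j' 0" using horn1 by auto
    hence g: "\<gamma> = const_op j 0" using c by simp
    have "BAct W (n - 1) 1 (idl (n - 1)) \<gamma> (x k) =
      BAct W (n - 1) 0 (idl (n - 1)) (const_op j 0) (BAct W (n - 1) 1 (idl (n - 1)) [0] (x k))"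
      using bs_act_act[OF W x[OF k] idl_ord _ idl_ord, of "[0]" 0 "const_op j 0" j]
      by (simp add: g ocomp_const_right)
    also have "\<dots> = BAct W n 0 (face n k) (const_op j 0) \<rho>"
      unfolding start[OF k] using bs_act_act[OF W r face_in_ord[OF n] _ idl_ord, of "[0]" 0 "const_op j 0" j]
      using n by (simp add: ocomp_const_right ocomp_idl_right)
    also have "\<dots> = BAct W n j (face n k) (idl j) (y \<gamma>)"
      unfolding g yc using bs_act_act[OF W r idl_ord _ face_in_ord[OF n] idl_ord, of "const_op j 0" j]
      by (simp add: ocomp_idl_left[OF face_in_ord[OF n]] ocomp_idl_right)
    finally show "BAct W (n - 1) 1 (idl (n - 1)) \<gamma> (x k) = BAct W n j (face n k) (idl j) (y \<gamma>)" .
  next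
    fix w assume w: "w \<in> BSmp W n 1" "\<And>k. k \<in> I \<Longrightarrow> BAct W n 1 (face n k) (idl 1) w = x k"
      "\<And>\<gamma>. \<gamma> \<in> horn 1 0 \<Longrightarrow> BAct W n 1 (idl n) \<gamma> w = y \<gamma>"
    have "[0] \<in> horn (Suc 0) 0" unfolding horn1 by (rule exI[of _ 0]) (simp add: const_op_simps)
    hence "BAct W n 1 (idl n) [0] w = \<rho>"
      using w(3)[of "[0]"] bs_act_id[OF W r] by (simp add: y_def idl_simps)
    thus thesis using that[OF w(1)] w(2) by (simp add: idl_simps)
  qed (use compat in \<open>simp_all add: idl_simps\<close>)
qed

section \<open>Spaces of composable edges\<close>

lemma zero_ord: "[0] \<in> ord 0 n"
  by simp

lemma list_nth2: "length xs = 2 \<Longrightarrow> xs = [xs ! 0, xs ! 1]"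
  by (cases xs; cases "tl xs") auto

lemma spine_simps:
  "Smp (spine_space W n) l = {xs. length xs = n \<and> set xs \<subseteq> BSmp W 1 l \<and>
        (\<forall>i. Suc i < n \<longrightarrow> BAct W 1 l [1] (idl l) (xs ! i) = BAct W 1 l [0] (idl l) (xs ! Suc i))}"
  "Act (spine_space W n) l \<gamma> xs = map (BAct W 1 l (idl 1) \<gamma>) xs"
  by (simp_all add: spine_space_def)

lemma spine2_iff:
  "xs \<in> Smp (spine_space W 2) l \<longleftrightarrow> (\<exists>x y. xs = [x, y] \<and> x \<in> BSmp W 1 l \<and> y \<in> BSmp W 1 l \<and>
     BAct W 1 l [1] (idl l) x = BAct W 1 l [0] (idl l) y)"
proof
  assume a: "xs \<in> Smp (spine_space W 2) l"
  then obtain x y where "xs = [x, y]" using list_nth2[of xs] by (auto simp: spine_simps)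
  thus "\<exists>x y. xs = [x, y] \<and> x \<in> BSmp W 1 l \<and> y \<in> BSmp W 1 l \<and>
     BAct W 1 l [1] (idl l) x = BAct W 1 l [0] (idl l) y"
    using a unfolding spine_simps by auto
qed (auto simp: spine_simps)

lemma spine_simplicial:
  assumes W: "bisimplicial_set W"
  shows "simplicial_set (spine_space W n)"
  unfolding simplicial_set_def
proof (intro conjI allI ballI)
  have one: "[i] \<in> ord 0 1" if "i \<le> 1" for i using that by simp
  fix m l \<gamma> xs assume c: "\<gamma> \<in> ord m l" and xs: "xs \<in> Smp (spine_space W n) l"
  have x: "xs ! i \<in> BSmp W 1 l" if "i < n" for i using xs that by (auto simp: spine_simps)
  have *: "BAct W 1 m [k] (idl m) (BAct W 1 l (idl 1) \<gamma> (xs ! i)) = BAct W 0 l [0] \<gamma> (BAct W 1 l [k] (idl l) (xs ! i))"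
    if "i < n" "k \<le> 1" for i k
    unfolding bs_act_act[OF W x[OF that(1)] idl_ord c one[OF that(2)] idl_ord]
      bs_act_act[OF W x[OF that(1)] one[OF that(2)] idl_ord zero_ord c]
    using that(2) by (simp add: ocomp_idl_right[OF ord_length[OF c]] ocomp_idl_left[OF c] ocomp_idl_left[OF one[OF that(2)], simplified])
  show "Act (spine_space W n) l \<gamma> xs \<in> Smp (spine_space W n) m"
    using xs * bs_act_in[OF W _ idl_ord c] by (auto simp: spine_simps)
next
  fix l xs assume xs: "xs \<in> Smp (spine_space W n) l"
  thus "Act (spine_space W n) l (idl l) xs = xs"
    using bs_act_id[OF W] by (auto simp: spine_simps intro!: map_idI)
next
  fix k m l \<gamma> \<delta> xs assume c: "\<gamma> \<in> ord m l" "\<delta> \<in> ord k m" and xs: "xs \<in> Smp (spine_space W n) l"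
  thus "Act (spine_space W n) m \<delta> (Act (spine_space W n) l \<gamma> xs) = Act (spine_space W n) l (ocomp \<gamma> \<delta>) xs"
    using bs_act_act[OF W _ idl_ord c(1) idl_ord c(2)] by (auto simp: spine_simps)
qed

text \<open>The horn of first edges is filled by itself; the horn of second edges is then filled
  with its source already prescribed as the target of the first filler.\<close>

lemma spine2_kan:
  assumes W: "bisimplicial_set W" and R: "reedy_fibrant W"
  shows "kan_complex (spine_space W 2)"
  unfolding kan_complex_def
proof (intro conjI allI impI spine_simplicial[OF W]; elim conjE)
  fix l i g assume l: "1 \<le> l" "i \<le> l" and g: "partial_simplex (spine_space W 2) l (horn l i) g"
  have g2: "\<exists>x y. g \<gamma> = [x, y] \<and> x \<in> BSmp W 1 j \<and> y \<in> BSmp W 1 j \<and> BAct W 1 j [1] (idl j) x = BAct W 1 j [0] (idl j) y"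
    if "\<gamma> \<in> horn l i" "\<gamma> \<in> ord j l" for \<gamma> j
    using partial_simplexD(1)[OF g that] unfolding spine2_iff .
  have gact: "g (ocomp \<gamma> \<delta>) = map (BAct W 1 j (idl 1) \<delta>) (g \<gamma>)"
    if "\<gamma> \<in> horn l i" "\<gamma> \<in> ord j l" "\<delta> \<in> ord k j" for \<gamma> \<delta> j k
    using partial_simplexD(2)[OF g that] unfolding spine_simps .
  have gk: "partial_simplex (level W 1) l (horn l i) (\<lambda>\<gamma>. g \<gamma> ! k)" if "k = 0 \<or> k = 1" for k
    unfolding partial_simplex_def
  proof (intro allI ballI conjI)
    fix j \<gamma> assume "\<gamma> \<in> horn l i \<inter> ord j l"
    hence c: "\<gamma> \<in> horn l i" "\<gamma> \<in> ord j l" by auto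
    obtain x y where xy: "g \<gamma> = [x, y]" "x \<in> BSmp W 1 j" "y \<in> BSmp W 1 j" using g2[OF c] by blast
    show "g \<gamma> ! k \<in> Smp (level W 1) j" using xy that by auto
    show "g (ocomp \<gamma> \<delta>) ! k = Act (level W 1) j \<delta> (g \<gamma> ! k)" if "\<delta> \<in> ord m j" for \<delta> m
      using gact[OF c that] xy \<open>k = 0 \<or> k = 1\<close> by auto
  qed
  obtain x where x: "fills (level W 1) l (horn l i) (\<lambda>\<gamma>. g \<gamma> ! 0) x"
    using level_kan[OF W R, of 1] l gk unfolding kan_complex_def by blast
  have x1: "x \<in> BSmp W 1 l" and xg: "\<And>\<gamma>. \<gamma> \<in> horn l i \<Longrightarrow> BAct W 1 l (idl 1) \<gamma> x = g \<gamma> ! 0"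
    using x by (auto simp: fills_def)
  have one: "[1] \<in> ord 0 1" by simp
  show "\<exists>x. fills (spine_space W 2) l (horn l i) g x"
  \<comment> \<open>The index set is \<open>{1}\<close> because \<open>face 1 1\<close> is
    \<open>[0]\<close>, the source of the second edge.\<close>
  proof (rule reedy_extend_faces[OF W R l, of 1 "{1}" "\<lambda>_. BAct W 1 l [1] (idl l) x" "\<lambda>\<gamma>. g \<gamma> ! 1"])
    show "BAct W 1 l [1] (idl l) x \<in> BSmp W (1 - 1) l"
      using bs_act_in[OF W x1 one idl_ord] by simp
    show "partial_simplex (level W 1) l (horn l i) (\<lambda>\<gamma>. g \<gamma> ! 1)" by (rule gk) simp
    fix k j \<gamma> assume "k \<in> {1::nat}" and c: "\<gamma> \<in> horn l i" "\<gamma> \<in> ord j l"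
    have "BAct W 0 l (idl 0) \<gamma> (BAct W 1 l [1] (idl l) x) = BAct W 1 l [1] \<gamma> x"
      using bs_act_act[OF W x1 one idl_ord idl_ord c(2)] by (simp add: ocomp_idl_left[OF c(2)] idl_simps)
    also have "\<dots> = BAct W 1 j [1] (idl j) (BAct W 1 l (idl 1) \<gamma> x)"
      using bs_act_act[OF W x1 idl_ord c(2) one idl_ord]
      by (simp add: ocomp_idl_left[OF one, simplified] ocomp_idl_right[OF ord_length[OF c(2)]])
    also have "\<dots> = BAct W 1 j [0] (idl j) (g \<gamma> ! 1)"
      unfolding xg[OF c(1)] using g2[OF c] by auto
    finally show "BAct W (1 - 1) l (idl (1 - 1)) \<gamma> (BAct W 1 l [1] (idl l) x) = BAct W 1 j (face 1 k) (idl j) (g \<gamma> ! 1)"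
      using \<open>k \<in> {1}\<close> by (simp add: face_simps)
  next
    fix w assume w: "w \<in> BSmp W 1 l" "\<And>k. k \<in> {1} \<Longrightarrow> BAct W 1 l (face 1 k) (idl l) w = BAct W 1 l [1] (idl l) x"
      "\<And>\<gamma>. \<gamma> \<in> horn l i \<Longrightarrow> BAct W 1 l (idl 1) \<gamma> w = g \<gamma> ! 1"
    have "[x, w] \<in> Smp (spine_space W 2) l"
      unfolding spine2_iff using x1 w(1) w(2)[of 1] by (simp add: face_simps)
    moreover have "Act (spine_space W 2) l \<gamma> [x, w] = g \<gamma>" if c: "\<gamma> \<in> horn l i" for \<gamma>
      using xg[OF c] w(3)[OF c] g2[OF c hornD[OF c]] by (auto simp: spine_simps)
    ultimately show ?thesis unfolding fills_def by blast
  qed auto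
qed

section \<open>Paths in Kan complexes and homotopies between maps\<close>

text \<open>The two outer horns of the triangle, filled with an identity as the long edge, give the
  one-sided inverses.\<close>

lemma kan_inverse:
  assumes X: "kan_complex X" and f: "edge X f x y"
  shows "\<exists>g. qc_composite X f g (qc_id X x)" "\<exists>g. qc_composite X g f (qc_id X y)"
proof -
  have S: "simplicial_set X" using X by (simp add: kan_complex_def)
  interpret hocat "\<lambda>x y f. edge X f x y" "qc_composite X" "qc_id X"
    by (rule hocat_sset[OF kan_complex_inner3[OF X]])
  have ids: "edge X (qc_id X x) x x" "edge X (qc_id X y) y y" using id_arr[OF f] by auto
  have "horn 2 0 = facets 2 {1, 2}"
    by (subst horn_facets, simp, rule arg_cong[of _ _ "facets 2"]) auto
  moreover have "horn 2 2 = facets 2 {0, 1}"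
    by (subst horn_facets, simp, rule arg_cong[of _ _ "facets 2"]) auto
  moreover have "\<exists>x. fills X 2 (horn 2 k) g x" if "k \<le> 2" "partial_simplex X 2 (horn 2 k) g" for k g
    using X that unfolding kan_complex_def by simp
  ultimately have fill: "partial_simplex X 2 (facets 2 {1,2}) g \<Longrightarrow> \<exists>x. fills X 2 (facets 2 {1,2}) g x"
    "partial_simplex X 2 (facets 2 {0,1}) g \<Longrightarrow> \<exists>x. fills X 2 (facets 2 {0,1}) g x" for g
    by (metis le0, metis order_refl)
  have "\<exists>z\<in>Smp X 2. Act X 2 (face 2 1) z = qc_id X x \<and> Act X 2 (face 2 2) z = f"
    by (rule fill2[OF S _ _ _ _ _ fill(1)]) (use ids f in \<open>simp_all add: edge_def face_simps\<close>)
  thus "\<exists>g. qc_composite X f g (qc_id X x)" unfolding qc_composite_def by (auto simp: face_simps)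
  have "\<exists>z\<in>Smp X 2. Act X 2 (face 2 0) z = f \<and> Act X 2 (face 2 1) z = qc_id X y"
    by (rule fill2[OF S _ _ _ _ _ fill(2)]) (use ids f in \<open>simp_all add: edge_def face_simps\<close>)
  thus "\<exists>g. qc_composite X g f (qc_id X y)" unfolding qc_composite_def by (auto simp: face_simps)
qed

lemma simplicial_map_edge:
  assumes "simplicial_map X Y f" "edge X e x y"
  shows "edge Y (f 1 e) (f 0 x) (f 0 y)"
  using assms simplicial_map_in[OF assms(1)] simplicial_map_act[OF assms(1), of e 1 "[0]" 0]
    simplicial_map_act[OF assms(1), of e 1 "[1]" 0] by (auto simp: edge_def)

lemma simplicial_map_composite:
  assumes f: "simplicial_map X Y f" and T: "qc_composite X a b c"
  shows "qc_composite Y (f 1 a) (f 1 b) (f 1 c)"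
proof -
  obtain \<sigma> where s: "\<sigma> \<in> Smp X 2" "Act X 2 [0,1] \<sigma> = a" "Act X 2 [1,2] \<sigma> = b" "Act X 2 [0,2] \<sigma> = c"
    using T by (auto simp: qc_composite_def)
  have "f 1 (Act X 2 \<alpha> \<sigma>) = Act Y 2 \<alpha> (f 2 \<sigma>)" if "\<alpha> \<in> ord 1 2" for \<alpha>
    by (rule simplicial_map_act[OF f s(1) that])
  thus ?thesis unfolding qc_composite_def
    using simplicial_map_in[OF f s(1)] s by (intro bexI[of _ "f 2 \<sigma>"]) (simp_all flip: s(2-))
qed

lemma simplicial_map_id:
  assumes "simplicial_map X Y f" "x \<in> Smp X 0"
  shows "f 1 (qc_id X x) = qc_id Y (f 0 x)"
  unfolding qc_id_def by (rule simplicial_map_act[OF assms]) simp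

lemma sprod_simps [simp]:
  "Smp (sprod X Y) n = Smp X n \<times> Smp Y n"
  "Act (sprod X Y) n \<alpha> (x, y) = (Act X n \<alpha> x, Act Y n \<alpha> y)"
  by (simp_all add: sprod_def)

lemma Delta_simps [simp]: "Smp (Delta n) m = ord m n" "Act (Delta n) m \<alpha> x = ocomp x \<alpha>"
  by (simp_all add: Delta_def)

lemma homotopy_edge:
  assumes X: "simplicial_set X" and H: "simplicial_map (sprod X (Delta 1)) Y H" and x: "x \<in> Smp X 0"
  shows "edge Y (H 1 (qc_id X x, [0,1])) (H 0 (x, [0])) (H 0 (x, [1]))"
proof -
  have i: "qc_id X x \<in> Smp X 1" unfolding qc_id_def by (rule sset_act_in[OF X x]) simp
  have e: "Act X 1 [k] (qc_id X x) = x" if "k \<le> 1" for k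
    unfolding qc_id_def using sset_act_act[OF X x, of "[0,0]" 1 "[k]" 0] sset_act_id[OF X x] that
    by (cases k) (auto simp: idl_simps)
  have "H 0 (Act (sprod X (Delta 1)) 1 [k] (qc_id X x, [0,1])) = Act Y 1 [k] (H 1 (qc_id X x, [0,1]))"
    if "k \<le> 1" for k
    by (rule simplicial_map_act[OF H]) (use i that in auto)
  from this[of 0] this[of 1] show ?thesis
    unfolding edge_def using simplicial_map_in[OF H, of "(qc_id X x, [0,1])" 1] i e[of 0] e[of 1] by auto
qed

text \<open>The square obtained from the homotopy on the edge \<open>n\<close> consists of two
  triangles with the common diagonal \<open>H 1 (n, [0,1])\<close>.\<close>

lemma homotopy_natural:
  assumes X: "simplicial_set X" and H: "simplicial_map (sprod X (Delta 1)) Y H" and n: "edge X n x y"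
  shows "qc_composite Y (H 1 (n, [0,0])) (H 1 (qc_id X y, [0,1])) (H 1 (n, [0,1]))"
    "qc_composite Y (H 1 (qc_id X x, [0,1])) (H 1 (n, [1,1])) (H 1 (n, [0,1]))"
proof -
  have n1: "n \<in> Smp X 1" and xy: "x = Act X 1 [0] n" "y = Act X 1 [1] n" using n by (auto simp: edge_def)
  have D: "Act X 1 a n \<in> Smp X 2" if "a \<in> ord 2 1" for a by (rule sset_act_in[OF X n1 that])
  have A: "Act Y 2 b (H 2 (Act X 1 a n, c)) = H 1 (Act X 1 (ocomp a b) n, ocomp c b)"
    if "a \<in> ord 2 1" "b \<in> ord 1 2" "c \<in> ord 2 1" for a b c
    using simplicial_map_act[OF H, of "(Act X 1 a n, c)" 2 b 1] D[OF that(1)] that sset_act_act[OF X n1 that(1,2)]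
    by simp
  have i: "Act X 1 [0,1] n = n" using sset_act_id[OF X n1] by (simp add: idl_simps)
  have iy: "Act X 1 [1,1] n = qc_id X y" "Act X 1 [0,0] n = qc_id X x"
    unfolding qc_id_def xy using sset_act_act[OF X n1, of "[1]" 0 "[0,0]" 1] sset_act_act[OF X n1, of "[0]" 0 "[0,0]" 1]
    by simp_all
  have "H 2 (Act X 1 a n, c) \<in> Smp Y 2" if "a \<in> ord 2 1" "c \<in> ord 2 1" for a c
    using simplicial_map_in[OF H, of "(Act X 1 a n, c)" 2] D[OF that(1)] that by simp
  hence mem: "H 2 (Act X 1 [0,1,1] n, [0,0,1]) \<in> Smp Y 2" "H 2 (Act X 1 [0,0,1] n, [0,1,1]) \<in> Smp Y 2"
    by simp_all
  show "qc_composite Y (H 1 (n, [0,0])) (H 1 (qc_id X y, [0,1])) (H 1 (n, [0,1]))"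
    unfolding qc_composite_def
    by (rule bexI[OF _ mem(1)]) (use A[of "[0,1,1]" _ "[0,0,1]"] i iy in simp)
  show "qc_composite Y (H 1 (qc_id X x, [0,1])) (H 1 (n, [1,1])) (H 1 (n, [0,1]))"
    unfolding qc_composite_def
    by (rule bexI[OF _ mem(2)]) (use A[of "[0,0,1]" _ "[0,1,1]"] i iy in simp)
qed

text \<open>The path between \<open>\<sigma>\<close> and \<open>\<sigma>'\<close> obtained from the homotopy inverse is corrected by the
  image of a loop, so that its own image is null-homotopic.\<close>

lemma kan_equivalence_fibre_path:
  assumes X: "kan_complex X" and Y: "kan_complex Y" and E: "kan_equivalence X Y \<phi>"
    and s: "\<sigma> \<in> Smp X 0" "\<sigma>' \<in> Smp X 0" and y: "\<phi> 0 \<sigma> = y" "\<phi> 0 \<sigma>' = y"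
  shows "\<exists>q. edge X q \<sigma> \<sigma>' \<and> qc_composite Y (\<phi> 1 q) (qc_id Y y) (qc_id Y y)"
proof -
  have SX: "simplicial_set X" and SY: "simplicial_set Y" using X Y by (simp_all add: kan_complex_def)
  interpret X: hocat "\<lambda>x y f. edge X f x y" "qc_composite X" "qc_id X"
    by (rule hocat_sset[OF kan_complex_inner3[OF X]])
  interpret Y: hocat "\<lambda>x y f. edge Y f x y" "qc_composite Y" "qc_id Y"
    by (rule hocat_sset[OF kan_complex_inner3[OF Y]])
  obtain \<psi> H H' where phi: "simplicial_map X Y \<phi>" and psi: "simplicial_map Y X \<psi>"
    and H: "simplicial_map (sprod X (Delta 1)) X H"
      "\<And>n x. x \<in> Smp X n \<Longrightarrow> H n (x, const_op n 0) = \<psi> n (\<phi> n x) \<and> H n (x, const_op n 1) = x"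
    and H': "simplicial_map (sprod Y (Delta 1)) Y H'"
      "\<And>n x. x \<in> Smp Y n \<Longrightarrow> H' n (x, const_op n 0) = \<phi> n (\<psi> n x) \<and> H' n (x, const_op n 1) = x"
    using E unfolding kan_equivalence_def homotopic_def by blast
  have y0: "y \<in> Smp Y 0" using simplicial_map_in[OF phi s(1)] y by simp
  define s0 where "s0 = \<psi> 0 y"
  define t0 where "t0 = \<phi> 0 s0"
  define e where "e = H 1 (qc_id X \<sigma>, [0,1])"
  define e' where "e' = H 1 (qc_id X \<sigma>', [0,1])"
  define a where "a = H' 1 (qc_id Y y, [0,1])"
  have e: "edge X e s0 \<sigma>" and e': "edge X e' s0 \<sigma>'"
    unfolding e_def e'_def s0_def
    using homotopy_edge[OF SX H(1) s(1)] homotopy_edge[OF SX H(1) s(2)] H(2)[OF s(1)] H(2)[OF s(2)] y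
    by (simp_all add: const_op_simps)
  have a: "edge Y a t0 y" unfolding a_def t0_def s0_def
    using homotopy_edge[OF SY H'(1) y0] H'(2)[OF y0] by (simp add: const_op_simps)
  note pe = simplicial_map_edge[OF phi]
  have fe: "edge Y (\<phi> 1 e) t0 y" and fe': "edge Y (\<phi> 1 e') t0 y"
    using pe[OF e] pe[OF e'] y by (simp_all add: t0_def)
  have Ycl: "Y.hm x z (Y.cl f)" if "edge Y f x z" for f x z by (rule Y.hmI[OF that])
  have inv: "\<exists>g. edge Y g z x \<and> Y.cmp (Y.cl g) (Y.cl f) = Y.hid z \<and> Y.cmp (Y.cl f) (Y.cl g) = Y.hid x"
    if f: "edge Y f x z" for f x z
  proof -
    obtain g g' where g: "qc_composite Y f g (qc_id Y x)" and g': "qc_composite Y g' f (qc_id Y z)"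
      using kan_inverse[OF Y f] by blast
    obtain u v w where "edge Y f u v" "edge Y g v w" "edge Y (qc_id Y x) u w" using Y.T_arr[OF g] by blast
    hence gz: "edge Y g z x" using Y.arr_unique[OF f] Y.id_arr[OF f] Y.arr_unique by metis
    obtain u v w where "edge Y g' u v" "edge Y f v w" "edge Y (qc_id Y z) u w" using Y.T_arr[OF g'] by blast
    hence gz': "edge Y g' z x" using Y.arr_unique[OF f] Y.id_arr[OF f] Y.arr_unique by metis
    have c: "Y.cmp (Y.cl f) (Y.cl g) = Y.hid x" "Y.cmp (Y.cl g') (Y.cl f) = Y.hid z"
      using Y.cmp_cl[OF g] Y.cmp_cl[OF g'] by (simp_all add: Y.hid_def)
    have "Y.cl g' = Y.cmp (Y.cl g') (Y.cmp (Y.cl f) (Y.cl g))" using c Y.cmp_id Ycl[OF gz'] by simp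
    also have "\<dots> = Y.cl g" using Y.cmp_assoc[OF Ycl[OF gz'] Ycl[OF f] Ycl[OF gz]] c Y.cmp_id Ycl[OF gz] by simp
    finally show ?thesis using gz c by auto
  qed
  obtain ei where ei: "qc_composite X ei e (qc_id X \<sigma>)" using kan_inverse(2)[OF X e] by blast
  obtain u v w where "edge X ei u v" "edge X e v w" "edge X (qc_id X \<sigma>) u w" using X.T_arr[OF ei] by blast
  hence ei': "edge X ei \<sigma> s0" using X.arr_unique[OF e] X.id_arr[OF e] X.arr_unique by metis
  have fei: "edge Y (\<phi> 1 ei) y t0" using pe[OF ei'] y by (simp add: t0_def)
  have fei_e: "Y.cmp (Y.cl (\<phi> 1 ei)) (Y.cl (\<phi> 1 e)) = Y.hid y"
    using Y.cmp_cl[OF simplicial_map_composite[OF phi ei]] simplicial_map_id[OF phi s(1)] y by (simp add: Y.hid_def)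
  obtain ai where ai: "edge Y ai y t0" "Y.cmp (Y.cl ai) (Y.cl a) = Y.hid y" "Y.cmp (Y.cl a) (Y.cl ai) = Y.hid t0"
    using inv[OF a] by blast
  obtain b where b: "edge Y b y t0" "Y.cmp (Y.cl b) (Y.cl (\<phi> 1 e')) = Y.hid y"
    using inv[OF fe'] by blast
  let ?A = "Y.cl a" and ?Ai = "Y.cl ai" and ?E = "Y.cl (\<phi> 1 e)" and ?E' = "Y.cl (\<phi> 1 e')" and ?B = "Y.cl b"
    and ?Ei = "Y.cl (\<phi> 1 ei)"
  note hms = Ycl[OF a] Ycl[OF ai(1)] Ycl[OF fe] Ycl[OF fe'] Ycl[OF b(1)] Ycl[OF fei]
  \<comment> \<open>The discrepancy between the images of \<open>e\<close> and \<open>e'\<close> is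
    the loop \<open>?E\<close> followed by \<open>?B\<close> at \<open>t0\<close>. Conjugation by
    \<open>a\<close> turns it into a loop at \<open>y\<close>; naturality of \<open>H'\<close> will
    identify the class of \<open>\<phi>\<close> applied to \<open>\<psi>\<close> of this loop with
    the discrepancy itself.\<close>
  have "Y.hm y y (Y.cmp (Y.cmp ?Ai ?E) (Y.cmp ?B ?A))" using hms Y.hm_cmp by blast
  then obtain n where n: "edge Y n y y" "Y.cl n = Y.cmp (Y.cmp ?Ai ?E) (Y.cmp ?B ?A)"
    unfolding Y.hm_def by blast
  have pn: "edge X (\<psi> 1 n) s0 s0" using simplicial_map_edge[OF psi n(1)] by (simp add: s0_def)
  let ?M = "Y.cl (\<phi> 1 (\<psi> 1 n))"
  have M: "Y.hm t0 t0 ?M" using Ycl[OF pe[OF pn]] by (simp add: t0_def)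
  have n1: "n \<in> Smp Y 1" using n by (simp add: edge_def)
  have "Y.cmp ?M ?A = Y.cl (H' 1 (n, [0,1]))" "Y.cmp ?A (Y.cl n) = Y.cl (H' 1 (n, [0,1]))"
    using Y.cmp_cl[OF homotopy_natural(1)[OF SY H'(1) n(1)]] Y.cmp_cl[OF homotopy_natural(2)[OF SY H'(1) n(1)]]
      H'(2)[OF n1] by (simp_all add: a_def const_op_simps)
  hence MA: "Y.cmp ?M ?A = Y.cmp ?A (Y.cl n)" by simp
  have "Y.cmp ?A (Y.cl n) = Y.cmp (Y.cmp ?A (Y.cmp ?Ai ?E)) (Y.cmp ?B ?A)"
    unfolding n(2) by (rule Y.cmp_assoc[symmetric]) (use hms Y.hm_cmp in blast)+
  also have "Y.cmp ?A (Y.cmp ?Ai ?E) = ?E"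
    using Y.cmp_assoc[OF hms(1,2,3)] ai(3) Y.cmp_id(1)[OF hms(3)] by simp
  also have "Y.cmp ?E (Y.cmp ?B ?A) = Y.cmp (Y.cmp ?E ?B) ?A"
    by (rule Y.cmp_assoc[OF hms(3,5,1), symmetric])
  finally have MA': "Y.cmp ?M ?A = Y.cmp (Y.cmp ?E ?B) ?A" using MA by simp
  have EB: "Y.hm t0 t0 (Y.cmp ?E ?B)" by (rule Y.hm_cmp[OF hms(3,5)])
  have "?M = Y.cmp (Y.cmp ?M ?A) ?Ai"
    using Y.cmp_assoc[OF M hms(1,2)] ai(3) Y.cmp_id(2)[OF M] by simp
  also have "\<dots> = Y.cmp ?E ?B"
    unfolding MA' using Y.cmp_assoc[OF EB hms(1,2)] ai(3) Y.cmp_id(2)[OF EB] by simp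
  finally have M': "?M = Y.cmp ?E ?B" .
  \<comment> \<open>The path runs back along \<open>e\<close>, around the corrected loop at
    \<open>s0\<close>, and out along \<open>e'\<close>. Its image has class \<open>?Ei\<close>
    \<open>?M\<close> \<open>?E'\<close>, which collapses to \<open>?B\<close> \<open>?E'\<close>,
    an identity.\<close>
  obtain r where r: "qc_composite X ei (\<psi> 1 n) r" using X.T_ex[OF ei' pn] by blast
  have r': "edge X r \<sigma> s0" by (rule X.T_arrs(2)[OF r ei' pn])
  obtain q where q: "qc_composite X r e' q" using X.T_ex[OF r' e'] by blast
  have q': "edge X q \<sigma> \<sigma>'" by (rule X.T_arrs(2)[OF q r' e'])
  have "Y.cl (\<phi> 1 q) = Y.cmp (Y.cmp ?Ei ?M) ?E'"
    using Y.cmp_cl[OF simplicial_map_composite[OF phi q]] Y.cmp_cl[OF simplicial_map_composite[OF phi r]] by simp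
  also have "Y.cmp ?Ei ?M = ?B"
    unfolding M' using Y.cmp_assoc[OF hms(6,3,5)] fei_e Y.cmp_id(1)[OF hms(5)] by simp
  also have "Y.cmp ?B ?E' = Y.hid y" by (rule b(2))
  finally have clq: "Y.cl (\<phi> 1 q) = Y.hid y" .
  have fq: "edge Y (\<phi> 1 q) y y" using pe[OF q'] y by simp
  have "qc_composite Y (\<phi> 1 q) (qc_id Y y) (qc_id Y y)"
  proof (subst Y.T_iff)
    show "edge Y (\<phi> 1 q) y y" by (rule fq)
    show "edge Y (qc_id Y y) y y" "edge Y (qc_id Y y) y y" using Y.id_arr[OF fq] by auto
    show "Y.cmp (Y.cl (\<phi> 1 q)) (Y.cl (qc_id Y y)) = Y.cl (qc_id Y y)"
      using clq Y.cmp_id(2)[OF Ycl[OF fq]] by (simp add: Y.hid_def)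
  qed
  thus ?thesis using q' by blast
qed

section \<open>The first row of a Segal space\<close>

lemma kan_equivalence_surj:
  assumes Y: "simplicial_set Y" and E: "kan_equivalence X Y \<phi>" and y: "y \<in> Smp Y 0"
  shows "\<exists>x\<in>Smp X 0. \<exists>a. edge Y a (\<phi> 0 x) y"
proof -
  obtain \<psi> H' where psi: "simplicial_map Y X \<psi>"
    and H': "simplicial_map (sprod Y (Delta 1)) Y H'"
      "\<And>n x. x \<in> Smp Y n \<Longrightarrow> H' n (x, const_op n 0) = \<phi> n (\<psi> n x) \<and> H' n (x, const_op n 1) = x"
    using E unfolding kan_equivalence_def homotopic_def by blast
  have "edge Y (H' 1 (qc_id Y y, [0,1])) (\<phi> 0 (\<psi> 0 y)) y"
    using homotopy_edge[OF Y H'(1) y] H'(2)[OF y] by (simp add: const_op_simps)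
  thus ?thesis using simplicial_map_in[OF psi y] by blast
qed

lemma spine_edges:
  "map (\<lambda>i. BAct W n l [i, Suc i] \<gamma> x) [0..<2] = [BAct W n l [0,1] \<gamma> x, BAct W n l [1,2] \<gamma> x]"
  "map (\<lambda>i. BAct W n l [i, Suc i] \<gamma> x) [0..<3] =
     [BAct W n l [0,1] \<gamma> x, BAct W n l [1,2] \<gamma> x, BAct W n l [2,3] \<gamma> x]"
  by (simp_all add: numeral_eq_Suc)

lemma segalD:
  assumes "segal_space W"
  shows "bisimplicial_set W" "reedy_fibrant W"
    "2 \<le> n \<Longrightarrow> kan_equivalence (level W n) (spine_space W n)
       (\<lambda>l x. map (\<lambda>i. BAct W n l [i, Suc i] (idl l) x) [0..<n])"
  using assms by (simp_all add: segal_space_def)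

lemma path_extend2:
  assumes W: "bisimplicial_set W" and R: "reedy_fibrant W" and r: "\<rho> \<in> BSmp W 2 0"
    and x: "x \<in> BSmp W 1 1" "y \<in> BSmp W 1 1"
    and c: "BAct W 1 1 [1] [0,1] x = BAct W 1 1 [0] [0,1] y"
    and s: "BAct W 1 1 [0,1] [0] x = BAct W 2 0 [0,1] [0] \<rho>" "BAct W 1 1 [0,1] [0] y = BAct W 2 0 [1,2] [0] \<rho>"
  obtains w where "w \<in> BSmp W 2 1" "BAct W 2 1 [0,1,2] [0] w = \<rho>"
    "BAct W 2 1 [0,1] [0,1] w = x" "BAct W 2 1 [1,2] [0,1] w = y"
proof (rule path_extend[OF W R _ _ r, of "{0,2}" "\<lambda>k. if k = 0 then y else x"])
  fix k j :: nat assume "k \<in> {0,2}" "j \<in> {0,2}" "k < j"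
  hence "k = 0" "j = 2" by auto
  thus "BAct W (2 - 1) 1 (face (2 - 1) k) [0,1] (if j = 0 then y else x) =
    BAct W (2 - 1) 1 (face (2 - 1) (j - 1)) [0,1] (if k = 0 then y else x)"
    using c by (simp add: face_simps)
next
  fix k :: nat assume "k \<in> {0,2}"
  thus "BAct W (2 - 1) 1 (idl (2 - 1)) [0] (if k = 0 then y else x) = BAct W 2 0 (face 2 k) [0] \<rho>"
    using s by (auto simp: face_simps idl_simps)
next
  fix w assume "w \<in> BSmp W 2 1" "BAct W 2 1 (idl 2) [0] w = \<rho>"
    "\<And>k. k \<in> {0,2} \<Longrightarrow> BAct W 2 1 (face 2 k) [0,1] w = (if k = 0 then y else x)"
  from this(1,2) this(3)[of 0] this(3)[of 2] show thesis
    by (intro that) (simp_all add: face_simps idl_simps)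
qed (use x in auto)

lemma bs_end:
  assumes W: "bisimplicial_set W" and w: "w \<in> BSmp W n 1" and a: "\<alpha> \<in> ord m n" and i: "i \<le> 1"
  shows "BAct W n 0 \<alpha> [0] (BAct W n 1 (idl n) [i] w) = BAct W m 1 (idl m) [i] (BAct W n 1 \<alpha> [0,1] w)"
  using bs_act_act[OF W w idl_ord _ a zero_ord, of "[i]" 0] bs_act_act[OF W w a _ idl_ord, of "[0,1]" 1 "[i]" 0] i
  by (cases i) (auto simp: ocomp_idl_left[OF a] ocomp_idl_right[OF ord_length[OF a]])

text \<open>The Segal map is surjective only up to a path. That path in the spine space is a pair of
  matching paths of edges, along which \<open>path_extend2\<close> carries the approximate filler to
  one with spine exactly \<open>f\<close>, \<open>g\<close>.\<close>

lemma segal2_exists: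
  assumes S: "segal_space W" and f: "f \<in> BSmp W 1 0" "g \<in> BSmp W 1 0"
    and fg: "BAct W 1 0 [1] [0] f = BAct W 1 0 [0] [0] g"
  shows "\<exists>\<sigma>\<in>BSmp W 2 0. BAct W 2 0 [0,1] [0] \<sigma> = f \<and> BAct W 2 0 [1,2] [0] \<sigma> = g"
proof -
  note W = segalD(1)[OF S] and R = segalD(2)[OF S]
  have y: "[f, g] \<in> Smp (spine_space W 2) 0" unfolding spine2_iff using f fg by (simp add: idl_simps)
  obtain \<rho> a where r: "\<rho> \<in> BSmp W 2 0"
    and a: "edge (spine_space W 2) a (map (\<lambda>i. BAct W 2 0 [i, Suc i] (idl 0) \<rho>) [0..<2]) [f, g]"
    using kan_equivalence_surj[OF spine_simplicial[OF W] segalD(3)[OF S order_refl] y] by auto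
  obtain x y where xy: "a = [x, y]" "x \<in> BSmp W 1 1" "y \<in> BSmp W 1 1"
    "BAct W 1 1 [1] (idl 1) x = BAct W 1 1 [0] (idl 1) y"
    using a unfolding edge_def spine2_iff by blast
  have e: "BAct W 1 1 [0,1] [0] x = BAct W 2 0 [0,1] [0] \<rho>" "BAct W 1 1 [0,1] [0] y = BAct W 2 0 [1,2] [0] \<rho>"
    "BAct W 1 1 [0,1] [1] x = f" "BAct W 1 1 [0,1] [1] y = g"
    using a by (simp_all add: edge_def spine_simps xy spine_edges idl_simps)
  obtain w where w: "w \<in> BSmp W 2 1" "BAct W 2 1 [0,1] [0,1] w = x" "BAct W 2 1 [1,2] [0,1] w = y"
    using path_extend2[OF W R r xy(2,3) _ e(1,2)] xy(4) by (auto simp: idl_simps)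
  have "BAct W 2 1 (idl 2) [1] w \<in> BSmp W 2 0" by (rule bs_act_in[OF W w(1) idl_ord]) simp
  thus ?thesis
    using bs_end[OF W w(1), of "[0,1]" 1 1] bs_end[OF W w(1), of "[1,2]" 1 1] w(2,3) e
    by (intro bexI[of _ "BAct W 2 1 (idl 2) [1] w"]) (simp_all add: idl_simps)
qed

text \<open>Two triangles with the same spine are joined by a path that keeps the spine constant.
  \<open>kan_equivalence_fibre_path\<close> gives a path whose spine is only a null-homotopic loop;
  the null-homotopy is lifted to \<open>W\<close> and the long edge of the lift has constant
  spine.\<close>

lemma segal2_fibre:
  assumes S: "segal_space W" and s: "\<sigma> \<in> BSmp W 2 0" "\<sigma>' \<in> BSmp W 2 0"
    and f: "BAct W 2 0 [0,1] [0] \<sigma> = f" "BAct W 2 0 [0,1] [0] \<sigma>' = f"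
    and g: "BAct W 2 0 [1,2] [0] \<sigma> = g" "BAct W 2 0 [1,2] [0] \<sigma>' = g"
  obtains w where "w \<in> BSmp W 2 1" "BAct W 2 1 [0,1,2] [0] w = \<sigma>" "BAct W 2 1 [0,1,2] [1] w = \<sigma>'"
    "BAct W 2 1 [0,1] [0,1] w = BAct W 1 0 [0,1] [0,0] f" "BAct W 2 1 [1,2] [0,1] w = BAct W 1 0 [0,1] [0,0] g"
proof -
  note W = segalD(1)[OF S] and R = segalD(2)[OF S]
  let ?Y = "spine_space W 2" and ?phi = "\<lambda>l x. map (\<lambda>i. BAct W 2 l [i, Suc i] (idl l) x) [0..<2]"
  have "\<exists>q. edge (level W 2) q \<sigma> \<sigma>' \<and> qc_composite ?Y (?phi 1 q) (qc_id ?Y [f, g]) (qc_id ?Y [f, g])"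
    by (rule kan_equivalence_fibre_path[OF level_kan[OF W R] spine2_kan[OF W R] segalD(3)[OF S order_refl]])
      (use s f g in \<open>simp_all add: spine_edges idl_simps\<close>)
  then obtain q \<tau> where q: "edge (level W 2) q \<sigma> \<sigma>'" and t: "\<tau> \<in> Smp ?Y 2" "Act ?Y 2 [0,1] \<tau> = ?phi 1 q"
    "Act ?Y 2 [1,2] \<tau> = qc_id ?Y [f, g]" "Act ?Y 2 [0,2] \<tau> = qc_id ?Y [f, g]"
    unfolding qc_composite_def by blast
  have q1: "q \<in> BSmp W 2 1" and qe: "BAct W 2 1 (idl 2) [0] q = \<sigma>" "BAct W 2 1 (idl 2) [1] q = \<sigma>'"
    using q by (simp_all add: edge_def)
  obtain a b where ab: "\<tau> = [a, b]" "a \<in> BSmp W 1 2" "b \<in> BSmp W 1 2"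
    "BAct W 1 2 [1] (idl 2) a = BAct W 1 2 [0] (idl 2) b"
    using t(1) unfolding spine2_iff by blast
  define d where "d = BAct W 2 0 (idl 2) [0,0] \<sigma>'"
  have d1: "d \<in> BSmp W 2 1" unfolding d_def by (rule bs_act_in[OF W s(2) idl_ord]) simp
  have ids: "[0,1] \<in> ord 1 1" "[0,0] \<in> ord 1 0" "[0,1] \<in> ord 1 2" "[1,2] \<in> ord 1 2" by simp_all
  have id12: "ocomp (idl 2) [0,1] = [0,1]" "ocomp (idl 2) [1,2] = [1,2]" by (simp_all add: idl_simps)
  have dx: "BAct W 2 1 [0,1] (idl 1) d = BAct W 1 0 [0,1] [0,0] f" "BAct W 2 1 [1,2] (idl 1) d = BAct W 1 0 [0,1] [0,0] g"
    unfolding d_def f(2)[symmetric] g(2)[symmetric]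
      bs_act_act[OF W s(2) idl_ord ids(2) ids(3) idl_ord] bs_act_act[OF W s(2) idl_ord ids(2) ids(4) idl_ord]
      bs_act_act[OF W s(2) ids(3) zero_ord ids(1) ids(2)] bs_act_act[OF W s(2) ids(4) zero_ord ids(1) ids(2)]
    by (simp_all add: idl_simps)
  have e: "BAct W 1 2 (idl 1) [0,1] a = BAct W 2 1 [0,1] (idl 1) q" "BAct W 1 2 (idl 1) [0,1] b = BAct W 2 1 [1,2] (idl 1) q"
    "BAct W 1 2 (idl 1) [1,2] a = BAct W 2 1 [0,1] (idl 1) d" "BAct W 1 2 (idl 1) [1,2] b = BAct W 2 1 [1,2] (idl 1) d"
    "BAct W 1 2 (idl 1) [0,2] a = BAct W 1 0 [0,1] [0,0] f" "BAct W 1 2 (idl 1) [0,2] b = BAct W 1 0 [0,1] [0,0] g"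
    using t(2-4) unfolding dx by (simp_all add: spine_simps ab spine_edges qc_id_def idl_simps)
  have h21: "horn 2 1 = facets 2 {0,2}"
    by (subst horn_facets, simp, rule arg_cong[of _ _ "facets 2"]) auto
  \<comment> \<open>The spatial horn to be filled: the path \<open>q\<close> as edge from 0 to 1,
    then the constant path \<open>d\<close> at \<open>\<sigma>'\<close> as edge from 1 to 2.\<close>
  let ?x = "\<lambda>k::nat. if k = 0 then d else q"
  obtain y where y: "partial_simplex (level W 2) 2 (facets 2 {0,2}) y" "\<And>i. i \<in> {0,2} \<Longrightarrow> y (face 2 i) = ?x i"
    and y': "\<And>i \<alpha> m. i \<in> {0,2} \<Longrightarrow> \<alpha> \<in> ord m 2 \<Longrightarrow> i \<notin> set \<alpha> \<Longrightarrow> y \<alpha> = Act (level W 2) (2 - 1) (squeeze i \<alpha>) (?x i)"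
  proof (rule glue_facets[where X = "level W 2" and n = 2 and I = "{0,2}" and x = ?x])
    fix i j :: nat assume "i \<in> {0,2}" "j \<in> {0,2}" "i < j"
    hence ij: "i = 0" "j = 2" by auto
    have "BAct W 2 1 (idl 2) [0] d = \<sigma>'"
      unfolding d_def using bs_act_act[OF W s(2) idl_ord ids(2) idl_ord, of "[0]" 0] bs_act_id[OF W s(2)]
      by (simp add: idl_simps)
    thus "Act (level W 2) (2 - 1) (face (2 - 1) i) (?x j) = Act (level W 2) (2 - 1) (face (2 - 1) (j - 1)) (?x i)"
      using qe ij by (simp add: face_simps)
  qed (use d1 q1 level_simplicial[OF W] in auto)
  \<comment> \<open>The prescribed categorical faces: the components of the null-homotopy
    \<open>\<tau>\<close> on the second and on the first edge of the spine.\<close>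
  let ?z = "\<lambda>k::nat. if k = 0 then b else a"
  have key: "BAct W 1 2 (idl 1) (face 2 m) (?z k) = BAct W 2 1 (face 2 k) (idl 1) (?x m)"
    if "m \<in> {0,2}" "k \<in> {0,2}" for m k using that e by (auto simp: face_simps)
  obtain v where v: "v \<in> BSmp W 2 2" "\<And>k. k \<in> {0,2} \<Longrightarrow> BAct W 2 2 (face 2 k) (idl 2) v = ?z k"
    "\<And>\<gamma>. \<gamma> \<in> horn 2 1 \<Longrightarrow> BAct W 2 2 (idl 2) \<gamma> v = y \<gamma>"
  proof (rule reedy_extend_faces[OF W R, of 2 1 2 "{0,2}" ?z y])
    fix k j :: nat assume "k \<in> {0,2}" "j \<in> {0,2}" "k < j"
    hence ij: "k = 0" "j = 2" by auto
    thus "BAct W (2 - 1) 2 (face (2 - 1) k) (idl 2) (?z j) = BAct W (2 - 1) 2 (face (2 - 1) (j - 1)) (idl 2) (?z k)"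
      using ab(4) by (simp add: face_simps)
  next
    fix k j :: nat and \<gamma> assume k: "k \<in> {0,2}" and c: "\<gamma> \<in> horn 2 1" "\<gamma> \<in> ord j 2"
    obtain m where m: "m \<in> {0,2}" "m \<notin> set \<gamma>" using c(1) unfolding h21 facets_def by blast
    have m2: "m \<le> 2" using m by auto
    have sq: "squeeze m \<gamma> \<in> ord j 1" using squeeze_in_ord[OF c(2) m(2) m2] by simp
    have fm: "face 2 m \<in> ord 1 2" "face 2 k \<in> ord 1 2" using face_in_ord[of 2] by simp_all
    have zk: "?z k \<in> BSmp W 1 2" and xm: "?x m \<in> BSmp W 2 1" using ab d1 q1 by simp_all
    have "BAct W 1 2 (idl 1) \<gamma> (?z k) = BAct W 1 1 (idl 1) (squeeze m \<gamma>) (BAct W 1 2 (idl 1) (face 2 m) (?z k))"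
      unfolding bs_act_act[OF W zk idl_ord fm(1) idl_ord sq] using face_squeeze[OF c(2) m(2) m2] by simp
    also have "\<dots> = BAct W 2 1 (face 2 k) (squeeze m \<gamma>) (?x m)"
      unfolding key[OF m(1) k] bs_act_act[OF W xm fm(2) idl_ord idl_ord sq]
      by (simp only: ocomp_idl_left[OF sq] ocomp_idl_right[OF ord_length[OF fm(2)]])
    also have "\<dots> = BAct W 2 j (face 2 k) (idl j) (BAct W 2 1 (idl 2) (squeeze m \<gamma>) (?x m))"
      unfolding bs_act_act[OF W xm idl_ord sq fm(2) idl_ord]
      by (simp only: ocomp_idl_left[OF fm(2)] ocomp_idl_right[OF ord_length[OF sq]])
    also have "BAct W 2 1 (idl 2) (squeeze m \<gamma>) (?x m) = y \<gamma>" using y'[OF m(1) c(2) m(2)] by simp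
    finally show "BAct W (2 - 1) 2 (idl (2 - 1)) \<gamma> (?z k) = BAct W 2 j (face 2 k) (idl j) (y \<gamma>)" by simp
  qed (use ab y(1) h21 in auto)
  \<comment> \<open>The long spatial edge of the lift has as spine the long edges of
    \<open>a\<close> and \<open>b\<close>, and these are constant.\<close>
  define w where "w = BAct W 2 2 (idl 2) [0,2] v"
  have p02: "[0,2] \<in> ord 1 2" by simp
  have w1: "w \<in> BSmp W 2 1" unfolding w_def by (rule bs_act_in[OF W v(1) idl_ord p02])
  have vq: "BAct W 2 2 (idl 2) [0,1] v = q" "BAct W 2 2 (idl 2) [1,2] v = d"
    using v(3)[of "face 2 2"] v(3)[of "face 2 0"] y(2)[of 2] y(2)[of 0] face_in_facets[of 2 2 "{0,2}"]
      face_in_facets[of 2 0 "{0,2}"] h21 by (simp_all add: face_simps)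
  have "BAct W 2 1 (idl 2) [0] w = BAct W 2 1 (idl 2) [0] q"
    unfolding w_def vq(1)[symmetric] bs_act_act[OF W v(1) idl_ord p02 idl_ord zero_ord]
      bs_act_act[OF W v(1) idl_ord ids(3) idl_ord zero_ord] by simp
  hence w0: "BAct W 2 1 [0,1,2] [0] w = \<sigma>" using qe by (simp add: idl_simps)
  have o1: "[1] \<in> ord 0 1" by simp
  have dd: "BAct W 2 1 (idl 2) [1] d = \<sigma>'"
    unfolding d_def bs_act_act[OF W s(2) idl_ord ids(2) idl_ord o1] using bs_act_id[OF W s(2)] by (simp add: idl_simps)
  have "BAct W 2 1 (idl 2) [1] w = BAct W 2 1 (idl 2) [1] d"
    unfolding w_def vq(2)[symmetric] bs_act_act[OF W v(1) idl_ord p02 idl_ord o1]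
      bs_act_act[OF W v(1) idl_ord ids(4) idl_ord o1] by simp
  hence w1': "BAct W 2 1 [0,1,2] [1] w = \<sigma>'" using dd by (simp add: idl_simps)
  have fw: "BAct W 2 1 \<alpha> [0,1] w = BAct W 1 2 (idl 1) [0,2] (BAct W 2 2 \<alpha> (idl 2) v)" if a: "\<alpha> \<in> ord 1 2" for \<alpha>
    unfolding w_def bs_act_act[OF W v(1) idl_ord p02 a ids(1)] bs_act_act[OF W v(1) a idl_ord idl_ord p02]
    by (simp only: idl_simps(3)[symmetric] ocomp_idl_left[OF a] ocomp_idl_right[OF ord_length[OF a]]
      ocomp_idl_left[OF p02] ocomp_idl_right[OF ord_length[OF p02]])
  have "BAct W 2 1 [0,1] [0,1] w = BAct W 1 0 [0,1] [0,0] f" "BAct W 2 1 [1,2] [0,1] w = BAct W 1 0 [0,1] [0,0] g"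
    unfolding fw[OF ids(3)] fw[OF ids(4)] using v(2)[of 2] v(2)[of 0] e(5,6) by (simp_all add: face_simps)
  thus ?thesis using that w1 w0 w1' by blast
qed

text \<open>The path from the approximate spine to \<open>f\<close>, \<open>g\<close>,
  \<open>k\<close> is first extended over the triangles 012 and 123. The two extensions share the
  path of the middle edge, so together they move the whole tetrahedron.\<close>

lemma segal3_exists:
  assumes S: "segal_space W" and f: "f \<in> BSmp W 1 0" "g \<in> BSmp W 1 0" "k \<in> BSmp W 1 0"
    and fg: "BAct W 1 0 [1] [0] f = BAct W 1 0 [0] [0] g" "BAct W 1 0 [1] [0] g = BAct W 1 0 [0] [0] k"
  shows "\<exists>\<rho>\<in>BSmp W 3 0. BAct W 3 0 [0,1] [0] \<rho> = f \<and> BAct W 3 0 [1,2] [0] \<rho> = g \<and> BAct W 3 0 [2,3] [0] \<rho> = k"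
proof -
  note W = segalD(1)[OF S] and R = segalD(2)[OF S]
  have "\<forall>i. Suc i < 3 \<longrightarrow> BAct W 1 0 [1] (idl 0) ([f, g, k] ! i) = BAct W 1 0 [0] (idl 0) ([f, g, k] ! Suc i)"
    using fg by (auto simp: idl_simps numeral_eq_Suc less_Suc_eq)
  hence y: "[f, g, k] \<in> Smp (spine_space W 3) 0" unfolding spine_simps using f by simp
  obtain \<rho> a where r: "\<rho> \<in> BSmp W 3 0"
    and a: "edge (spine_space W 3) a (map (\<lambda>i. BAct W 3 0 [i, Suc i] (idl 0) \<rho>) [0..<3]) [f, g, k]"
    using kan_equivalence_surj[OF spine_simplicial[OF W] segalD(3)[OF S] y] by auto
  have mem: "a \<in> Smp (spine_space W 3) 1" using a unfolding edge_def by blast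
  have a3: "length a = 3" "set a \<subseteq> BSmp W 1 1"
    "\<And>i. Suc i < 3 \<Longrightarrow> BAct W 1 1 [1] (idl 1) (a ! i) = BAct W 1 1 [0] (idl 1) (a ! Suc i)"
    using mem unfolding spine_simps by blast+
  obtain x y z where xyz: "a = [x, y, z]"
    using a3(1) by (auto simp: numeral_eq_Suc length_Suc_conv)
  have m: "x \<in> BSmp W 1 1" "y \<in> BSmp W 1 1" "z \<in> BSmp W 1 1" using a3(2) xyz by auto
  have c: "BAct W 1 1 [1] [0,1] x = BAct W 1 1 [0] [0,1] y" "BAct W 1 1 [1] [0,1] y = BAct W 1 1 [0] [0,1] z"
    using a3(3)[of 0] a3(3)[of 1] by (simp_all add: xyz idl_simps)
  have e: "BAct W 1 1 [0,1] [0] x = BAct W 3 0 [0,1] [0] \<rho>" "BAct W 1 1 [0,1] [0] y = BAct W 3 0 [1,2] [0] \<rho>"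
    "BAct W 1 1 [0,1] [0] z = BAct W 3 0 [2,3] [0] \<rho>"
    "BAct W 1 1 [0,1] [1] x = f" "BAct W 1 1 [0,1] [1] y = g" "BAct W 1 1 [0,1] [1] z = k"
    using a by (simp_all add: edge_def spine_simps xyz spine_edges idl_simps)
  have r2: "BAct W 3 0 \<alpha> [0] \<rho> \<in> BSmp W 2 0" if "\<alpha> \<in> ord 2 3" for \<alpha>
    by (rule bs_act_in[OF W r that zero_ord])
  have rf: "BAct W 2 0 \<beta> [0] (BAct W 3 0 \<alpha> [0] \<rho>) = BAct W 3 0 (ocomp \<alpha> \<beta>) [0] \<rho>"
    if "\<alpha> \<in> ord 2 3" "\<beta> \<in> ord 1 2" for \<alpha> \<beta>
    using bs_act_act[OF W r that(1) zero_ord that(2) zero_ord] by simp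
  obtain u where u: "u \<in> BSmp W 2 1" "BAct W 2 1 [0,1,2] [0] u = BAct W 3 0 [0,1,2] [0] \<rho>"
    "BAct W 2 1 [0,1] [0,1] u = x" "BAct W 2 1 [1,2] [0,1] u = y"
    by (rule path_extend2[OF W R r2 m(1,2) c(1), of "[0,1,2]"]) (use e rf[of "[0,1,2]"] in auto)
  obtain v where v: "v \<in> BSmp W 2 1" "BAct W 2 1 [0,1,2] [0] v = BAct W 3 0 [1,2,3] [0] \<rho>"
    "BAct W 2 1 [0,1] [0,1] v = y" "BAct W 2 1 [1,2] [0,1] v = z"
    by (rule path_extend2[OF W R r2 m(2,3) c(2), of "[1,2,3]"]) (use e rf[of "[1,2,3]"] in auto)
  obtain w where w: "w \<in> BSmp W 3 1" "BAct W 3 1 (idl 3) [0] w = \<rho>"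
    "\<And>k. k \<in> {0,3} \<Longrightarrow> BAct W 3 1 (face 3 k) [0,1] w = (if k = 0 then v else u)"
  proof (rule path_extend[OF W R _ _ r, of "{0,3}" "\<lambda>k. if k = 0 then v else u"])
    fix k j :: nat assume "k \<in> {0,3}" "j \<in> {0,3}" "k < j"
    hence "k = 0" "j = 3" by auto
    thus "BAct W (3 - 1) 1 (face (3 - 1) k) [0,1] (if j = 0 then v else u) =
      BAct W (3 - 1) 1 (face (3 - 1) (j - 1)) [0,1] (if k = 0 then v else u)"
      using u v by (simp add: face_simps)
  next
    fix k :: nat assume "k \<in> {0,3}"
    thus "BAct W (3 - 1) 1 (idl (3 - 1)) [0] (if k = 0 then v else u) = BAct W 3 0 (face 3 k) [0] \<rho>"
      using u(2) v(2) by (auto simp: face_simps idl_simps)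
  qed (use u v in auto)
  have wf: "BAct W 3 1 (ocomp \<alpha> \<beta>) [0,1] w = BAct W 2 1 \<beta> [0,1] (BAct W 3 1 \<alpha> [0,1] w)"
    if "\<alpha> \<in> ord 2 3" "\<beta> \<in> ord 1 2" for \<alpha> \<beta>
    using bs_act_act[OF W w(1) that(1) _ that(2), of "[0,1]" 1 "[0,1]" 1] by simp
  have we: "BAct W 3 1 [0,1,2] [0,1] w = u" "BAct W 3 1 [1,2,3] [0,1] w = v"
    using w(3)[of 0] w(3)[of 3] by (simp_all add: face_simps)
  have ww: "BAct W 3 1 [0,1] [0,1] w = x" "BAct W 3 1 [1,2] [0,1] w = y" "BAct W 3 1 [2,3] [0,1] w = z"
    using wf[of "[0,1,2]" "[0,1]"] wf[of "[0,1,2]" "[1,2]"] wf[of "[1,2,3]" "[1,2]"] we u v by simp_all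
  have "BAct W 3 1 (idl 3) [1] w \<in> BSmp W 3 0" by (rule bs_act_in[OF W w(1) idl_ord]) simp
  thus ?thesis
    using bs_end[OF W w(1), of "[0,1]" 1 1] bs_end[OF W w(1), of "[1,2]" 1 1] bs_end[OF W w(1), of "[2,3]" 1 1] ww e
    by (intro bexI[of _ "BAct W 3 1 (idl 3) [1] w"]) (simp_all add: idl_simps)
qed

definition const_path :: "'a bsset \<Rightarrow> nat \<Rightarrow> 'a \<Rightarrow> 'a" where
  "const_path W n x = BAct W n 0 (idl n) [0,0] x"

lemma const_path:
  assumes W: "bisimplicial_set W" and x: "x \<in> BSmp W n 0"
  shows "const_path W n x \<in> BSmp W n 1"
    and "i \<le> 1 \<Longrightarrow> BAct W n 1 (idl n) [i] (const_path W n x) = x"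
    and "\<alpha> \<in> ord m n \<Longrightarrow> BAct W n 1 \<alpha> [0,1] (const_path W n x) = const_path W m (BAct W n 0 \<alpha> [0] x)"
proof -
  have o: "[0,0] \<in> ord 1 0" "[0,1] \<in> ord 1 1" by simp_all
  show "const_path W n x \<in> BSmp W n 1" unfolding const_path_def by (rule bs_act_in[OF W x idl_ord o(1)])
  show "BAct W n 1 (idl n) [i] (const_path W n x) = x" if "i \<le> 1"
    unfolding const_path_def using bs_act_act[OF W x idl_ord o(1) idl_ord, of "[i]" 0] bs_act_id[OF W x] that
    by (cases i) (auto simp: idl_simps)
  show "BAct W n 1 \<alpha> [0,1] (const_path W n x) = const_path W m (BAct W n 0 \<alpha> [0] x)" if a: "\<alpha> \<in> ord m n"
    unfolding const_path_def bs_act_act[OF W x idl_ord o(1) a o(2)] bs_act_act[OF W x a zero_ord idl_ord o(1)]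
    by (simp add: ocomp_idl_left[OF a] ocomp_idl_right[OF ord_length[OF a]])
qed

text \<open>Replaces faces of a tetrahedron by the ends of compatible paths that start at
  them.\<close>

lemma move3:
  assumes W: "bisimplicial_set W" and R: "reedy_fibrant W" and r: "\<rho> \<in> BSmp W 3 0" and I: "I \<subseteq> {..3}"
    and x: "\<And>k. k \<in> I \<Longrightarrow> x k \<in> BSmp W 2 1"
    and s: "\<And>k. k \<in> I \<Longrightarrow> BAct W 2 1 [0,1,2] [0] (x k) = BAct W 3 0 (face 3 k) [0] \<rho>"
    and c: "\<And>k j. k \<in> I \<Longrightarrow> j \<in> I \<Longrightarrow> k < j \<Longrightarrow>
      BAct W 2 1 (face 2 k) [0,1] (x j) = BAct W 2 1 (face 2 (j - 1)) [0,1] (x k)"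
  obtains \<rho>' where "\<rho>' \<in> BSmp W 3 0" "\<And>k. k \<in> I \<Longrightarrow> BAct W 3 0 (face 3 k) [0] \<rho>' = BAct W 2 1 [0,1,2] [1] (x k)"
proof -
  obtain w where w: "w \<in> BSmp W 3 1" "\<And>k. k \<in> I \<Longrightarrow> BAct W 3 1 (face 3 k) [0,1] w = x k"
  proof (rule path_extend[OF W R _ I r, of x])
    fix w assume "w \<in> BSmp W 3 1" "\<And>k. k \<in> I \<Longrightarrow> BAct W 3 1 (face 3 k) [0,1] w = x k"
    thus ?thesis by (rule that)
  qed (use x s c in \<open>simp_all add: idl_simps\<close>)
  have f: "face 3 k \<in> ord 2 3" for k using face_in_ord[of 3 k] by simp
  have "BAct W 3 1 (idl 3) [1] w \<in> BSmp W 3 0" by (rule bs_act_in[OF W w(1) idl_ord]) simp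
  moreover have "BAct W 3 0 (face 3 k) [0] (BAct W 3 1 (idl 3) [1] w) = BAct W 2 1 [0,1,2] [1] (x k)"
    if "k \<in> I" for k using bs_end[OF W w(1) f, of 1] w(2)[OF that] by (simp add: idl_simps)
  ultimately show ?thesis by (rule that)
qed

text \<open>A tetrahedron with the correct spine exists, but its faces need not be the prescribed
  ones. By \<open>segal2_fibre\<close> each face is joined to the prescribed one by a path with
  constant spine, and such paths are compatible where the faces meet.\<close>

lemma segal_row_inner3:
  assumes S: "segal_space W"
  shows "inner3 (row W 0)"
proof -
  note W = segalD(1)[OF S] and R = segalD(2)[OF S]
  have i3: "{0,2,3} \<subseteq> {..3::nat}" "{0,1,3} \<subseteq> {..3::nat}" "{0,3} \<subseteq> {..3::nat}" by auto
  \<comment> \<open>Only the faces 012 and 123 are corrected here; they meet in the edge 12, which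
    lies on both spines and stays fixed.\<close>
  have pre: "\<exists>\<rho>\<in>BSmp W 3 0. BAct W 3 0 [0,1,2] [0] \<rho> = a \<and> BAct W 3 0 [1,2,3] [0] \<rho> = b"
    if a: "a \<in> BSmp W 2 0" and b: "b \<in> BSmp W 2 0" and ab: "BAct W 2 0 [1,2] [0] a = BAct W 2 0 [0,1] [0] b" for a b
  proof -
    have in1: "BAct W 2 0 \<alpha> [0] x \<in> BSmp W 1 0" if "x \<in> BSmp W 2 0" "\<alpha> \<in> ord 1 2" for x \<alpha>
      by (rule bs_act_in[OF W that zero_ord])
    have ff: "BAct W 1 0 \<beta> [0] (BAct W 2 0 \<alpha> [0] x) = BAct W 2 0 (ocomp \<alpha> \<beta>) [0] x"
      if "x \<in> BSmp W 2 0" "\<alpha> \<in> ord 1 2" "\<beta> \<in> ord 0 1" for x \<alpha> \<beta>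
      using bs_act_act[OF W that(1,2) zero_ord that(3) zero_ord] by simp
    have m: "BAct W 2 0 [0,1] [0] a \<in> BSmp W 1 0" "BAct W 2 0 [1,2] [0] a \<in> BSmp W 1 0" "BAct W 2 0 [1,2] [0] b \<in> BSmp W 1 0"
      using in1 a b by auto
    have "BAct W 1 0 [1] [0] (BAct W 2 0 [0,1] [0] a) = BAct W 1 0 [0] [0] (BAct W 2 0 [1,2] [0] a)"
      using ff[OF a] by simp
    moreover have "BAct W 1 0 [1] [0] (BAct W 2 0 [1,2] [0] a) = BAct W 1 0 [0] [0] (BAct W 2 0 [1,2] [0] b)"
      unfolding ab using ff[OF b] by simp
    ultimately obtain \<rho> where r: "\<rho> \<in> BSmp W 3 0" "BAct W 3 0 [0,1] [0] \<rho> = BAct W 2 0 [0,1] [0] a"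
      "BAct W 3 0 [1,2] [0] \<rho> = BAct W 2 0 [1,2] [0] a" "BAct W 3 0 [2,3] [0] \<rho> = BAct W 2 0 [1,2] [0] b"
      using segal3_exists[OF S m] by blast
    have r2: "BAct W 3 0 \<alpha> [0] \<rho> \<in> BSmp W 2 0" if "\<alpha> \<in> ord 2 3" for \<alpha>
      by (rule bs_act_in[OF W r(1) that zero_ord])
    have rf: "BAct W 2 0 \<beta> [0] (BAct W 3 0 \<alpha> [0] \<rho>) = BAct W 3 0 (ocomp \<alpha> \<beta>) [0] \<rho>"
      if "\<alpha> \<in> ord 2 3" "\<beta> \<in> ord 1 2" for \<alpha> \<beta>
      using bs_act_act[OF W r(1) that(1) zero_ord that(2) zero_ord] by simp
    obtain u where u: "u \<in> BSmp W 2 1" "BAct W 2 1 [0,1,2] [0] u = BAct W 3 0 [0,1,2] [0] \<rho>"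
      "BAct W 2 1 [0,1,2] [1] u = a"
      "BAct W 2 1 [1,2] [0,1] u = BAct W 1 0 [0,1] [0,0] (BAct W 2 0 [1,2] [0] a)"
      by (rule segal2_fibre[OF S r2 a _ refl _ refl, of "[0,1,2]"]) (use r rf[of "[0,1,2]"] in auto)
    obtain v where v: "v \<in> BSmp W 2 1" "BAct W 2 1 [0,1,2] [0] v = BAct W 3 0 [1,2,3] [0] \<rho>"
      "BAct W 2 1 [0,1,2] [1] v = b"
      "BAct W 2 1 [0,1] [0,1] v = BAct W 1 0 [0,1] [0,0] (BAct W 2 0 [0,1] [0] b)"
      by (rule segal2_fibre[OF S r2 b _ refl _ refl, of "[1,2,3]"]) (use r rf[of "[1,2,3]"] ab in auto)
    obtain \<rho>' where r': "\<rho>' \<in> BSmp W 3 0"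
      "\<And>k. k \<in> {0,3} \<Longrightarrow> BAct W 3 0 (face 3 k) [0] \<rho>' = BAct W 2 1 [0,1,2] [1] (if k = 0 then v else u)"
    proof (rule move3[OF W R r(1) i3(3), of "\<lambda>k. if k = 0 then v else u"])
      fix k j :: nat assume "k \<in> {0,3}" "j \<in> {0,3}" "k < j"
      hence "k = 0" "j = 3" by auto
      thus "BAct W 2 1 (face 2 k) [0,1] (if j = 0 then v else u) = BAct W 2 1 (face 2 (j - 1)) [0,1] (if k = 0 then v else u)"
        using u v ab by (simp add: face_simps)
    qed (use u v in \<open>auto simp: face_simps\<close>)
    show ?thesis using r'(1) r'(2)[of 0] r'(2)[of 3] u v by (auto simp: face_simps)
  qed
  \<comment> \<open>The missing face of the inner horn is \<open>3 - l\<close> and the third given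
    face is \<open>l\<close>. For \<open>l = 2\<close> the latter is 013, with short edges 01 of
    \<open>a\<close> and 02 of \<open>b\<close>; for \<open>l = 1\<close> it is 023, with short
    edges 02 of \<open>a\<close> and 12 of \<open>b\<close>. The terms \<open>3 - l\<close> and
    \<open>2 - l\<close> encode both cases.\<close>
  have post: "\<exists>\<rho>\<in>BSmp W 3 0. BAct W 3 0 [0,1,2] [0] \<rho> = a \<and> BAct W 3 0 [1,2,3] [0] \<rho> = b \<and> BAct W 3 0 (face 3 l) [0] \<rho> = c"
    if l: "l = 2 \<or> l = 1" and a: "a \<in> BSmp W 2 0" and b: "b \<in> BSmp W 2 0" and c: "c \<in> BSmp W 2 0"
      and ab: "BAct W 2 0 [1,2] [0] a = BAct W 2 0 [0,1] [0] b"
      and ac: "BAct W 2 0 [0,1] [0] c = BAct W 2 0 [0,3 - l] [0] a"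
      and bc: "BAct W 2 0 [1,2] [0] c = BAct W 2 0 [2 - l, 2] [0] b" for l a b c
  proof -
    have l': "l = 2 \<or> l = Suc 0" using l by simp
    obtain \<rho> where r: "\<rho> \<in> BSmp W 3 0" "BAct W 3 0 [0,1,2] [0] \<rho> = a" "BAct W 3 0 [1,2,3] [0] \<rho> = b"
      using pre[OF a b ab] by blast
    have fl: "face 3 l \<in> ord 2 3" using face_in_ord[of 3 l] by simp
    have r2: "BAct W 3 0 (face 3 l) [0] \<rho> \<in> BSmp W 2 0" by (rule bs_act_in[OF W r(1) fl zero_ord])
    have rf: "BAct W 2 0 \<beta> [0] (BAct W 3 0 \<alpha> [0] \<rho>) = BAct W 3 0 (ocomp \<alpha> \<beta>) [0] \<rho>"
      if "\<alpha> \<in> ord 2 3" "\<beta> \<in> ord 1 2" for \<alpha> \<beta>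
      using bs_act_act[OF W r(1) that(1) zero_ord that(2) zero_ord] by simp
    have e1: "BAct W 2 0 [0,1] [0] (BAct W 3 0 (face 3 l) [0] \<rho>) = BAct W 2 0 [0,1] [0] c"
      unfolding ac using rf[OF fl, of "[0,1]"] rf[of "[0,1,2]" "[0,3 - l]"] r(2) l' by (auto simp: face_simps)
    have e2: "BAct W 2 0 [1,2] [0] (BAct W 3 0 (face 3 l) [0] \<rho>) = BAct W 2 0 [1,2] [0] c"
      unfolding bc using rf[OF fl, of "[1,2]"] rf[of "[1,2,3]" "[2 - l,2]"] r(3) l' by (auto simp: face_simps)
    obtain w where w: "w \<in> BSmp W 2 1" "BAct W 2 1 [0,1,2] [0] w = BAct W 3 0 (face 3 l) [0] \<rho>"
      "BAct W 2 1 [0,1,2] [1] w = c"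
      "BAct W 2 1 [0,1] [0,1] w = const_path W 1 (BAct W 2 0 [0,1] [0] c)"
      "BAct W 2 1 [1,2] [0,1] w = const_path W 1 (BAct W 2 0 [1,2] [0] c)"
      using segal2_fibre[OF S r2 c e1 refl e2 refl] by (auto simp: const_path_def idl_simps)
    \<comment> \<open>The faces 0 and 3 are already right and are held constant while face
      \<open>l\<close> moves along \<open>w\<close>.\<close>
    let ?x = "\<lambda>k::nat. if k = 0 then const_path W 2 b else if k = 3 then const_path W 2 a else w"
    note cp = const_path[OF W a] const_path[OF W b]
    have I: "{0,l,3} \<subseteq> {..3}" using l by auto
    obtain \<rho>' where r': "\<rho>' \<in> BSmp W 3 0"
      "\<And>k. k \<in> {0,l,3} \<Longrightarrow> BAct W 3 0 (face 3 k) [0] \<rho>' = BAct W 2 1 [0,1,2] [1] (?x k)"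
    proof (rule move3[OF W R r(1) I, of ?x])
      fix k j assume "k \<in> {0,l,3}" "j \<in> {0,l,3}" "k < j"
      then consider "k = 0" "j = l" | "k = 0" "j = 3" | "k = l" "j = 3" using l' by auto
      thus "BAct W 2 1 (face 2 k) [0,1] (?x j) = BAct W 2 1 (face 2 (j - 1)) [0,1] (?x k)"
      proof cases
        case 1
        have "BAct W 2 1 [2 - l, 2] [0,1] (const_path W 2 b) = const_path W 1 (BAct W 2 0 [1,2] [0] c)"
          unfolding bc by (rule cp(6)) (use l' in auto)
        thus ?thesis using 1 l' w(5) by (auto simp: face_simps)
      next
        case 2
        thus ?thesis using cp(3)[of "[1,2]" 1] cp(6)[of "[0,1]" 1] ab by (simp add: face_simps)
      next
        case 3
        have "BAct W 2 1 [0,3 - l] [0,1] (const_path W 2 a) = const_path W 1 (BAct W 2 0 [0,1] [0] c)"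
          unfolding ac by (rule cp(3)) (use l' in auto)
        thus ?thesis using 3 l' w(4) by (auto simp: face_simps)
      qed
    next
      fix k assume k: "k \<in> {0,l,3}"
      show "BAct W 2 1 [0,1,2] [0] (?x k) = BAct W 3 0 (face 3 k) [0] \<rho>"
        using k w(2) r(2,3) cp(2)[of 0] cp(5)[of 0] by (auto simp: face_simps idl_simps)
    qed (use w cp in auto)
    have "BAct W 3 0 [0,1,2] [0] \<rho>' = a" "BAct W 3 0 [1,2,3] [0] \<rho>' = b"
      using r'(2)[of 0] r'(2)[of 3] cp(2)[of 1] cp(5)[of 1] by (simp_all add: face_simps idl_simps)
    moreover have "BAct W 3 0 (face 3 l) [0] \<rho>' = c" using r'(2)[of l] w(3) l' by auto
    ultimately show ?thesis using r'(1) by blast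
  qed
  show ?thesis unfolding inner3_def
  proof (intro conjI allI impI row_simplicial[OF W]; elim conjE)
    fix f g assume "f \<in> Smp (row W 0) 1" "g \<in> Smp (row W 0) 1" "Act (row W 0) 1 [1] f = Act (row W 0) 1 [0] g"
    thus "\<exists>\<sigma>\<in>Smp (row W 0) 2. Act (row W 0) 2 [0,1] \<sigma> = f \<and> Act (row W 0) 2 [1,2] \<sigma> = g"
      using segal2_exists[OF S] by (simp add: idl_simps)
  next
    fix a b c assume "a \<in> Smp (row W 0) 2" "b \<in> Smp (row W 0) 2" "c \<in> Smp (row W 0) 2"
      "Act (row W 0) 2 [1,2] a = Act (row W 0) 2 [0,1] b"
      "Act (row W 0) 2 [0,1] c = Act (row W 0) 2 [0,1] a" "Act (row W 0) 2 [1,2] c = Act (row W 0) 2 [0,2] b"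
    thus "\<exists>\<rho>\<in>Smp (row W 0) 3. Act (row W 0) 3 [0,1,2] \<rho> = a \<and> Act (row W 0) 3 [1,2,3] \<rho> = b \<and> Act (row W 0) 3 [0,1,3] \<rho> = c"
      using post[of 1 a b c] post[of 2 a b c] by (simp add: idl_simps face_simps)
  next
    fix a b c assume "a \<in> Smp (row W 0) 2" "b \<in> Smp (row W 0) 2" "c \<in> Smp (row W 0) 2"
      "Act (row W 0) 2 [1,2] a = Act (row W 0) 2 [0,1] b"
      "Act (row W 0) 2 [0,1] c = Act (row W 0) 2 [0,2] a" "Act (row W 0) 2 [1,2] c = Act (row W 0) 2 [1,2] b"
    thus "\<exists>\<rho>\<in>Smp (row W 0) 3. Act (row W 0) 3 [0,1,2] \<rho> = a \<and> Act (row W 0) 3 [1,2,3] \<rho> = b \<and> Act (row W 0) 3 [0,2,3] \<rho> = c"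
      using post[of 1 a b c] post[of 2 a b c] by (simp add: idl_simps face_simps)
  qed
qed

section \<open>Slices of complete Segal spaces\<close>

lemma qc_composite_row:
  "qc_composite (row W 0) f g h \<longleftrightarrow>
    (\<exists>\<sigma>\<in>BSmp W 2 0. BAct W 2 0 [0,1] [0] \<sigma> = f \<and> BAct W 2 0 [1,2] [0] \<sigma> = g \<and> BAct W 2 0 [0,2] [0] \<sigma> = h)"
  by (simp add: qc_composite_def idl_simps)

lemma edge_row: "edge (row W 0) f x y \<longleftrightarrow> css_edge W f x y"
  by (simp add: edge_def css_edge_def idl_simps)

lemma qc_id_row: "qc_id (row W 0) x = css_id W x"
  by (simp add: qc_id_def css_id_def bdegs_def idl_simps const_op_simps)

text \<open>A path in the mapping space has constant end points, so it fits with constant paths on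
  the two short edges, and the triangle can be moved until its long edge is exactly
  \<open>h\<close>. Hence \<open>css_composite\<close>, which holds up to a path, gives an honest
  triangle of the zeroth row.\<close>

lemma map_path_composite:
  assumes W: "bisimplicial_set W" and R: "reedy_fibrant W" and s: "\<sigma> \<in> BSmp W 2 0"
    and e: "edge (map_space W (BAct W 2 0 [0] [0] \<sigma>) (BAct W 2 0 [2] [0] \<sigma>)) p (BAct W 2 0 [0,2] [0] \<sigma>) h"
  shows "qc_composite (row W 0) (BAct W 2 0 [0,1] [0] \<sigma>) (BAct W 2 0 [1,2] [0] \<sigma>) h"
proof -
  let ?f = "BAct W 2 0 [0,1] [0] \<sigma>" and ?g = "BAct W 2 0 [1,2] [0] \<sigma>"
  have in1: "?f \<in> BSmp W 1 0" "?g \<in> BSmp W 1 0" by (rule bs_act_in[OF W s _ zero_ord], simp)+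
  have p: "p \<in> BSmp W 1 1" "BAct W 1 1 [0] [0,1] p = bdegs W 0 1 (BAct W 2 0 [0] [0] \<sigma>)"
    "BAct W 1 1 [1] [0,1] p = bdegs W 0 1 (BAct W 2 0 [2] [0] \<sigma>)"
    "BAct W 1 1 [0,1] [0] p = BAct W 2 0 [0,2] [0] \<sigma>" "BAct W 1 1 [0,1] [1] p = h"
    using e by (simp_all add: edge_def map_space_def idl_simps)
  have bd: "bdegs W 0 1 x = const_path W 0 x" for x
    by (simp add: bdegs_def const_path_def idl_simps const_op_simps)
  have ff: "BAct W 1 0 \<beta> [0] (BAct W 2 0 \<alpha> [0] \<sigma>) = BAct W 2 0 (ocomp \<alpha> \<beta>) [0] \<sigma>"
    if "\<alpha> \<in> ord 1 2" "\<beta> \<in> ord 0 1" for \<alpha> \<beta>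
    using bs_act_act[OF W s that(1) zero_ord that(2) zero_ord] by simp
  let ?x = "\<lambda>k::nat. if k = 0 then const_path W 1 ?g else if k = 1 then p else const_path W 1 ?f"
  note cf = const_path[OF W in1(1)] and cg = const_path[OF W in1(2)]
  obtain w where w: "w \<in> BSmp W 2 1" "BAct W 2 1 (idl 2) [0] w = \<sigma>"
    "\<And>k. k \<in> {0,1,2} \<Longrightarrow> BAct W 2 1 (face 2 k) [0,1] w = ?x k"
  proof (rule path_extend[OF W R _ _ s, of "{0,1,2}" ?x])
    fix k j :: nat assume "k \<in> {0,1,2}" "j \<in> {0,1,2}" "k < j"
    then consider "k = 0" "j = 1" | "k = 0" "j = 2" | "k = 1" "j = 2" by auto
    thus "BAct W (2 - 1) 1 (face (2 - 1) k) [0,1] (?x j) = BAct W (2 - 1) 1 (face (2 - 1) (j - 1)) [0,1] (?x k)"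
      using cf(3)[of "[0]" 0] cf(3)[of "[1]" 0] cg(3)[of "[0]" 0] cg(3)[of "[1]" 0] p(2,3) bd ff
      by cases (simp_all add: face_simps)
  next
    fix k :: nat assume "k \<in> {0,1,2}"
    thus "BAct W (2 - 1) 1 (idl (2 - 1)) [0] (?x k) = BAct W 2 0 (face 2 k) [0] \<sigma>"
      using cf(2)[of 0] cg(2)[of 0] p(4) by (auto simp: face_simps idl_simps)
  qed (use cf cg p in auto)
  have "BAct W 2 1 (idl 2) [1] w \<in> BSmp W 2 0" by (rule bs_act_in[OF W w(1) idl_ord]) simp
  moreover have "BAct W 2 0 \<alpha> [0] (BAct W 2 1 (idl 2) [1] w) = BAct W 1 1 [0,1] [1] (BAct W 2 1 \<alpha> [0,1] w)"
    if "\<alpha> \<in> ord 1 2" for \<alpha> using bs_end[OF W w(1) that, of 1] by (simp add: idl_simps)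
  ultimately show ?thesis
    unfolding qc_composite_row using w(3)[of 0] w(3)[of 1] w(3)[of 2] cf(2)[of 1] cg(2)[of 1] p(5)
    by (intro bexI[of _ "BAct W 2 1 (idl 2) [1] w"]) (simp_all add: face_simps idl_simps)
qed

lemma css_composite_row:
  assumes "segal_space W" "css_composite W f g h"
  shows "qc_composite (row W 0) f g h"
  using assms(2) map_path_composite[OF segalD(1,2)[OF assms(1)]] unfolding css_composite_def by blast

text \<open>\<open>map_path_composite\<close> for the degenerate triangle on \<open>h\<close> whose
  second edge is an identity.\<close>

lemma map_space_homotopic:
  assumes S: "segal_space W" and h: "css_edge W h x y" and p: "edge (map_space W x y) p h h'"
  shows "qc_composite (row W 0) h (css_id W y) h'"
proof -
  note W = segalD(1)[OF S] and R = segalD(2)[OF S]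
  have h1: "h \<in> BSmp W 1 0" and xy: "x = BAct W 1 0 [0] [0] h" "y = BAct W 1 0 [1] [0] h"
    using h by (auto simp: css_edge_def)
  have o: "[0,1,1] \<in> ord 2 1" by simp
  let ?s = "BAct W 1 0 [0,1,1] [0] h"
  have s: "?s \<in> BSmp W 2 0" by (rule bs_act_in[OF W h1 o zero_ord])
  have e: "BAct W 2 0 \<alpha> [0] ?s = BAct W 1 0 (ocomp [0,1,1] \<alpha>) [0] h" if "\<alpha> \<in> ord k 2" for \<alpha> k
    using bs_act_act[OF W h1 o zero_ord that zero_ord] by simp
  have id1: "BAct W 1 0 [0,1] [0] h = h" using bs_act_id[OF W h1] by (simp add: idl_simps)
  have id2: "BAct W 1 0 [1,1] [0] h = css_id W y"
    unfolding css_id_def bdegs_def xy using bs_act_act[OF W h1 _ zero_ord _ zero_ord, of "[1]" 0 "[0,0]" 1]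
    by (simp add: const_op_simps)
  have "qc_composite (row W 0) (BAct W 2 0 [0,1] [0] ?s) (BAct W 2 0 [1,2] [0] ?s) h'"
    by (rule map_path_composite[OF W R s, of p])
      (use p e[of "[0]" 0] e[of "[2]" 0] e[of "[0,2]" 1] xy id1 in simp)
  thus ?thesis using e[of "[0,1]" 1] e[of "[1,2]" 1] id1 id2 by simp
qed

lemma css_equiv_row:
  assumes S: "segal_space W" and f: "css_equiv W f"
  obtains x y g h where "css_edge W f x y" "css_edge W g y x" "css_edge W h y x"
    "qc_composite (row W 0) f g (css_id W x)" "qc_composite (row W 0) h f (css_id W y)"
  using f css_composite_row[OF S] unfolding css_equiv_def by blast

section \<open>The triangulation of the prism\<close>

definition psum :: "nat list \<Rightarrow> nat list \<Rightarrow> nat list" where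
  "psum \<alpha> \<beta> = map2 (+) \<alpha> \<beta>"

text \<open>The pair \<open>(\<alpha>, \<beta>)\<close> factors through the maximal chain of the prism that steps from level 0 to level 1
  at the vertex \<open>j\<close>; on this chain the vertex \<open>(a, b)\<close> has position \<open>a + b\<close>.\<close>

definition on_chain :: "nat \<Rightarrow> nat list \<Rightarrow> nat list \<Rightarrow> bool" where
  "on_chain j \<alpha> \<beta> \<longleftrightarrow> (\<forall>i<length \<alpha>. (\<beta> ! i = 0 \<longrightarrow> \<alpha> ! i \<le> j) \<and> (\<beta> ! i \<noteq> 0 \<longrightarrow> j \<le> \<alpha> ! i))"

lemma psum_simps [simp]: "psum [] \<beta> = []" "psum (a # \<alpha>) (b # \<beta>) = (a + b) # psum \<alpha> \<beta>"
  by (simp_all add: psum_def)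

lemma nth_psum: "i < length \<alpha> \<Longrightarrow> length \<beta> = length \<alpha> \<Longrightarrow> psum \<alpha> \<beta> ! i = \<alpha> ! i + \<beta> ! i"
  by (simp add: psum_def)

lemma length_psum: "length \<beta> = length \<alpha> \<Longrightarrow> length (psum \<alpha> \<beta>) = length \<alpha>"
  by (simp add: psum_def)

lemma psum_in_ord:
  assumes a: "\<alpha> \<in> ord k n" and b: "\<beta> \<in> ord k 1"
  shows "psum \<alpha> \<beta> \<in> ord k (Suc n)"
proof (rule ordI)
  have l: "length \<alpha> = Suc k" "length \<beta> = Suc k" using ord_length[OF a] ord_length[OF b] by auto
  show "length (psum \<alpha> \<beta>) = Suc k" using l by (simp add: length_psum)
  have nth: "psum \<alpha> \<beta> ! i = \<alpha> ! i + \<beta> ! i" if "i \<le> k" for i using l that by (simp add: nth_psum)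
  show "psum \<alpha> \<beta> ! i \<le> psum \<alpha> \<beta> ! j" if "i \<le> j" "j \<le> k" for i j
    using ord_nth_mono[OF a that] ord_nth_mono[OF b that] that by (simp add: nth)
  show "psum \<alpha> \<beta> ! i \<le> Suc n" if "i \<le> k" for i
    using ord_nth_le[OF a that] ord_nth_le[OF b that] that by (simp add: nth)
qed

lemma psum_ocomp:
  assumes a: "\<alpha> \<in> ord k n" and b: "\<beta> \<in> ord k 1" and t: "\<theta> \<in> ord m k"
  shows "psum (ocomp \<alpha> \<theta>) (ocomp \<beta> \<theta>) = ocomp (psum \<alpha> \<beta>) \<theta>"
proof (rule nth_equalityI)
  fix i assume "i < length (psum (ocomp \<alpha> \<theta>) (ocomp \<beta> \<theta>))"
  hence i: "i < length \<theta>" by (simp add: length_psum)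
  hence "\<theta> ! i \<le> k" using ord_nth_le[OF t, of i] ord_length[OF t] by simp
  thus "psum (ocomp \<alpha> \<theta>) (ocomp \<beta> \<theta>) ! i = ocomp (psum \<alpha> \<beta>) \<theta> ! i"
    using i ord_length[OF a] ord_length[OF b] by (simp add: nth_psum)
qed (simp add: length_psum)

lemma on_chain_ocomp:
  assumes "on_chain j \<alpha> \<beta>" "\<alpha> \<in> ord k n" "\<theta> \<in> ord m k"
  shows "on_chain j (ocomp \<alpha> \<theta>) (ocomp \<beta> \<theta>)"
proof -
  have "\<theta> ! i < length \<alpha>" if "i < length \<theta>" for i
    using ord_nth_le[OF assms(3), of i] ord_length[OF assms(3)] ord_length[OF assms(2)] that by simp
  thus ?thesis using assms(1) unfolding on_chain_def by simp
qed

text \<open>The step may be taken at the value of \<open>\<alpha>\<close> at the last index where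
  \<open>\<beta>\<close> vanishes, or at vertex 0 if there is no such index.\<close>

lemma on_chain_exists:
  assumes a: "\<alpha> \<in> ord k n" and b: "\<beta> \<in> ord k 1"
  shows "\<exists>j\<le>n. on_chain j \<alpha> \<beta>"
proof (cases "\<exists>i\<le>k. \<beta> ! i = 0")
  case False
  hence "on_chain 0 \<alpha> \<beta>" unfolding on_chain_def using ord_length[OF a] by (auto simp: less_Suc_eq_le)
  thus ?thesis by blast
next
  case True
  let ?M = "{i. i \<le> k \<and> \<beta> ! i = 0}"
  define m where "m = Max ?M"
  have fin: "finite ?M" by simp
  have m: "m \<le> k" "\<beta> ! m = 0" using Max_in[OF fin] True unfolding m_def by blast+
  have ub: "i \<le> m" if "i \<le> k" "\<beta> ! i = 0" for i unfolding m_def by (rule Max_ge[OF fin]) (use that in simp)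
  have "on_chain (\<alpha> ! m) \<alpha> \<beta>" unfolding on_chain_def
  proof (intro allI impI conjI)
    fix i assume i: "i < length \<alpha>"
    hence ik: "i \<le> k" using ord_length[OF a] by simp
    show "\<alpha> ! i \<le> \<alpha> ! m" if "\<beta> ! i = 0" by (rule ord_nth_mono[OF a ub[OF ik that] m(1)])
    show "\<alpha> ! m \<le> \<alpha> ! i" if "\<beta> ! i \<noteq> 0"
    proof (rule ord_nth_mono[OF a _ ik], rule ccontr)
      assume "\<not> m \<le> i"
      hence "\<beta> ! i \<le> \<beta> ! m" using ord_nth_mono[OF b, of i m] m by simp
      thus False using m that by simp
    qed
  qed
  thus ?thesis using ord_nth_le[OF a m(1)] by blast
qed

lemma prism_iff: "(\<alpha>, \<beta>) \<in> prism n \<longleftrightarrow> (\<exists>k. \<alpha> \<in> ord k n \<and> \<beta> \<in> ord k 1)"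
  by (simp add: prism_def)

lemma prism_mapsD:
  assumes "\<phi> \<in> prism_maps X n"
  shows "\<phi> \<in> extensional (prism n)"
    and "\<alpha> \<in> ord k n \<Longrightarrow> \<beta> \<in> ord k 1 \<Longrightarrow> \<phi> (\<alpha>, \<beta>) \<in> Smp X k"
    and "\<alpha> \<in> ord k n \<Longrightarrow> \<beta> \<in> ord k 1 \<Longrightarrow> \<theta> \<in> ord m k \<Longrightarrow> \<phi> (ocomp \<alpha> \<theta>, ocomp \<beta> \<theta>) = Act X k \<theta> (\<phi> (\<alpha>, \<beta>))"
  using assms unfolding prism_maps_def by blast+

text \<open>The prism is the union of \<open>n + 1\<close> top simplices, one per maximal chain, and
  consecutive ones meet in the face opposite to position \<open>j + 1\<close>. Matching there is all
  that a map out of the prism requires.\<close>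

lemma prism_glue:
  assumes X: "simplicial_set X" and r: "\<And>j. j \<le> n \<Longrightarrow> \<rho> j \<in> Smp X (Suc n)"
    and c: "\<And>j. j < n \<Longrightarrow> Act X (Suc n) (face (Suc n) (Suc j)) (\<rho> j) = Act X (Suc n) (face (Suc n) (Suc j)) (\<rho> (Suc j))"
  obtains \<phi> where "\<phi> \<in> prism_maps X n"
    "\<And>j k \<alpha> \<beta>. j \<le> n \<Longrightarrow> \<alpha> \<in> ord k n \<Longrightarrow> \<beta> \<in> ord k 1 \<Longrightarrow> on_chain j \<alpha> \<beta> \<Longrightarrow>
      \<phi> (\<alpha>, \<beta>) = Act X (Suc n) (psum \<alpha> \<beta>) (\<rho> j)"
proof -
  have step: "Act X (Suc n) (psum \<alpha> \<beta>) (\<rho> j) = Act X (Suc n) (psum \<alpha> \<beta>) (\<rho> (Suc j))"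
    if j: "j < n" and a: "\<alpha> \<in> ord k n" and b: "\<beta> \<in> ord k 1" and ch: "on_chain j \<alpha> \<beta>" "on_chain (Suc j) \<alpha> \<beta>" for j k \<alpha> \<beta>
  proof -
    note ps = psum_in_ord[OF a b]
    \<comment> \<open>Position \<open>j + 1\<close> is the vertex \<open>(j + 1, 0)\<close> on chain
      \<open>j + 1\<close> but \<open>(j, 1)\<close> on chain \<open>j\<close>; a pair lying on both
      chains avoids both.\<close>
    have "psum \<alpha> \<beta> ! i \<noteq> Suc j" if "i < length \<alpha>" for i
      using ch that ord_length[OF a] ord_length[OF b] ord_nth_le[OF b, of i]
      unfolding on_chain_def by (cases "\<beta> ! i = 0") (force simp: nth_psum)+
    hence ni: "Suc j \<notin> set (psum \<alpha> \<beta>)"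
      using ord_length[OF a] ord_length[OF b] by (auto simp: in_set_conv_nth length_psum)
    have fo: "face (Suc n) (Suc j) \<in> ord n (Suc n)" using face_in_ord[of "Suc n" "Suc j"] by simp
    have sq: "squeeze (Suc j) (psum \<alpha> \<beta>) \<in> ord k n" using squeeze_in_ord[OF ps ni] j by simp
    have e: "psum \<alpha> \<beta> = ocomp (face (Suc n) (Suc j)) (squeeze (Suc j) (psum \<alpha> \<beta>))"
      using face_squeeze[OF ps ni] j by simp
    have "Act X (Suc n) (psum \<alpha> \<beta>) (\<rho> i) = Act X n (squeeze (Suc j) (psum \<alpha> \<beta>)) (Act X (Suc n) (face (Suc n) (Suc j)) (\<rho> i))"
      if "i \<le> n" for i using sset_act_act[OF X r[OF that] fo sq] e by simp
    thus ?thesis using c[OF j] j by simp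
  qed
  \<comment> \<open>A pair that lies on two chains lies on every chain between them, so the one-step
    comparison can be iterated.\<close>
  have wd': "Act X (Suc n) (psum \<alpha> \<beta>) (\<rho> i) = Act X (Suc n) (psum \<alpha> \<beta>) (\<rho> (i + d))"
    if "i + d \<le> n" and a: "\<alpha> \<in> ord k n" and b: "\<beta> \<in> ord k 1" and ch: "on_chain i \<alpha> \<beta>" "on_chain (i + d) \<alpha> \<beta>" for i d k \<alpha> \<beta>
    using that(1,5)
  proof (induction d)
    case (Suc d)
    have cd: "on_chain (i + d) \<alpha> \<beta>" using ch(1) Suc.prems(2) unfolding on_chain_def by force
    show ?case using Suc.IH[OF _ cd] step[OF _ a b cd] Suc.prems by simp
  qed simp
  have wd: "Act X (Suc n) (psum \<alpha> \<beta>) (\<rho> i) = Act X (Suc n) (psum \<alpha> \<beta>) (\<rho> j)"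
    if le: "i \<le> n" "j \<le> n" and ab: "\<alpha> \<in> ord k n" "\<beta> \<in> ord k 1" and ch: "on_chain i \<alpha> \<beta>" "on_chain j \<alpha> \<beta>" for i j k \<alpha> \<beta>
  proof (cases "i \<le> j")
    case True
    thus ?thesis using wd'[of i "j - i", OF _ ab ch(1)] le ch by simp
  next
    case False
    thus ?thesis using wd'[of j "i - j", OF _ ab ch(2)] le ch by simp
  qed
  define \<phi> where "\<phi> = restrict (\<lambda>(\<alpha>, \<beta>). Act X (Suc n) (psum \<alpha> \<beta>) (\<rho> (SOME j. j \<le> n \<and> on_chain j \<alpha> \<beta>))) (prism n)"
  have phi: "\<phi> (\<alpha>, \<beta>) = Act X (Suc n) (psum \<alpha> \<beta>) (\<rho> j)"
    if j: "j \<le> n" and ab: "\<alpha> \<in> ord k n" "\<beta> \<in> ord k 1" and ch: "on_chain j \<alpha> \<beta>" for j k \<alpha> \<beta>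
  proof -
    define i where "i = (SOME j. j \<le> n \<and> on_chain j \<alpha> \<beta>)"
    have "i \<le> n \<and> on_chain i \<alpha> \<beta>" unfolding i_def by (rule someI[of _ j]) (use j ch in simp)
    hence "Act X (Suc n) (psum \<alpha> \<beta>) (\<rho> i) = Act X (Suc n) (psum \<alpha> \<beta>) (\<rho> j)" using wd[OF _ j ab _ ch] by blast
    moreover have "(\<alpha>, \<beta>) \<in> prism n" using ab prism_iff by blast
    ultimately show ?thesis by (simp add: \<phi>_def i_def)
  qed
  have "\<phi> \<in> prism_maps X n" unfolding prism_maps_def
  proof (intro CollectI conjI allI ballI)
    show "\<phi> \<in> extensional (prism n)" by (simp add: \<phi>_def)
    fix k \<alpha> \<beta> assume a: "\<alpha> \<in> ord k n" and b: "\<beta> \<in> ord k 1"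
    obtain j where j: "j \<le> n" "on_chain j \<alpha> \<beta>" using on_chain_exists[OF a b] by blast
    note ps = psum_in_ord[OF a b]
    show "\<phi> (\<alpha>, \<beta>) \<in> Smp X k" unfolding phi[OF j(1) a b j(2)] by (rule sset_act_in[OF X r[OF j(1)] ps])
    fix m \<theta> assume t: "\<theta> \<in> ord m k"
    show "\<phi> (ocomp \<alpha> \<theta>, ocomp \<beta> \<theta>) = Act X k \<theta> (\<phi> (\<alpha>, \<beta>))"
      unfolding phi[OF j(1) a b j(2)] phi[OF j(1) ocomp_in_ord[OF a t] ocomp_in_ord[OF b t] on_chain_ocomp[OF j(2) a t]]
        psum_ocomp[OF a b t] by (rule sset_act_act[OF X r[OF j(1)] ps t, symmetric])
  qed
  thus ?thesis using phi by (rule that)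
qed

text \<open>With \<open>chain_b\<close>, the two coordinates of the maximal chain that steps up at
  \<open>j\<close>, regarded as a simplex of the prism; the vertex \<open>j\<close> is repeated
  there.\<close>

definition chain_a :: "nat \<Rightarrow> nat \<Rightarrow> nat list" where
  "chain_a n j = map (\<lambda>i. if i \<le> j then i else i - 1) [0..<Suc (Suc n)]"

definition chain_b :: "nat \<Rightarrow> nat \<Rightarrow> nat list" where
  "chain_b n j = map (\<lambda>i. if i \<le> j then 0 else 1) [0..<Suc (Suc n)]"

lemma chain_nth: "i \<le> Suc n \<Longrightarrow> chain_a n j ! i = (if i \<le> j then i else i - 1)"
  "i \<le> Suc n \<Longrightarrow> chain_b n j ! i = (if i \<le> j then 0 else 1)"
  by (simp_all add: chain_a_def chain_b_def del: upt_Suc)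

lemma chain_in_ord: "j \<le> n \<Longrightarrow> chain_a n j \<in> ord (Suc n) n" "chain_b n j \<in> ord (Suc n) 1"
proof -
  have "length (chain_a n j) = Suc (Suc n)" "length (chain_b n j) = Suc (Suc n)"
    by (simp_all add: chain_a_def chain_b_def)
  thus "j \<le> n \<Longrightarrow> chain_a n j \<in> ord (Suc n) n" "chain_b n j \<in> ord (Suc n) 1"
    by (auto intro!: ordI simp: chain_nth)
qed

lemma chain_simps:
  "chain_a 0 0 = [0,0]" "chain_b 0 0 = [0,1]"
  "chain_a (Suc 0) 0 = [0,0,1]" "chain_b (Suc 0) 0 = [0,1,1]"
  "chain_a (Suc 0) (Suc 0) = [0,1,1]" "chain_b (Suc 0) (Suc 0) = [0,0,1]"
  by (simp_all add: chain_a_def chain_b_def)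

lemma on_chain_factor:
  assumes j: "j \<le> n" and a: "\<alpha> \<in> ord k n" and b: "\<beta> \<in> ord k 1" and c: "on_chain j \<alpha> \<beta>"
  shows "\<alpha> = ocomp (chain_a n j) (psum \<alpha> \<beta>)" "\<beta> = ocomp (chain_b n j) (psum \<alpha> \<beta>)"
proof -
  have l: "length \<alpha> = Suc k" "length \<beta> = Suc k" using ord_length[OF a] ord_length[OF b] by auto
  have *: "\<alpha> ! i = chain_a n j ! (\<alpha> ! i + \<beta> ! i) \<and> \<beta> ! i = chain_b n j ! (\<alpha> ! i + \<beta> ! i)" if i: "i < Suc k" for i
  proof -
    have "\<alpha> ! i \<le> n" "\<beta> ! i \<le> 1" using ord_nth_le[OF a] ord_nth_le[OF b] i by auto
    thus ?thesis using c i l unfolding on_chain_def by (cases "\<beta> ! i = 0") (auto simp: chain_nth)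
  qed
  show "\<alpha> = ocomp (chain_a n j) (psum \<alpha> \<beta>)" "\<beta> = ocomp (chain_b n j) (psum \<alpha> \<beta>)"
    by (rule nth_equalityI, use * l in \<open>auto simp: length_psum nth_psum\<close>)+
qed

text \<open>The uniqueness that complements \<open>prism_glue\<close>: every simplex of the prism
  factors through some maximal chain.\<close>

lemma prism_maps_eqI:
  assumes p: "\<phi> \<in> prism_maps X n" "\<psi> \<in> prism_maps X n"
    and e: "\<And>j. j \<le> n \<Longrightarrow> \<phi> (chain_a n j, chain_b n j) = \<psi> (chain_a n j, chain_b n j)"
  shows "\<phi> = \<psi>"
proof (rule extensionalityI[OF prism_mapsD(1)[OF p(1)] prism_mapsD(1)[OF p(2)]])
  fix x assume "x \<in> prism n"
  then obtain \<alpha> \<beta> k where x: "x = (\<alpha>, \<beta>)" and a: "\<alpha> \<in> ord k n" and b: "\<beta> \<in> ord k 1"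
    by (auto simp: prism_def)
  obtain j where j: "j \<le> n" "on_chain j \<alpha> \<beta>" using on_chain_exists[OF a b] by blast
  note f = on_chain_factor[OF j(1) a b j(2)]
  have *: "\<chi> x = Act X (Suc n) (psum \<alpha> \<beta>) (\<chi> (chain_a n j, chain_b n j))" if "\<chi> \<in> prism_maps X n" for \<chi>
    using prism_mapsD(3)[OF that chain_in_ord(1)[OF j(1)] chain_in_ord(2)[of n j] psum_in_ord[OF a b]]
    by (simp only: f[symmetric] x)
  show "\<phi> x = \<psi> x" unfolding *[OF p(1)] *[OF p(2)] e[OF j(1)] ..
qed

section \<open>Objects, morphisms and composites in a slice\<close>

lemma slice_iff:
  "\<phi> \<in> BSmp (css_slice W c) n l \<longleftrightarrow> \<phi> \<in> prism_maps (row W l) n \<and>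
    (\<forall>k. \<forall>\<alpha>\<in>ord k n. \<phi> (\<alpha>, const_op k 1) = bdegs W k l c)"
  by (simp add: css_slice_def)

lemma slice_act:
  assumes "\<theta> \<in> ord m n" "\<alpha> \<in> ord k m" "\<beta> \<in> ord k 1"
  shows "BAct (css_slice W c) n l \<theta> \<gamma> \<phi> (\<alpha>, \<beta>) = BAct W k l (idl k) \<gamma> (\<phi> (ocomp \<theta> \<alpha>, \<beta>))"
proof -
  have "(\<alpha>, \<beta>) \<in> prism m" using assms prism_iff by blast
  thus ?thesis by (simp add: css_slice_def prism_act_def ord_length[OF assms(1)] ord_length[OF assms(2)])
qed

lemma slice_act_ext: "\<theta> \<in> ord m n \<Longrightarrow> BAct (css_slice W c) n l \<theta> \<gamma> \<phi> \<in> extensional (prism m)"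
  by (simp add: css_slice_def ord_length)

lemma slice_val:
  assumes "\<phi> \<in> BSmp (css_slice W c) n l" "\<alpha> \<in> ord k n" "\<beta> \<in> ord k 1"
  shows "\<phi> (\<alpha>, \<beta>) \<in> BSmp W k l"
    and "\<theta> \<in> ord m k \<Longrightarrow> \<phi> (ocomp \<alpha> \<theta>, ocomp \<beta> \<theta>) = BAct W k l \<theta> (idl l) (\<phi> (\<alpha>, \<beta>))"
  using prism_mapsD(2,3)[of \<phi> "row W l" n \<alpha> k \<beta>] assms by (simp_all add: slice_iff)

lemma bdegs_act:
  assumes W: "bisimplicial_set W" and c: "c \<in> BSmp W 0 0" and a: "\<alpha> \<in> ord m n" and g: "\<gamma> \<in> ord j l"
  shows "BAct W n l \<alpha> \<gamma> (bdegs W n l c) = bdegs W m j c"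
  unfolding bdegs_def using bs_act_act[OF W c _ _ a g, of "const_op n 0" "const_op l 0"]
  by (simp add: ocomp_const_left[OF a] ocomp_const_left[OF g])

lemma ext_pairI:
  assumes "\<phi> \<in> extensional (prism n)" "\<psi> \<in> extensional (prism n)"
    and "\<And>k \<alpha> \<beta>. \<alpha> \<in> ord k n \<Longrightarrow> \<beta> \<in> ord k 1 \<Longrightarrow> \<phi> (\<alpha>, \<beta>) = \<psi> (\<alpha>, \<beta>)"
  shows "\<phi> = \<psi>"
  by (rule extensionalityI[OF assms(1,2)]) (use assms(3) in \<open>auto simp: prism_def\<close>)

lemma css_slice_bisimplicial:
  assumes W: "bisimplicial_set W" and c: "c \<in> BSmp W 0 0"
  shows "bisimplicial_set (css_slice W c)"
  unfolding bisimplicial_set_def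
proof (intro conjI allI ballI)
  let ?S = "css_slice W c"
  show in_slice: "BAct ?S n l \<theta> \<gamma> \<phi> \<in> BSmp ?S m j"
    if t: "\<theta> \<in> ord m n" and g: "\<gamma> \<in> ord j l" and p: "\<phi> \<in> BSmp ?S n l" for m n j l \<theta> \<gamma> \<phi>
    unfolding slice_iff prism_maps_def
  proof (intro conjI CollectI allI ballI slice_act_ext[OF t])
    fix k \<alpha> \<beta> assume a: "\<alpha> \<in> ord k m" and b: "\<beta> \<in> ord k 1"
    note v = slice_val[OF p ocomp_in_ord[OF t a] b]
    show "BAct ?S n l \<theta> \<gamma> \<phi> (\<alpha>, \<beta>) \<in> Smp (row W j) k"
      unfolding slice_act[OF t a b] using bs_act_in[OF W v(1) idl_ord g] by simp
    fix i \<psi> assume q: "\<psi> \<in> ord i k"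
    have "\<phi> (ocomp \<theta> (ocomp \<alpha> \<psi>), ocomp \<beta> \<psi>) = BAct W k l \<psi> (idl l) (\<phi> (ocomp \<theta> \<alpha>, \<beta>))"
      unfolding ocomp_assoc[OF ord_length[OF a] q, symmetric] by (rule v(2)[OF q])
    thus "BAct ?S n l \<theta> \<gamma> \<phi> (ocomp \<alpha> \<psi>, ocomp \<beta> \<psi>) = Act (row W j) k \<psi> (BAct ?S n l \<theta> \<gamma> \<phi> (\<alpha>, \<beta>))"
      unfolding slice_act[OF t a b] slice_act[OF t ocomp_in_ord[OF a q] ocomp_in_ord[OF b q]] row_simps
        bs_act_act[OF W v(1) idl_ord g q idl_ord]
      using bs_act_act[OF W v(1) q idl_ord idl_ord g]
      by (simp add: ocomp_idl_left[OF q] ocomp_idl_right[OF ord_length[OF q]] ocomp_idl_left[OF g] ocomp_idl_right[OF ord_length[OF g]])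
  next
    fix k \<alpha> assume a: "\<alpha> \<in> ord k m"
    have "\<phi> (ocomp \<theta> \<alpha>, const_op k 1) = bdegs W k l c" using p ocomp_in_ord[OF t a] unfolding slice_iff by blast
    moreover have "const_op k 1 \<in> ord k 1" by simp
    ultimately show "BAct ?S n l \<theta> \<gamma> \<phi> (\<alpha>, const_op k 1) = bdegs W k j c"
      by (simp only: slice_act[OF t a] bdegs_act[OF W c idl_ord g])
  qed
  show "BAct ?S n l (idl n) (idl l) \<phi> = \<phi>" if p: "\<phi> \<in> BSmp ?S n l" for n l \<phi>
  proof (rule ext_pairI[OF slice_act_ext[OF idl_ord]])
    show "\<phi> \<in> extensional (prism n)" using p prism_mapsD(1) unfolding slice_iff by blast
    show "BAct ?S n l (idl n) (idl l) \<phi> (\<alpha>, \<beta>) = \<phi> (\<alpha>, \<beta>)" if a: "\<alpha> \<in> ord k n" and b: "\<beta> \<in> ord k 1" for k \<alpha> \<beta>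
      unfolding slice_act[OF idl_ord a b] ocomp_idl_left[OF a] by (rule bs_act_id[OF W slice_val(1)[OF p a b]])
  qed
  show "BAct ?S m j \<theta>' \<gamma>' (BAct ?S n l \<theta> \<gamma> \<phi>) = BAct ?S n l (ocomp \<theta> \<theta>') (ocomp \<gamma> \<gamma>') \<phi>"
    if t: "\<theta> \<in> ord m n" and t': "\<theta>' \<in> ord k m" and g: "\<gamma> \<in> ord j l" and g': "\<gamma>' \<in> ord i j" and p: "\<phi> \<in> BSmp ?S n l"
    for k m n i j l \<theta> \<theta>' \<gamma> \<gamma>' \<phi>
  proof (rule ext_pairI[OF slice_act_ext[OF t'] slice_act_ext[OF ocomp_in_ord[OF t t']]])
    fix h \<alpha> \<beta> assume a: "\<alpha> \<in> ord h k" and b: "\<beta> \<in> ord h 1"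
    note ta = ocomp_in_ord[OF t' a]
    show "BAct ?S m j \<theta>' \<gamma>' (BAct ?S n l \<theta> \<gamma> \<phi>) (\<alpha>, \<beta>) = BAct ?S n l (ocomp \<theta> \<theta>') (ocomp \<gamma> \<gamma>') \<phi> (\<alpha>, \<beta>)"
      unfolding slice_act[OF t' a b] slice_act[OF t ta b] slice_act[OF ocomp_in_ord[OF t t'] a b]
        ocomp_assoc[OF ord_length[OF t'] a]
      using bs_act_act[OF W slice_val(1)[OF p ocomp_in_ord[OF t ta] b] idl_ord g idl_ord g'] by simp
  qed
qed

lemma css_forget_in: "\<phi> \<in> BSmp (css_slice W c) n l \<Longrightarrow> css_forget n \<phi> \<in> BSmp W n l"
  unfolding css_forget_def by (rule slice_val(1)[OF _ idl_ord]) simp_all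

lemma css_forget_act:
  assumes W: "bisimplicial_set W" and p: "\<phi> \<in> BSmp (css_slice W c) n l" and t: "\<theta> \<in> ord m n" and g: "\<gamma> \<in> ord j l"
  shows "css_forget m (BAct (css_slice W c) n l \<theta> \<gamma> \<phi>) = BAct W n l \<theta> \<gamma> (css_forget n \<phi>)"
proof -
  have c0: "const_op k 0 \<in> ord k 1" for k by simp
  have "\<phi> (\<theta>, const_op m 0) = BAct W n l \<theta> (idl l) (\<phi> (idl n, const_op n 0))"
    using slice_val(2)[OF p idl_ord c0 t] by (simp add: ocomp_idl_left[OF t] ocomp_const_left[OF t])
  thus ?thesis unfolding css_forget_def slice_act[OF t idl_ord c0] ocomp_idl_right[OF ord_length[OF t]]
    using bs_act_act[OF W slice_val(1)[OF p idl_ord c0] t idl_ord idl_ord g]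
    by (simp add: ocomp_idl_left[OF g] ocomp_idl_right[OF ord_length[OF t]])
qed

lemma slice_obj_in:
  assumes W: "bisimplicial_set W" and f: "css_edge W f x c"
  shows "slice_obj W f \<in> BSmp (css_slice W c) 0 0"
proof -
  have f1: "f \<in> BSmp W 1 0" and fc: "BAct W 1 0 [1] [0] f = c" using f by (auto simp: css_edge_def)
  have val: "slice_obj W f (\<alpha>, \<beta>) = BAct W 1 0 \<beta> [0] f" if "\<alpha> \<in> ord k 0" "\<beta> \<in> ord k 1" for \<alpha> \<beta> k
    using that by (auto simp: slice_obj_def prism_iff)
  show ?thesis unfolding slice_iff prism_maps_def
  proof (intro conjI CollectI allI ballI)
    show "slice_obj W f \<in> extensional (prism 0)" by (simp add: slice_obj_def)
    fix k \<alpha> \<beta> assume a: "\<alpha> \<in> ord k 0" and b: "\<beta> \<in> ord k 1"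
    show "slice_obj W f (\<alpha>, \<beta>) \<in> Smp (row W 0) k" unfolding val[OF a b] using bs_act_in[OF W f1 b zero_ord] by simp
    fix m \<theta> assume t: "\<theta> \<in> ord m k"
    show "slice_obj W f (ocomp \<alpha> \<theta>, ocomp \<beta> \<theta>) = Act (row W 0) k \<theta> (slice_obj W f (\<alpha>, \<beta>))"
      unfolding val[OF a b] val[OF ocomp_in_ord[OF a t] ocomp_in_ord[OF b t]]
      using bs_act_act[OF W f1 b zero_ord t zero_ord] by (simp add: idl_simps)
  next
    fix k \<alpha> assume a: "\<alpha> \<in> ord k 0"
    show "slice_obj W f (\<alpha>, const_op k 1) = bdegs W k 0 c"
      using val[OF a, of "const_op k 1"] bs_act_act[OF W f1 _ zero_ord _ zero_ord, of "[1]" 0 "const_op k 0" k] fc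
      by (simp add: bdegs_def const_op_simps(1) ocomp_const_right)
  qed
qed

lemma slice_edge_obj:
  assumes W: "bisimplicial_set W" and f: "css_edge W f x c"
  shows "slice_edge (slice_obj W f) = f" "css_forget 0 (slice_obj W f) = x"
proof -
  have f1: "f \<in> BSmp W 1 0" using f by (simp add: css_edge_def)
  have "([0,0],[0,1]) \<in> prism 0" "([0],[0]) \<in> prism 0" by (auto simp: prism_iff)
  thus "slice_edge (slice_obj W f) = f" "css_forget 0 (slice_obj W f) = x"
    using bs_act_id[OF W f1] f
    by (simp_all add: slice_edge_def slice_obj_def css_forget_def idl_simps const_op_simps css_edge_def)
qed

lemma slice_edge_css:
  assumes W: "bisimplicial_set W" and c: "c \<in> BSmp W 0 0" and z: "z \<in> BSmp (css_slice W c) 0 0"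
  shows "css_edge W (slice_edge z) (css_forget 0 z) c" "slice_obj W (slice_edge z) = z"
proof -
  have o: "[0,0] \<in> ord 1 0" "[0,1] \<in> ord 1 1" by simp_all
  note v = slice_val[OF z o]
  have e: "z ([0], [i]) = BAct W 1 0 [i] [0] (z ([0,0],[0,1]))" if "i \<le> 1" for i
    using v(2)[of "[i]" 0] that by (cases i) (simp_all add: idl_simps)
  have "bdegs W 0 0 c = c" using bs_act_id[OF W c] by (simp add: bdegs_def const_op_simps idl_simps)
  moreover have "z ([0], const_op 0 1) = bdegs W 0 0 c"
    using z zero_ord unfolding slice_iff by blast
  ultimately have "z ([0],[1]) = c" by (simp add: const_op_simps)
  thus ce: "css_edge W (slice_edge z) (css_forget 0 z) c"
    using v(1) e[of 0] e[of 1] by (simp add: css_edge_def slice_edge_def css_forget_def idl_simps const_op_simps)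
  show "slice_obj W (slice_edge z) = z"
  proof (rule prism_maps_eqI)
    show "slice_obj W (slice_edge z) \<in> prism_maps (row W 0) 0" using slice_obj_in[OF W ce] by (simp add: slice_iff)
    show "z \<in> prism_maps (row W 0) 0" using z by (simp add: slice_iff)
    fix j :: nat assume "j \<le> 0"
    thus "slice_obj W (slice_edge z) (chain_a 0 j, chain_b 0 j) = z (chain_a 0 j, chain_b 0 j)"
      using slice_edge_obj(1)[OF W ce] by (simp add: chain_simps slice_edge_def)
  qed
qed

lemma slice_edge_ends:
  assumes W: "bisimplicial_set W" and p: "\<phi> \<in> BSmp (css_slice W c) 1 0" and i: "i \<le> 1"
  shows "slice_edge (BAct (css_slice W c) 1 0 [i] [0] \<phi>) = \<phi> ([i,i], [0,1])"
proof -
  have o: "[i] \<in> ord 0 1" "[0,0] \<in> ord 1 0" "[0,1] \<in> ord 1 1" using i by simp_all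
  have "\<phi> ([i,i],[0,1]) \<in> BSmp W 1 0" by (rule slice_val(1)[OF p]) (use i in simp_all)
  from bs_act_id[OF W this] show ?thesis unfolding slice_edge_def slice_act[OF o] by (simp add: idl_simps)
qed

text \<open>The square \<open>\<phi>\<close> has two triangles with a common diagonal. One exhibits
  the diagonal as the composite of the underlying map and the target structure map; the other has an
  identity of \<open>c\<close> as second edge and so makes the diagonal homotopic to the source
  structure map.\<close>

lemma slice_edge_composite:
  assumes W: "bisimplicial_set W" and I: "inner3 (row W 0)" and c: "c \<in> BSmp W 0 0"
    and p: "\<phi> \<in> BSmp (css_slice W c) 1 0"
  shows "qc_composite (row W 0) (css_forget 1 \<phi>) (\<phi> ([1,1],[0,1])) (\<phi> ([0,0],[0,1]))"
proof -
  interpret hocat "\<lambda>x y f. edge (row W 0) f x y" "qc_composite (row W 0)" "qc_id (row W 0)"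
    by (rule hocat_sset[OF I])
  have o: "[0,0,1] \<in> ord 2 1" "[0,1,1] \<in> ord 2 1" by simp_all
  note u = slice_val[OF p o(2,1)] and d = slice_val[OF p o(1,2)]
  have T1: "qc_composite (row W 0) (css_forget 1 \<phi>) (\<phi> ([1,1],[0,1])) (\<phi> ([0,1],[0,1]))"
    unfolding qc_composite_row
    by (rule bexI[OF _ u(1)]) (use u(2)[of "[0,1]" 1] u(2)[of "[1,2]" 1] u(2)[of "[0,2]" 1] in \<open>simp add: css_forget_def idl_simps const_op_simps\<close>)
  have b: "\<phi> ([0,1],[1,1]) = css_id W c"
    using p unfolding slice_iff css_id_def by (auto simp: const_op_simps dest!: spec[of _ 1] bspec[of _ _ "[0,1]"])
  have T2: "qc_composite (row W 0) (\<phi> ([0,0],[0,1])) (qc_id (row W 0) c) (\<phi> ([0,1],[0,1]))"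
    unfolding qc_composite_row qc_id_row b[symmetric]
    by (rule bexI[OF _ d(1)]) (use d(2)[of "[0,1]" 1] d(2)[of "[1,2]" 1] d(2)[of "[0,2]" 1] in \<open>simp add: idl_simps\<close>)
  have e: "edge (row W 0) (\<phi> ([0,0],[0,1])) (css_forget 0 (BAct (css_slice W c) 1 0 [0] [0] \<phi>)) c"
    unfolding edge_row using slice_edge_css(1)[OF W c bs_act_in[OF css_slice_bisimplicial[OF W c] p _ zero_ord, of "[0]" 0]]
      slice_edge_ends[OF W p, of 0] by simp
  have "eqv (\<phi> ([0,0],[0,1])) (\<phi> ([0,1],[0,1]))" using eqv_iff[OF e] T2 by simp
  thus ?thesis using T_unique[OF T1] eqv_sym by blast
qed

text \<open>Conversely, the triangle witnessing the composite and a degenerate triangle on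
  \<open>g\<close>, glued along the diagonal \<open>g\<close>, form a square that is constant at
  \<open>c\<close> on its far side.\<close>

lemma slice_edge_of_composite:
  assumes W: "bisimplicial_set W" and k: "css_edge W k x y" and f: "css_edge W f y c" and g: "css_edge W g x c"
    and T: "qc_composite (row W 0) k f g"
  obtains \<phi> where "\<phi> \<in> BSmp (css_slice W c) 1 0" "css_forget 1 \<phi> = k"
    "BAct (css_slice W c) 1 0 [0] [0] \<phi> = slice_obj W g" "BAct (css_slice W c) 1 0 [1] [0] \<phi> = slice_obj W f"
proof -
  have g1: "g \<in> BSmp W 1 0" and gc: "BAct W 1 0 [1] [0] g = c" using g by (auto simp: css_edge_def)
  have c0: "c \<in> BSmp W 0 0" using bs_act_in[OF W g1 _ zero_ord, of "[1]" 0] gc by simp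
  have R: "simplicial_set (row W 0)" by (rule row_simplicial[OF W])
  obtain \<sigma> where s: "\<sigma> \<in> BSmp W 2 0" "BAct W 2 0 [0,1] [0] \<sigma> = k" "BAct W 2 0 [1,2] [0] \<sigma> = f" "BAct W 2 0 [0,2] [0] \<sigma> = g"
    using T unfolding qc_composite_row by blast
  have o: "[0,1,1] \<in> ord 2 1" by simp
  \<comment> \<open>The triangle on the chain that steps up at once: \<open>g\<close> followed by
    the identity of \<open>c\<close>.\<close>
  define \<tau> where "\<tau> = BAct W 1 0 [0,1,1] [0] g"
  have t: "\<tau> \<in> BSmp W 2 0" unfolding \<tau>_def by (rule bs_act_in[OF W g1 o zero_ord])
  have te: "BAct W 2 0 \<alpha> [0] \<tau> = BAct W 1 0 (ocomp [0,1,1] \<alpha>) [0] g" if "\<alpha> \<in> ord m 2" for \<alpha> m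
    unfolding \<tau>_def using bs_act_act[OF W g1 o zero_ord that zero_ord] by simp
  have g01: "BAct W 1 0 [0,1] [0] g = g" using bs_act_id[OF W g1] by (simp add: idl_simps)
  let ?r = "\<lambda>j::nat. if j = 0 then \<tau> else \<sigma>"
  obtain \<phi> where phi: "\<phi> \<in> prism_maps (row W 0) 1"
    and v: "\<And>j k \<alpha> \<beta>. j \<le> 1 \<Longrightarrow> \<alpha> \<in> ord k 1 \<Longrightarrow> \<beta> \<in> ord k 1 \<Longrightarrow> on_chain j \<alpha> \<beta> \<Longrightarrow>
      \<phi> (\<alpha>, \<beta>) = Act (row W 0) (Suc 1) (psum \<alpha> \<beta>) (?r j)"
  proof (rule prism_glue[OF R, of 1 ?r])
    fix j :: nat assume "j < 1"
    thus "Act (row W 0) (Suc 1) (face (Suc 1) (Suc j)) (?r j) = Act (row W 0) (Suc 1) (face (Suc 1) (Suc j)) (?r (Suc j))"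
      using te[of "[0,2]" 1] s g01 by (simp add: face_simps idl_simps flip: numeral_2_eq_2)
  qed (use s t in \<open>auto simp: numeral_2_eq_2\<close>)
  have v': "\<phi> (\<alpha>, \<beta>) = BAct W 2 0 (psum \<alpha> \<beta>) [0] (?r j)"
    if "j \<le> 1" "\<alpha> \<in> ord m 1" "\<beta> \<in> ord m 1" "on_chain j \<alpha> \<beta>" for j m \<alpha> \<beta>
    using v[OF that] by (simp add: idl_simps numeral_2_eq_2)
  have pS: "\<phi> \<in> BSmp (css_slice W c) 1 0" unfolding slice_iff
  proof (intro conjI phi allI ballI)
    fix m \<alpha> assume a: "\<alpha> \<in> ord m 1"
    have ch: "on_chain 0 \<alpha> (const_op m 1)" by (simp add: on_chain_def ord_length[OF a])
    have l: "length \<alpha> = Suc m" by (rule ord_length[OF a])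
    have ps: "psum \<alpha> (const_op m 1) \<in> ord m 2"
      using psum_in_ord[OF a, of "const_op m 1"] by (simp add: numeral_2_eq_2)
    have "ocomp [0,1,1] (psum \<alpha> (const_op m 1)) = const_op m 1"
    proof (rule nth_equalityI)
      fix i assume "i < length (ocomp [0,1,1] (psum \<alpha> (const_op m 1)))"
      hence i: "i \<le> m" using l by (simp add: length_psum)
      hence "\<alpha> ! i = 0 \<or> \<alpha> ! i = 1" using ord_nth_le[OF a i] by auto
      thus "ocomp [0,1,1] (psum \<alpha> (const_op m 1)) ! i = const_op m 1 ! i"
        using i l by (auto simp: length_psum nth_psum)
    qed (simp add: l length_psum)
    hence "\<phi> (\<alpha>, const_op m 1) = BAct W 1 0 (const_op m 1) [0] g"
      using v'[OF _ a _ ch] te[OF ps] by simp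
    thus "\<phi> (\<alpha>, const_op m 1) = bdegs W m 0 c"
      using bs_act_act[OF W g1 _ zero_ord _ zero_ord, of "[1]" 0 "const_op m 0" m] gc
      by (simp add: bdegs_def const_op_simps(1) ocomp_const_right)
  qed
  have oc: "on_chain 1 [0,1] [0,0]" "on_chain 0 [0,0] [0,1]" "on_chain 1 [1,1] [0,1]"
    by (auto simp: on_chain_def less_Suc_eq)
  have "css_forget 1 \<phi> = k" unfolding css_forget_def using v'[OF _ _ _ oc(1), of 1] s by (simp add: idl_simps const_op_simps)
  moreover have ends: "BAct (css_slice W c) 1 0 [i] [0] \<phi> = slice_obj W h"
    if "i \<le> 1" "\<phi> ([i,i],[0,1]) = h" for i h
    using slice_edge_css(2)[OF W c0 bs_act_in[OF css_slice_bisimplicial[OF W c0] pS _ zero_ord, of "[i]" 0]]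
      slice_edge_ends[OF W pS that(1)] that by simp
  moreover have "\<phi> ([0,0],[0,1]) = g" using v'[OF _ _ _ oc(2), of 1] te[of "[0,1]" 1] g01 by simp
  moreover have "\<phi> ([1,1],[0,1]) = f" using v'[OF _ _ _ oc(3), of 1] s by (simp flip: numeral_2_eq_2)
  ultimately show ?thesis using that[OF pS] ends[of 0 g] ends[of 1 f] by simp
qed

text \<open>A triangle of the slice is a prism made of three tetrahedra. \<open>F\<close> and
  \<open>G\<close> fix two triangles each on the side squares and the bottom has to be constant; the
  tetrahedra are obtained from inner horns in an order where each new one meets an earlier one along
  a face already known.\<close>

lemma slice_composite_exists:
  assumes W: "bisimplicial_set W" and I: "inner3 (row W 0)" and c: "c \<in> BSmp W 0 0"
    and F: "F \<in> BSmp (css_slice W c) 1 0" and G: "G \<in> BSmp (css_slice W c) 1 0"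
    and FG: "BAct (css_slice W c) 1 0 [1] [0] F = BAct (css_slice W c) 1 0 [0] [0] G"
  shows "\<exists>\<Sigma>\<in>BSmp (css_slice W c) 2 0. BAct (css_slice W c) 2 0 [0,1] [0] \<Sigma> = F \<and> BAct (css_slice W c) 2 0 [1,2] [0] \<Sigma> = G"
proof -
  let ?S = "css_slice W c"
  have R: "simplicial_set (row W 0)" by (rule row_simplicial[OF W])
  have I2: "\<exists>\<sigma>\<in>BSmp W 2 0. BAct W 2 0 [0,1] [0] \<sigma> = f \<and> BAct W 2 0 [1,2] [0] \<sigma> = g"
    if "f \<in> BSmp W 1 0" "g \<in> BSmp W 1 0" "BAct W 1 0 [1] [0] f = BAct W 1 0 [0] [0] g" for f g
    using I that unfolding inner3_def row_simps idl_simps by blast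
  have I31: "\<exists>\<rho>\<in>BSmp W 3 0. BAct W 3 0 [0,1,2] [0] \<rho> = a \<and> BAct W 3 0 [1,2,3] [0] \<rho> = b \<and> BAct W 3 0 [0,1,3] [0] \<rho> = d"
    if "a \<in> BSmp W 2 0" "b \<in> BSmp W 2 0" "d \<in> BSmp W 2 0" "BAct W 2 0 [1,2] [0] a = BAct W 2 0 [0,1] [0] b"
      "BAct W 2 0 [0,1] [0] d = BAct W 2 0 [0,1] [0] a" "BAct W 2 0 [1,2] [0] d = BAct W 2 0 [0,2] [0] b" for a b d
    using I that unfolding inner3_def row_simps idl_simps by blast
  have I32: "\<exists>\<rho>\<in>BSmp W 3 0. BAct W 3 0 [0,1,2] [0] \<rho> = a \<and> BAct W 3 0 [1,2,3] [0] \<rho> = b \<and> BAct W 3 0 [0,2,3] [0] \<rho> = d"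
    if "a \<in> BSmp W 2 0" "b \<in> BSmp W 2 0" "d \<in> BSmp W 2 0" "BAct W 2 0 [1,2] [0] a = BAct W 2 0 [0,1] [0] b"
      "BAct W 2 0 [0,1] [0] d = BAct W 2 0 [0,2] [0] a" "BAct W 2 0 [1,2] [0] d = BAct W 2 0 [1,2] [0] b" for a b d
    using I that unfolding inner3_def row_simps idl_simps by blast
  have l: "[0,0,1] \<in> ord 2 1" "[0,1,1] \<in> ord 2 1" by simp_all
  define F0 where "F0 = F ([0,0,1],[0,1,1])"
  define F1 where "F1 = F ([0,1,1],[0,0,1])"
  define G0 where "G0 = G ([0,0,1],[0,1,1])"
  define G1 where "G1 = G ([0,1,1],[0,0,1])"
  have v: "F0 \<in> BSmp W 2 0" "F1 \<in> BSmp W 2 0" "G0 \<in> BSmp W 2 0" "G1 \<in> BSmp W 2 0"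
    unfolding F0_def F1_def G0_def G1_def by (rule slice_val(1)[OF F l] slice_val(1)[OF F l(2,1)]
      slice_val(1)[OF G l] slice_val(1)[OF G l(2,1)])+
  have e0: "BAct W 2 0 \<theta> [0] (H ([0,0,1],[0,1,1])) = H (ocomp [0,0,1] \<theta>, ocomp [0,1,1] \<theta>)"
    if "H \<in> BSmp ?S 1 0" "\<theta> \<in> ord 1 2" for H \<theta>
    using slice_val(2)[OF that(1) l that(2)] by (simp add: idl_simps)
  have e1: "BAct W 2 0 \<theta> [0] (H ([0,1,1],[0,0,1])) = H (ocomp [0,1,1] \<theta>, ocomp [0,0,1] \<theta>)"
    if "H \<in> BSmp ?S 1 0" "\<theta> \<in> ord 1 2" for H \<theta>
    using slice_val(2)[OF that(1) l(2,1) that(2)] by (simp add: idl_simps)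
  have mid: "F ([1,1],[0,1]) = G ([0,0],[0,1])"
    using slice_edge_ends[OF W F, of 1] slice_edge_ends[OF W G, of 0] FG by simp
  have bot: "H ([0,1],[1,1]) = bdegs W 1 0 c" if "H \<in> BSmp ?S 1 0" for H
    using that unfolding slice_iff by (auto simp: const_op_simps dest!: spec[of _ 1] bspec[of _ _ "[0,1]"])
  define D where "D = bdegs W 2 0 c"
  have D: "D \<in> BSmp W 2 0" unfolding D_def bdegs_def by (rule bs_act_in[OF W c]) simp_all
  have De: "BAct W 2 0 \<theta> [0] D = bdegs W m 0 c" if "\<theta> \<in> ord m 2" for \<theta> m
    unfolding D_def by (rule bdegs_act[OF W c that zero_ord])
  have Fv: "F ([0,1],[0,0]) \<in> BSmp W 1 0" "G ([0,1],[0,1]) \<in> BSmp W 1 0"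
    using slice_val(1)[OF F] slice_val(1)[OF G] by simp_all
  have "BAct W 1 0 [1] [0] (F ([0,1],[0,0])) = BAct W 1 0 [0] [0] (G ([0,1],[0,1]))"
  proof -
    have o: "[0,1] \<in> ord 1 1" "[0,0] \<in> ord 1 1" "[1,1] \<in> ord 1 1" "[1] \<in> ord 0 1" by simp_all
    show ?thesis
      using slice_val(2)[OF F o(1,2,4)] slice_val(2)[OF F o(3,1) zero_ord] slice_val(2)[OF G o(1,1) zero_ord]
        slice_val(2)[OF G o(2,1) zero_ord] mid by (simp add: idl_simps)
  qed
  then obtain t where t: "t \<in> BSmp W 2 0" "BAct W 2 0 [0,1] [0] t = F ([0,1],[0,0])" "BAct W 2 0 [1,2] [0] t = G ([0,1],[0,1])"
    using I2[OF Fv] by blast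
  \<comment> \<open>The middle tetrahedron, on the chain that steps up at vertex 1. It contains the
    triangle of \<open>F\<close> with vertices (0,0), (1,0), (1,1) and the triangle of
    \<open>G\<close> with vertices (1,0), (1,1), (2,1); \<open>t\<close> is chosen as a filler on
    (0,0), (1,0), (2,1).\<close>
  have "\<exists>\<rho>\<in>BSmp W 3 0. BAct W 3 0 [0,1,2] [0] \<rho> = F1 \<and> BAct W 3 0 [1,2,3] [0] \<rho> = G0 \<and> BAct W 3 0 [0,1,3] [0] \<rho> = t"
    by (rule I31[OF v(2,3) t(1)]) (use e0[OF G] e1[OF F] t mid in \<open>simp_all add: F1_def G0_def\<close>)
  then obtain r1 where r1: "r1 \<in> BSmp W 3 0" "BAct W 3 0 [0,1,2] [0] r1 = F1" "BAct W 3 0 [1,2,3] [0] r1 = G0" "BAct W 3 0 [0,1,3] [0] r1 = t"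
    by blast
  have r1e: "BAct W 2 0 \<beta> [0] (BAct W 3 0 \<alpha> [0] r1) = BAct W 3 0 (ocomp \<alpha> \<beta>) [0] r1" if "\<alpha> \<in> ord 2 3" "\<beta> \<in> ord 1 2" for \<alpha> \<beta>
    using bs_act_act[OF W r1(1) that(1) zero_ord that(2) zero_ord] by simp
  define r1d where "r1d = BAct W 3 0 [0,2,3] [0] r1"
  have r1d: "r1d \<in> BSmp W 2 0" unfolding r1d_def by (rule bs_act_in[OF W r1(1) _ zero_ord]) simp
  have r1d1: "BAct W 2 0 [0,1] [0] r1d = BAct W 2 0 [0,2] [0] F1" "BAct W 2 0 [1,2] [0] r1d = BAct W 2 0 [1,2] [0] G0"
    using r1e[of "[0,2,3]" "[0,1]"] r1e[of "[0,1,2]" "[0,2]"] r1e[of "[0,2,3]" "[1,2]"] r1e[of "[1,2,3]" "[1,2]"] r1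
    by (simp_all add: r1d_def)
  \<comment> \<open>The tetrahedron stepping up at vertex 0 has the constant triangle
    \<open>D\<close> as its bottom face and meets the middle one in \<open>r1d\<close>.\<close>
  have "\<exists>\<rho>\<in>BSmp W 3 0. BAct W 3 0 [0,1,2] [0] \<rho> = F0 \<and> BAct W 3 0 [1,2,3] [0] \<rho> = D \<and> BAct W 3 0 [0,2,3] [0] \<rho> = r1d"
    by (rule I32[OF v(1) D r1d])
      (use e0[OF F] e0[OF G] e1[OF F] De[of "[0,1]" 1] De[of "[1,2]" 1] bot[OF F] bot[OF G] r1d1 in
        \<open>simp_all add: F0_def F1_def G0_def\<close>)
  then obtain r0 where r0: "r0 \<in> BSmp W 3 0" "BAct W 3 0 [0,1,2] [0] r0 = F0" "BAct W 3 0 [1,2,3] [0] r0 = D" "BAct W 3 0 [0,2,3] [0] r0 = r1d"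
    by blast
  have Gv: "G ([0,1],[0,0]) \<in> BSmp W 1 0" using slice_val(1)[OF G] by simp
  have "BAct W 1 0 [1] [0] (F ([0,1],[0,0])) = BAct W 1 0 [0] [0] (G ([0,1],[0,0]))"
  proof -
    have o: "[0,1] \<in> ord 1 1" "[0,0] \<in> ord 1 1" "[1,1] \<in> ord 1 1" "[1] \<in> ord 0 1" by simp_all
    show ?thesis
      using slice_val(2)[OF F o(1,2,4)] slice_val(2)[OF F o(3,1) zero_ord] slice_val(2)[OF G o(1,2) zero_ord]
        slice_val(2)[OF G o(2,1) zero_ord] mid by (simp add: idl_simps)
  qed
  then obtain t' where t': "t' \<in> BSmp W 2 0" "BAct W 2 0 [0,1] [0] t' = F ([0,1],[0,0])" "BAct W 2 0 [1,2] [0] t' = G ([0,1],[0,0])"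
    using I2[OF Fv(1) Gv] by blast
  \<comment> \<open>The tetrahedron stepping up at vertex 2 meets the middle one in
    \<open>t\<close>; its top face \<open>t'\<close> is any composite of the underlying
    maps.\<close>
  have "\<exists>\<rho>\<in>BSmp W 3 0. BAct W 3 0 [0,1,2] [0] \<rho> = t' \<and> BAct W 3 0 [1,2,3] [0] \<rho> = G1 \<and> BAct W 3 0 [0,1,3] [0] \<rho> = t"
    by (rule I31[OF t'(1) v(4) t(1)]) (use e1[OF G] t t' in \<open>simp_all add: G1_def\<close>)
  then obtain r2 where r2: "r2 \<in> BSmp W 3 0" "BAct W 3 0 [0,1,2] [0] r2 = t'" "BAct W 3 0 [1,2,3] [0] r2 = G1" "BAct W 3 0 [0,1,3] [0] r2 = t"
    by blast
  let ?r = "\<lambda>j::nat. if j = 0 then r0 else if j = 1 then r1 else r2"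
  have S2: "Suc 2 = 3" by simp
  obtain \<Sigma> where sg: "\<Sigma> \<in> prism_maps (row W 0) 2"
    and sv: "\<And>j k \<alpha> \<beta>. j \<le> 2 \<Longrightarrow> \<alpha> \<in> ord k 2 \<Longrightarrow> \<beta> \<in> ord k 1 \<Longrightarrow> on_chain j \<alpha> \<beta> \<Longrightarrow>
      \<Sigma> (\<alpha>, \<beta>) = Act (row W 0) 3 (psum \<alpha> \<beta>) (?r j)"
  proof (rule prism_glue[OF R, of 2 ?r, unfolded S2])
    fix j :: nat assume "j < 2"
    then consider "j = 0" | "j = 1" by linarith
    thus "Act (row W 0) 3 (face 3 (Suc j)) (?r j) = Act (row W 0) 3 (face 3 (Suc j)) (?r (Suc j))"
      using r0 r1 r2 by cases (simp_all add: face_simps idl_simps r1d_def flip: numeral_2_eq_2)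
  qed (use r0 r1 r2 in auto)
  have sv': "\<Sigma> (\<alpha>, \<beta>) = BAct W 3 0 (psum \<alpha> \<beta>) [0] (?r j)"
    if "j \<le> 2" "\<alpha> \<in> ord m 2" "\<beta> \<in> ord m 1" "on_chain j \<alpha> \<beta>" for j m \<alpha> \<beta>
    using sv[OF that] by (simp add: idl_simps)
  have sS: "\<Sigma> \<in> BSmp ?S 2 0" unfolding slice_iff
  proof (intro conjI sg allI ballI)
    fix m \<alpha> assume a: "\<alpha> \<in> ord m 2"
    have ch: "on_chain 0 \<alpha> (const_op m 1)" by (simp add: on_chain_def ord_length[OF a])
    have ln: "length \<alpha> = Suc m" by (rule ord_length[OF a])
    have ps: "psum \<alpha> (const_op m 1) = ocomp [1,2,3] \<alpha>"
    proof (rule nth_equalityI)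
      fix i assume "i < length (psum \<alpha> (const_op m 1))"
      hence i: "i \<le> m" using ln by (simp add: length_psum)
      hence "\<alpha> ! i = 0 \<or> \<alpha> ! i = 1 \<or> \<alpha> ! i = 2" using ord_nth_le[OF a i] by auto
      thus "psum \<alpha> (const_op m 1) ! i = ocomp [1,2,3] \<alpha> ! i" using i ln by (auto simp: nth_psum)
    qed (simp add: ln length_psum)
    have "\<Sigma> (\<alpha>, const_op m 1) = BAct W 2 0 \<alpha> [0] D"
      using sv'[OF _ a _ ch] ps bs_act_act[OF W r0(1) _ zero_ord a zero_ord, of "[1,2,3]"] r0(3) by simp
    thus "\<Sigma> (\<alpha>, const_op m 1) = bdegs W m 0 c" using De[OF a] by simp
  qed
  have SB: "bisimplicial_set ?S" by (rule css_slice_bisimplicial[OF W c])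
  have ev: "BAct ?S 2 0 \<theta> [0] \<Sigma> (\<alpha>, \<beta>) = BAct W 3 0 (psum (ocomp \<theta> \<alpha>) \<beta>) [0] (?r j)"
    if th: "\<theta> \<in> ord 1 2" and a: "\<alpha> \<in> ord 2 1" and b: "\<beta> \<in> ord 2 1" and j: "j \<le> 2" and ch: "on_chain j (ocomp \<theta> \<alpha>) \<beta>" for \<theta> \<alpha> \<beta> j
  proof -
    note oa = ocomp_in_ord[OF th a]
    show ?thesis unfolding slice_act[OF th a b]
      using bs_act_id[OF W slice_val(1)[OF sS oa b]] sv'[OF j oa b ch] by (simp add: idl_simps)
  qed
  have ch: "on_chain 0 [0,0,1] [0,1,1]" "on_chain 1 [0,1,1] [0,0,1]" "on_chain 1 [1,1,2] [0,1,1]" "on_chain 2 [1,2,2] [0,0,1]"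
    by (auto simp: on_chain_def less_Suc_eq numeral_eq_Suc)
  have th: "[0,1] \<in> ord 1 2" "[1,2] \<in> ord 1 2" by simp_all
  have eq1: "BAct ?S 2 0 [0,1] [0] \<Sigma> = F"
  proof (rule prism_maps_eqI)
    show "BAct ?S 2 0 [0,1] [0] \<Sigma> \<in> prism_maps (row W 0) 1" "F \<in> prism_maps (row W 0) 1"
      using bs_act_in[OF SB sS th(1) zero_ord] F by (simp_all add: slice_iff)
    fix j :: nat assume "j \<le> 1"
    then consider "j = 0" | "j = 1" by linarith
    thus "BAct ?S 2 0 [0,1] [0] \<Sigma> (chain_a 1 j, chain_b 1 j) = F (chain_a 1 j, chain_b 1 j)"
      using ev[OF th(1) l, of 0] ev[OF th(1) l(2,1), of 1] ch r0(2) r1(2)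
      by cases (simp_all add: chain_simps F0_def F1_def flip: numeral_2_eq_2)
  qed
  have eq2: "BAct ?S 2 0 [1,2] [0] \<Sigma> = G"
  proof (rule prism_maps_eqI)
    show "BAct ?S 2 0 [1,2] [0] \<Sigma> \<in> prism_maps (row W 0) 1" "G \<in> prism_maps (row W 0) 1"
      using bs_act_in[OF SB sS th(2) zero_ord] G by (simp_all add: slice_iff)
    fix j :: nat assume "j \<le> 1"
    then consider "j = 0" | "j = 1" by linarith
    thus "BAct ?S 2 0 [1,2] [0] \<Sigma> (chain_a 1 j, chain_b 1 j) = G (chain_a 1 j, chain_b 1 j)"
      using ev[OF th(2) l, of 1] ev[OF th(2) l(2,1), of 2] ch r1(3) r2(3)
      by cases (simp_all add: chain_simps G0_def G1_def numeral_eq_Suc)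
  qed
  show ?thesis using sS eq1 eq2 by blast
qed

section \<open>Contractible mapping spaces, final objects and cones\<close>

lemma boundary_0: "boundary 0 = {}"
proof -
  have "0 \<in> set \<alpha>" if a: "\<alpha> \<in> ord m 0" for \<alpha> m
  proof -
    have "\<alpha> ! 0 \<in> set \<alpha>" using ord_length[OF a] by simp
    thus ?thesis using ord_nth_le[OF a, of 0] by simp
  qed
  thus ?thesis unfolding boundary_facets facets_def by auto
qed

lemma contractible_vertex: "contractible X \<Longrightarrow> \<exists>x. x \<in> Smp X 0"
  unfolding contractible_def fills_def partial_simplex_def using boundary_0 by blast

lemma contractible_edge:
  assumes X: "simplicial_set X" and C: "contractible X" and uv: "u \<in> Smp X 0" "v \<in> Smp X 0"
  shows "\<exists>s. edge X s u v"
proof -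
  have "\<exists>z\<in>Smp X 1. \<forall>i\<in>{..1}. Act X 1 (face 1 i) z = (if i = 0 then v else u)"
  proof (rule glue_fill[OF X])
    fix g assume "partial_simplex X 1 (facets 1 {..1}) g"
    thus "\<exists>z. fills X 1 (facets 1 {..1}) g z"
      using C unfolding contractible_def boundary_facets by blast
  qed (use uv in auto)
  then obtain z where z: "z \<in> Smp X 1" "\<And>i. i \<le> 1 \<Longrightarrow> Act X 1 (face 1 i) z = (if i = 0 then v else u)" by auto
  have "edge X z u v" using z(1) z(2)[of 0] z(2)[of 1] by (simp add: edge_def face_simps)
  thus ?thesis by blast
qed

lemma map_space_simplicial:
  assumes B: "bisimplicial_set B" and xy: "x \<in> BSmp B 0 0" "y \<in> BSmp B 0 0"
  shows "simplicial_set (map_space B x y)"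
proof -
  have o: "[0] \<in> ord 0 1" "[1] \<in> ord 0 1" by simp_all
  have e: "BAct B 1 j [i] (idl j) (BAct B 1 l (idl 1) \<gamma> w) = BAct B 0 l (idl 0) \<gamma> (BAct B 1 l [i] (idl l) w)"
    if w: "w \<in> BSmp B 1 l" and g: "\<gamma> \<in> ord j l" and i: "[i] \<in> ord 0 1" for i j l \<gamma> w
    unfolding bs_act_act[OF B w idl_ord g i idl_ord] bs_act_act[OF B w i idl_ord idl_ord g]
    by (simp only: ocomp_idl_left[OF i] ocomp_idl_left[OF g] ocomp_idl_right[OF ord_length[OF g]] ocomp_idl_right[OF ord_length[OF i]])
  show ?thesis unfolding simplicial_set_def map_space_def
    using bs_act_in[OF B _ idl_ord] bs_act_id[OF B] bs_act_act[OF B _ idl_ord _ idl_ord] e[OF _ _ o(1)] e[OF _ _ o(2)]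
      bdegs_act[OF B xy(1) idl_ord] bdegs_act[OF B xy(2) idl_ord] by auto
qed

lemma map_space_vertex:
  assumes B: "bisimplicial_set B" and xy: "x \<in> BSmp B 0 0" "y \<in> BSmp B 0 0"
  shows "w \<in> Smp (map_space B x y) 0 \<longleftrightarrow> css_edge B w x y"
proof -
  have "bdegs B 0 0 z = z" if "z \<in> BSmp B 0 0" for z
    using bs_act_id[OF B that] by (simp add: bdegs_def const_op_simps idl_simps)
  thus ?thesis using xy by (simp add: map_space_def css_edge_def idl_simps)
qed

lemma css_final_edges:
  assumes B: "bisimplicial_set B" and e: "css_final B e" and x: "x \<in> BSmp B 0 0"
  shows "\<exists>w. css_edge B w x e"
    and "css_edge B w x e \<Longrightarrow> css_edge B w' x e \<Longrightarrow> \<exists>s. edge (map_space B x e) s w w'"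
proof -
  have e0: "e \<in> BSmp B 0 0" and C: "contractible (map_space B x e)" using e x by (auto simp: css_final_def)
  show "\<exists>w. css_edge B w x e" using contractible_vertex[OF C] map_space_vertex[OF B x e0] by blast
  show "css_edge B w x e \<Longrightarrow> css_edge B w' x e \<Longrightarrow> \<exists>s. edge (map_space B x e) s w w'"
    using contractible_edge[OF map_space_simplicial[OF B x e0] C] map_space_vertex[OF B x e0] by blast
qed

lemma css_edge_objs: "bisimplicial_set B \<Longrightarrow> css_edge B f x y \<Longrightarrow> x \<in> BSmp B 0 0 \<and> y \<in> BSmp B 0 0"
  using bs_act_in[of B f 1 0 _ 0 "[0]" 0] by (auto simp: css_edge_def)

lemma map_space_map:
  assumes X: "bisimplicial_set X" and f: "bisimplicial_map X Y f" and x: "x \<in> BSmp X 0 0" "y \<in> BSmp X 0 0"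
    and s: "edge (map_space X x y) s u v"
  shows "edge (map_space Y (f 0 0 x) (f 0 0 y)) (f 1 1 s) (f 1 0 u) (f 1 0 v)"
proof -
  have s1: "s \<in> BSmp X 1 1" and s2: "BAct X 1 1 [0] (idl 1) s = bdegs X 0 1 x" "BAct X 1 1 [1] (idl 1) s = bdegs X 0 1 y"
    and s3: "BAct X 1 1 (idl 1) [0] s = u" "BAct X 1 1 (idl 1) [1] s = v"
    using s by (simp_all add: edge_def map_space_def)
  have F: "f n l x \<in> BSmp Y n l" if "x \<in> BSmp X n l" for n l x using f that by (simp add: bisimplicial_map_def)
  have A: "f m j (BAct X n l \<alpha> \<gamma> x) = BAct Y n l \<alpha> \<gamma> (f n l x)" if "x \<in> BSmp X n l" "\<alpha> \<in> ord m n" "\<gamma> \<in> ord j l" for m j n l \<alpha> \<gamma> x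
    using f that by (simp add: bisimplicial_map_def)
  have o: "[0] \<in> ord 0 1" "[1] \<in> ord 0 1" by simp_all
  have d: "f 0 1 (bdegs X 0 1 z) = bdegs Y 0 1 (f 0 0 z)" if "z \<in> BSmp X 0 0" for z
    unfolding bdegs_def by (rule A[OF that]) simp_all
  show ?thesis unfolding edge_def map_space_def
    using F[OF s1] A[OF s1 o(1) idl_ord] A[OF s1 o(2) idl_ord] A[OF s1 idl_ord o(1)] A[OF s1 idl_ord o(2)]
      s2 s3 d[OF x(1)] d[OF x(2)] by simp
qed

lemma cone_iff:
  "x \<in> BSmp (css_cone W a b) n l \<longleftrightarrow> fst x \<in> BSmp (css_slice W a) n l \<and> snd x \<in> BSmp (css_slice W b) n l \<and>
     css_forget n (fst x) = css_forget n (snd x)"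
  by (auto simp: css_cone_def)

lemma cone_act:
  "BAct (css_cone W a b) n l \<theta> \<gamma> x =
     (BAct (css_slice W a) n l \<theta> \<gamma> (fst x), BAct (css_slice W b) n l \<theta> \<gamma> (snd x))"
  by (simp add: css_cone_def split: prod.split)

lemma css_cone_bisimplicial:
  assumes W: "bisimplicial_set W" and a: "a \<in> BSmp W 0 0" and b: "b \<in> BSmp W 0 0"
  shows "bisimplicial_set (css_cone W a b)"
proof -
  note A = css_slice_bisimplicial[OF W a] and B = css_slice_bisimplicial[OF W b]
  show ?thesis unfolding bisimplicial_set_def
  proof (intro conjI allI ballI)
    fix m n j l \<theta> \<gamma> x
    assume t: "\<theta> \<in> ord m n" and g: "\<gamma> \<in> ord j l" and x: "x \<in> BSmp (css_cone W a b) n l"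
    hence x': "fst x \<in> BSmp (css_slice W a) n l" "snd x \<in> BSmp (css_slice W b) n l"
      "css_forget n (fst x) = css_forget n (snd x)" by (simp_all add: cone_iff)
    show "BAct (css_cone W a b) n l \<theta> \<gamma> x \<in> BSmp (css_cone W a b) m j"
      unfolding cone_act cone_iff fst_conv snd_conv css_forget_act[OF W x'(1) t g] css_forget_act[OF W x'(2) t g]
      using bs_act_in[OF A x'(1) t g] bs_act_in[OF B x'(2) t g] x'(3) by simp
  next
    fix n l x assume x: "x \<in> BSmp (css_cone W a b) n l"
    thus "BAct (css_cone W a b) n l (idl n) (idl l) x = x"
      unfolding cone_act cone_iff using bs_act_id[OF A] bs_act_id[OF B] by (simp add: prod_eq_iff)
  next
    fix k m n i j l \<theta> \<theta>' \<gamma> \<gamma>' x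
    assume "\<theta> \<in> ord m n" "\<theta>' \<in> ord k m" "\<gamma> \<in> ord j l" "\<gamma>' \<in> ord i j" "x \<in> BSmp (css_cone W a b) n l"
    thus "BAct (css_cone W a b) m j \<theta>' \<gamma>' (BAct (css_cone W a b) n l \<theta> \<gamma> x) =
      BAct (css_cone W a b) n l (ocomp \<theta> \<theta>') (ocomp \<gamma> \<gamma>') x"
      unfolding cone_act cone_iff using bs_act_act[OF A] bs_act_act[OF B] by simp
  qed
qed

lemma css_forget_map: "bisimplicial_set W \<Longrightarrow> bisimplicial_map (css_slice W c) W (\<lambda>n l. css_forget n)"
  unfolding bisimplicial_map_def by (simp add: css_forget_in css_forget_act)

lemma cone_snd_map: "bisimplicial_map (css_cone W a b) (css_slice W b) (\<lambda>n l. snd)"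
  unfolding bisimplicial_map_def by (simp add: cone_iff cone_act)

section \<open>Products and slice equivalences in a Segal space\<close>

locale segal =
  fixes W :: "'a bsset"
  assumes segal: "segal_space W"
begin

lemmas W = segalD(1)[OF segal]
lemmas I = segal_row_inner3[OF segal]

sublocale hocat "\<lambda>x y f. css_edge W f x y" "qc_composite (row W 0)" "css_id W"
proof -
  have "qc_id (row W 0) = css_id W" by (rule ext) (rule qc_id_row)
  thus "hocat (\<lambda>x y f. css_edge W f x y) (qc_composite (row W 0)) (css_id W)"
    using hocat_sset[OF segal_row_inner3[OF segal]] unfolding edge_row by simp
qed

lemmas edge_objs = css_edge_objs[OF segalD(1)[OF segal]]

lemma hm_edge: "hm x y A \<Longrightarrow> \<exists>f. css_edge W f x y \<and> A = cl f"
  by (simp add: hm_def)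

lemma edge_hm: "css_edge W f x y \<Longrightarrow> hm x y (cl f)"
  by (rule hmI)

lemma T_iff_row:
  "css_edge W f x y \<Longrightarrow> css_edge W g y z \<Longrightarrow> css_edge W h x z \<Longrightarrow>
    qc_composite (row W 0) f g h \<longleftrightarrow> cmp (cl f) (cl g) = cl h"
  by (rule T_iff)

text \<open>A morphism of cones into a product with domain the cone \<open>(f, g)\<close>.\<close>

definition cone_edge :: "'a \<Rightarrow> 'a \<Rightarrow> 'a \<Rightarrow> 'a \<Rightarrow> 'a \<Rightarrow> 'a \<Rightarrow>
    (nat list \<times> nat list \<Rightarrow> 'a) \<Rightarrow> (nat list \<times> nat list \<Rightarrow> 'a) \<Rightarrow> bool" where
  "cone_edge a b f g p q \<phi> \<psi> \<longleftrightarrow>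
    css_edge (css_slice W a) \<phi> (slice_obj W f) (slice_obj W p) \<and>
    css_edge (css_slice W b) \<psi> (slice_obj W g) (slice_obj W q) \<and> css_forget 1 \<phi> = css_forget 1 \<psi>"

lemma cone_obj:
  assumes "css_edge W f x a" "css_edge W g x b"
  shows "(slice_obj W f, slice_obj W g) \<in> BSmp (css_cone W a b) 0 0"
  using slice_obj_in[OF W assms(1)] slice_obj_in[OF W assms(2)] slice_edge_obj(2)[OF W assms(1)]
    slice_edge_obj(2)[OF W assms(2)] by (simp add: cone_iff)

lemma cone_edge_iff:
  "css_edge (css_cone W a b) w (slice_obj W f, slice_obj W g) (slice_obj W p, slice_obj W q) \<longleftrightarrow>
    cone_edge a b f g p q (fst w) (snd w)"
  unfolding css_edge_def cone_edge_def cone_iff cone_act by (auto simp: prod_eq_iff)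

lemma product_lift:
  assumes P: "css_product W P p q a b" and f: "css_edge W f x a" and g: "css_edge W g x b"
  shows "\<exists>\<phi> \<psi>. cone_edge a b f g p q \<phi> \<psi>"
proof -
  have "a \<in> BSmp W 0 0" "b \<in> BSmp W 0 0" using edge_objs f g by auto
  note B = css_cone_bisimplicial[OF W this]
  have "css_final (css_cone W a b) (slice_obj W p, slice_obj W q)" using P by (simp add: css_product_def)
  from css_final_edges(1)[OF B this cone_obj[OF f g]] show ?thesis unfolding cone_edge_iff by blast
qed

text \<open>Contractibility joins the two morphisms of cones by a path in the category of cones;
  projecting to the second slice and then forgetting it gives the two paths.\<close>

lemma product_unique:
  assumes P: "css_product W P p q a b" and f: "css_edge W f x a" and g: "css_edge W g x b"
    and e: "cone_edge a b f g p q \<phi> \<psi>" "cone_edge a b f g p q \<phi>' \<psi>'"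
  shows "\<exists>s. edge (map_space (css_slice W b) (slice_obj W g) (slice_obj W q)) s \<psi> \<psi>'"
    and "\<exists>s. edge (map_space W x P) s (css_forget 1 \<psi>) (css_forget 1 \<psi>')"
proof -
  have ab: "a \<in> BSmp W 0 0" "b \<in> BSmp W 0 0" using edge_objs f g by auto
  note B = css_cone_bisimplicial[OF W ab]
  have pq: "css_edge W p P a" "css_edge W q P b" and F: "css_final (css_cone W a b) (slice_obj W p, slice_obj W q)"
    using P by (simp_all add: css_product_def)
  obtain s where s: "edge (map_space (css_cone W a b) (slice_obj W f, slice_obj W g) (slice_obj W p, slice_obj W q)) s
      (\<phi>, \<psi>) (\<phi>', \<psi>')"
    using css_final_edges(2)[OF B F cone_obj[OF f g], of "(\<phi>, \<psi>)" "(\<phi>', \<psi>')"] e unfolding cone_edge_iff by auto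
  have 1: "edge (map_space (css_slice W b) (slice_obj W g) (slice_obj W q)) (snd s) \<psi> \<psi>'"
    using map_space_map[OF B cone_snd_map cone_obj[OF f g] cone_obj[OF pq] s] by simp
  thus "\<exists>s. edge (map_space (css_slice W b) (slice_obj W g) (slice_obj W q)) s \<psi> \<psi>'" by blast
  have "edge (map_space W x P) (css_forget 1 (snd s)) (css_forget 1 \<psi>) (css_forget 1 \<psi>')"
    using map_space_map[OF css_slice_bisimplicial[OF W ab(2)] css_forget_map[OF W] slice_obj_in[OF W g] slice_obj_in[OF W pq(2)] 1]
      slice_edge_obj(2)[OF W g] slice_edge_obj(2)[OF W pq(2)] by simp
  thus "\<exists>s. edge (map_space W x P) s (css_forget 1 \<psi>) (css_forget 1 \<psi>')" by blast
qed

lemma slice_css_edge: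
  assumes c: "c \<in> BSmp W 0 0" and p: "css_edge (css_slice W c) \<phi> x y"
  shows "css_edge W (css_forget 1 \<phi>) (css_forget 0 x) (css_forget 0 y)"
    "qc_composite (row W 0) (css_forget 1 \<phi>) (slice_edge y) (slice_edge x)"
proof -
  have p1: "\<phi> \<in> BSmp (css_slice W c) 1 0" and xy: "BAct (css_slice W c) 1 0 [0] [0] \<phi> = x" "BAct (css_slice W c) 1 0 [1] [0] \<phi> = y"
    using p by (simp_all add: css_edge_def)
  show "css_edge W (css_forget 1 \<phi>) (css_forget 0 x) (css_forget 0 y)"
    unfolding css_edge_def xy[symmetric]
    using css_forget_in[OF p1] css_forget_act[OF W p1 _ zero_ord, of "[0]" 0] css_forget_act[OF W p1 _ zero_ord, of "[1]" 0] by simp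
  show "qc_composite (row W 0) (css_forget 1 \<phi>) (slice_edge y) (slice_edge x)"
    using slice_edge_composite[OF W I c p1] slice_edge_ends[OF W p1, of 0] slice_edge_ends[OF W p1, of 1] xy by simp
qed

lemma cone_edge_composites:
  assumes f: "css_edge W f x a" and g: "css_edge W g x b" and p: "css_edge W p P a" and q: "css_edge W q P b"
    and e: "cone_edge a b f g p q \<phi> \<psi>"
  shows "css_edge W (css_forget 1 \<psi>) x P" "cmp (cl (css_forget 1 \<psi>)) (cl p) = cl f" "cmp (cl (css_forget 1 \<psi>)) (cl q) = cl g"
proof -
  have ab: "a \<in> BSmp W 0 0" "b \<in> BSmp W 0 0" using edge_objs f g by auto
  have e': "css_edge (css_slice W a) \<phi> (slice_obj W f) (slice_obj W p)"
    "css_edge (css_slice W b) \<psi> (slice_obj W g) (slice_obj W q)" "css_forget 1 \<phi> = css_forget 1 \<psi>"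
    using e by (simp_all add: cone_edge_def)
  note so = slice_edge_obj[OF W f] slice_edge_obj[OF W g] slice_edge_obj[OF W p] slice_edge_obj[OF W q]
  show "css_edge W (css_forget 1 \<psi>) x P" using slice_css_edge(1)[OF ab(2) e'(2)] so by simp
  show "cmp (cl (css_forget 1 \<psi>)) (cl p) = cl f"
    using cmp_cl[OF slice_css_edge(2)[OF ab(1) e'(1)]] so e'(3) by simp
  show "cmp (cl (css_forget 1 \<psi>)) (cl q) = cl g"
    using cmp_cl[OF slice_css_edge(2)[OF ab(2) e'(2)]] so by simp
qed

text \<open>An equality of classes is witnessed by a triangle with \<open>k\<close> itself as first
  edge. The two slice morphisms thus lie over the same map, which is what makes them a morphism of
  cones.\<close>

lemma cone_edge_of_composites:
  assumes k: "css_edge W k x P" and f: "css_edge W f x a" and g: "css_edge W g x b"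
    and p: "css_edge W p P a" and q: "css_edge W q P b"
    and T: "cmp (cl k) (cl p) = cl f" "cmp (cl k) (cl q) = cl g"
  shows "\<exists>\<phi> \<psi>. cone_edge a b f g p q \<phi> \<psi> \<and> css_forget 1 \<psi> = k"
proof -
  have T': "qc_composite (row W 0) k p f" "qc_composite (row W 0) k q g"
    using T_iff_row[OF k p f] T_iff_row[OF k q g] T by blast+
  obtain \<phi> where 1: "\<phi> \<in> BSmp (css_slice W a) 1 0" "css_forget 1 \<phi> = k"
    "BAct (css_slice W a) 1 0 [0] [0] \<phi> = slice_obj W f" "BAct (css_slice W a) 1 0 [1] [0] \<phi> = slice_obj W p"
    by (rule slice_edge_of_composite[OF W k p f T'(1)])
  obtain \<psi> where 2: "\<psi> \<in> BSmp (css_slice W b) 1 0" "css_forget 1 \<psi> = k"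
    "BAct (css_slice W b) 1 0 [0] [0] \<psi> = slice_obj W g" "BAct (css_slice W b) 1 0 [1] [0] \<psi> = slice_obj W q"
    by (rule slice_edge_of_composite[OF W k q g T'(2)])
  show ?thesis unfolding cone_edge_def css_edge_def
    by (rule exI[of _ \<phi>], rule exI[of _ \<psi>]) (use 1 2 in simp)
qed

text \<open>Existence of pairings is nonemptiness of the mapping space into the final cone. For
  uniqueness, two maps with equal components underlie morphisms between the same two cones, and the
  path between these makes the maps homotopic.\<close>

lemma product_hprod:
  assumes P: "css_product W P p q a b"
  shows "hprod P (cl p) (cl q) a b"
  unfolding hprod_def
proof (intro conjI allI impI; (elim conjE)?)
  have pq: "css_edge W p P a" "css_edge W q P b" using P by (simp_all add: css_product_def)
  show "hm P a (cl p)" "hm P b (cl q)" using pq edge_hm by auto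
  show "\<exists>k. hm Z P k \<and> cmp k (cl p) = A \<and> cmp k (cl q) = B" if "hm Z a A" "hm Z b B" for Z A B
  proof -
    obtain f g where f: "css_edge W f Z a" "A = cl f" and g: "css_edge W g Z b" "B = cl g"
      using hm_edge[OF \<open>hm Z a A\<close>] hm_edge[OF \<open>hm Z b B\<close>] by blast
    obtain \<phi> \<psi> where "cone_edge a b f g p q \<phi> \<psi>" using product_lift[OF P f(1) g(1)] by blast
    from cone_edge_composites[OF f(1) g(1) pq this] show ?thesis using f g edge_hm by blast
  qed
  show "K = K'" if K: "hm Z P K" and K': "hm Z P K'"
    and e: "cmp K (cl p) = cmp K' (cl p)" "cmp K (cl q) = cmp K' (cl q)" for Z K K'
  proof -
    obtain k k' where k: "css_edge W k Z P" "K = cl k" and k': "css_edge W k' Z P" "K' = cl k'"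
      using hm_edge[OF K] hm_edge[OF K'] by blast
    obtain f where f: "css_edge W f Z a" "cmp K (cl p) = cl f" using hm_edge[OF hm_cmp[OF K edge_hm[OF pq(1)]]] by blast
    obtain g where g: "css_edge W g Z b" "cmp K (cl q) = cl g" using hm_edge[OF hm_cmp[OF K edge_hm[OF pq(2)]]] by blast
    obtain \<phi> \<psi> where 1: "cone_edge a b f g p q \<phi> \<psi>" "css_forget 1 \<psi> = k"
      using cone_edge_of_composites[OF k(1) f(1) g(1) pq] f g k by auto
    obtain \<phi>' \<psi>' where 2: "cone_edge a b f g p q \<phi>' \<psi>'" "css_forget 1 \<psi>' = k'"
      using cone_edge_of_composites[OF k'(1) f(1) g(1) pq] f g k' e by auto
    obtain s where s: "edge (map_space W Z P) s k k'"
      using product_unique(2)[OF P f(1) g(1) 1(1) 2(1)] 1 2 by auto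
    have "eqv k k'"
      using map_space_homotopic[OF segal k(1) s] k(1) eqv_iff[OF k(1)] by simp
    thus ?thesis using cl_eq_iff[OF k(1)] k k' by simp
  qed
qed

lemma css_equiv_hiso:
  assumes "css_equiv W f" "css_edge W f x y"
  shows "hiso x y (cl f)"
proof -
  obtain x' y' g h where o: "css_edge W f x' y'" "css_edge W g y' x'" "css_edge W h y' x'"
    "qc_composite (row W 0) f g (css_id W x')" "qc_composite (row W 0) h f (css_id W y')"
    by (rule css_equiv_row[OF segal assms(1)])
  have "x' = x" "y' = y" using o(1) assms(2) by (auto simp: css_edge_def)
  thus ?thesis using hiso_left_right[OF edge_hm[OF o(1)] edge_hm[OF o(2)] edge_hm[OF o(3)]]
      cmp_cl[OF o(4)] cmp_cl[OF o(5)] by (simp add: hid_def)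
qed

lemma css_id_slice:
  assumes c: "c \<in> BSmp W 0 0" and z: "z \<in> BSmp (css_slice W c) 0 0"
  shows "css_edge (css_slice W c) (css_id (css_slice W c) z) z z"
    "css_forget 1 (css_id (css_slice W c) z) = css_id W (css_forget 0 z)"
proof -
  note S = css_slice_bisimplicial[OF W c]
  have e: "css_edge B (css_id B z) z z" if "bisimplicial_set B" "z \<in> BSmp B 0 0" for B :: "'x bsset" and z
    unfolding css_edge_def css_id_def bdegs_def
    using bs_act_in[OF that, of "const_op 1 0" 1 "const_op 0 0" 0] bs_act_id[OF that]
      bs_act_act[OF that, of "const_op 1 0" 1 "const_op 0 0" 0 "[0]" 0 "[0]" 0]
      bs_act_act[OF that, of "const_op 1 0" 1 "const_op 0 0" 0 "[1]" 0 "[0]" 0] by (simp add: const_op_simps idl_simps)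
  show "css_edge (css_slice W c) (css_id (css_slice W c) z) z z" by (rule e[OF S z])
  show "css_forget 1 (css_id (css_slice W c) z) = css_id W (css_forget 0 z)"
    unfolding css_id_def bdegs_def by (rule css_forget_act[OF W z]) simp_all
qed

text \<open>The composite \<open>K\<close> of \<open>F\<close> and \<open>G\<close> must be joined
  to the identity inside the slice, not only in \<open>W\<close>. As \<open>K\<close> commutes with
  the other projection \<open>p\<close>, both \<open>K\<close> and the identity extend to
  endomorphisms of the product cone, and finality of that cone gives the path over
  \<open>c\<close>.\<close>

lemma slice_composite_id:
  assumes P: "css_product W P p (slice_edge z) a c" and z: "z \<in> BSmp (css_slice W c) 0 0" "css_forget 0 z = P"
    and F: "css_edge (css_slice W c) F z z'" and G: "css_edge (css_slice W c) G z' z"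
    and e: "cmp (cmp (cl (css_forget 1 F)) (cl (css_forget 1 G))) (cl p) = cl p"
  shows "css_composite (css_slice W c) F G (css_id (css_slice W c) z)"
proof -
  let ?S = "css_slice W c"
  have p: "css_edge W p P a" and q: "css_edge W (slice_edge z) P c" using P by (simp_all add: css_product_def)
  have c: "c \<in> BSmp W 0 0" using edge_objs q by blast
  note S = css_slice_bisimplicial[OF W c]
  have zo: "slice_obj W (slice_edge z) = z" by (rule slice_edge_css(2)[OF W c z(1)])
  have F1: "F \<in> BSmp ?S 1 0" and G1: "G \<in> BSmp ?S 1 0"
    and FG: "BAct ?S 1 0 [0] [0] F = z" "BAct ?S 1 0 [1] [0] F = z'" "BAct ?S 1 0 [0] [0] G = z'" "BAct ?S 1 0 [1] [0] G = z"
    using F G by (simp_all add: css_edge_def)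
  obtain \<Sigma> where s: "\<Sigma> \<in> BSmp ?S 2 0" "BAct ?S 2 0 [0,1] [0] \<Sigma> = F" "BAct ?S 2 0 [1,2] [0] \<Sigma> = G"
    using slice_composite_exists[OF W I c F1 G1] FG by auto
  define K where "K = BAct ?S 2 0 [0,2] [0] \<Sigma>"
  have ver: "BAct ?S 2 0 [0] [0] \<Sigma> = z" "BAct ?S 2 0 [2] [0] \<Sigma> = z"
    using bs_act_act[OF S s(1) _ zero_ord _ zero_ord, of "[0,1]" 1 "[0]" 0]
      bs_act_act[OF S s(1) _ zero_ord _ zero_ord, of "[1,2]" 1 "[1]" 0] s FG by simp_all
  have K: "css_edge ?S K z z" unfolding css_edge_def K_def
    using bs_act_in[OF S s(1) _ zero_ord, of "[0,2]" 1] ver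
      bs_act_act[OF S s(1) _ zero_ord _ zero_ord, of "[0,2]" 1 "[0]" 0]
      bs_act_act[OF S s(1) _ zero_ord _ zero_ord, of "[0,2]" 1 "[1]" 0] by simp
  have fs: "css_forget 2 \<Sigma> \<in> BSmp W 2 0" by (rule css_forget_in[OF s(1)])
  have "qc_composite (row W 0) (css_forget 1 F) (css_forget 1 G) (css_forget 1 K)"
    unfolding qc_composite_row
    by (rule bexI[OF _ fs])
      (use css_forget_act[OF W s(1) _ zero_ord, of "[0,1]" 1] css_forget_act[OF W s(1) _ zero_ord, of "[1,2]" 1]
        css_forget_act[OF W s(1) _ zero_ord, of "[0,2]" 1] s K_def in simp)
  hence Kp: "cmp (cl (css_forget 1 K)) (cl p) = cl p" using cmp_cl e by simp
  have Ke: "css_edge W (css_forget 1 K) P P" using slice_css_edge(1)[OF c K] z by simp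
  have lift: "\<exists>\<phi>. cone_edge a c p (slice_edge z) p (slice_edge z) \<phi> L"
    if L: "css_edge ?S L z z" "cmp (cl (css_forget 1 L)) (cl p) = cl p" for L
  proof -
    have Le: "css_edge W (css_forget 1 L) P P" using slice_css_edge(1)[OF c L(1)] z by simp
    have T: "qc_composite (row W 0) (css_forget 1 L) p p" using T_iff_row[OF Le p p] L(2) by blast
    obtain \<phi> where "\<phi> \<in> BSmp (css_slice W a) 1 0" "css_forget 1 \<phi> = css_forget 1 L"
      "BAct (css_slice W a) 1 0 [0] [0] \<phi> = slice_obj W p" "BAct (css_slice W a) 1 0 [1] [0] \<phi> = slice_obj W p"
      by (rule slice_edge_of_composite[OF W Le p p T])
    thus ?thesis using L(1) zo unfolding cone_edge_def css_edge_def[of "css_slice W a"] by auto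
  qed
  note idz = css_id_slice[OF c z(1)]
  have "cmp (cl (css_forget 1 (css_id ?S z))) (cl p) = cl p"
    unfolding idz(2) z(2) using cmp_id(1)[OF edge_hm[OF p]] by (simp add: hid_def)
  then obtain \<phi>' where 2: "cone_edge a c p (slice_edge z) p (slice_edge z) \<phi>' (css_id ?S z)" using lift[OF idz(1)] by blast
  obtain \<phi> where 1: "cone_edge a c p (slice_edge z) p (slice_edge z) \<phi> K" using lift[OF K Kp] by blast
  obtain t where "edge (map_space ?S z z) t K (css_id ?S z)" using product_unique(1)[OF P p q 1 2] zo by auto
  thus ?thesis unfolding css_composite_def
    by (intro bexI[OF _ s(1)] conjI s(2,3) exI[of _ t]) (simp only: ver K_def)
qed

text \<open>The inverse is induced by the universal property of \<open>P\<close>: its components are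
  a representative of \<open>A\<close> and the structure map of \<open>z'\<close>. Both composites
  with \<open>F\<close> then preserve the first projections.\<close>

lemma slice_equiv:
  assumes P: "css_product W P p (slice_edge z) a c" and z: "z \<in> BSmp (css_slice W c) 0 0" "css_forget 0 z = P"
    and P': "css_product W P' p' (slice_edge z') b c" and z': "z' \<in> BSmp (css_slice W c) 0 0" "css_forget 0 z' = P'"
    and F: "css_edge (css_slice W c) F z z'" and f: "hm a b f" and Fp: "cmp (cl (css_forget 1 F)) (cl p') = cmp (cl p) f"
    and A: "hm P' a A" "cmp A f = cl p'" "cmp (cl (css_forget 1 F)) A = cl p"
  shows "css_equiv (css_slice W c) F"
proof -
  let ?S = "css_slice W c"
  have p: "css_edge W p P a" and q: "css_edge W (slice_edge z) P c" using P by (simp_all add: css_product_def)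
  have p': "css_edge W p' P' b" and q': "css_edge W (slice_edge z') P' c" using P' by (simp_all add: css_product_def)
  have c: "c \<in> BSmp W 0 0" using edge_objs q by blast
  have zo: "slice_obj W (slice_edge z) = z" "slice_obj W (slice_edge z') = z'"
    using slice_edge_css(2)[OF W c] z z' by auto
  obtain h where h: "css_edge W h P' a" "A = cl h" using hm_edge[OF A(1)] by blast
  obtain \<phi> G where g: "cone_edge a c h (slice_edge z') p (slice_edge z) \<phi> G" using product_lift[OF P h(1) q'] by blast
  note gc = cone_edge_composites[OF h(1) q' p q g]
  have G: "css_edge ?S G z' z" using g zo by (simp add: cone_edge_def)
  have Fe: "css_edge W (css_forget 1 F) P P'" using slice_css_edge(1)[OF c F] z z' by simp
  note hms = edge_hm[OF Fe] edge_hm[OF gc(1)] edge_hm[OF p] edge_hm[OF p']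
  have "cmp (cmp (cl (css_forget 1 F)) (cl (css_forget 1 G))) (cl p) = cl p"
    using cmp_assoc[OF hms(1,2,3)] gc(2) h(2) A(3) by simp
  from slice_composite_id[OF P z F G this] have 1: "css_composite ?S F G (css_id ?S z)" .
  have "cmp (cmp (cl (css_forget 1 G)) (cl (css_forget 1 F))) (cl p') = cmp (cmp (cl (css_forget 1 G)) (cl p)) f"
    using cmp_assoc[OF hms(2,1,4)] cmp_assoc[OF hms(2,3) f] Fp by simp
  also have "\<dots> = cl p'" using gc(2) h(2) A(2) by simp
  finally have 2: "css_composite ?S G F (css_id ?S z')" by (rule slice_composite_id[OF P' z' G F])
  show ?thesis unfolding css_equiv_def using F G 1 2 by blast
qed

end

section \<open>Filtered colimits and filters\<close>

locale directed =
  fixes I :: "'i set" and le :: "'i \<Rightarrow> 'i \<Rightarrow> bool"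
  assumes le_refl: "i \<in> I \<Longrightarrow> le i i"
    and le_trans: "i \<in> I \<Longrightarrow> j \<in> I \<Longrightarrow> k \<in> I \<Longrightarrow> le i j \<Longrightarrow> le j k \<Longrightarrow> le i k"
    and dir: "i \<in> I \<Longrightarrow> j \<in> I \<Longrightarrow> \<exists>k\<in>I. le k i \<and> le k j"
begin

text \<open>Truth at all sufficiently small indices. Equations between representatives persist under
  the transition maps, so finitely many of them can be realized at one stage by
  \<open>evt_conj\<close>.\<close>

definition evt :: "('i \<Rightarrow> bool) \<Rightarrow> bool" where
  "evt P \<longleftrightarrow> (\<exists>w\<in>I. \<forall>w'\<in>I. le w' w \<longrightarrow> P w')"

lemma evt_conj: "evt P \<Longrightarrow> evt Q \<Longrightarrow> evt (\<lambda>w. P w \<and> Q w)"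
proof -
  assume "evt P" "evt Q"
  then obtain u v where u: "u \<in> I" "\<And>w. w \<in> I \<Longrightarrow> le w u \<Longrightarrow> P w" and v: "v \<in> I" "\<And>w. w \<in> I \<Longrightarrow> le w v \<Longrightarrow> Q w"
    unfolding evt_def by blast
  obtain x where x: "x \<in> I" "le x u" "le x v" using dir[OF u(1) v(1)] by blast
  have "P w \<and> Q w" if w: "w \<in> I" "le w x" for w
    using u(2)[OF w(1) le_trans[OF w(1) x(1) u(1) w(2) x(2)]] v(2)[OF w(1) le_trans[OF w(1) x(1) v(1) w(2) x(3)]] by simp
  thus "evt (\<lambda>w. P w \<and> Q w)" unfolding evt_def using x(1) by blast
qed

lemma evt_ex: "evt P \<Longrightarrow> \<exists>w\<in>I. P w"
  unfolding evt_def using le_refl by blast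

lemma evt_le: "v \<in> I \<Longrightarrow> evt (\<lambda>w. le w v)"
  unfolding evt_def by blast

end

locale dirsys = directed I le for I :: "'i set" and le +
  fixes D :: "'i \<Rightarrow> 'a set" and t :: "'i \<Rightarrow> 'i \<Rightarrow> 'a \<Rightarrow> 'a"
  assumes t_in: "v \<in> I \<Longrightarrow> w \<in> I \<Longrightarrow> le w v \<Longrightarrow> a \<in> D v \<Longrightarrow> t v w a \<in> D w"
    and t_id: "v \<in> I \<Longrightarrow> a \<in> D v \<Longrightarrow> t v v a = a"
    and t_comp: "v \<in> I \<Longrightarrow> w \<in> I \<Longrightarrow> x \<in> I \<Longrightarrow> le w v \<Longrightarrow> le x w \<Longrightarrow> a \<in> D v \<Longrightarrow> t w x (t v w a) = t v x a"
begin

abbreviation cls :: "'i \<Rightarrow> 'a \<Rightarrow> ('i \<times> 'a) set" where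
  "cls \<equiv> colim_class I le D t"

lemma later_eq:
  assumes "v \<in> I" "u \<in> I" "w \<in> I" "x \<in> I" "le w v" "le w u" "le x w" "a \<in> D v" "b \<in> D u" "t v w a = t u w b"
  shows "t v x a = t u x b"
  using t_comp[OF assms(1,3,4,5,7,8)] t_comp[OF assms(2,3,4,6,7,9)] assms(10) by simp

lemma cls_self: "v \<in> I \<Longrightarrow> a \<in> D v \<Longrightarrow> (v, a) \<in> cls v a"
  unfolding colim_class_def using le_refl by blast

lemma cls_mem_sym: "v \<in> I \<Longrightarrow> a \<in> D v \<Longrightarrow> (u, b) \<in> cls v a \<Longrightarrow> u \<in> I \<and> b \<in> D u \<and> (v, a) \<in> cls u b"
  unfolding colim_class_def by auto

lemma cls_mem_subset:
  assumes v: "v \<in> I" "a \<in> D v" and m: "(u, b) \<in> cls v a"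
  shows "cls u b \<subseteq> cls v a"
proof
  obtain w where u: "u \<in> I" "b \<in> D u" and w: "w \<in> I" "le w v" "le w u" "t v w a = t u w b"
    using m unfolding colim_class_def by blast
  fix p assume "p \<in> cls u b"
  then obtain u' b' w' where p: "p = (u', b')" "u' \<in> I" "b' \<in> D u'" and w': "w' \<in> I" "le w' u" "le w' u'" "t u w' b = t u' w' b'"
    unfolding colim_class_def by blast
  obtain x where x: "x \<in> I" "le x w" "le x w'" using dir[OF w(1) w'(1)] by blast
  have "t v x a = t u x b" by (rule later_eq[OF v(1) u(1) w(1) x(1) w(2,3) x(2) v(2) u(2) w(4)])
  also have "\<dots> = t u' x b'" by (rule later_eq[OF u(1) p(2) w'(1) x(1) w'(2,3) x(3) u(2) p(3) w'(4)])
  finally have "t v x a = t u' x b'" .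
  moreover have "le x v" "le x u'" using le_trans[OF x(1) w(1) v(1) x(2) w(2)] le_trans[OF x(1) w'(1) p(2) x(3) w'(3)] by auto
  ultimately show "p \<in> cls v a" unfolding p(1) colim_class_def using p x(1) by blast
qed

lemma cls_mem_eq:
  assumes v: "v \<in> I" "a \<in> D v" and m: "(u, b) \<in> cls v a"
  shows "cls u b = cls v a"
  using cls_mem_subset[OF v m] cls_mem_sym[OF v m] cls_mem_subset[of u b v a] by blast

lemma cls_eqD:
  assumes v: "v \<in> I" "a \<in> D v" and u: "u \<in> I" "b \<in> D u" and e: "cls v a = cls u b"
  shows "evt (\<lambda>w. le w v \<and> le w u \<and> t v w a = t u w b)"
proof -
  have "(u, b) \<in> cls v a" using cls_self[OF u] e by simp
  then obtain w where w: "w \<in> I" "le w v" "le w u" "t v w a = t u w b" unfolding colim_class_def by blast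
  have "le x v \<and> le x u \<and> t v x a = t u x b" if x: "x \<in> I" "le x w" for x
    using later_eq[OF v(1) u(1) w(1) x(1) w(2,3) x(2) v(2) u(2) w(4)] le_trans[OF x(1) w(1) v(1) x(2) w(2)]
      le_trans[OF x(1) w(1) u(1) x(2) w(3)] by simp
  thus ?thesis unfolding evt_def using w(1) by blast
qed

lemma cls_eqI:
  assumes v: "v \<in> I" "a \<in> D v" and u: "u \<in> I" "b \<in> D u" and w: "w \<in> I" "le w v" "le w u" "t v w a = t u w b"
  shows "cls v a = cls u b"
proof -
  have "(u, b) \<in> cls v a" unfolding colim_class_def using u w by blast
  thus ?thesis using cls_mem_eq[OF v] by simp
qed

lemma cls_restrict:
  assumes v: "v \<in> I" "a \<in> D v" and w: "w \<in> I" "le w v"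
  shows "cls w (t v w a) = cls v a"
  by (rule cls_eqI[OF w(1) t_in[OF v(1) w v(2)] v w(1) le_refl[OF w(1)] w(2) t_id[OF w(1) t_in[OF v(1) w v(2)]]])

end

locale dir_sset = directed I le for I :: "'i set" and le +
  fixes D :: "'i \<Rightarrow> 'a sset" and t :: "'i \<Rightarrow> 'i \<Rightarrow> nat \<Rightarrow> 'a \<Rightarrow> 'a"
  assumes D_sset: "v \<in> I \<Longrightarrow> simplicial_set (D v)"
    and t_map: "v \<in> I \<Longrightarrow> w \<in> I \<Longrightarrow> le w v \<Longrightarrow> simplicial_map (D v) (D w) (t v w)"
    and t_id: "v \<in> I \<Longrightarrow> a \<in> Smp (D v) n \<Longrightarrow> t v v n a = a"
    and t_comp: "v \<in> I \<Longrightarrow> w \<in> I \<Longrightarrow> x \<in> I \<Longrightarrow> le w v \<Longrightarrow> le x w \<Longrightarrow> a \<in> Smp (D v) n \<Longrightarrow> t w x n (t v w n a) = t v x n a"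
begin

lemma dirsys_level: "dirsys I le (\<lambda>v. Smp (D v) n) (\<lambda>v w. t v w n)"
  by unfold_locales (auto intro: t_id t_comp simplicial_map_in[OF t_map])

abbreviation cln :: "nat \<Rightarrow> 'i \<Rightarrow> 'a \<Rightarrow> ('i \<times> 'a) set" where
  "cln n \<equiv> colim_class I le (\<lambda>v. Smp (D v) n) (\<lambda>v w. t v w n)"

abbreviation Q :: "('i \<times> 'a) set sset" where
  "Q \<equiv> colim_sset I le D t"

lemma Q_Smp: "x \<in> Smp Q n \<longleftrightarrow> (\<exists>v a. v \<in> I \<and> a \<in> Smp (D v) n \<and> x = cln n v a)"
  by (auto simp: colim_sset_def Let_def)

text \<open>The action on the colimit picks a representative by \<open>SOME\<close>. Any two
  representatives agree at a common stage, and the transition maps commute with the action.\<close>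

lemma cln_act:
  assumes v: "v \<in> I" "a \<in> Smp (D v) n" and al: "\<alpha> \<in> ord m n"
  shows "Act Q n \<alpha> (cln n v a) = cln m v (Act (D v) n \<alpha> a)"
proof -
  obtain u b where ub: "(SOME p. p \<in> cln n v a) = (u, b)" by (cases "SOME p. p \<in> cln n v a")
  have "(SOME p. p \<in> cln n v a) \<in> cln n v a"
    by (rule someI[of "\<lambda>p. p \<in> cln n v a", OF dirsys.cls_self[OF dirsys_level v]])
  hence "(u, b) \<in> cln n v a" unfolding ub .
  then obtain w where u: "u \<in> I" "b \<in> Smp (D u) n" and w: "w \<in> I" "le w v" "le w u" "t v w n a = t u w n b"
    unfolding colim_class_def by blast
  have "t v w m (Act (D v) n \<alpha> a) = t u w m (Act (D u) n \<alpha> b)"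
    using simplicial_map_act[OF t_map[OF v(1) w(1,2)] v(2) al] simplicial_map_act[OF t_map[OF u(1) w(1,3)] u(2) al] w(4) by simp
  hence "cln m v (Act (D v) n \<alpha> a) = cln m u (Act (D u) n \<alpha> b)"
    by (rule dirsys.cls_eqI[OF dirsys_level v(1) sset_act_in[OF D_sset[OF v(1)] v(2) al] u(1)
          sset_act_in[OF D_sset[OF u(1)] u(2) al] w(1-3)])
  thus ?thesis by (simp add: colim_sset_def Let_def ub ord_length[OF al])
qed

lemma cln_map:
  assumes v: "v \<in> I"
  shows "simplicial_map (D v) Q (\<lambda>n. cln n v)"
  unfolding simplicial_map_def
proof (intro conjI allI ballI)
  show "cln n v x \<in> Smp Q n" if "x \<in> Smp (D v) n" for n x unfolding Q_Smp using v that by blast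
  show "cln m v (Act (D v) n \<alpha> x) = Act Q n \<alpha> (cln n v x)" if "\<alpha> \<in> ord m n" "x \<in> Smp (D v) n" for m n \<alpha> x
    by (rule cln_act[OF v that(2,1), symmetric])
qed

end

locale dir_bsset = directed I le for I :: "'i set" and le +
  fixes D :: "'i \<Rightarrow> 'a bsset" and t :: "'i \<Rightarrow> 'i \<Rightarrow> nat \<Rightarrow> nat \<Rightarrow> 'a \<Rightarrow> 'a"
  assumes D_bsset: "v \<in> I \<Longrightarrow> bisimplicial_set (D v)"
    and t_map: "v \<in> I \<Longrightarrow> w \<in> I \<Longrightarrow> le w v \<Longrightarrow> bisimplicial_map (D v) (D w) (t v w)"
    and t_id: "v \<in> I \<Longrightarrow> a \<in> BSmp (D v) n l \<Longrightarrow> t v v n l a = a"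
    and t_comp: "v \<in> I \<Longrightarrow> w \<in> I \<Longrightarrow> x \<in> I \<Longrightarrow> le w v \<Longrightarrow> le x w \<Longrightarrow> a \<in> BSmp (D v) n l \<Longrightarrow>
      t w x n l (t v w n l a) = t v x n l a"
begin

lemma t_in: "v \<in> I \<Longrightarrow> w \<in> I \<Longrightarrow> le w v \<Longrightarrow> a \<in> BSmp (D v) n l \<Longrightarrow> t v w n l a \<in> BSmp (D w) n l"
  using t_map unfolding bisimplicial_map_def by blast

lemma t_act: "v \<in> I \<Longrightarrow> w \<in> I \<Longrightarrow> le w v \<Longrightarrow> a \<in> BSmp (D v) n l \<Longrightarrow> \<alpha> \<in> ord m n \<Longrightarrow> \<gamma> \<in> ord j l \<Longrightarrow>
    t v w m j (BAct (D v) n l \<alpha> \<gamma> a) = BAct (D w) n l \<alpha> \<gamma> (t v w n l a)"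
  using t_map unfolding bisimplicial_map_def by blast

lemma dirsys_level: "dirsys I le (\<lambda>v. BSmp (D v) n l) (\<lambda>v w. t v w n l)"
  by unfold_locales (auto intro: t_id t_comp t_in)

abbreviation cln :: "nat \<Rightarrow> nat \<Rightarrow> 'i \<Rightarrow> 'a \<Rightarrow> ('i \<times> 'a) set" where
  "cln n l \<equiv> colim_class I le (\<lambda>v. BSmp (D v) n l) (\<lambda>v w. t v w n l)"

abbreviation Q :: "('i \<times> 'a) set bsset" where
  "Q \<equiv> colim_bsset I le D t"

lemma Q_Smp: "x \<in> BSmp Q n l \<longleftrightarrow> (\<exists>v a. v \<in> I \<and> a \<in> BSmp (D v) n l \<and> x = cln n l v a)"
  by (auto simp: colim_bsset_def Let_def)

lemma cln_act:
  assumes v: "v \<in> I" "a \<in> BSmp (D v) n l" and al: "\<alpha> \<in> ord m n" and ga: "\<gamma> \<in> ord j l"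
  shows "BAct Q n l \<alpha> \<gamma> (cln n l v a) = cln m j v (BAct (D v) n l \<alpha> \<gamma> a)"
proof -
  obtain u b where ub: "(SOME p. p \<in> cln n l v a) = (u, b)" by (cases "SOME p. p \<in> cln n l v a")
  have "(SOME p. p \<in> cln n l v a) \<in> cln n l v a"
    by (rule someI[of "\<lambda>p. p \<in> cln n l v a", OF dirsys.cls_self[OF dirsys_level v]])
  hence "(u, b) \<in> cln n l v a" unfolding ub .
  then obtain w where u: "u \<in> I" "b \<in> BSmp (D u) n l" and w: "w \<in> I" "le w v" "le w u" "t v w n l a = t u w n l b"
    unfolding colim_class_def by blast
  have "t v w m j (BAct (D v) n l \<alpha> \<gamma> a) = t u w m j (BAct (D u) n l \<alpha> \<gamma> b)"
    using t_act[OF v(1) w(1,2) v(2) al ga] t_act[OF u(1) w(1,3) u(2) al ga] w(4) by simp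
  hence "cln m j v (BAct (D v) n l \<alpha> \<gamma> a) = cln m j u (BAct (D u) n l \<alpha> \<gamma> b)"
    by (rule dirsys.cls_eqI[OF dirsys_level v(1) bs_act_in[OF D_bsset[OF v(1)] v(2) al ga] u(1)
          bs_act_in[OF D_bsset[OF u(1)] u(2) al ga] w(1-3)])
  thus ?thesis by (simp add: colim_bsset_def Let_def ub ord_length[OF al] ord_length[OF ga])
qed

lemma cln_map:
  assumes v: "v \<in> I"
  shows "bisimplicial_map (D v) Q (\<lambda>n l. cln n l v)"
  unfolding bisimplicial_map_def
proof (intro conjI allI ballI)
  show "cln n l v x \<in> BSmp Q n l" if "x \<in> BSmp (D v) n l" for n l x unfolding Q_Smp using v that by blast
  show "cln m j v (BAct (D v) n l \<alpha> \<gamma> x) = BAct Q n l \<alpha> \<gamma> (cln n l v x)"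
    if "\<alpha> \<in> ord m n" "\<gamma> \<in> ord j l" "x \<in> BSmp (D v) n l" for m n j l \<alpha> \<gamma> x
    by (rule cln_act[OF v that(3,1,2), symmetric])
qed

end

section \<open>Equivalences under maps and at stages of a colimit\<close>

lemma simplicial_map_qc_equiv:
  assumes f: "simplicial_map X Y f" and X: "simplicial_set X" and e: "qc_equiv X a"
  shows "qc_equiv Y (f 1 a)"
proof -
  obtain x y g where g: "edge X a x y" "edge X g y x" "qc_composite X a g (qc_id X x)" "qc_composite X g a (qc_id X y)"
    using e unfolding qc_equiv_def by blast
  have xy: "x \<in> Smp X 0" "y \<in> Smp X 0" using g(1) sset_act_in[OF X, of a 1 _ 0] by (auto simp: edge_def)
  show ?thesis unfolding qc_equiv_def
    using simplicial_map_edge[OF f g(1)] simplicial_map_edge[OF f g(2)]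
      simplicial_map_composite[OF f g(3)] simplicial_map_composite[OF f g(4)]
      simplicial_map_id[OF f xy(1)] simplicial_map_id[OF f xy(2)] by auto
qed

lemma bisimplicial_map_css_equiv:
  assumes f: "bisimplicial_map X Y f" and X: "bisimplicial_set X" and e: "css_equiv X a"
  shows "css_equiv Y (f 1 0 a)"
proof -
  have F: "f n l x \<in> BSmp Y n l" if "x \<in> BSmp X n l" for n l x using f that by (simp add: bisimplicial_map_def)
  have A: "f m j (BAct X n l \<alpha> \<gamma> x) = BAct Y n l \<alpha> \<gamma> (f n l x)" if "x \<in> BSmp X n l" "\<alpha> \<in> ord m n" "\<gamma> \<in> ord j l" for m j n l \<alpha> \<gamma> x
    using f that by (simp add: bisimplicial_map_def)
  have E: "css_edge Y (f 1 0 h) (f 0 0 x) (f 0 0 y)" if "css_edge X h x y" for h x y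
    using that F[of h 1 0] A[of h 1 0 "[0]" 0 "[0]" 0] A[of h 1 0 "[1]" 0 "[0]" 0] by (auto simp: css_edge_def)
  have C: "css_composite Y (f 1 0 g) (f 1 0 h) (f 1 0 k)" if c: "css_composite X g h k" for g h k
  proof -
    obtain \<sigma> s where s: "\<sigma> \<in> BSmp X 2 0" "BAct X 2 0 [0,1] [0] \<sigma> = g" "BAct X 2 0 [1,2] [0] \<sigma> = h"
      and e: "edge (map_space X (BAct X 2 0 [0] [0] \<sigma>) (BAct X 2 0 [2] [0] \<sigma>)) s (BAct X 2 0 [0,2] [0] \<sigma>) k"
      using c unfolding css_composite_def by blast
    have v: "BAct X 2 0 [0] [0] \<sigma> \<in> BSmp X 0 0" "BAct X 2 0 [2] [0] \<sigma> \<in> BSmp X 0 0"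
      by (rule bs_act_in[OF X s(1) _ zero_ord], simp)+
    have a: "f m 0 (BAct X 2 0 \<alpha> [0] \<sigma>) = BAct Y 2 0 \<alpha> [0] (f 2 0 \<sigma>)" if "\<alpha> \<in> ord m 2" for m \<alpha>
      by (rule A[OF s(1) that zero_ord])
    show ?thesis unfolding css_composite_def
      using F[OF s(1)] a[of "[0,1]" 1] a[of "[1,2]" 1] a[of "[0,2]" 1] a[of "[0]" 0] a[of "[2]" 0] s(2,3) map_space_map[OF X f v e]
      by (intro bexI[of _ "f 2 0 \<sigma>"]) auto
  qed
  obtain x y g h where g: "css_edge X a x y" "css_edge X g y x" "css_edge X h y x"
    "css_composite X a g (css_id X x)" "css_composite X h a (css_id X y)"
    using e unfolding css_equiv_def by blast
  have i: "f 1 0 (css_id X z) = css_id Y (f 0 0 z)" if "z \<in> BSmp X 0 0" for z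
    unfolding css_id_def bdegs_def by (rule A[OF that]) simp_all
  have xy: "x \<in> BSmp X 0 0" "y \<in> BSmp X 0 0" using css_edge_objs[OF X g(1)] by auto
  show ?thesis unfolding css_equiv_def
    using E[OF g(1)] E[OF g(2)] E[OF g(3)] C[OF g(4)] C[OF g(5)] i[OF xy(1)] i[OF xy(2)] by auto
qed

text \<open>An inverse and the two triangles are three simplices of the colimit. Representatives are
  brought to a common stage \<open>u\<close>, where the required equations between their faces hold
  in the colimit and therefore at all small enough stages.\<close>

lemma (in dir_sset) qc_equiv_stage:
  assumes v: "v \<in> I" "a \<in> Smp (D v) 1" and e: "qc_equiv Q (cln 1 v a)"
  shows "\<exists>w\<in>I. le w v \<and> qc_equiv (D w) (t v w 1 a)"
proof -
  obtain x y g where g: "edge Q (cln 1 v a) x y" "edge Q g y x"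
    "qc_composite Q (cln 1 v a) g (qc_id Q x)" "qc_composite Q g (cln 1 v a) (qc_id Q y)"
    using e unfolding qc_equiv_def by blast
  obtain \<sigma> where s: "\<sigma> \<in> Smp Q 2" "Act Q 2 [0,1] \<sigma> = cln 1 v a" "Act Q 2 [1,2] \<sigma> = g" "Act Q 2 [0,2] \<sigma> = qc_id Q x"
    using g(3) unfolding qc_composite_def by blast
  obtain \<tau> where r: "\<tau> \<in> Smp Q 2" "Act Q 2 [0,1] \<tau> = g" "Act Q 2 [1,2] \<tau> = cln 1 v a" "Act Q 2 [0,2] \<tau> = qc_id Q y"
    using g(4) unfolding qc_composite_def by blast
  obtain v1 g1 where g1: "v1 \<in> I" "g1 \<in> Smp (D v1) 1" "g = cln 1 v1 g1" using g(2) Q_Smp[of g 1] unfolding edge_def by blast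
  obtain v2 s1 where s1: "v2 \<in> I" "s1 \<in> Smp (D v2) 2" "\<sigma> = cln 2 v2 s1" using s(1) Q_Smp by blast
  obtain v3 r1 where r1: "v3 \<in> I" "r1 \<in> Smp (D v3) 2" "\<tau> = cln 2 v3 r1" using r(1) Q_Smp by blast
  have ev: "evt (\<lambda>w. ((le w v \<and> le w v1) \<and> le w v2) \<and> le w v3)"
    using evt_conj[OF evt_conj[OF evt_conj[OF evt_le[OF v(1)] evt_le[OF g1(1)]] evt_le[OF s1(1)]] evt_le[OF r1(1)]] .
  obtain u where u: "u \<in> I" "le u v" "le u v1" "le u v2" "le u v3" using evt_ex[OF ev] by blast
  define a0 where "a0 = t v u 1 a"
  define g0 where "g0 = t v1 u 1 g1"
  define s0 where "s0 = t v2 u 2 s1"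
  define r0 where "r0 = t v3 u 2 r1"
  have in0: "a0 \<in> Smp (D u) 1" "g0 \<in> Smp (D u) 1" "s0 \<in> Smp (D u) 2" "r0 \<in> Smp (D u) 2"
    unfolding a0_def g0_def s0_def r0_def using dirsys.t_in[OF dirsys_level] v g1 s1 r1 u by blast+
  note cr = dirsys.cls_restrict[OF dirsys_level]
  have cl0: "cln 1 v a = cln 1 u a0" "g = cln 1 u g0" "\<sigma> = cln 2 u s0" "\<tau> = cln 2 u r0"
    unfolding a0_def g0_def s0_def r0_def g1(3) s1(3) r1(3)
    using cr[OF v u(1,2)] cr[OF g1(1,2) u(1,3)] cr[OF s1(1,2) u(1,4)] cr[OF r1(1,2) u(1,5)] by simp_all
  have Du: "simplicial_set (D u)" by (rule D_sset[OF u(1)])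
  note act = cln_act[OF u(1)]
  have st: "evt (\<lambda>w. le w u \<and> t u w m p = t u w m q)"
    if "p \<in> Smp (D u) m" "q \<in> Smp (D u) m" "cln m u p = cln m u q" for m p q
  proof -
    have "evt (\<lambda>w. le w u \<and> le w u \<and> t u w m p = t u w m q)"
      by (rule dirsys.cls_eqD[OF dirsys_level u(1) that(1) u(1) that(2,3)])
    thus ?thesis by simp
  qed
  note sin = sset_act_in[OF Du]
  have v0: "Act (D u) 1 [i] a0 \<in> Smp (D u) 0" "Act (D u) 1 [i] g0 \<in> Smp (D u) 0" if "i \<le> 1" for i
    using sin in0 that by simp_all
  have x0: "x = cln 0 u (Act (D u) 1 [0] a0)" "y = cln 0 u (Act (D u) 1 [1] a0)"
    "x = cln 0 u (Act (D u) 1 [1] g0)" "y = cln 0 u (Act (D u) 1 [0] g0)"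
    using g(1,2) act[OF in0(1), of "[0]" 0] act[OF in0(1), of "[1]" 0] act[OF in0(2), of "[0]" 0] act[OF in0(2), of "[1]" 0]
    unfolding edge_def cl0 by simp_all
  have idx: "qc_id Q x = cln 1 u (Act (D u) 0 [0,0] (Act (D u) 1 [0] a0))"
    "qc_id Q y = cln 1 u (Act (D u) 0 [0,0] (Act (D u) 1 [1] a0))"
    unfolding x0(1,2) qc_id_def by (rule act[OF v0(1)]; simp)+
  have idin: "Act (D u) 0 [0,0] (Act (D u) 1 [i] a0) \<in> Smp (D u) 1" if "i \<le> 1" for i
    by (rule sin[OF v0(1)[OF that]]) simp
  have s2: "Act (D u) 2 \<alpha> s0 \<in> Smp (D u) 1" "Act (D u) 2 \<alpha> r0 \<in> Smp (D u) 1" if "\<alpha> \<in> ord 1 2" for \<alpha>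
    using sin in0 that by simp_all
  \<comment> \<open>Eight equations express the data: two for the end points of the inverse, and
    three for the edges of each triangle.\<close>
  have E1: "evt (\<lambda>w. le w u \<and> t u w 0 (Act (D u) 1 [0] a0) = t u w 0 (Act (D u) 1 [1] g0))"
    by (rule st) (use v0 x0 in auto)
  have E2: "evt (\<lambda>w. le w u \<and> t u w 0 (Act (D u) 1 [1] a0) = t u w 0 (Act (D u) 1 [0] g0))"
    by (rule st) (use v0 x0 in auto)
  have E3: "evt (\<lambda>w. le w u \<and> t u w 1 (Act (D u) 2 [0,1] s0) = t u w 1 a0)"
    by (rule st) (use s2 in0 s(2) act[OF in0(3), of "[0,1]" 1] cl0 in auto)
  have E4: "evt (\<lambda>w. le w u \<and> t u w 1 (Act (D u) 2 [1,2] s0) = t u w 1 g0)"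
    by (rule st) (use s2 in0 s(3) act[OF in0(3), of "[1,2]" 1] cl0 in auto)
  have E5: "evt (\<lambda>w. le w u \<and> t u w 1 (Act (D u) 2 [0,2] s0) = t u w 1 (Act (D u) 0 [0,0] (Act (D u) 1 [0] a0)))"
    by (rule st) (use s2 idin s(4) act[OF in0(3), of "[0,2]" 1] cl0 idx in auto)
  have E6: "evt (\<lambda>w. le w u \<and> t u w 1 (Act (D u) 2 [0,1] r0) = t u w 1 g0)"
    by (rule st) (use s2 in0 r(2) act[OF in0(4), of "[0,1]" 1] cl0 in auto)
  have E7: "evt (\<lambda>w. le w u \<and> t u w 1 (Act (D u) 2 [1,2] r0) = t u w 1 a0)"
    by (rule st) (use s2 in0 r(3) act[OF in0(4), of "[1,2]" 1] cl0 in auto)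
  have E8: "evt (\<lambda>w. le w u \<and> t u w 1 (Act (D u) 2 [0,2] r0) = t u w 1 (Act (D u) 0 [0,0] (Act (D u) 1 [1] a0)))"
    by (rule st) (use s2 idin r(4) act[OF in0(4), of "[0,2]" 1] cl0 idx in auto)
  obtain w where w: "w \<in> I" and wu: "le w u"
    and e12: "t u w 0 (Act (D u) 1 [0] a0) = t u w 0 (Act (D u) 1 [1] g0)" "t u w 0 (Act (D u) 1 [1] a0) = t u w 0 (Act (D u) 1 [0] g0)"
    and e3: "t u w 1 (Act (D u) 2 [0,1] s0) = t u w 1 a0" and e4: "t u w 1 (Act (D u) 2 [1,2] s0) = t u w 1 g0"
    and e5: "t u w 1 (Act (D u) 2 [0,2] s0) = t u w 1 (Act (D u) 0 [0,0] (Act (D u) 1 [0] a0))"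
    and e6: "t u w 1 (Act (D u) 2 [0,1] r0) = t u w 1 g0" and e7: "t u w 1 (Act (D u) 2 [1,2] r0) = t u w 1 a0"
    and e8: "t u w 1 (Act (D u) 2 [0,2] r0) = t u w 1 (Act (D u) 0 [0,0] (Act (D u) 1 [1] a0))"
    using evt_ex[OF evt_conj[OF E1 evt_conj[OF E2 evt_conj[OF E3 evt_conj[OF E4 evt_conj[OF E5 evt_conj[OF E6 evt_conj[OF E7 E8]]]]]]]]
    by blast
  have M: "simplicial_map (D u) (D w) (t u w)" by (rule t_map[OF u(1) w wu])
  note ma = simplicial_map_act[OF M] and mi = simplicial_map_in[OF M]
  let ?a = "t u w 1 a0" and ?g = "t u w 1 g0" and ?s = "t u w 2 s0" and ?r = "t u w 2 r0"
  have E: "edge (D w) ?a (Act (D w) 1 [0] ?a) (Act (D w) 1 [1] ?a)" "edge (D w) ?g (Act (D w) 1 [1] ?a) (Act (D w) 1 [0] ?a)"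
    using mi[OF in0(1)] mi[OF in0(2)] e12 ma[OF in0(1), of "[0]" 0] ma[OF in0(1), of "[1]" 0]
      ma[OF in0(2), of "[0]" 0] ma[OF in0(2), of "[1]" 0] by (simp_all add: edge_def)
  have idw: "t u w 1 (Act (D u) 0 [0,0] (Act (D u) 1 [i] a0)) = qc_id (D w) (Act (D w) 1 [i] ?a)" if "i \<le> 1" for i
    using ma[OF v0(1)[OF that], of "[0,0]" 1] ma[OF in0(1), of "[i]" 0] that by (simp add: qc_id_def)
  have C1: "qc_composite (D w) ?a ?g (qc_id (D w) (Act (D w) 1 [0] ?a))"
    unfolding qc_composite_def
    by (rule bexI[OF _ mi[OF in0(3)]])
      (use ma[OF in0(3), of "[0,1]" 1] ma[OF in0(3), of "[1,2]" 1] ma[OF in0(3), of "[0,2]" 1] e3 e4 e5 idw[of 0] in simp)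
  have C2: "qc_composite (D w) ?g ?a (qc_id (D w) (Act (D w) 1 [1] ?a))"
    unfolding qc_composite_def
    by (rule bexI[OF _ mi[OF in0(4)]])
      (use ma[OF in0(4), of "[0,1]" 1] ma[OF in0(4), of "[1,2]" 1] ma[OF in0(4), of "[0,2]" 1] e6 e7 e8 idw[of 1] in simp)
  have "qc_equiv (D w) ?a" unfolding qc_equiv_def by (intro exI conjI) (rule E(1), rule E(2), rule C1, rule C2)
  hence "qc_equiv (D w) (t v w 1 a)" unfolding a0_def t_comp[OF v(1) u(1) w u(2) wu v(2)] .
  thus ?thesis using w le_trans[OF w u(1) v(1) wu u(2)] by blast
qed

text \<open>A lower bound of two elements is the class of a product of their representatives, which
  lies in \<open>\<Phi>\<close> by closure under products and maps to both factors by the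
  projections. \<open>Ob\<close> bounds the objects on which \<open>R\<close> has to be transitive,
  since in an enriched category composition is available only between members of
  \<open>Objs\<close>.\<close>

lemma filter_directed:
  assumes F: "product_closed_filter S R IsF IsP \<Phi>"
    and obj: "S \<subseteq> Ob" and prod_obj: "\<And>P U V. IsP P U V \<Longrightarrow> P \<in> Ob"
    and refl: "\<And>U. U \<in> S \<Longrightarrow> R U U"
    and trans: "\<And>U V X. U \<in> Ob \<Longrightarrow> V \<in> Ob \<Longrightarrow> X \<in> Ob \<Longrightarrow> R U V \<Longrightarrow> R V X \<Longrightarrow> R U X"
    and rep: "\<And>v. v \<in> \<Phi> \<Longrightarrow> rep v \<in> v"
    and prod: "\<And>u v. u \<in> \<Phi> \<Longrightarrow> v \<in> \<Phi> \<Longrightarrow> \<exists>P. IsP P (rep u) (rep v) \<and> R P (rep u) \<and> R P (rep v)"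
  shows "directed \<Phi> (sub_le R)"
    and "\<And>u v. u \<in> \<Phi> \<Longrightarrow> v \<in> \<Phi> \<Longrightarrow> sub_le R u v \<longleftrightarrow> R (rep u) (rep v)"
proof -
  have sub: "\<Phi> \<subseteq> sub_poset S R" using F unfolding product_closed_filter_def by (elim conjE)
  have rep_cls: "\<exists>X\<in>S. v = sub_class S R X" if "v \<in> \<Phi>" for v
    using subsetD[OF sub that] unfolding sub_poset_def by (elim imageE) (rule bexI)
  have memb: "U \<in> Ob" if v: "v \<in> \<Phi>" and U: "U \<in> v" for v U
  proof -
    obtain X where "v = sub_class S R X" using rep_cls[OF v] by (elim bexE)
    thus ?thesis using U obj unfolding sub_class_def by auto
  qed
  have cls: "R U V" if v: "v \<in> \<Phi>" and UV: "U \<in> v" "V \<in> v" for v U V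
  proof -
    obtain X where XS: "X \<in> S" and X: "v = sub_class S R X" using rep_cls[OF v] by (elim bexE)
    have "R U X" "R X V" using UV unfolding X sub_class_def by simp_all
    thus ?thesis using trans[OF memb[OF v UV(1)] subsetD[OF obj XS] memb[OF v UV(2)]] by simp
  qed
  show iff: "sub_le R u v \<longleftrightarrow> R (rep u) (rep v)" if u: "u \<in> \<Phi>" and v: "v \<in> \<Phi>" for u v
  proof
    assume "sub_le R u v"
    then obtain U V where UV: "U \<in> u" "V \<in> v" "R U V" unfolding sub_le_def by (elim bexE)
    show "R (rep u) (rep v)"
      by (rule trans[OF memb[OF u rep[OF u]] memb[OF v UV(2)] memb[OF v rep[OF v]]
            trans[OF memb[OF u rep[OF u]] memb[OF u UV(1)] memb[OF v UV(2)] cls[OF u rep[OF u] UV(1)] UV(3)]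
            cls[OF v UV(2) rep[OF v]]])
  next
    assume "R (rep u) (rep v)"
    thus "sub_le R u v" unfolding sub_le_def using rep[OF u] rep[OF v] by (intro bexI)
  qed
  have S: "rep v \<in> S" if v: "v \<in> \<Phi>" for v
  proof -
    obtain X where X: "v = sub_class S R X" using rep_cls[OF v] by (elim bexE)
    show ?thesis using rep[OF v] unfolding X sub_class_def by simp
  qed
  show "directed \<Phi> (sub_le R)"
  proof
    show "sub_le R i i" if "i \<in> \<Phi>" for i using iff[OF that that] refl[OF S[OF that]] by simp
    show "sub_le R i k" if "i \<in> \<Phi>" "j \<in> \<Phi>" "k \<in> \<Phi>" "sub_le R i j" "sub_le R j k" for i j k
      using trans[of "rep i" "rep j" "rep k"] memb rep iff[of i j] iff[of j k] iff[of i k] that by simp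
    fix u v assume u: "u \<in> \<Phi>" and v: "v \<in> \<Phi>"
    obtain P where P: "IsP P (rep u) (rep v)" "R P (rep u)" "R P (rep v)" using prod[OF u v] by blast
    have cl: "\<forall>u\<in>\<Phi>. \<forall>v\<in>\<Phi>. \<forall>U\<in>u. \<forall>V\<in>v. \<forall>P. IsP P U V \<longrightarrow> sub_class S R P \<in> \<Phi>"
      using F unfolding product_closed_filter_def by (elim conjE)
    have w: "sub_class S R P \<in> \<Phi>"
      by (rule cl[rule_format, OF u v rep[OF u] rep[OF v] P(1)])
    have RP: "R (rep (sub_class S R P)) P" using rep[OF w] unfolding sub_class_def by simp
    note ob = memb[OF w rep[OF w]] prod_obj[OF P(1)]
    have "sub_le R (sub_class S R P) u \<and> sub_le R (sub_class S R P) v"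
      using iff[OF w u] iff[OF w v] trans[OF ob memb[OF u rep[OF u]] RP P(2)] trans[OF ob memb[OF v rep[OF v]] RP P(3)] by simp
    thus "\<exists>k\<in>\<Phi>. sub_le R k u \<and> sub_le R k v" using w by (rule bexI)
  qed
qed

lemma (in directed) evt_mono: "evt P \<Longrightarrow> (\<And>w. w \<in> I \<Longrightarrow> P w \<Longrightarrow> P' w) \<Longrightarrow> evt P'"
  unfolding evt_def by meson

section \<open>Equivalences at a stage of a colimit of bisimplicial sets\<close>

context dir_bsset
begin

lemma stage_eq:
  assumes "u \<in> I" "p \<in> BSmp (D u) n l" "q \<in> BSmp (D u) n l" "cln n l u p = cln n l u q"
  shows "evt (\<lambda>w. le w u \<and> t u w n l p = t u w n l q)"
proof -
  have "evt (\<lambda>w. le w u \<and> le w u \<and> t u w n l p = t u w n l q)"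
    by (rule dirsys.cls_eqD[OF dirsys_level assms(1,2,1,3,4)])
  thus ?thesis by simp
qed

text \<open>Here the data are a triangle and a path in a mapping space. Constancy of the ends of the
  path is itself an equation between classes, so it too holds only from some stage on.\<close>

lemma css_composite_stage:
  assumes u: "u \<in> I" and fgk: "f \<in> BSmp (D u) 1 0" "g \<in> BSmp (D u) 1 0" "k \<in> BSmp (D u) 1 0"
    and c: "css_composite Q (cln 1 0 u f) (cln 1 0 u g) (cln 1 0 u k)"
  shows "evt (\<lambda>w. le w u \<and> css_composite (D w) (t u w 1 0 f) (t u w 1 0 g) (t u w 1 0 k))"
proof -
  obtain \<sigma> s where s: "\<sigma> \<in> BSmp Q 2 0" "BAct Q 2 0 [0,1] [0] \<sigma> = cln 1 0 u f" "BAct Q 2 0 [1,2] [0] \<sigma> = cln 1 0 u g"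
    and e: "edge (map_space Q (BAct Q 2 0 [0] [0] \<sigma>) (BAct Q 2 0 [2] [0] \<sigma>)) s (BAct Q 2 0 [0,2] [0] \<sigma>) (cln 1 0 u k)"
    using c unfolding css_composite_def by blast
  have e': "s \<in> BSmp Q 1 1" "BAct Q 1 1 [0] (idl 1) s = bdegs Q 0 1 (BAct Q 2 0 [0] [0] \<sigma>)"
    "BAct Q 1 1 [1] (idl 1) s = bdegs Q 0 1 (BAct Q 2 0 [2] [0] \<sigma>)"
    "BAct Q 1 1 (idl 1) [0] s = BAct Q 2 0 [0,2] [0] \<sigma>" "BAct Q 1 1 (idl 1) [1] s = cln 1 0 u k"
    using e by (simp_all add: edge_def map_space_def)
  obtain v1 s1 where s1: "v1 \<in> I" "s1 \<in> BSmp (D v1) 2 0" "\<sigma> = cln 2 0 v1 s1" using s(1) Q_Smp by blast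
  obtain v2 p1 where p1: "v2 \<in> I" "p1 \<in> BSmp (D v2) 1 1" "s = cln 1 1 v2 p1" using e'(1) Q_Smp by blast
  obtain x where x: "x \<in> I" "le x u" "le x v1" "le x v2"
    using evt_ex[OF evt_conj[OF evt_le[OF u] evt_conj[OF evt_le[OF s1(1)] evt_le[OF p1(1)]]]] by blast
  define f0 where "f0 = t u x 1 0 f"
  define g0 where "g0 = t u x 1 0 g"
  define k0 where "k0 = t u x 1 0 k"
  define s0 where "s0 = t v1 x 2 0 s1"
  define p0 where "p0 = t v2 x 1 1 p1"
  have in0: "f0 \<in> BSmp (D x) 1 0" "g0 \<in> BSmp (D x) 1 0" "k0 \<in> BSmp (D x) 1 0" "s0 \<in> BSmp (D x) 2 0" "p0 \<in> BSmp (D x) 1 1"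
    unfolding f0_def g0_def k0_def s0_def p0_def
    by (rule t_in[OF u x(1,2) fgk(1)] t_in[OF u x(1,2) fgk(2)] t_in[OF u x(1,2) fgk(3)] t_in[OF s1(1) x(1,3) s1(2)]
        t_in[OF p1(1) x(1,4) p1(2)])+
  note cr = dirsys.cls_restrict[OF dirsys_level]
  have cl0: "cln 1 0 u f = cln 1 0 x f0" "cln 1 0 u g = cln 1 0 x g0" "cln 1 0 u k = cln 1 0 x k0"
    "\<sigma> = cln 2 0 x s0" "s = cln 1 1 x p0"
    unfolding f0_def g0_def k0_def s0_def p0_def s1(3) p1(3)
    by (rule cr[OF u fgk(1) x(1,2), symmetric] cr[OF u fgk(2) x(1,2), symmetric] cr[OF u fgk(3) x(1,2), symmetric]
        cr[OF s1(1,2) x(1,3), symmetric] cr[OF p1(1,2) x(1,4), symmetric])+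
  have B: "bisimplicial_set (D x)" by (rule D_bsset[OF x(1)])
  have o: "[0] \<in> ord 0 1" "[1] \<in> ord 0 1" "[0,1] \<in> ord 1 2" "[1,2] \<in> ord 1 2" "[0,2] \<in> ord 1 2" "[0] \<in> ord 0 2" "[2] \<in> ord 0 2"
    "const_op 0 0 \<in> ord 0 0" "const_op 1 0 \<in> ord 1 0" by simp_all
  note act = cln_act[OF x(1)] and bin = bs_act_in[OF B]
  let ?v = "\<lambda>i. BAct (D x) 2 0 [i] [0] s0"
  let ?d = "\<lambda>i. BAct (D x) 0 0 (const_op 0 0) (const_op 1 0) (?v i)"
  have vin: "?v 0 \<in> BSmp (D x) 0 0" "?v 2 \<in> BSmp (D x) 0 0" by (rule bin[OF in0(4) o(6) zero_ord] bin[OF in0(4) o(7) zero_ord])+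
  have din: "?d 0 \<in> BSmp (D x) 0 1" "?d 2 \<in> BSmp (D x) 0 1" by (rule bin[OF vin(1) o(8,9)] bin[OF vin(2) o(8,9)])+
  have dQ: "bdegs Q 0 1 (BAct Q 2 0 [0] [0] \<sigma>) = cln 0 1 x (?d 0)" "bdegs Q 0 1 (BAct Q 2 0 [2] [0] \<sigma>) = cln 0 1 x (?d 2)"
    unfolding bdegs_def cl0(4) act[OF in0(4) o(6) zero_ord] act[OF in0(4) o(7) zero_ord] act[OF vin(1) o(8,9)] act[OF vin(2) o(8,9)]
    by (rule refl)+
  note st = stage_eq[OF x(1)]
  have E1: "evt (\<lambda>w. le w x \<and> t x w 1 0 (BAct (D x) 2 0 [0,1] [0] s0) = t x w 1 0 f0)"
    by (rule st[OF bin[OF in0(4) o(3) zero_ord] in0(1)]) (use s(2) in \<open>unfold cl0 act[OF in0(4) o(3) zero_ord]\<close>)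
  have E2: "evt (\<lambda>w. le w x \<and> t x w 1 0 (BAct (D x) 2 0 [1,2] [0] s0) = t x w 1 0 g0)"
    by (rule st[OF bin[OF in0(4) o(4) zero_ord] in0(2)]) (use s(3) in \<open>unfold cl0 act[OF in0(4) o(4) zero_ord]\<close>)
  have E3: "evt (\<lambda>w. le w x \<and> t x w 0 1 (BAct (D x) 1 1 [0] (idl 1) p0) = t x w 0 1 (?d 0))"
    by (rule st[OF bin[OF in0(5) o(1) idl_ord] din(1)]) (use e'(2) in \<open>unfold dQ, unfold cl0(5) act[OF in0(5) o(1) idl_ord]\<close>)
  have E4: "evt (\<lambda>w. le w x \<and> t x w 0 1 (BAct (D x) 1 1 [1] (idl 1) p0) = t x w 0 1 (?d 2))"
    by (rule st[OF bin[OF in0(5) o(2) idl_ord] din(2)]) (use e'(3) in \<open>unfold dQ, unfold cl0(5) act[OF in0(5) o(2) idl_ord]\<close>)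
  have E5: "evt (\<lambda>w. le w x \<and> t x w 1 0 (BAct (D x) 1 1 (idl 1) [0] p0) = t x w 1 0 (BAct (D x) 2 0 [0,2] [0] s0))"
    by (rule st[OF bin[OF in0(5) idl_ord o(1)] bin[OF in0(4) o(5) zero_ord]])
      (use e'(4) in \<open>unfold cl0(4,5) act[OF in0(5) idl_ord o(1)] act[OF in0(4) o(5) zero_ord]\<close>)
  have E6: "evt (\<lambda>w. le w x \<and> t x w 1 0 (BAct (D x) 1 1 (idl 1) [1] p0) = t x w 1 0 k0)"
    by (rule st[OF bin[OF in0(5) idl_ord o(2)] in0(3)]) (use e'(5) in \<open>unfold cl0 act[OF in0(5) idl_ord o(2)]\<close>)
  show ?thesis
  proof (rule evt_mono[OF evt_conj[OF E1 evt_conj[OF E2 evt_conj[OF E3 evt_conj[OF E4 evt_conj[OF E5 E6]]]]]])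
    fix w assume w: "w \<in> I"
      "(le w x \<and> t x w 1 0 (BAct (D x) 2 0 [0,1] [0] s0) = t x w 1 0 f0) \<and>
       (le w x \<and> t x w 1 0 (BAct (D x) 2 0 [1,2] [0] s0) = t x w 1 0 g0) \<and>
       (le w x \<and> t x w 0 1 (BAct (D x) 1 1 [0] (idl 1) p0) = t x w 0 1 (?d 0)) \<and>
       (le w x \<and> t x w 0 1 (BAct (D x) 1 1 [1] (idl 1) p0) = t x w 0 1 (?d 2)) \<and>
       (le w x \<and> t x w 1 0 (BAct (D x) 1 1 (idl 1) [0] p0) = t x w 1 0 (BAct (D x) 2 0 [0,2] [0] s0)) \<and>
       (le w x \<and> t x w 1 0 (BAct (D x) 1 1 (idl 1) [1] p0) = t x w 1 0 k0)"
    hence wx: "le w x" by blast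
    have wu: "le w u" by (rule le_trans[OF w(1) x(1) u wx x(2)])
    note ta = t_act[OF x(1) w(1) wx]
    let ?s = "t x w 2 0 s0" and ?p = "t x w 1 1 p0"
    have s_in: "?s \<in> BSmp (D w) 2 0" and p_in: "?p \<in> BSmp (D w) 1 1"
      by (rule t_in[OF x(1) w(1) wx in0(4)] t_in[OF x(1) w(1) wx in0(5)])+
    have td: "t x w 0 1 (?d 0) = bdegs (D w) 0 1 (BAct (D w) 2 0 [0] [0] ?s)"
      "t x w 0 1 (?d 2) = bdegs (D w) 0 1 (BAct (D w) 2 0 [2] [0] ?s)"
      unfolding bdegs_def ta[OF vin(1) o(8,9)] ta[OF vin(2) o(8,9)] ta[OF in0(4) o(6) zero_ord] ta[OF in0(4) o(7) zero_ord]
      by (rule refl)+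
    have tt: "t x w 1 0 f0 = t u w 1 0 f" "t x w 1 0 g0 = t u w 1 0 g" "t x w 1 0 k0 = t u w 1 0 k"
      unfolding f0_def g0_def k0_def
      by (rule t_comp[OF u x(1) w(1) x(2) wx fgk(1)] t_comp[OF u x(1) w(1) x(2) wx fgk(2)] t_comp[OF u x(1) w(1) x(2) wx fgk(3)])+
    have eqs: "BAct (D w) 2 0 [0,1] [0] ?s = t u w 1 0 f" "BAct (D w) 2 0 [1,2] [0] ?s = t u w 1 0 g"
      "BAct (D w) 1 1 [0] (idl 1) ?p = bdegs (D w) 0 1 (BAct (D w) 2 0 [0] [0] ?s)"
      "BAct (D w) 1 1 [1] (idl 1) ?p = bdegs (D w) 0 1 (BAct (D w) 2 0 [2] [0] ?s)"
      "BAct (D w) 1 1 (idl 1) [0] ?p = BAct (D w) 2 0 [0,2] [0] ?s" "BAct (D w) 1 1 (idl 1) [1] ?p = t u w 1 0 k"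
      using w(2) unfolding td tt ta[OF in0(4) o(3) zero_ord] ta[OF in0(4) o(4) zero_ord] ta[OF in0(4) o(5) zero_ord]
        ta[OF in0(5) o(1) idl_ord] ta[OF in0(5) o(2) idl_ord] ta[OF in0(5) idl_ord o(1)] ta[OF in0(5) idl_ord o(2)]
      by simp_all
    have "edge (map_space (D w) (BAct (D w) 2 0 [0] [0] ?s) (BAct (D w) 2 0 [2] [0] ?s)) ?p (BAct (D w) 2 0 [0,2] [0] ?s) (t u w 1 0 k)"
      unfolding edge_def map_space_def using p_in eqs(3-6) by simp
    hence "css_composite (D w) (t u w 1 0 f) (t u w 1 0 g) (t u w 1 0 k)"
      unfolding css_composite_def by (intro bexI[OF _ s_in] conjI eqs(1,2) exI)
    thus "le w u \<and> css_composite (D w) (t u w 1 0 f) (t u w 1 0 g) (t u w 1 0 k)" using wu by (rule conjI[rotated])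
  qed
qed

lemma css_equiv_stage:
  assumes v: "v \<in> I" "a \<in> BSmp (D v) 1 0" and e: "css_equiv Q (cln 1 0 v a)"
  shows "\<exists>w\<in>I. le w v \<and> css_equiv (D w) (t v w 1 0 a)"
proof -
  obtain x y g h where g: "css_edge Q (cln 1 0 v a) x y" "css_edge Q g y x" "css_edge Q h y x"
    "css_composite Q (cln 1 0 v a) g (css_id Q x)" "css_composite Q h (cln 1 0 v a) (css_id Q y)"
    using e unfolding css_equiv_def by blast
  obtain v1 g1 where g1: "v1 \<in> I" "g1 \<in> BSmp (D v1) 1 0" "g = cln 1 0 v1 g1" using g(2) Q_Smp[of g 1] unfolding css_edge_def by blast
  obtain v2 h1 where h1: "v2 \<in> I" "h1 \<in> BSmp (D v2) 1 0" "h = cln 1 0 v2 h1" using g(3) Q_Smp[of h 1] unfolding css_edge_def by blast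
  obtain u where u: "u \<in> I" "le u v" "le u v1" "le u v2"
    using evt_ex[OF evt_conj[OF evt_le[OF v(1)] evt_conj[OF evt_le[OF g1(1)] evt_le[OF h1(1)]]]] by blast
  define a0 where "a0 = t v u 1 0 a"
  define g0 where "g0 = t v1 u 1 0 g1"
  define h0 where "h0 = t v2 u 1 0 h1"
  have in0: "a0 \<in> BSmp (D u) 1 0" "g0 \<in> BSmp (D u) 1 0" "h0 \<in> BSmp (D u) 1 0"
    unfolding a0_def g0_def h0_def
    by (rule t_in[OF v(1) u(1,2) v(2)] t_in[OF g1(1) u(1,3) g1(2)] t_in[OF h1(1) u(1,4) h1(2)])+
  note cr = dirsys.cls_restrict[OF dirsys_level]
  have cl0: "cln 1 0 v a = cln 1 0 u a0" "g = cln 1 0 u g0" "h = cln 1 0 u h0"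
    unfolding a0_def g0_def h0_def g1(3) h1(3)
    by (rule cr[OF v u(1,2), symmetric] cr[OF g1(1,2) u(1,3), symmetric] cr[OF h1(1,2) u(1,4), symmetric])+
  have B: "bisimplicial_set (D u)" by (rule D_bsset[OF u(1)])
  have o: "[0] \<in> ord 0 1" "[1] \<in> ord 0 1" "const_op 1 0 \<in> ord 1 0" "const_op 0 0 \<in> ord 0 0" by simp_all
  note act = cln_act[OF u(1)] and bin = bs_act_in[OF B]
  let ?e = "\<lambda>i f. BAct (D u) 1 0 [i] [0] f"
  have vin: "?e 0 f \<in> BSmp (D u) 0 0" "?e 1 f \<in> BSmp (D u) 0 0" if "f \<in> BSmp (D u) 1 0" for f
    by (rule bin[OF that o(1) zero_ord] bin[OF that o(2) zero_ord])+
  have x0: "x = cln 0 0 u (?e 0 a0)" "y = cln 0 0 u (?e 1 a0)" "x = cln 0 0 u (?e 1 g0)" "y = cln 0 0 u (?e 0 g0)"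
    "x = cln 0 0 u (?e 1 h0)" "y = cln 0 0 u (?e 0 h0)"
    using g(1-3) unfolding css_edge_def cl0 act[OF in0(1) o(1) zero_ord] act[OF in0(1) o(2) zero_ord]
      act[OF in0(2) o(1) zero_ord] act[OF in0(2) o(2) zero_ord] act[OF in0(3) o(1) zero_ord] act[OF in0(3) o(2) zero_ord] by simp_all
  have idx: "css_id Q x = cln 1 0 u (css_id (D u) (?e 0 a0))" "css_id Q y = cln 1 0 u (css_id (D u) (?e 1 a0))"
    unfolding x0(1,2) css_id_def bdegs_def act[OF vin(1)[OF in0(1)] o(3,4)] act[OF vin(2)[OF in0(1)] o(3,4)] by (rule refl)+
  have idin: "css_id (D u) (?e 0 a0) \<in> BSmp (D u) 1 0" "css_id (D u) (?e 1 a0) \<in> BSmp (D u) 1 0"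
    unfolding css_id_def bdegs_def by (rule bin[OF vin(1)[OF in0(1)] o(3,4)] bin[OF vin(2)[OF in0(1)] o(3,4)])+
  note st = stage_eq[OF u(1)]
  have E1: "evt (\<lambda>w. le w u \<and> t u w 0 0 (?e 1 g0) = t u w 0 0 (?e 0 a0))"
    by (rule st[OF vin(2)[OF in0(2)] vin(1)[OF in0(1)]]) (use x0 in simp)
  have E2: "evt (\<lambda>w. le w u \<and> t u w 0 0 (?e 0 g0) = t u w 0 0 (?e 1 a0))"
    by (rule st[OF vin(1)[OF in0(2)] vin(2)[OF in0(1)]]) (use x0 in simp)
  have E3: "evt (\<lambda>w. le w u \<and> t u w 0 0 (?e 1 h0) = t u w 0 0 (?e 0 a0))"
    by (rule st[OF vin(2)[OF in0(3)] vin(1)[OF in0(1)]]) (use x0 in simp)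
  have E4: "evt (\<lambda>w. le w u \<and> t u w 0 0 (?e 0 h0) = t u w 0 0 (?e 1 a0))"
    by (rule st[OF vin(1)[OF in0(3)] vin(2)[OF in0(1)]]) (use x0 in simp)
  note E5 = css_composite_stage[OF u(1) in0(1,2) idin(1) g(4)[unfolded cl0 idx]]
  note E6 = css_composite_stage[OF u(1) in0(3,1) idin(2) g(5)[unfolded cl0 idx]]
  obtain w where w: "w \<in> I" and wu: "le w u"
    and e: "t u w 0 0 (?e 1 g0) = t u w 0 0 (?e 0 a0)" "t u w 0 0 (?e 0 g0) = t u w 0 0 (?e 1 a0)"
      "t u w 0 0 (?e 1 h0) = t u w 0 0 (?e 0 a0)" "t u w 0 0 (?e 0 h0) = t u w 0 0 (?e 1 a0)"
    and c: "css_composite (D w) (t u w 1 0 a0) (t u w 1 0 g0) (t u w 1 0 (css_id (D u) (?e 0 a0)))"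
      "css_composite (D w) (t u w 1 0 h0) (t u w 1 0 a0) (t u w 1 0 (css_id (D u) (?e 1 a0)))"
    using evt_ex[OF evt_conj[OF E1 evt_conj[OF E2 evt_conj[OF E3 evt_conj[OF E4 evt_conj[OF E5 E6]]]]]] by blast
  note ta = t_act[OF u(1) w wu] and ti = t_in[OF u(1) w wu]
  let ?a = "t u w 1 0 a0" and ?g = "t u w 1 0 g0" and ?h = "t u w 1 0 h0"
  let ?x = "BAct (D w) 1 0 [0] [0] ?a" and ?y = "BAct (D w) 1 0 [1] [0] ?a"
  note tv = ta[OF in0(1) o(1) zero_ord] ta[OF in0(1) o(2) zero_ord] ta[OF in0(2) o(1) zero_ord] ta[OF in0(2) o(2) zero_ord]
    ta[OF in0(3) o(1) zero_ord] ta[OF in0(3) o(2) zero_ord]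
  have tid: "t u w 1 0 (css_id (D u) (?e 0 a0)) = css_id (D w) ?x" "t u w 1 0 (css_id (D u) (?e 1 a0)) = css_id (D w) ?y"
    unfolding css_id_def bdegs_def ta[OF vin(1)[OF in0(1)] o(3,4)] ta[OF vin(2)[OF in0(1)] o(3,4)] tv by (rule refl)+
  have "css_edge (D w) ?a ?x ?y" "css_edge (D w) ?g ?y ?x" "css_edge (D w) ?h ?y ?x"
    unfolding css_edge_def using ti[OF in0(1)] ti[OF in0(2)] ti[OF in0(3)] e unfolding tv by simp_all
  hence "css_equiv (D w) ?a" unfolding css_equiv_def using c[unfolded tid] by (intro exI conjI)
  hence "css_equiv (D w) (t v w 1 0 a)" unfolding a0_def t_comp[OF v(1) u(1) w u(2) wu v(2)] .
  thus ?thesis using w le_trans[OF w u(1) v(1) wu u(2)] by blast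
qed

end

section \<open>Filter quotients of complete Segal spaces\<close>

lemma css_diagramD:
  assumes "css_diagram W \<Phi> rep t"
  shows "v \<in> \<Phi> \<Longrightarrow> rep v \<in> v"
    and "v \<in> \<Phi> \<Longrightarrow> u \<in> \<Phi> \<Longrightarrow> sub_le (css_map_exists W) u v \<Longrightarrow> css_product_functor W (rep v) (rep u) (t v u)"
    and "v \<in> \<Phi> \<Longrightarrow> \<phi> \<in> BSmp (css_slice W (rep v)) n l \<Longrightarrow> t v v n l \<phi> = \<phi>"
    and "v \<in> \<Phi> \<Longrightarrow> u \<in> \<Phi> \<Longrightarrow> w \<in> \<Phi> \<Longrightarrow> sub_le (css_map_exists W) u v \<Longrightarrow> sub_le (css_map_exists W) w u \<Longrightarrow>
      \<phi> \<in> BSmp (css_slice W (rep v)) n l \<Longrightarrow> t u w n l (t v u n l \<phi>) = t v w n l \<phi>"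
  using assms unfolding css_diagram_def by simp_all

context segal
begin

lemma map_exists_trans: "css_map_exists W U V \<Longrightarrow> css_map_exists W V X \<Longrightarrow> css_map_exists W U X"
proof -
  assume "css_map_exists W U V" "css_map_exists W V X"
  then obtain f g where fg: "css_edge W f U V" "css_edge W g V X" unfolding css_map_exists_def by blast
  obtain h where h: "qc_composite (row W 0) f g h" using T_ex[OF fg] by blast
  have "css_edge W h U X" by (rule T_arrs(2)[OF h fg])
  thus ?thesis unfolding css_map_exists_def by blast
qed

lemma subobject_obj: "U \<in> css_subobjects W \<Longrightarrow> U \<in> BSmp W 0 0"
  unfolding css_subobjects_def using edge_objs by blast

lemma map_exists_refl:
  assumes "U \<in> css_subobjects W"
  shows "css_map_exists W U U"
proof -
  obtain e m where "css_edge W m U e" using assms unfolding css_subobjects_def by blast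
  thus ?thesis using id_arr unfolding css_map_exists_def by blast
qed

lemma rep_subobject:
  assumes "css_filter W \<Phi>" "v \<in> \<Phi>" "U \<in> v"
  shows "U \<in> css_subobjects W"
proof -
  have "\<Phi> \<subseteq> sub_poset (css_subobjects W) (css_map_exists W)"
    using assms(1) unfolding css_filter_def product_closed_filter_def by (elim conjE)
  thus ?thesis using assms(2,3) unfolding sub_poset_def sub_class_def by auto
qed

text \<open>The diagram already provides products: the transition functor from the greatest element
  to \<open>v\<close>, applied to a map from \<open>rep u\<close> to the greatest representative,
  yields a product of \<open>rep u\<close> and \<open>rep v\<close>.\<close>

lemma filter_products:
  assumes fin: "css_finitely_complete W" and F: "css_filter W \<Phi>" and D: "css_diagram W \<Phi> rep t"
    and u: "u \<in> \<Phi>" and v: "v \<in> \<Phi>"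
  shows "\<exists>P p q. css_product W P p q (rep u) (rep v)"
proof -
  let ?R = "css_map_exists W"
  obtain e where e: "css_final W e" using fin unfolding css_finitely_complete_def by blast
  define top where "top = sub_class (css_subobjects W) ?R e"
  have "\<forall>e. css_final W e \<longrightarrow> top' e \<in> \<Phi>" if "top' = sub_class (css_subobjects W) ?R" for top'
    using F unfolding css_filter_def product_closed_filter_def that by (elim conjE)
  hence top: "top \<in> \<Phi>" using e unfolding top_def by simp
  note rep = css_diagramD(1)[OF D]
  have obj: "rep w \<in> BSmp W 0 0" if "w \<in> \<Phi>" for w
    by (rule subobject_obj[OF rep_subobject[OF F that rep[OF that]]])
  have et: "?R e (rep top)" using rep[OF top] unfolding top_def sub_class_def by blast
  have Rtop: "?R (rep w) (rep top)" if "w \<in> \<Phi>" for w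
  proof -
    have "?R (rep w) e" unfolding css_map_exists_def by (rule css_final_edges(1)[OF W e obj[OF that]])
    thus ?thesis using map_exists_trans et by blast
  qed
  have "sub_le ?R v top" unfolding sub_le_def using rep[OF v] rep[OF top] Rtop[OF v] by blast
  hence pf: "css_product_functor W (rep top) (rep v) (t top v)"
    by (rule css_diagramD(2)[OF D top v])
  obtain i where i: "css_edge W i (rep u) (rep top)" using Rtop[OF u] unfolding css_map_exists_def by blast
  obtain H where H: "bisimplicial_map (bsprod (css_slice W (rep top)) (bF 1)) W H \<and>
      (\<forall>n l. \<forall>\<phi>\<in>BSmp (css_slice W (rep top)) n l. H n l (\<phi>, const_op n 0) = css_forget n (t top v n l \<phi>) \<and>
         H n l (\<phi>, const_op n 1) = css_forget n \<phi>) \<and>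
      (\<forall>\<phi>\<in>BSmp (css_slice W (rep top)) 0 0.
         css_product W (css_forget 0 (t top v 0 0 \<phi>)) (H 1 0 (css_id (css_slice W (rep top)) \<phi>, [0,1]))
           (slice_edge (t top v 0 0 \<phi>)) (css_forget 0 \<phi>) (rep v))"
    using pf[unfolded css_product_functor_def, THEN conjunct2] by (rule exE)
  note H[THEN conjunct2, THEN conjunct2]
  hence "css_product W (css_forget 0 (t top v 0 0 (slice_obj W i))) (H 1 0 (css_id (css_slice W (rep top)) (slice_obj W i), [0,1]))
           (slice_edge (t top v 0 0 (slice_obj W i))) (css_forget 0 (slice_obj W i)) (rep v)"
    by (rule bspec) (rule slice_obj_in[OF W i])
  thus ?thesis unfolding slice_edge_obj(2)[OF W i] by blast
qed

lemma filter_directed_css: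
  assumes fin: "css_finitely_complete W" and F: "css_filter W \<Phi>" and D: "css_diagram W \<Phi> rep t"
  shows "directed \<Phi> (sub_le (css_map_exists W))"
    and "\<And>u v. u \<in> \<Phi> \<Longrightarrow> v \<in> \<Phi> \<Longrightarrow> sub_le (css_map_exists W) u v \<longleftrightarrow> css_map_exists W (rep u) (rep v)"
proof -
  note rep = css_diagramD(1)[OF D]
  have prod: "\<exists>P. (\<exists>p q. css_product W P p q (rep u) (rep v)) \<and> css_map_exists W P (rep u) \<and> css_map_exists W P (rep v)"
    if u: "u \<in> \<Phi>" and v: "v \<in> \<Phi>" for u v
    using filter_products[OF fin F D u v] unfolding css_map_exists_def css_product_def by blast
  note fd = filter_directed[where Ob = UNIV, OF F[unfolded css_filter_def] subset_UNIV UNIV_I map_exists_refl map_exists_trans rep prod]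
  show "directed \<Phi> (sub_le (css_map_exists W))" by (rule fd(1))
  show "\<And>u v. u \<in> \<Phi> \<Longrightarrow> v \<in> \<Phi> \<Longrightarrow> sub_le (css_map_exists W) u v \<longleftrightarrow> css_map_exists W (rep u) (rep v)" by (rule fd(2))
qed

lemma diagram_dir_bsset:
  assumes fin: "css_finitely_complete W" and F: "css_filter W \<Phi>" and D: "css_diagram W \<Phi> rep t"
  shows "dir_bsset \<Phi> (sub_le (css_map_exists W)) (\<lambda>v. css_slice W (rep v)) t"
proof -
  interpret directed \<Phi> "sub_le (css_map_exists W)" by (rule filter_directed_css(1)[OF fin F D])
  note rep = css_diagramD(1)[OF D]
  show ?thesis
  proof
    show "bisimplicial_set (css_slice W (rep v))" if "v \<in> \<Phi>" for v
      by (rule css_slice_bisimplicial[OF W subobject_obj[OF rep_subobject[OF F that rep[OF that]]]])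
    show "bisimplicial_map (css_slice W (rep v)) (css_slice W (rep w)) (t v w)"
      if "v \<in> \<Phi>" "w \<in> \<Phi>" "sub_le (css_map_exists W) w v" for v w
      using css_diagramD(2)[OF D that] unfolding css_product_functor_def by (elim conjE)
    show "t v v n l a = a" if "v \<in> \<Phi>" "a \<in> BSmp (css_slice W (rep v)) n l" for v a n l
      by (rule css_diagramD(3)[OF D that])
    show "t w x n l (t v w n l a) = t v x n l a"
      if "v \<in> \<Phi>" "w \<in> \<Phi>" "x \<in> \<Phi>" "sub_le (css_map_exists W) w v" "sub_le (css_map_exists W) x w"
        "a \<in> BSmp (css_slice W (rep v)) n l" for v w x a n l
      by (rule css_diagramD(4)[OF D that])
  qed
qed

text \<open>The transition functor applied to \<open>f\<close> sits in a naturality square over \<open>f\<close>.\<close>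

lemma product_functor_square:
  assumes V: "V \<in> BSmp W 0 0" and U: "U \<in> BSmp W 0 0"
    and pf: "css_product_functor W V U \<tau>" and f: "css_edge (css_slice W V) f x y"
  obtains p p' where
    "css_edge (css_slice W U) (\<tau> 1 0 f) (\<tau> 0 0 x) (\<tau> 0 0 y)"
    "css_product W (css_forget 0 (\<tau> 0 0 x)) p (slice_edge (\<tau> 0 0 x)) (css_forget 0 x) U"
    "css_product W (css_forget 0 (\<tau> 0 0 y)) p' (slice_edge (\<tau> 0 0 y)) (css_forget 0 y) U"
    "cmp (cl (css_forget 1 (\<tau> 1 0 f))) (cl p') = cmp (cl p) (cl (css_forget 1 f))"
    "\<exists>s\<in>prism_maps (row W 0) 1. s ([0,1], [0,0]) = css_forget 1 (\<tau> 1 0 f) \<and> s ([0,1], [1,1]) = css_forget 1 f \<and>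
       s ([0,0], [0,1]) = p \<and> s ([1,1], [0,1]) = p'"
proof -
  let ?S = "css_slice W V"
  note SV = css_slice_bisimplicial[OF W V] and SU = css_slice_bisimplicial[OF W U]
  obtain H where HH: "bisimplicial_map (bsprod ?S (bF 1)) W H \<and>
      (\<forall>n l. \<forall>\<phi>\<in>BSmp ?S n l. H n l (\<phi>, const_op n 0) = css_forget n (\<tau> n l \<phi>) \<and>
         H n l (\<phi>, const_op n 1) = css_forget n \<phi>) \<and>
      (\<forall>\<phi>\<in>BSmp ?S 0 0. css_product W (css_forget 0 (\<tau> 0 0 \<phi>)) (H 1 0 (css_id ?S \<phi>, [0,1]))
           (slice_edge (\<tau> 0 0 \<phi>)) (css_forget 0 \<phi>) U)"
    using pf[unfolded css_product_functor_def, THEN conjunct2] by (rule exE)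
  note t = pf[unfolded css_product_functor_def, THEN conjunct1]
    and H = HH[THEN conjunct1]
    and He = HH[THEN conjunct2, THEN conjunct1, rule_format]
    and Hp = HH[THEN conjunct2, THEN conjunct2, rule_format]
  have f1: "f \<in> BSmp ?S 1 0" and fxy: "BAct ?S 1 0 [0] [0] f = x" "BAct ?S 1 0 [1] [0] f = y"
    using f by (simp_all add: css_edge_def)
  have xy: "x \<in> BSmp ?S 0 0" "y \<in> BSmp ?S 0 0" using css_edge_objs[OF SV f] by auto
  have e: "css_edge (css_slice W U) (\<tau> 1 0 f) (\<tau> 0 0 x) (\<tau> 0 0 y)"
  proof -
    have i: "\<tau> 1 0 f \<in> BSmp (css_slice W U) 1 0" using t f1 unfolding bisimplicial_map_def by blast
    have a: "\<tau> 0 0 (BAct ?S 1 0 [i] [0] f) = BAct (css_slice W U) 1 0 [i] [0] (\<tau> 1 0 f)" if "[i] \<in> ord 0 1" for i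
      using t f1 that zero_ord unfolding bisimplicial_map_def by blast
    show ?thesis unfolding css_edge_def using i a[of 0] a[of 1] fxy by simp
  qed
  have Hin: "H k 0 (\<phi>, \<beta>) \<in> BSmp W k 0" if "\<phi> \<in> BSmp ?S k 0" "\<beta> \<in> ord k 1" for k \<phi> \<beta>
    using H that unfolding bisimplicial_map_def bsprod_def bF_def by auto
  have Hact: "H m 0 (BAct ?S k 0 \<theta> [0] \<phi>, ocomp \<beta> \<theta>) = BAct W k 0 \<theta> [0] (H k 0 (\<phi>, \<beta>))"
    if "\<phi> \<in> BSmp ?S k 0" "\<beta> \<in> ord k 1" "\<theta> \<in> ord m k" for k m \<theta> \<phi> \<beta>
  proof -
    have "\<forall>x\<in>BSmp (bsprod ?S (bF 1)) k 0. H m 0 (BAct (bsprod ?S (bF 1)) k 0 \<theta> [0] x) = BAct W k 0 \<theta> [0] (H k 0 x)"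
      using H that(3) zero_ord unfolding bisimplicial_map_def by blast
    moreover have "(\<phi>, \<beta>) \<in> BSmp (bsprod ?S (bF 1)) k 0" using that by (simp add: bsprod_def bF_def)
    ultimately have "H m 0 (BAct (bsprod ?S (bF 1)) k 0 \<theta> [0] (\<phi>, \<beta>)) = BAct W k 0 \<theta> [0] (H k 0 (\<phi>, \<beta>))" by (rule bspec)
    thus ?thesis by (simp add: bsprod_def bF_def)
  qed
  have HR: "simplicial_map (sprod (row ?S 0) (Delta 1)) (row W 0) (\<lambda>n. H n 0)"
    unfolding simplicial_map_def using Hin Hact by (auto simp: idl_simps)
  have fe: "edge (row ?S 0) f x y" using f by (simp add: edge_row)
  have c2: "H 1 0 (f, [0,0]) = css_forget 1 (\<tau> 1 0 f)" "H 1 0 (f, [1,1]) = css_forget 1 f"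
    using He[OF f1] by (simp_all add: const_op_simps)
  define p where "p = H 1 0 (css_id ?S x, [0,1])"
  define p' where "p' = H 1 0 (css_id ?S y, [0,1])"
  note nat = homotopy_natural[OF row_simplicial[OF SV] HR fe, unfolded qc_id_row, folded p_def p'_def, unfolded c2]
  have sq: "cmp (cl (css_forget 1 (\<tau> 1 0 f))) (cl p') = cmp (cl p) (cl (css_forget 1 f))"
    using cmp_cl[OF nat(1)] cmp_cl[OF nat(2)] by simp
  \<comment> \<open>The homotopy evaluated on \<open>f\<close> is a map from the square, the form in
    which \<open>css_times_id\<close> asks for compatibility with the projections.\<close>
  define s where "s = restrict (\<lambda>(\<alpha>, \<beta>). H (length \<alpha> - 1) 0 (BAct ?S 1 0 \<alpha> [0] f, \<beta>)) (prism 1)"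
  have sv: "s (\<alpha>, \<beta>) = H k 0 (BAct ?S 1 0 \<alpha> [0] f, \<beta>)" if "\<alpha> \<in> ord k 1" "\<beta> \<in> ord k 1" for \<alpha> \<beta> k
  proof -
    have "(\<alpha>, \<beta>) \<in> prism 1" using that prism_iff by blast
    thus ?thesis by (simp add: s_def ord_length[OF that(1)])
  qed
  have fin: "BAct ?S 1 0 \<alpha> [0] f \<in> BSmp ?S k 0" if "\<alpha> \<in> ord k 1" for \<alpha> k by (rule bs_act_in[OF SV f1 that zero_ord])
  have sP: "s \<in> prism_maps (row W 0) 1" unfolding prism_maps_def
  proof (intro CollectI conjI allI ballI)
    show "s \<in> extensional (prism 1)" by (simp add: s_def)
    fix k \<alpha> \<beta> assume a: "\<alpha> \<in> ord k 1" and b: "\<beta> \<in> ord k 1"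
    show "s (\<alpha>, \<beta>) \<in> Smp (row W 0) k" unfolding sv[OF a b] using Hin[OF fin[OF a] b] by simp
    fix m \<theta> assume th: "\<theta> \<in> ord m k"
    have "BAct ?S 1 0 (ocomp \<alpha> \<theta>) [0] f = BAct ?S k 0 \<theta> [0] (BAct ?S 1 0 \<alpha> [0] f)"
      using bs_act_act[OF SV f1 a zero_ord th zero_ord] by simp
    thus "s (ocomp \<alpha> \<theta>, ocomp \<beta> \<theta>) = Act (row W 0) k \<theta> (s (\<alpha>, \<beta>))"
      unfolding sv[OF a b] sv[OF ocomp_in_ord[OF a th] ocomp_in_ord[OF b th]]
      using Hact[OF fin[OF a] b th] by (simp add: idl_simps)
  qed
  have o: "[0,1] \<in> ord 1 1" "[0,0] \<in> ord 1 1" "[1,1] \<in> ord 1 1" by simp_all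
  have fi: "BAct ?S 1 0 [0,1] [0] f = f" using bs_act_id[OF SV f1] by (simp add: idl_simps)
  have fid: "BAct ?S 1 0 [0,0] [0] f = css_id ?S x" "BAct ?S 1 0 [1,1] [0] f = css_id ?S y"
    unfolding css_id_def bdegs_def fxy[symmetric]
    using bs_act_act[OF SV f1 _ zero_ord _ zero_ord, of "[0]" 0 "[0,0]" 1]
      bs_act_act[OF SV f1 _ zero_ord _ zero_ord, of "[1]" 0 "[0,0]" 1] by (simp_all add: const_op_simps)
  have "s ([0,1], [0,0]) = css_forget 1 (\<tau> 1 0 f)" "s ([0,1], [1,1]) = css_forget 1 f" "s ([0,0], [0,1]) = p" "s ([1,1], [0,1]) = p'"
    unfolding sv[OF o(1,2)] sv[OF o(1,3)] sv[OF o(2,1)] sv[OF o(3,1)] fi fid c2 p_def p'_def by (rule refl)+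
  thus ?thesis using that[OF e Hp[OF xy(1), folded p_def] Hp[OF xy(2), folded p'_def] sq] sP by blast
qed

lemma prism_square:
  assumes s: "s \<in> prism_maps (row W 0) 1"
  shows "cmp (cl (s ([0,1],[0,0]))) (cl (s ([1,1],[0,1]))) = cmp (cl (s ([0,0],[0,1]))) (cl (s ([0,1],[1,1])))"
proof -
  have o: "[0,1,1] \<in> ord 2 1" "[0,0,1] \<in> ord 2 1" by simp_all
  note u = prism_mapsD(2,3)[OF s o] and d = prism_mapsD(2,3)[OF s o(2,1)]
  have "qc_composite (row W 0) (s ([0,1],[0,0])) (s ([1,1],[0,1])) (s ([0,1],[0,1]))"
    unfolding qc_composite_def
    by (rule bexI[OF _ u(1)]) (use u(2)[of "[0,1]" 1] u(2)[of "[1,2]" 1] u(2)[of "[0,2]" 1] in simp)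
  moreover have "qc_composite (row W 0) (s ([0,0],[0,1])) (s ([0,1],[1,1])) (s ([0,1],[0,1]))"
    unfolding qc_composite_def
    by (rule bexI[OF _ d(1)]) (use d(2)[of "[0,1]" 1] d(2)[of "[1,2]" 1] d(2)[of "[0,2]" 1] in simp)
  ultimately show ?thesis using cmp_cl by simp
qed

lemma css_quotient_equiv:
  assumes fin: "css_finitely_complete W" and F: "css_filter W \<Phi>" and D: "css_diagram W \<Phi> rep t"
    and f: "f \<in> BSmp (css_quotient W \<Phi> rep t) 1 0" and m: "(v, fv) \<in> f"
  shows "css_equiv (css_quotient W \<Phi> rep t) f \<longleftrightarrow>
    (\<exists>u\<in>\<Phi>. \<exists>h. css_times_id W (css_forget 1 fv) (rep u) h \<and> css_equiv W h)"
proof -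
  let ?R = "css_map_exists W"
  interpret Dg: dir_bsset \<Phi> "sub_le ?R" "\<lambda>v. css_slice W (rep v)" t by (rule diagram_dir_bsset[OF fin F D])
  note iff = filter_directed_css(2)[OF fin F D]
  note rep = css_diagramD(1)[OF D]
  have obj: "rep w \<in> BSmp W 0 0" if "w \<in> \<Phi>" for w
    by (rule subobject_obj[OF rep_subobject[OF F that rep[OF that]]])
  note pf = css_diagramD(2)[OF D]
  obtain v0 a0 where a0: "v0 \<in> \<Phi>" "a0 \<in> BSmp (css_slice W (rep v0)) 1 0" "f = Dg.cln 1 0 v0 a0"
    using f unfolding css_quotient_def Dg.Q_Smp by blast
  have v: "v \<in> \<Phi>" "fv \<in> BSmp (css_slice W (rep v)) 1 0"
    using dirsys.cls_mem_sym[OF Dg.dirsys_level a0(1,2) m[unfolded a0(3)]] by auto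
  have fcl: "f = Dg.cln 1 0 v fv"
    unfolding a0(3) by (rule dirsys.cls_mem_eq[OF Dg.dirsys_level a0(1,2) m[unfolded a0(3)], symmetric])
  let ?Sv = "css_slice W (rep v)"
  define x where "x = BAct ?Sv 1 0 [0] [0] fv"
  define y where "y = BAct ?Sv 1 0 [1] [0] fv"
  have fe: "css_edge ?Sv fv x y" using v(2) by (simp add: css_edge_def x_def y_def)
  have fW: "css_edge W (css_forget 1 fv) (css_forget 0 x) (css_forget 0 y)" by (rule slice_css_edge(1)[OF obj[OF v(1)] fe])
  show ?thesis
  proof
    assume "css_equiv (css_quotient W \<Phi> rep t) f"
    then obtain w where w: "w \<in> \<Phi>" "sub_le ?R w v" and e: "css_equiv (css_slice W (rep w)) (t v w 1 0 fv)"
      using Dg.css_equiv_stage[OF v] unfolding css_quotient_def fcl by blast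
    obtain p p' where sq: "css_edge (css_slice W (rep w)) (t v w 1 0 fv) (t v w 0 0 x) (t v w 0 0 y)"
      "css_product W (css_forget 0 (t v w 0 0 x)) p (slice_edge (t v w 0 0 x)) (css_forget 0 x) (rep w)"
      "css_product W (css_forget 0 (t v w 0 0 y)) p' (slice_edge (t v w 0 0 y)) (css_forget 0 y) (rep w)"
      "\<exists>s\<in>prism_maps (row W 0) 1. s ([0,1], [0,0]) = css_forget 1 (t v w 1 0 fv) \<and> s ([0,1], [1,1]) = css_forget 1 fv \<and>
         s ([0,0], [0,1]) = p \<and> s ([1,1], [0,1]) = p'"
      by (rule product_functor_square[OF obj[OF v(1)] obj[OF w(1)] pf[OF v(1) w] fe])
    let ?h = "css_forget 1 (t v w 1 0 fv)"
    have r: "t v w 1 0 fv \<in> BSmp (css_slice W (rep w)) 1 0"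
      "BAct (css_slice W (rep w)) 1 0 [0] [0] (t v w 1 0 fv) = t v w 0 0 x"
      "BAct (css_slice W (rep w)) 1 0 [1] [0] (t v w 1 0 fv) = t v w 0 0 y"
      using sq(1) by (simp_all add: css_edge_def)
    have rr: "t v w 1 0 fv ([0,0], [0,1]) = slice_edge (t v w 0 0 x)" "t v w 1 0 fv ([1,1], [0,1]) = slice_edge (t v w 0 0 y)"
      using slice_edge_ends[OF W r(1), of 0] slice_edge_ends[OF W r(1), of 1] r(2,3) by simp_all
    have he: "css_edge W ?h (css_forget 0 (t v w 0 0 x)) (css_forget 0 (t v w 0 0 y))"
      by (rule slice_css_edge(1)[OF obj[OF w(1)] sq(1)])
    have re: "\<exists>r\<in>BSmp (css_slice W (rep w)) 1 0. css_forget 1 r = ?h \<and> r ([0,0], [0,1]) = slice_edge (t v w 0 0 x) \<and>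
      r ([1,1], [0,1]) = slice_edge (t v w 0 0 y)"
      by (rule bexI[OF _ r(1)]) (intro conjI refl rr)
    have "css_times_id W (css_forget 1 fv) (rep w) ?h"
      unfolding css_times_id_def
      by (intro exI) (intro conjI, rule fW, rule he, rule sq(2), rule sq(3), rule sq(4), rule re)
    moreover have "css_equiv W ?h"
      by (rule bisimplicial_map_css_equiv[OF css_forget_map[OF W] css_slice_bisimplicial[OF W obj[OF w(1)]] e])
    ultimately show "\<exists>u\<in>\<Phi>. \<exists>h. css_times_id W (css_forget 1 fv) (rep u) h \<and> css_equiv W h" using w(1) by blast
  next
    assume "\<exists>u\<in>\<Phi>. \<exists>h. css_times_id W (css_forget 1 fv) (rep u) h \<and> css_equiv W h"
    then obtain u h where u: "u \<in> \<Phi>" and h: "css_times_id W (css_forget 1 fv) (rep u) h" "css_equiv W h" by blast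
    obtain A B P Q p q p' q' s r where A: "css_edge W (css_forget 1 fv) A B" and hE: "css_edge W h P Q"
      and P: "css_product W P p q A (rep u)" and Q: "css_product W Q p' q' B (rep u)"
      and s: "s \<in> prism_maps (row W 0) 1" "s ([0,1], [0,0]) = h" "s ([0,1], [1,1]) = css_forget 1 fv"
        "s ([0,0], [0,1]) = p" "s ([1,1], [0,1]) = p'"
      and r: "r \<in> BSmp (css_slice W (rep u)) 1 0" "css_forget 1 r = h" "r ([0,0], [0,1]) = q" "r ([1,1], [0,1]) = q'"
      using h(1) unfolding css_times_id_def by blast
    have AB: "A = css_forget 0 x" "B = css_forget 0 y" using A fW by (auto simp: css_edge_def)
    \<comment> \<open>The given \<open>u\<close> need not lie below \<open>v\<close>; over a common
      lower bound both the transported map and the invertible product are available.\<close>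
    obtain w where w: "w \<in> \<Phi>" "sub_le ?R w v" "sub_le ?R w u" using Dg.dir[OF v(1) u] by blast
    obtain k k' where sq: "css_edge (css_slice W (rep w)) (t v w 1 0 fv) (t v w 0 0 x) (t v w 0 0 y)"
      "css_product W (css_forget 0 (t v w 0 0 x)) k (slice_edge (t v w 0 0 x)) (css_forget 0 x) (rep w)"
      "css_product W (css_forget 0 (t v w 0 0 y)) k' (slice_edge (t v w 0 0 y)) (css_forget 0 y) (rep w)"
      "cmp (cl (css_forget 1 (t v w 1 0 fv))) (cl k') = cmp (cl k) (cl (css_forget 1 fv))"
      by (rule product_functor_square[OF obj[OF v(1)] obj[OF w(1)] pf[OF v(1) w(1,2)] fe])
    have z: "t v w 0 0 x \<in> BSmp (css_slice W (rep w)) 0 0" "t v w 0 0 y \<in> BSmp (css_slice W (rep w)) 0 0"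
      using css_edge_objs[OF css_slice_bisimplicial[OF W obj[OF w(1)]] sq(1)] by auto
    have fh: "hm A B (cl (css_forget 1 fv))" by (rule edge_hm[OF A])
    have hp: "cmp (cl h) (cl p') = cmp (cl p) (cl (css_forget 1 fv))" using prism_square[OF s(1)] s by simp
    have hq: "cmp (cl h) (cl q') = cl q"
      using cmp_cl[OF slice_edge_composite[OF W I obj[OF u] r(1)]] r by simp
    have kp: "css_edge W k (css_forget 0 (t v w 0 0 x)) A" "css_edge W k' (css_forget 0 (t v w 0 0 y)) B"
      "css_edge W (slice_edge (t v w 0 0 x)) (css_forget 0 (t v w 0 0 x)) (rep w)"
      "css_edge W (slice_edge (t v w 0 0 y)) (css_forget 0 (t v w 0 0 y)) (rep w)"
      using sq(2,3) AB by (simp_all add: css_product_def)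
    obtain j where j: "css_edge W j (rep w) (rep u)" using w iff[OF w(1) u] unfolding css_map_exists_def by blast
    note FE = edge_hm[OF slice_css_edge(1)[OF obj[OF w(1)] sq(1)]]
    \<comment> \<open>The products with \<open>rep w\<close> map to \<open>rep u\<close> through
      \<open>j\<close>; this is the only way in which the invertibility over \<open>u\<close> is
      used over \<open>w\<close>.\<close>
    obtain a where a: "hm (css_forget 0 (t v w 0 0 y)) A a" "cmp a (cl (css_forget 1 fv)) = cl k'"
      "cmp (cl (css_forget 1 (t v w 1 0 fv))) a = cl k"
      using lift_inverse[OF product_hprod[OF P] product_hprod[OF Q] fh css_equiv_hiso[OF h(2) hE] hp hq
          edge_hm[OF kp(1)] edge_hm[OF kp(2)] FE sq(4) hm_cmp[OF edge_hm[OF kp(3)] edge_hm[OF j]]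
          hm_cmp[OF edge_hm[OF kp(4)] edge_hm[OF j]]] by blast
    have "css_equiv (css_slice W (rep w)) (t v w 1 0 fv)"
      by (rule slice_equiv[OF sq(2) z(1) refl sq(3) z(2) refl sq(1) fh[unfolded AB] sq(4) a(1)[unfolded AB] a(2,3)])
    from bisimplicial_map_css_equiv[OF Dg.cln_map[OF w(1)] css_slice_bisimplicial[OF W obj[OF w(1)]] this]
    have "css_equiv (css_quotient W \<Phi> rep t) (Dg.cln 1 0 w (t v w 1 0 fv))" unfolding css_quotient_def .
    thus "css_equiv (css_quotient W \<Phi> rep t) f"
      unfolding fcl dirsys.cls_restrict[OF Dg.dirsys_level v w(1,2)] .
  qed
qed

end

section \<open>Filter quotients of quasi-categories\<close>

lemma qc_slice_simps:
  "\<sigma> \<in> Smp (qc_slice C c) n \<longleftrightarrow> \<sigma> \<in> Smp C (Suc n) \<and> Act C (Suc n) [Suc n] \<sigma> = c"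
  "Act (qc_slice C c) n \<alpha> \<sigma> = Act C (Suc n) (\<alpha> @ [Suc n]) \<sigma>"
  by (simp_all add: qc_slice_def)

text \<open>The join of \<open>\<alpha>\<close> with the cone point, which is the last vertex in a
  slice.\<close>

lemma snoc_in_ord: "\<alpha> \<in> ord m n \<Longrightarrow> \<alpha> @ [Suc n] \<in> ord (Suc m) (Suc n)"
  by (auto simp: ord_def sorted_append)

lemma nth_snoc: "\<alpha> \<in> ord m n \<Longrightarrow> (\<alpha> @ [x]) ! Suc m = x"
  by (simp add: nth_append ord_length)

lemma ocomp_snoc:
  assumes a: "\<alpha> \<in> ord m n" and b: "\<beta> \<in> ord k m"
  shows "ocomp (\<alpha> @ [x]) \<beta> = ocomp \<alpha> \<beta>" "ocomp (\<alpha> @ [x]) (\<beta> @ [Suc m]) = ocomp \<alpha> \<beta> @ [x]"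
proof -
  have "\<forall>i\<in>set \<beta>. (\<alpha> @ [x]) ! i = \<alpha> ! i"
    using ord_le[OF b] ord_length[OF a] by (simp add: nth_append less_Suc_eq_le)
  thus 1: "ocomp (\<alpha> @ [x]) \<beta> = ocomp \<alpha> \<beta>" by (simp add: ocomp_def)
  show "ocomp (\<alpha> @ [x]) (\<beta> @ [Suc m]) = ocomp \<alpha> \<beta> @ [x]"
    using 1 by (simp add: ocomp_def nth_snoc[OF a])
qed

lemma idl_snoc: "idl n @ [Suc n] = idl (Suc n)"
  by (simp add: idl_def)

lemma idl_ord_Suc: "idl n \<in> ord n (Suc n)"
  by (rule ordI) simp_all

lemma qc_slice_simplicial:
  assumes C: "simplicial_set C"
  shows "simplicial_set (qc_slice C c)"
  unfolding simplicial_set_def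
proof (intro conjI allI ballI)
  fix m n \<alpha> \<sigma> assume a: "\<alpha> \<in> ord m n" and "\<sigma> \<in> Smp (qc_slice C c) n"
  hence s: "\<sigma> \<in> Smp C (Suc n)" "Act C (Suc n) [Suc n] \<sigma> = c" by (simp_all add: qc_slice_simps)
  show "Act (qc_slice C c) n \<alpha> \<sigma> \<in> Smp (qc_slice C c) m"
    unfolding qc_slice_simps
    using sset_act_in[OF C s(1) snoc_in_ord[OF a]] sset_act_act[OF C s(1) snoc_in_ord[OF a], of "[Suc m]" 0] s(2)
    by (simp add: nth_snoc[OF a])
  fix k \<beta> assume b: "\<beta> \<in> ord k m"
  show "Act (qc_slice C c) m \<beta> (Act (qc_slice C c) n \<alpha> \<sigma>) = Act (qc_slice C c) n (ocomp \<alpha> \<beta>) \<sigma>"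
    unfolding qc_slice_simps(2) ocomp_snoc(2)[OF a b, symmetric]
    by (rule sset_act_act[OF C s(1) snoc_in_ord[OF a] snoc_in_ord[OF b]])
next
  fix n \<sigma> assume "\<sigma> \<in> Smp (qc_slice C c) n"
  thus "Act (qc_slice C c) n (idl n) \<sigma> = \<sigma>" by (simp add: qc_slice_simps idl_snoc sset_act_id[OF C])
qed

lemma qc_forget_map:
  assumes C: "simplicial_set C"
  shows "simplicial_map (qc_slice C c) C (qc_forget C)"
  unfolding simplicial_map_def
proof (intro conjI allI ballI)
  show "qc_forget C n \<sigma> \<in> Smp C n" if "\<sigma> \<in> Smp (qc_slice C c) n" for n \<sigma>
    using that sset_act_in[OF C _ idl_ord_Suc] by (simp add: qc_forget_def qc_slice_simps)
  fix m n \<alpha> \<sigma> assume a: "\<alpha> \<in> ord m n" and "\<sigma> \<in> Smp (qc_slice C c) n"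
  hence s: "\<sigma> \<in> Smp C (Suc n)" by (simp add: qc_slice_simps)
  have "ocomp (\<alpha> @ [Suc n]) (idl m) = \<alpha>" using ocomp_snoc(1)[OF a idl_ord] ocomp_idl_right[OF ord_length[OF a]] by simp
  thus "qc_forget C m (Act (qc_slice C c) n \<alpha> \<sigma>) = Act C n \<alpha> (qc_forget C n \<sigma>)"
    unfolding qc_forget_def qc_slice_simps(2) sset_act_act[OF C s snoc_in_ord[OF a] idl_ord_Suc]
      sset_act_act[OF C s idl_ord_Suc a] by (simp add: ocomp_idl_left[OF a])
qed

lemma qc_cone_simps:
  "x \<in> Smp (qc_cone C a b) n \<longleftrightarrow> fst x \<in> Smp (qc_slice C a) n \<and> snd x \<in> Smp (qc_slice C b) n \<and>
     qc_forget C n (fst x) = qc_forget C n (snd x)"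
  "Act (qc_cone C a b) n \<alpha> x = (Act (qc_slice C a) n \<alpha> (fst x), Act (qc_slice C b) n \<alpha> (snd x))"
  by (auto simp: qc_cone_def split: prod.split)

lemma qc_cone_simplicial:
  assumes C: "simplicial_set C"
  shows "simplicial_set (qc_cone C a b)"
proof -
  note A = qc_slice_simplicial[OF C]
  note F = simplicial_map_act[OF qc_forget_map[OF C]]
  show ?thesis unfolding simplicial_set_def
  proof (intro conjI allI ballI)
    fix m n \<alpha> x assume al: "\<alpha> \<in> ord m n" and "x \<in> Smp (qc_cone C a b) n"
    hence x: "fst x \<in> Smp (qc_slice C a) n" "snd x \<in> Smp (qc_slice C b) n" "qc_forget C n (fst x) = qc_forget C n (snd x)"
      by (simp_all add: qc_cone_simps)
    show "Act (qc_cone C a b) n \<alpha> x \<in> Smp (qc_cone C a b) m"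
      unfolding qc_cone_simps fst_conv snd_conv F[OF x(1) al] F[OF x(2) al] x(3)
      using sset_act_in[OF A x(1) al] sset_act_in[OF A x(2) al] by simp
    fix k \<beta> assume b: "\<beta> \<in> ord k m"
    show "Act (qc_cone C a b) m \<beta> (Act (qc_cone C a b) n \<alpha> x) = Act (qc_cone C a b) n (ocomp \<alpha> \<beta>) x"
      unfolding qc_cone_simps fst_conv snd_conv sset_act_act[OF A x(1) al b] sset_act_act[OF A x(2) al b] ..
  next
    fix n x assume "x \<in> Smp (qc_cone C a b) n"
    thus "Act (qc_cone C a b) n (idl n) x = x"
      unfolding qc_cone_simps by (simp add: sset_act_id[OF A])
  qed
qed

lemma qc_cone_snd: "simplicial_map (qc_cone C a b) (qc_slice C b) (\<lambda>n. snd)"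
  unfolding simplicial_map_def by (simp add: qc_cone_simps)

lemma qc_final_edge:
  assumes E: "simplicial_set E" and e: "qc_final E e" and x: "x \<in> Smp E 0"
  shows "\<exists>w. edge E w x e"
proof (rule glue_facets[where X = E and n = 1 and I = "{..1}" and x = "\<lambda>i. if i = 0 then e else x"])
  have e0: "e \<in> Smp E 0" using e by (simp add: qc_final_def)
  show "(if i = 0 then e else x) \<in> Smp E (1 - 1)" for i :: nat using e0 x by simp
  fix g assume g: "partial_simplex E 1 (facets 1 {..1}) g" "\<And>i. i \<in> {..1} \<Longrightarrow> g (face 1 i) = (if i = 0 then e else x)"
  have "g [1] = e" using g(2)[of 0] by (simp add: face_simps)
  then obtain z where z: "fills E 1 (boundary 1) g z"
    using e g(1) unfolding qc_final_def boundary_facets by (metis order_refl)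
  have "Act E 1 (face 1 i) z = (if i = 0 then e else x)" if "i \<in> {..1}" for i
    using fills_face[OF z _ that] g(2)[OF that] by (simp add: boundary_facets)
  from this[of 0] this[of 1] show ?thesis
    using z by (auto simp: edge_def fills_def face_simps)
qed (use E in auto)

text \<open>Three edges with matching ends bound a triangle whose last vertex is \<open>e\<close>,
  and finality fills it. Thus any two maps into \<open>e\<close> are compatible with every map
  between their sources.\<close>

lemma qc_final_composite:
  assumes E: "simplicial_set E" and e: "qc_final E e"
    and u: "edge E u x y" and v: "edge E v y e" and w: "edge E w x e"
  shows "qc_composite E u v w"
proof (rule glue_facets[where X = E and n = 2 and I = "{..2}" and x = "\<lambda>i. if i = 0 then v else if i = 1 then w else u"])
  let ?x = "\<lambda>i::nat. if i = 0 then v else if i = 1 then w else u"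
  show "?x i \<in> Smp E (2 - 1)" for i using u v w by (simp add: edge_def)
  show "Act E (2 - 1) (face (2 - 1) i) (?x j) = Act E (2 - 1) (face (2 - 1) (j - 1)) (?x i)"
    if ij: "i \<in> {..2}" "j \<in> {..2}" "i < j" for i j
  proof -
    have "i = 0 \<and> j = 1 \<or> i = 0 \<and> j = 2 \<or> i = 1 \<and> j = 2" using ij by auto
    then consider "i = 0" "j = 1" | "i = 0" "j = 2" | "i = 1" "j = 2" by blast
    thus ?thesis using u v w by cases (simp_all add: edge_def face_simps)
  qed
  fix g assume g: "partial_simplex E 2 (facets 2 {..2}) g" "\<And>i. i \<in> {..2} \<Longrightarrow> g (face 2 i) = ?x i"
    "\<And>i \<alpha> m. i \<in> {..2} \<Longrightarrow> \<alpha> \<in> ord m 2 \<Longrightarrow> i \<notin> set \<alpha> \<Longrightarrow> g \<alpha> = Act E (2 - 1) (squeeze i \<alpha>) (?x i)"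
  have "g [2] = e" using g(3)[of 0 "[2]" 0] v by (simp add: squeeze_def edge_def)
  moreover have "\<forall>n g. 1 \<le> n \<and> partial_simplex E n (boundary n) g \<and> g [n] = e \<longrightarrow> (\<exists>x. fills E n (boundary n) g x)"
    using e unfolding qc_final_def by (elim conjE)
  moreover have "partial_simplex E 2 (boundary 2) g" using g(1) by (simp add: boundary_facets)
  ultimately have "\<exists>z. fills E 2 (boundary 2) g z" by (metis one_le_numeral)
  then obtain z where z: "fills E 2 (boundary 2) g z" by (elim exE)
  have "Act E 2 (face 2 i) z = ?x i" if "i \<in> {..2}" for i
    using fills_face[OF z _ that] g(2)[OF that] by (simp add: boundary_facets)
  from this[of 0] this[of 1] this[of 2] show ?thesis
    unfolding qc_composite_def using z by (intro bexI[of _ z]) (auto simp: fills_def face_simps)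
qed (use E in auto)

lemma qc_id_edge:
  assumes "simplicial_set E" "x \<in> Smp E 0"
  shows "edge E (qc_id E x) x x"
  unfolding edge_def qc_id_def
  using sset_act_in[OF assms, of "[0,0]" 1] sset_act_act[OF assms, of "[0,0]" 1 "[0]" 0]
    sset_act_act[OF assms, of "[0,0]" 1 "[1]" 0] sset_act_id[OF assms] by (simp add: idl_simps)

section \<open>Products and slice equivalences in a quasi-category\<close>

locale quasicat =
  fixes C :: "'a sset"
  assumes quasi: "quasi_category C"
begin

lemma C: "simplicial_set C"
  using quasi by (simp add: quasi_category_def)

sublocale hocat "\<lambda>x y f. edge C f x y" "qc_composite C" "qc_id C"
  by (rule hocat_sset[OF quasi_category_inner3[OF quasi]])

lemma edge_obj: "edge C f x y \<Longrightarrow> x \<in> Smp C 0 \<and> y \<in> Smp C 0"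
  using sset_act_in[OF C, of f 1 _ 0] by (auto simp: edge_def)

lemma slice_edge_iff:
  "edge (qc_slice C c) \<phi> f g \<longleftrightarrow> \<phi> \<in> Smp C 2 \<and> Act C 2 [2] \<phi> = c \<and> Act C 2 [0,2] \<phi> = f \<and> Act C 2 [1,2] \<phi> = g"
  by (auto simp: edge_def qc_slice_simps numeral_2_eq_2)

lemma slice_obj_iff: "f \<in> Smp (qc_slice C c) 0 \<longleftrightarrow> edge C f (qc_forget C 0 f) c"
  by (auto simp: edge_def qc_slice_simps qc_forget_def idl_simps)

lemma slice_edge_T:
  assumes "edge (qc_slice C c) \<phi> f g"
  shows "qc_composite C (qc_forget C 1 \<phi>) g f"
proof -
  have "qc_forget C 1 \<phi> = Act C 2 [0,1] \<phi>" by (simp add: qc_forget_def idl_simps numeral_2_eq_2)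
  thus ?thesis using assms unfolding slice_edge_iff qc_composite_def
    by (intro bexI[of _ \<phi>]) simp_all
qed

lemma slice_edge_of_T:
  assumes T: "qc_composite C k g f" and g: "edge C g y c"
  shows "\<exists>\<phi>. edge (qc_slice C c) \<phi> f g \<and> qc_forget C 1 \<phi> = k"
proof -
  obtain \<sigma> where s: "\<sigma> \<in> Smp C 2" "Act C 2 [0,1] \<sigma> = k" "Act C 2 [1,2] \<sigma> = g" "Act C 2 [0,2] \<sigma> = f"
    using T unfolding qc_composite_def by blast
  have "Act C 2 [2] \<sigma> = c"
    using sset_act_act[OF C s(1), of "[1,2]" 1 "[1]" 0] s(3) g by (simp add: edge_def)
  moreover have "qc_forget C 1 \<sigma> = k" using s(2) by (simp add: qc_forget_def idl_simps numeral_2_eq_2)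
  ultimately show ?thesis unfolding slice_edge_iff using s by (intro exI[of _ \<sigma>]) simp
qed

lemma forget_edge: "edge (qc_slice C c) \<phi> f g \<Longrightarrow> edge C (qc_forget C 1 \<phi>) (qc_forget C 0 f) (qc_forget C 0 g)"
  by (rule simplicial_map_edge[OF qc_forget_map[OF C]])

lemma forget_obj: "edge C f x c \<Longrightarrow> qc_forget C 0 f = x"
  by (simp add: edge_def qc_forget_def idl_simps)

lemma cone_edge_iff:
  "edge (qc_cone C a b) w (f, g) (p, q) \<longleftrightarrow> edge (qc_slice C a) (fst w) f p \<and> edge (qc_slice C b) (snd w) g q \<and>
     qc_forget C 1 (fst w) = qc_forget C 1 (snd w)"
  unfolding edge_def qc_cone_simps by auto

lemma cone_obj:
  assumes "edge C f x a" "edge C g x b"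
  shows "(f, g) \<in> Smp (qc_cone C a b) 0"
  using assms forget_obj[OF assms(1)] forget_obj[OF assms(2)] by (simp add: qc_cone_simps slice_obj_iff)

lemma product_lift:
  assumes P: "qc_product C P p q a b" and f: "edge C f x a" and g: "edge C g x b"
  shows "\<exists>\<phi> \<psi>. edge (qc_cone C a b) (\<phi>, \<psi>) (f, g) (p, q)"
proof -
  have "qc_final (qc_cone C a b) (p, q)" using P by (simp add: qc_product_def)
  from qc_final_edge[OF qc_cone_simplicial[OF C] this cone_obj[OF f g]] show ?thesis by auto
qed

lemma product_triangle:
  assumes P: "qc_product C P p q a b" and u: "edge (qc_cone C a b) u x y"
    and v: "edge (qc_cone C a b) v y (p, q)" and w: "edge (qc_cone C a b) w x (p, q)"
  shows "qc_composite (qc_slice C b) (snd u) (snd v) (snd w)"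
proof -
  have "qc_final (qc_cone C a b) (p, q)" using P by (simp add: qc_product_def)
  from simplicial_map_composite[OF qc_cone_snd qc_final_composite[OF qc_cone_simplicial[OF C] this u v w]]
  show ?thesis .
qed

lemma cone_edge_composites:
  assumes f: "edge C f x a" and p: "edge C p P a"
    and e: "edge (qc_cone C a b) (\<phi>, \<psi>) (f, g) (p, q)"
  shows "edge C (qc_forget C 1 \<psi>) x P" "cmp (cl (qc_forget C 1 \<psi>)) (cl p) = cl f" "cmp (cl (qc_forget C 1 \<psi>)) (cl q) = cl g"
proof -
  have e': "edge (qc_slice C a) \<phi> f p" "edge (qc_slice C b) \<psi> g q" "qc_forget C 1 \<phi> = qc_forget C 1 \<psi>"
    using e unfolding cone_edge_iff by simp_all
  show "edge C (qc_forget C 1 \<psi>) x P"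
    using forget_edge[OF e'(1)] forget_obj[OF f] forget_obj[OF p] e'(3) by simp
  show "cmp (cl (qc_forget C 1 \<psi>)) (cl p) = cl f" using cmp_cl[OF slice_edge_T[OF e'(1)]] e'(3) by simp
  show "cmp (cl (qc_forget C 1 \<psi>)) (cl q) = cl g" by (rule cmp_cl[OF slice_edge_T[OF e'(2)]])
qed

lemma slice_edge_of_cmp:
  assumes "edge C k x y" "edge C p y c" "edge C f x c" "cmp (cl k) (cl p) = cl f"
  shows "\<exists>\<phi>. edge (qc_slice C c) \<phi> f p \<and> qc_forget C 1 \<phi> = k"
  by (rule slice_edge_of_T[OF _ assms(2)]) (use T_iff[OF assms(1-3)] assms(4) in simp)

text \<open>Existence is an edge into the final cone. For uniqueness, two edges between the same
  cones form with an identity a triangle ending in the final cone; the filler, projected to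
  \<open>C\<close>, shows that the underlying maps are homotopic.\<close>

lemma product_hprod:
  assumes P: "qc_product C P p q a b"
  shows "hprod P (cl p) (cl q) a b"
  unfolding hprod_def
proof (intro conjI allI impI; (elim conjE)?)
  have pq: "edge C p P a" "edge C q P b" using P by (simp_all add: qc_product_def)
  show "hm P a (cl p)" "hm P b (cl q)" using hmI[OF pq(1)] hmI[OF pq(2)] by auto
  show "\<exists>k. hm Z P k \<and> cmp k (cl p) = A \<and> cmp k (cl q) = B" if "hm Z a A" "hm Z b B" for Z A B
  proof -
    obtain f g where f: "edge C f Z a" "A = cl f" and g: "edge C g Z b" "B = cl g"
      using \<open>hm Z a A\<close> \<open>hm Z b B\<close> unfolding hm_def by blast
    obtain \<phi> \<psi> where "edge (qc_cone C a b) (\<phi>, \<psi>) (f, g) (p, q)" using product_lift[OF P f(1) g(1)] by blast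
    note ce = cone_edge_composites[OF f(1) pq(1) this]
    show ?thesis using ce(2,3) f(2) g(2) hmI[OF ce(1)] by blast
  qed
  show "K = K'" if K: "hm Z P K" and K': "hm Z P K'"
    and e: "cmp K (cl p) = cmp K' (cl p)" "cmp K (cl q) = cmp K' (cl q)" for Z K K'
  proof -
    obtain k k' where k: "edge C k Z P" "K = cl k" and k': "edge C k' Z P" "K' = cl k'"
      using K K' unfolding hm_def by blast
    obtain f where f: "edge C f Z a" "cmp K (cl p) = cl f" using hm_cmp[OF K hmI[OF pq(1)]] unfolding hm_def by blast
    obtain g where g: "edge C g Z b" "cmp K (cl q) = cl g" using hm_cmp[OF K hmI[OF pq(2)]] unfolding hm_def by blast
    have lift: "\<exists>w. edge (qc_cone C a b) w (f, g) (p, q) \<and> qc_forget C 1 (snd w) = l"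
      if l: "edge C l Z P" "cmp (cl l) (cl p) = cl f" "cmp (cl l) (cl q) = cl g" for l
    proof -
      obtain \<phi> where 1: "edge (qc_slice C a) \<phi> f p" "qc_forget C 1 \<phi> = l"
        using slice_edge_of_cmp[OF l(1) pq(1) f(1) l(2)] by blast
      obtain \<psi> where 2: "edge (qc_slice C b) \<psi> g q" "qc_forget C 1 \<psi> = l"
        using slice_edge_of_cmp[OF l(1) pq(2) g(1) l(3)] by blast
      show ?thesis unfolding cone_edge_iff by (rule exI[of _ "(\<phi>, \<psi>)"]) (use 1 2 in simp)
    qed
    obtain w where w: "edge (qc_cone C a b) w (f, g) (p, q)" "qc_forget C 1 (snd w) = k"
      using lift[OF k(1)] f(2) g(2) k(2) by auto
    obtain w' where w': "edge (qc_cone C a b) w' (f, g) (p, q)" "qc_forget C 1 (snd w') = k'"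
      using lift[OF k'(1)] f(2) g(2) k'(2) e by auto
    have idf: "qc_forget C 1 (qc_id (qc_slice C b) g) = qc_id C Z"
      using simplicial_map_id[OF qc_forget_map[OF C], of g b] g(1) forget_obj[OF g(1)] by (simp add: slice_obj_iff)
    note ci = qc_id_edge[OF qc_cone_simplicial[OF C] cone_obj[OF f(1) g(1)]]
    have "snd (qc_id (qc_cone C a b) (f, g)) = qc_id (qc_slice C b) g" by (simp add: qc_id_def qc_cone_simps)
    hence "qc_composite (qc_slice C b) (qc_id (qc_slice C b) g) (snd w') (snd w)"
      using product_triangle[OF P ci w'(1) w(1)] by simp
    from simplicial_map_composite[OF qc_forget_map[OF C] this]
    have "qc_composite C (qc_id C Z) k' k" unfolding idf w(2) w'(2) .
    hence "cmp (hid Z) (cl k') = cl k" using cmp_cl by (simp add: hid_def)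
    thus ?thesis using cmp_id(1)[OF K'] k(2) k'(2) by simp
  qed
qed

lemma qc_equiv_hiso:
  assumes "qc_equiv C f" "edge C f x y"
  shows "hiso x y (cl f)"
proof -
  obtain x' y' g where o: "edge C f x' y'" "edge C g y' x'"
    "qc_composite C f g (qc_id C x')" "qc_composite C g f (qc_id C y')"
    using assms(1) unfolding qc_equiv_def by blast
  have "x' = x" "y' = y" using o(1) assms(2) by (auto simp: edge_def)
  thus ?thesis using hiso_left_right[OF hmI[OF o(1)] hmI[OF o(2)] hmI[OF o(2)]]
      cmp_cl[OF o(3)] cmp_cl[OF o(4)] by (simp add: hid_def)
qed

text \<open>\<open>F\<close> and \<open>G\<close> lift to morphisms of cones between
  \<open>(p, z)\<close> and \<open>(h, z')\<close>. With the identity they bound a triangle ending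
  in the product cone, so its filler gives the composite in the slice directly.\<close>

lemma slice_composite_id:
  assumes P: "qc_product C P p z a c" and F: "edge (qc_slice C c) F z z'" and G: "edge (qc_slice C c) G z' z"
    and h: "edge C h (qc_forget C 0 z') a"
    and e: "cmp (cl (qc_forget C 1 F)) (cl h) = cl p" "cmp (cl (qc_forget C 1 G)) (cl p) = cl h"
  shows "qc_composite (qc_slice C c) F G (qc_id (qc_slice C c) z)"
proof -
  have pz: "edge C p P a" "edge C z P c" using P by (simp_all add: qc_product_def)
  note zP = forget_obj[OF pz(2)]
  have FG: "edge C (qc_forget C 1 F) P (qc_forget C 0 z')" "edge C (qc_forget C 1 G) (qc_forget C 0 z') P"
    using forget_edge[OF F] forget_edge[OF G] zP by simp_all
  obtain \<phi> where 1: "edge (qc_slice C a) \<phi> p h" "qc_forget C 1 \<phi> = qc_forget C 1 F"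
    using slice_edge_of_cmp[OF FG(1) h pz(1) e(1)] by blast
  obtain \<psi> where 2: "edge (qc_slice C a) \<psi> h p" "qc_forget C 1 \<psi> = qc_forget C 1 G"
    using slice_edge_of_cmp[OF FG(2) pz(1) h e(2)] by blast
  have c1: "edge (qc_cone C a c) (\<phi>, F) (p, z) (h, z')" "edge (qc_cone C a c) (\<psi>, G) (h, z') (p, z)"
    unfolding cone_edge_iff using 1 2 F G by simp_all
  note ci = qc_id_edge[OF qc_cone_simplicial[OF C] cone_obj[OF pz]]
  have "snd (qc_id (qc_cone C a c) (p, z)) = qc_id (qc_slice C c) z" by (simp add: qc_id_def qc_cone_simps)
  thus ?thesis using product_triangle[OF P c1 ci] by simp
qed

text \<open>The inverse \<open>G\<close> is induced by the product \<open>P\<close> from a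
  representative of \<open>A\<close> and the structure map \<open>z'\<close>. One composite is
  treated with the product cone of \<open>P\<close>, the other with that of
  \<open>P'\<close>.\<close>

lemma slice_equiv:
  assumes P: "qc_product C P p z a c" and P': "qc_product C P' p' z' b c"
    and F: "edge (qc_slice C c) F z z'" and f: "hm a b f" and Fp: "cmp (cl (qc_forget C 1 F)) (cl p') = cmp (cl p) f"
    and A: "hm P' a A" "cmp A f = cl p'" "cmp (cl (qc_forget C 1 F)) A = cl p"
  shows "qc_equiv (qc_slice C c) F"
proof -
  let ?S = "qc_slice C c"
  have pz: "edge C p P a" "edge C z P c" and pz': "edge C p' P' b" "edge C z' P' c"
    using P P' by (simp_all add: qc_product_def)
  note zP = forget_obj[OF pz(2)] forget_obj[OF pz'(2)]
  obtain h where h: "edge C h P' a" "A = cl h" using A(1) unfolding hm_def by blast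
  obtain \<phi> G where g: "edge (qc_cone C a c) (\<phi>, G) (h, z') (p, z)" using product_lift[OF P h(1) pz'(2)] by blast
  note gc = cone_edge_composites[OF h(1) pz(1) g]
  have G: "edge ?S G z' z" using g unfolding cone_edge_iff by simp
  have Fe: "edge C (qc_forget C 1 F) P P'" using forget_edge[OF F] zP by simp
  note hms = hmI[OF Fe] hmI[OF gc(1)] hmI[OF pz(1)] hmI[OF pz'(1)]
  have 1: "qc_composite ?S F G (qc_id ?S z)"
    by (rule slice_composite_id[OF P F G, of h]) (use h zP A(3) gc(2) in simp_all)
  \<comment> \<open>\<open>f\<close> is only a class, whereas the second use of
    \<open>slice_composite_id\<close> asks for an edge from \<open>P\<close> to
    \<open>b\<close>.\<close>
  obtain l where l: "edge C l P b" "cmp (cl p) f = cl l" using hm_cmp[OF hms(3) f] unfolding hm_def by blast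
  have Gl: "cmp (cl (qc_forget C 1 G)) (cl l) = cl p'"
    unfolding l(2)[symmetric] using cmp_assoc[OF hms(2,3) f] gc(2) h(2) A(2) by simp
  have 2: "qc_composite ?S G F (qc_id ?S z')"
    by (rule slice_composite_id[OF P' G F, of l]) (use l zP Gl Fp in simp_all)
  show ?thesis unfolding qc_equiv_def
    using 1 2 F G by (intro exI conjI)
qed

end

section \<open>The transition functors and the comparison with the product\<close>

lemma qc_diagramD:
  assumes "qc_diagram C \<Phi> rep t"
  shows "v \<in> \<Phi> \<Longrightarrow> rep v \<in> v"
    and "v \<in> \<Phi> \<Longrightarrow> u \<in> \<Phi> \<Longrightarrow> sub_le (qc_map_exists C) u v \<Longrightarrow> qc_product_functor C (rep v) (rep u) (t v u)"
    and "v \<in> \<Phi> \<Longrightarrow> \<sigma> \<in> Smp (qc_slice C (rep v)) n \<Longrightarrow> t v v n \<sigma> = \<sigma>"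
    and "v \<in> \<Phi> \<Longrightarrow> u \<in> \<Phi> \<Longrightarrow> w \<in> \<Phi> \<Longrightarrow> sub_le (qc_map_exists C) u v \<Longrightarrow> sub_le (qc_map_exists C) w u \<Longrightarrow>
      \<sigma> \<in> Smp (qc_slice C (rep v)) n \<Longrightarrow> t u w n (t v u n \<sigma>) = t v w n \<sigma>"
  using assms unfolding qc_diagram_def by simp_all

context quasicat
begin

lemma map_exists_trans: "qc_map_exists C U V \<Longrightarrow> qc_map_exists C V X \<Longrightarrow> qc_map_exists C U X"
proof -
  assume "qc_map_exists C U V" "qc_map_exists C V X"
  then obtain f g where fg: "edge C f U V" "edge C g V X" unfolding qc_map_exists_def by blast
  obtain h where h: "qc_composite C f g h" using T_ex[OF fg] by blast
  have "edge C h U X" by (rule T_arrs(2)[OF h fg])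
  thus ?thesis unfolding qc_map_exists_def by blast
qed

lemma subobject_obj:
  assumes "U \<in> qc_subobjects C"
  shows "U \<in> Smp C 0" "qc_map_exists C U U"
proof -
  obtain e m where m: "edge C m U e" using assms unfolding qc_subobjects_def by blast
  show "U \<in> Smp C 0" using edge_obj[OF m] by simp
  show "qc_map_exists C U U" using id_arr[OF m] unfolding qc_map_exists_def by blast
qed

lemma rep_subobject:
  assumes "qc_filter C \<Phi>" "v \<in> \<Phi>" "U \<in> v"
  shows "U \<in> qc_subobjects C"
proof -
  have "\<Phi> \<subseteq> sub_poset (qc_subobjects C) (qc_map_exists C)"
    using assms(1) unfolding qc_filter_def product_closed_filter_def by (elim conjE)
  thus ?thesis using assms(2,3) unfolding sub_poset_def sub_class_def by auto
qed

lemma product_functor_square: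
  assumes pf: "qc_product_functor C V U \<tau>" and f: "edge (qc_slice C V) f x y"
  obtains p p' d where
    "edge (qc_slice C U) (\<tau> 1 f) (\<tau> 0 x) (\<tau> 0 y)"
    "qc_product C (qc_forget C 0 (\<tau> 0 x)) p (\<tau> 0 x) (qc_forget C 0 x) U"
    "qc_product C (qc_forget C 0 (\<tau> 0 y)) p' (\<tau> 0 y) (qc_forget C 0 y) U"
    "qc_composite C p (qc_forget C 1 f) d" "qc_composite C (qc_forget C 1 (\<tau> 1 f)) p' d"
proof -
  let ?S = "qc_slice C V"
  note SV = qc_slice_simplicial[OF C, of V]
  obtain H where HH: "simplicial_map (sprod ?S (Delta 1)) C H \<and>
      (\<forall>n. \<forall>\<sigma>\<in>Smp ?S n. H n (\<sigma>, const_op n 0) = qc_forget C n (\<tau> n \<sigma>) \<and> H n (\<sigma>, const_op n 1) = qc_forget C n \<sigma>) \<and>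
      (\<forall>\<sigma>\<in>Smp ?S 0. qc_product C (qc_forget C 0 (\<tau> 0 \<sigma>)) (H 1 (qc_id ?S \<sigma>, [0,1])) (\<tau> 0 \<sigma>) (qc_forget C 0 \<sigma>) U)"
    using pf[unfolded qc_product_functor_def, THEN conjunct2] by (rule exE)
  note t = pf[unfolded qc_product_functor_def, THEN conjunct1]
    and H = HH[THEN conjunct1]
    and He = HH[THEN conjunct2, THEN conjunct1, rule_format]
    and Hp = HH[THEN conjunct2, THEN conjunct2, rule_format]
  have f1: "f \<in> Smp ?S 1" and xy: "x = Act ?S 1 [0] f" "y = Act ?S 1 [1] f" using f by (auto simp: edge_def)
  have xy0: "x \<in> Smp ?S 0" "y \<in> Smp ?S 0" unfolding xy by (rule sset_act_in[OF SV f1], simp)+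
  have c2: "H 1 (f, [0,0]) = qc_forget C 1 (\<tau> 1 f)" "H 1 (f, [1,1]) = qc_forget C 1 f"
    using He[OF f1] by (simp_all add: const_op_simps)
  show ?thesis
    by (rule that[OF simplicial_map_edge[OF t f] Hp[OF xy0(1)] Hp[OF xy0(2)]
        homotopy_natural(2)[OF SV H f, unfolded c2] homotopy_natural(1)[OF SV H f, unfolded c2]])
qed

text \<open>As for Segal spaces, products of representatives are read off from the transition
  functor that starts at the greatest element.\<close>

lemma filter_products:
  assumes fin: "qc_finitely_complete C" and F: "qc_filter C \<Phi>" and D: "qc_diagram C \<Phi> rep t"
    and u: "u \<in> \<Phi>" and v: "v \<in> \<Phi>"
  shows "\<exists>P p q. qc_product C P p q (rep u) (rep v)"
proof -
  let ?R = "qc_map_exists C"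
  obtain e where e: "qc_final C e" using fin unfolding qc_finitely_complete_def by blast
  define top where "top = sub_class (qc_subobjects C) ?R e"
  have "\<forall>e. qc_final C e \<longrightarrow> sub_class (qc_subobjects C) ?R e \<in> \<Phi>"
    using F unfolding qc_filter_def product_closed_filter_def by (elim conjE)
  hence top: "top \<in> \<Phi>" using e unfolding top_def by simp
  note rep = qc_diagramD(1)[OF D]
  have obj: "rep w \<in> Smp C 0" if "w \<in> \<Phi>" for w
    by (rule subobject_obj(1)[OF rep_subobject[OF F that rep[OF that]]])
  have et: "?R e (rep top)" using rep[OF top] unfolding top_def sub_class_def by blast
  have Rtop: "?R (rep w) (rep top)" if "w \<in> \<Phi>" for w
  proof -
    have "?R (rep w) e" unfolding qc_map_exists_def by (rule qc_final_edge[OF C e obj[OF that]])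
    thus ?thesis using map_exists_trans et by blast
  qed
  have "sub_le ?R v top" unfolding sub_le_def using rep[OF v] rep[OF top] Rtop[OF v] by blast
  hence pf: "qc_product_functor C (rep top) (rep v) (t top v)" by (rule qc_diagramD(2)[OF D top v])
  obtain i where i: "edge C i (rep u) (rep top)" using Rtop[OF u] unfolding qc_map_exists_def by blast
  have "i \<in> Smp (qc_slice C (rep top)) 0" using i forget_obj[OF i] by (simp add: slice_obj_iff)
  \<comment> \<open>\<open>product_functor_square\<close> speaks about edges of the slice; the
    degenerate edge reduces an object to that case.\<close>
  hence ii: "edge (qc_slice C (rep top)) (qc_id (qc_slice C (rep top)) i) i i"
    by (rule qc_id_edge[OF qc_slice_simplicial[OF C]])
  obtain p where "qc_product C (qc_forget C 0 (t top v 0 i)) p (t top v 0 i) (qc_forget C 0 i) (rep v)"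
    by (rule product_functor_square[OF pf ii])
  thus ?thesis unfolding forget_obj[OF i] by blast
qed

lemma filter_directed_qc:
  assumes fin: "qc_finitely_complete C" and F: "qc_filter C \<Phi>" and D: "qc_diagram C \<Phi> rep t"
  shows "directed \<Phi> (sub_le (qc_map_exists C))"
    and "\<And>u v. u \<in> \<Phi> \<Longrightarrow> v \<in> \<Phi> \<Longrightarrow> sub_le (qc_map_exists C) u v \<longleftrightarrow> qc_map_exists C (rep u) (rep v)"
proof -
  have prod: "\<exists>P. (\<exists>p q. qc_product C P p q (rep u) (rep v)) \<and> qc_map_exists C P (rep u) \<and> qc_map_exists C P (rep v)"
    if u: "u \<in> \<Phi>" and v: "v \<in> \<Phi>" for u v
    using filter_products[OF fin F D u v] unfolding qc_map_exists_def qc_product_def by blast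
  note fd = filter_directed[where Ob = UNIV, OF F[unfolded qc_filter_def] subset_UNIV UNIV_I subobject_obj(2) map_exists_trans qc_diagramD(1)[OF D] prod]
  show "directed \<Phi> (sub_le (qc_map_exists C))" by (rule fd(1))
  show "\<And>u v. u \<in> \<Phi> \<Longrightarrow> v \<in> \<Phi> \<Longrightarrow> sub_le (qc_map_exists C) u v \<longleftrightarrow> qc_map_exists C (rep u) (rep v)" by (rule fd(2))
qed

lemma diagram_dir_sset:
  assumes fin: "qc_finitely_complete C" and F: "qc_filter C \<Phi>" and D: "qc_diagram C \<Phi> rep t"
  shows "dir_sset \<Phi> (sub_le (qc_map_exists C)) (\<lambda>v. qc_slice C (rep v)) t"
proof -
  interpret directed \<Phi> "sub_le (qc_map_exists C)" by (rule filter_directed_qc(1)[OF fin F D])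
  show ?thesis
  proof
    show "simplicial_set (qc_slice C (rep v))" for v by (rule qc_slice_simplicial[OF C])
    show "simplicial_map (qc_slice C (rep v)) (qc_slice C (rep w)) (t v w)"
      if "v \<in> \<Phi>" "w \<in> \<Phi>" "sub_le (qc_map_exists C) w v" for v w
      using qc_diagramD(2)[OF D that] unfolding qc_product_functor_def by (elim conjE)
    show "t v v n a = a" if "v \<in> \<Phi>" "a \<in> Smp (qc_slice C (rep v)) n" for v a n
      by (rule qc_diagramD(3)[OF D that])
    show "t w x n (t v w n a) = t v x n a"
      if "v \<in> \<Phi>" "w \<in> \<Phi>" "x \<in> \<Phi>" "sub_le (qc_map_exists C) w v" "sub_le (qc_map_exists C) x w"
        "a \<in> Smp (qc_slice C (rep v)) n" for v w x a n
      by (rule qc_diagramD(4)[OF D that])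
  qed
qed

lemma qc_quotient_equiv:
  assumes fin: "qc_finitely_complete C" and F: "qc_filter C \<Phi>" and D: "qc_diagram C \<Phi> rep t"
    and f: "f \<in> Smp (qc_quotient C \<Phi> rep t) 1" and m: "(v, fv) \<in> f"
  shows "qc_equiv (qc_quotient C \<Phi> rep t) f \<longleftrightarrow>
    (\<exists>u\<in>\<Phi>. \<exists>h. qc_times_id C (qc_forget C 1 fv) (rep u) h \<and> qc_equiv C h)"
proof -
  let ?R = "qc_map_exists C"
  interpret Dg: dir_sset \<Phi> "sub_le ?R" "\<lambda>v. qc_slice C (rep v)" t by (rule diagram_dir_sset[OF fin F D])
  note iff = filter_directed_qc(2)[OF fin F D]
  note pf = qc_diagramD(2)[OF D]
  note SS = qc_slice_simplicial[OF C]
  obtain v0 a0 where a0: "v0 \<in> \<Phi>" "a0 \<in> Smp (qc_slice C (rep v0)) 1" "f = Dg.cln 1 v0 a0"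
    using f unfolding qc_quotient_def Dg.Q_Smp by blast
  have v: "v \<in> \<Phi>" "fv \<in> Smp (qc_slice C (rep v)) 1"
    using dirsys.cls_mem_sym[OF Dg.dirsys_level a0(1,2) m[unfolded a0(3)]] by auto
  have fcl: "f = Dg.cln 1 v fv"
    unfolding a0(3) by (rule dirsys.cls_mem_eq[OF Dg.dirsys_level a0(1,2) m[unfolded a0(3)], symmetric])
  let ?Sv = "qc_slice C (rep v)"
  define x where "x = Act ?Sv 1 [0] fv"
  define y where "y = Act ?Sv 1 [1] fv"
  have fe: "edge ?Sv fv x y" using v(2) by (simp add: edge_def x_def y_def)
  have fC: "edge C (qc_forget C 1 fv) (qc_forget C 0 x) (qc_forget C 0 y)" by (rule forget_edge[OF fe])
  show ?thesis
  proof
    assume "qc_equiv (qc_quotient C \<Phi> rep t) f"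
    then obtain w where w: "w \<in> \<Phi>" "sub_le ?R w v" and e: "qc_equiv (qc_slice C (rep w)) (t v w 1 fv)"
      using Dg.qc_equiv_stage[OF v] unfolding qc_quotient_def fcl by blast
    obtain p p' d where sq: "edge (qc_slice C (rep w)) (t v w 1 fv) (t v w 0 x) (t v w 0 y)"
      "qc_product C (qc_forget C 0 (t v w 0 x)) p (t v w 0 x) (qc_forget C 0 x) (rep w)"
      "qc_product C (qc_forget C 0 (t v w 0 y)) p' (t v w 0 y) (qc_forget C 0 y) (rep w)"
      "qc_composite C p (qc_forget C 1 fv) d" "qc_composite C (qc_forget C 1 (t v w 1 fv)) p' d"
      by (rule product_functor_square[OF pf[OF v(1) w] fe])
    have "qc_times_id C (qc_forget C 1 fv) (rep w) (qc_forget C 1 (t v w 1 fv))"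
      unfolding qc_times_id_def
      by (intro exI) (intro conjI, rule fC, rule forget_edge[OF sq(1)], rule sq(2), rule sq(3), rule sq(4), rule sq(5),
          rule slice_edge_T[OF sq(1)])
    moreover have "qc_equiv C (qc_forget C 1 (t v w 1 fv))"
      by (rule simplicial_map_qc_equiv[OF qc_forget_map[OF C] SS e])
    ultimately show "\<exists>u\<in>\<Phi>. \<exists>h. qc_times_id C (qc_forget C 1 fv) (rep u) h \<and> qc_equiv C h" using w(1) by blast
  next
    assume "\<exists>u\<in>\<Phi>. \<exists>h. qc_times_id C (qc_forget C 1 fv) (rep u) h \<and> qc_equiv C h"
    then obtain u h where u: "u \<in> \<Phi>" and h: "qc_times_id C (qc_forget C 1 fv) (rep u) h" "qc_equiv C h" by blast
    obtain A B P Q p q p' q' d where A: "edge C (qc_forget C 1 fv) A B" and hE: "edge C h P Q"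
      and P: "qc_product C P p q A (rep u)" and Q: "qc_product C Q p' q' B (rep u)"
      and T: "qc_composite C p (qc_forget C 1 fv) d" "qc_composite C h p' d" "qc_composite C h q' q"
      using h(1) unfolding qc_times_id_def by blast
    have AB: "A = qc_forget C 0 x" "B = qc_forget C 0 y" using A fC by (auto simp: edge_def)
    obtain w where w: "w \<in> \<Phi>" "sub_le ?R w v" "sub_le ?R w u" using Dg.dir[OF v(1) u] by blast
    obtain k k' d' where sq: "edge (qc_slice C (rep w)) (t v w 1 fv) (t v w 0 x) (t v w 0 y)"
      "qc_product C (qc_forget C 0 (t v w 0 x)) k (t v w 0 x) (qc_forget C 0 x) (rep w)"
      "qc_product C (qc_forget C 0 (t v w 0 y)) k' (t v w 0 y) (qc_forget C 0 y) (rep w)"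
      "qc_composite C k (qc_forget C 1 fv) d'" "qc_composite C (qc_forget C 1 (t v w 1 fv)) k' d'"
      by (rule product_functor_square[OF pf[OF v(1) w(1,2)] fe])
    have fh: "hm A B (cl (qc_forget C 1 fv))" by (rule hmI[OF A])
    have hp: "cmp (cl h) (cl p') = cmp (cl p) (cl (qc_forget C 1 fv))" using cmp_cl[OF T(1)] cmp_cl[OF T(2)] by simp
    have hq: "cmp (cl h) (cl q') = cl q" by (rule cmp_cl[OF T(3)])
    have kp: "edge C k (qc_forget C 0 (t v w 0 x)) A" "edge C k' (qc_forget C 0 (t v w 0 y)) B"
      "edge C (t v w 0 x) (qc_forget C 0 (t v w 0 x)) (rep w)"
      "edge C (t v w 0 y) (qc_forget C 0 (t v w 0 y)) (rep w)"
      using sq(2,3) AB by (simp_all add: qc_product_def)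
    have kk: "cmp (cl (qc_forget C 1 (t v w 1 fv))) (cl k') = cmp (cl k) (cl (qc_forget C 1 fv))"
      using cmp_cl[OF sq(4)] cmp_cl[OF sq(5)] by simp
    obtain j where j: "edge C j (rep w) (rep u)" using w iff[OF w(1) u] unfolding qc_map_exists_def by blast
    note FE = hmI[OF forget_edge[OF sq(1)]]
    obtain a where a: "hm (qc_forget C 0 (t v w 0 y)) A a" "cmp a (cl (qc_forget C 1 fv)) = cl k'"
      "cmp (cl (qc_forget C 1 (t v w 1 fv))) a = cl k"
      using lift_inverse[OF product_hprod[OF P] product_hprod[OF Q] fh qc_equiv_hiso[OF h(2) hE] hp hq
          hmI[OF kp(1)] hmI[OF kp(2)] FE kk hm_cmp[OF hmI[OF kp(3)] hmI[OF j]]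
          hm_cmp[OF hmI[OF kp(4)] hmI[OF j]]] by blast
    have "qc_equiv (qc_slice C (rep w)) (t v w 1 fv)"
      by (rule slice_equiv[OF sq(2,3,1) fh[unfolded AB] kk a(1)[unfolded AB] a(2,3)])
    from simplicial_map_qc_equiv[OF Dg.cln_map[OF w(1)] SS this]
    have "qc_equiv (qc_quotient C \<Phi> rep t) (Dg.cln 1 w (t v w 1 fv))" unfolding qc_quotient_def .
    thus "qc_equiv (qc_quotient C \<Phi> rep t) f"
      unfolding fcl dirsys.cls_restrict[OF Dg.dirsys_level v w(1,2)] .
  qed
qed

end

section \<open>Kan enriched categories\<close>

context hocat
begin

text \<open>\<open>cmp\<close> is defined on arbitrary sets of arrows, so associativity holds
  without typing hypotheses and can be used as an unconditional rewrite rule.\<close>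

lemma cmp_assoc_all: "cmp (cmp A B) C = cmp A (cmp B C)"
proof (intro set_eqI iffI)
  fix m assume "m \<in> cmp (cmp A B) C"
  then obtain f g h k where fg: "f \<in> A" "g \<in> B" "k \<in> C" and T: "T f g h" "T h k m" unfolding cmp_def by blast
  obtain x y z where a: "arr x y f" "arr y z g" "arr x z h" using T_arr[OF T(1)] by blast
  obtain x' z' u where b: "arr x' z' h" "arr z' u k" using T_arr[OF T(2)] by blast
  have "z' = z" using arr_unique[OF a(3) b(1)] by simp
  then obtain l where l: "T g k l" using T_ex[OF a(2), of u k] b(2) by blast
  have "T f l m" using T_assoc[OF T(1) l] T(2) by blast
  thus "m \<in> cmp A (cmp B C)" unfolding cmp_def using fg l by blast
next
  fix m assume "m \<in> cmp A (cmp B C)"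
  then obtain f g l k where fg: "f \<in> A" "g \<in> B" "k \<in> C" and T: "T g k l" "T f l m" unfolding cmp_def by blast
  obtain y z u where a: "arr y z g" "arr z u k" "arr y u l" using T_arr[OF T(1)] by blast
  obtain x y' u' where b: "arr x y' f" "arr y' u' l" using T_arr[OF T(2)] by blast
  have "y' = y" using arr_unique[OF a(3) b(2)] by simp
  then obtain h where h: "T f g h" using T_ex[OF b(1), of z g] a(1) by blast
  have "T h k m" using T_assoc[OF h T(1)] T(2) by blast
  thus "m \<in> cmp (cmp A B) C" unfolding cmp_def using fg h by blast
qed

text \<open>A one-sided inverse is two-sided if composition with \<open>F\<close> is injective:
  \<open>F\<close> \<open>G\<close> \<open>F\<close> equals \<open>F\<close>, so \<open>F\<close>
  \<open>G\<close> and the identity have the same composite with \<open>F\<close>.\<close>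

lemma hiso_of_bij:
  assumes F: "hm A B F" and G: "hm B A G" "cmp G F = hid B"
    and inj: "\<And>a a'. hm A A a \<Longrightarrow> hm A A a' \<Longrightarrow> cmp a F = cmp a' F \<Longrightarrow> a = a'"
  shows "hiso A B F"
proof -
  have "cmp (cmp F G) F = cmp (hid A) F"
    using cmp_assoc_all G(2) cmp_id[OF F] by simp
  hence "cmp F G = hid A" by (rule inj[OF hm_cmp[OF F G(1)] hid_hm(1)[OF F]])
  thus ?thesis unfolding hiso_def using F G by blast
qed

lemma hprod_pair: "hprod P p q A U \<Longrightarrow> hm Z A a \<Longrightarrow> hm Z U c \<Longrightarrow> \<exists>k. hm Z P k \<and> cmp k p = a \<and> cmp k q = c"
  unfolding hprod_def by blast

lemma hprod_eq: "hprod P p q A U \<Longrightarrow> hm Z P k \<Longrightarrow> hm Z P k' \<Longrightarrow> cmp k p = cmp k' p \<Longrightarrow> cmp k q = cmp k' q \<Longrightarrow> k = k'"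
  unfolding hprod_def by blast

lemma hprod_hm: "hprod P p q A U \<Longrightarrow> hm P A p" "hprod P p q A U \<Longrightarrow> hm P U q"
  unfolding hprod_def by auto

end

text \<open>A map \<open>\<phi>\<close> from \<open>X \<times> V\<close> to \<open>Y\<close>, the induced map \<open>F\<close> over \<open>V\<close> and the map \<open>F'\<close> over \<open>W\<close> obtained
  by restriction along \<open>\<iota>\<close>.\<close>

locale over_square = hocat arr T idt for arr :: "'o \<Rightarrow> 'o \<Rightarrow> 'a \<Rightarrow> bool" and T and idt +
  fixes X Y V W XV YV XW YW :: 'o and p1 p2 q1 q2 s1 s2 t1 t2 \<iota> i \<phi> F F' :: "'a set"
  assumes XV: "hprod XV p1 p2 X V" and YV: "hprod YV q1 q2 Y V"
    and XW: "hprod XW s1 s2 X W" and YW: "hprod YW t1 t2 Y W"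
    and \<iota>: "hm W V \<iota>" and i: "hm XW XV i" "cmp i p1 = s1" "cmp i p2 = cmp s2 \<iota>"
    and \<phi>: "hm XV Y \<phi>" and F: "hm XV YV F" "cmp F q1 = \<phi>" "cmp F q2 = p2"
    and F': "hm XW YW F'" "cmp F' t1 = cmp i \<phi>" "cmp F' t2 = s2"
begin

text \<open>The equations of the square with an arbitrary continuation \<open>z\<close>, so that
  they still apply after composites have been nested to the right.\<close>

lemma reassoc:
  "cmp i (cmp p1 z) = cmp s1 z" "cmp i (cmp p2 z) = cmp s2 (cmp \<iota> z)" "cmp F (cmp q1 z) = cmp \<phi> z"
  "cmp F (cmp q2 z) = cmp p2 z" "cmp F' (cmp t1 z) = cmp i (cmp \<phi> z)" "cmp F' (cmp t2 z) = cmp s2 z"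
  by (simp_all add: i F F' flip: cmp_assoc_all)

lemmas rules = cmp_assoc_all i(2,3) F(2,3) F'(2,3) reassoc

text \<open>Since \<open>W\<close> maps to \<open>V\<close> and to \<open>U\<close>, the product
  \<open>YW\<close> maps to \<open>YU\<close>; going back along the inverse of \<open>E\<close> and
  keeping the coordinate in \<open>W\<close> produces a one-sided inverse of \<open>F'\<close>.
  Injectivity is tested in the same way, by lifting maps to \<open>XW\<close> to maps to
  \<open>XU\<close>.\<close>

lemma iso_restrict:
  assumes XU: "hprod XU r1 r2 XV U" and YU: "hprod YU e1 e2 YV U" and k: "hm W U \<kappa>"
    and E: "hiso XU YU E" "cmp E e1 = cmp r1 F" "cmp E e2 = r2"
  shows "hiso XW YW F'"
proof -
  obtain E' where E': "hm YU XU E'" "cmp E E' = hid XU" "cmp E' E = hid YU" and Eh: "hm XU YU E"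
    using E(1) unfolding hiso_def by blast
  have Ez: "cmp E (cmp e1 z) = cmp r1 (cmp F z)" "cmp E (cmp e2 z) = cmp r2 z" for z
    by (simp_all add: E(2,3) flip: cmp_assoc_all)
  have b: "hm YW W t2" and y: "hm YW Y t1" using hprod_hm[OF YW] by auto
  obtain e' where e': "hm YW YV e'" "cmp e' q1 = t1" "cmp e' q2 = cmp t2 \<iota>"
    using hprod_pair[OF YV y hm_cmp[OF b \<iota>]] by blast
  obtain e where e: "hm YW YU e" "cmp e e1 = e'" "cmp e e2 = cmp t2 \<kappa>"
    using hprod_pair[OF YU e'(1) hm_cmp[OF b k]] by blast
  \<comment> \<open>The canonical map from \<open>YW\<close> to \<open>YU\<close>, carried back to
    \<open>XU\<close>. Its coordinate in \<open>X\<close>, paired with \<open>t2\<close>, is the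
    desired inverse \<open>a\<close>.\<close>
  define x where "x = cmp e E'"
  have xh: "hm YW XU x" unfolding x_def by (rule hm_cmp[OF e(1) E'(1)])
  have xE: "cmp x E = e" unfolding x_def using cmp_id(2)[OF e(1)] by (simp add: cmp_assoc_all E'(3))
  have r: "hm XU XV r1" by (rule hprod_hm(1)[OF XU])
  have xr: "hm YW XV (cmp x r1)" by (rule hm_cmp[OF xh r])
  have xrF: "cmp (cmp x r1) F = e'"
    using e(2) unfolding xE[symmetric] by (simp add: cmp_assoc_all E(2))
  obtain a where a: "hm YW XW a" "cmp a s1 = cmp (cmp x r1) p1" "cmp a s2 = t2"
    using hprod_pair[OF XW hm_cmp[OF xr hprod_hm(1)[OF XV]] b] by blast
  have ai: "cmp a i = cmp x r1"
  proof (rule hprod_eq[OF XV hm_cmp[OF a(1) i(1)] xr])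
    show "cmp (cmp a i) p1 = cmp (cmp x r1) p1" using a(2) by (simp add: rules)
    \<comment> \<open>The \<open>V\<close> coordinate can be computed after \<open>F\<close>,
      because \<open>F\<close> preserves it; there it is known to come from
      \<open>W\<close>.\<close>
    have "cmp (cmp x r1) p2 = cmp (cmp (cmp x r1) F) q2" by (simp add: rules)
    also have "\<dots> = cmp t2 \<iota>" unfolding xrF by (rule e'(3))
    also have "\<dots> = cmp (cmp a i) p2" using a(3) by (simp add: rules flip: a(3))
    finally show "cmp (cmp a i) p2 = cmp (cmp x r1) p2" ..
  qed
  have "cmp a F' = hid YW"
  proof (rule hprod_eq[OF YW hm_cmp[OF a(1) F'(1)] hid_hm(1)[OF y]])
    have "cmp (cmp a F') t1 = cmp (cmp a i) \<phi>" by (simp add: rules)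
    also have "\<dots> = cmp (cmp (cmp x r1) F) q1" unfolding ai by (simp add: rules)
    also have "\<dots> = t1" unfolding xrF by (rule e'(2))
    finally show "cmp (cmp a F') t1 = cmp (hid YW) t1" using cmp_id(1)[OF y] by simp
    show "cmp (cmp a F') t2 = cmp (hid YW) t2" using a(3) cmp_id(1)[OF b] by (simp add: rules)
  qed
  moreover have "a = a'" if a: "hm XW XW a" and a': "hm XW XW a'" and eq: "cmp a F' = cmp a' F'" for a a'
  proof -
    have s2: "cmp a s2 = cmp a' s2"
      using arg_cong[OF eq, of "\<lambda>z. cmp z t2"] by (simp add: rules)
    have bk: "hm XW U (cmp (cmp a s2) \<kappa>)" by (rule hm_cmp[OF hm_cmp[OF a hprod_hm(2)[OF XW]] k])
    obtain x where x: "hm XW XU x" "cmp x r1 = cmp a i" "cmp x r2 = cmp (cmp a s2) \<kappa>"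
      using hprod_pair[OF XU hm_cmp[OF a i(1)] bk] by blast
    obtain x' where x': "hm XW XU x'" "cmp x' r1 = cmp a' i" "cmp x' r2 = cmp (cmp a s2) \<kappa>"
      using hprod_pair[OF XU hm_cmp[OF a' i(1)] bk] by blast
    have F1: "cmp (cmp a i) F = cmp (cmp a' i) F"
    proof (rule hprod_eq[OF YV hm_cmp[OF hm_cmp[OF a i(1)] F(1)] hm_cmp[OF hm_cmp[OF a' i(1)] F(1)]])
      show "cmp (cmp (cmp a i) F) q1 = cmp (cmp (cmp a' i) F) q1"
        using arg_cong[OF eq, of "\<lambda>z. cmp z t1"] by (simp add: rules)
      show "cmp (cmp (cmp a i) F) q2 = cmp (cmp (cmp a' i) F) q2"
        using arg_cong[OF s2, of "\<lambda>z. cmp z \<iota>"] by (simp add: rules)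
    qed
    have xx: "cmp x E = cmp x' E"
    proof (rule hprod_eq[OF YU hm_cmp[OF x(1) Eh] hm_cmp[OF x'(1) Eh]])
      have "cmp (cmp x E) e1 = cmp (cmp x r1) F" "cmp (cmp x' E) e1 = cmp (cmp x' r1) F"
        by (simp_all add: cmp_assoc_all E(2))
      thus "cmp (cmp x E) e1 = cmp (cmp x' E) e1" using F1 x(2) x'(2) by simp
      show "cmp (cmp x E) e2 = cmp (cmp x' E) e2" using x(3) x'(3) by (simp add: cmp_assoc_all E(3))
    qed
    have "x = x'"
      using arg_cong[OF xx, of "\<lambda>z. cmp z E'"] cmp_id(2)[OF x(1)] cmp_id(2)[OF x'(1)] by (simp add: cmp_assoc_all E'(2))
    hence "cmp a i = cmp a' i" using x(2) x'(2) by simp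
    hence "cmp (cmp a i) p1 = cmp (cmp a' i) p1" by simp
    hence "cmp a s1 = cmp a' s1" by (simp add: rules)
    thus ?thesis by (rule hprod_eq[OF XW a a' _ s2])
  qed
  ultimately show ?thesis by (intro hiso_of_bij[OF F'(1) a(1)]) simp_all
qed

text \<open>Now \<open>XU\<close> and \<open>YU\<close> are products with \<open>W\<close>, so they
  carry two maps to \<open>V\<close>: the one of the first factor and the one induced from
  \<open>W\<close>. The hypothesis \<open>sub\<close> identifies them, whence \<open>XU\<close>
  behaves like \<open>XW\<close>, and the inverse \<open>G\<close> of \<open>F'\<close> can be
  transported.\<close>

lemma iso_extend:
  assumes XU: "hprod XU r1 r2 XV W" and YU: "hprod YU e1 e2 YV W"
    and E: "hm XU YU E" "cmp E e1 = cmp r1 F" "cmp E e2 = r2"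
    and iso: "hiso XW YW F'" and sub: "\<And>Z a b. hm Z V a \<Longrightarrow> hm Z V b \<Longrightarrow> a = b"
  shows "hiso XU YU E"
proof -
  obtain G where G: "hm YW XW G" "cmp F' G = hid XW" "cmp G F' = hid YW" using iso unfolding hiso_def by blast
  have p: "hm XV X p1" "hm XV V p2" and q: "hm YV Y q1" "hm YV V q2" and s: "hm XW X s1" "hm XW W s2"
    and t: "hm YW Y t1" "hm YW W t2" and r: "hm XU XV r1" "hm XU W r2" and e: "hm YU YV e1" "hm YU W e2"
    using hprod_hm[OF XV] hprod_hm[OF YV] hprod_hm[OF XW] hprod_hm[OF YW] hprod_hm[OF XU] hprod_hm[OF YU] by auto
  obtain b where b: "hm YU YW b" "cmp b t1 = cmp e1 q1" "cmp b t2 = e2"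
    using hprod_pair[OF YW hm_cmp[OF e(1) q(1)] e(2)] by blast
  define a where "a = cmp b G"
  have a: "hm YU XW a" unfolding a_def by (rule hm_cmp[OF b(1) G(1)])
  have aF: "cmp a F' = b" unfolding a_def using cmp_id(2)[OF b(1)] by (simp add: cmp_assoc_all G(3))
  have as2: "cmp a s2 = e2" using b(3) unfolding aF[symmetric] by (simp add: rules)
  note ai = hm_cmp[OF a i(1)]
  obtain x where x: "hm YU XU x" "cmp x r1 = cmp a i" "cmp x r2 = e2" using hprod_pair[OF XU ai e(2)] by blast
  have aiF: "cmp (cmp a i) F = e1"
  proof (rule hprod_eq[OF YV hm_cmp[OF ai F(1)] e(1)])
    have "cmp (cmp (cmp a i) F) q1 = cmp (cmp a F') t1" by (simp add: rules)
    thus "cmp (cmp (cmp a i) F) q1 = cmp e1 q1" unfolding aF using b(2) by simp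
    \<comment> \<open>The left side reaches \<open>V\<close> through \<open>W\<close>, the right
      side through the first factor.\<close>
    show "cmp (cmp (cmp a i) F) q2 = cmp e1 q2"
      by (rule sub[OF hm_cmp[OF hm_cmp[OF ai F(1)] q(2)] hm_cmp[OF e(1) q(2)]])
  qed
  have "cmp x E = hid YU"
  proof (rule hprod_eq[OF YU hm_cmp[OF x(1) E(1)] hid_hm(1)[OF e(1)]])
    have "cmp (cmp x E) e1 = cmp (cmp x r1) F" by (simp add: cmp_assoc_all E(2))
    thus "cmp (cmp x E) e1 = cmp (hid YU) e1" unfolding x(2) aiF using cmp_id(1)[OF e(1)] by simp
    show "cmp (cmp x E) e2 = cmp (hid YU) e2" using x(3) cmp_id(1)[OF e(2)] by (simp add: cmp_assoc_all E(3))
  qed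
  moreover have "x = x'" if x: "hm XU XU x" and x': "hm XU XU x'" and eq: "cmp x E = cmp x' E" for x x'
  proof -
    have r2: "cmp x r2 = cmp x' r2" using arg_cong[OF eq, of "\<lambda>z. cmp z e2"] by (simp add: cmp_assoc_all E(3))
    note xr = hm_cmp[OF x r(1)] and xr' = hm_cmp[OF x' r(1)] and xr2 = hm_cmp[OF x r(2)]
    have xrF: "cmp (cmp x r1) F = cmp (cmp x' r1) F"
      using arg_cong[OF eq, of "\<lambda>z. cmp z e1"] by (simp add: cmp_assoc_all E(2))
    obtain a where a: "hm XU XW a" "cmp a s1 = cmp (cmp x r1) p1" "cmp a s2 = cmp x r2"
      using hprod_pair[OF XW hm_cmp[OF xr p(1)] xr2] by blast
    obtain a' where a': "hm XU XW a'" "cmp a' s1 = cmp (cmp x' r1) p1" "cmp a' s2 = cmp x r2"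
      using hprod_pair[OF XW hm_cmp[OF xr' p(1)] xr2] by blast
    have ai: "cmp c i = d" if c: "hm XU XW c" "cmp c s1 = cmp d p1" and d: "hm XU XV d" for c d
    proof (rule hprod_eq[OF XV hm_cmp[OF c(1) i(1)] d])
      show "cmp (cmp c i) p1 = cmp d p1" using c(2) by (simp add: rules)
      show "cmp (cmp c i) p2 = cmp d p2" by (rule sub[OF hm_cmp[OF hm_cmp[OF c(1) i(1)] p(2)] hm_cmp[OF d p(2)]])
    qed
    have aF: "cmp a F' = cmp a' F'"
    proof (rule hprod_eq[OF YW hm_cmp[OF a(1) F'(1)] hm_cmp[OF a'(1) F'(1)]])
      have "cmp (cmp a F') t1 = cmp (cmp (cmp a i) F) q1" "cmp (cmp a' F') t1 = cmp (cmp (cmp a' i) F) q1"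
        by (simp_all add: rules)
      thus "cmp (cmp a F') t1 = cmp (cmp a' F') t1"
        unfolding ai[OF a(1,2) xr] ai[OF a'(1,2) xr'] xrF by simp
      show "cmp (cmp a F') t2 = cmp (cmp a' F') t2" using a(3) a'(3) by (simp add: rules)
    qed
    have "a = a'" using arg_cong[OF aF, of "\<lambda>z. cmp z G"] cmp_id(2)[OF a(1)] cmp_id(2)[OF a'(1)] by (simp add: cmp_assoc_all G(2))
    hence "cmp x r1 = cmp x' r1" using ai[OF a(1,2) xr] ai[OF a'(1,2) xr'] by simp
    thus ?thesis by (rule hprod_eq[OF XU x x' _ r2])
  qed
  ultimately show ?thesis by (intro hiso_of_bij[OF E(1) x(1)]) simp_all
qed

end

section \<open>Path components and homotopy equivalences\<close>

lemma degs_simps: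
  assumes X: "simplicial_set X" and x: "x \<in> Smp X 0"
  shows "degs X n x \<in> Smp X n" "degs X 0 x = x" "\<alpha> \<in> ord m n \<Longrightarrow> Act X n \<alpha> (degs X n x) = degs X m x"
    "degs X 1 x = qc_id X x"
proof -
  show "degs X n x \<in> Smp X n" unfolding degs_def by (rule sset_act_in[OF X x]) simp
  show "degs X 0 x = x" unfolding degs_def using sset_act_id[OF X x] by (simp add: const_op_simps idl_simps)
  show "\<alpha> \<in> ord m n \<Longrightarrow> Act X n \<alpha> (degs X n x) = degs X m x"
    unfolding degs_def using sset_act_act[OF X x, of "const_op n 0" n \<alpha> m] by (simp add: ocomp_const_left)
  show "degs X 1 x = qc_id X x" by (simp add: degs_def qc_id_def const_op_simps)
qed

definition path_eq :: "'a sset \<Rightarrow> 'a \<Rightarrow> 'a \<Rightarrow> bool" where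
  "path_eq X x y \<longleftrightarrow> (\<exists>s. edge X s x y)"

lemma path_eq_refl: "simplicial_set X \<Longrightarrow> x \<in> Smp X 0 \<Longrightarrow> path_eq X x x"
  unfolding path_eq_def by (rule exI) (rule qc_id_edge)

lemma path_eq_sym:
  assumes X: "kan_complex X" and p: "path_eq X x y"
  shows "path_eq X y x"
proof -
  interpret hocat "\<lambda>x y f. edge X f x y" "qc_composite X" "qc_id X"
    by (rule hocat_sset[OF kan_complex_inner3[OF X]])
  obtain s where s: "edge X s x y" using p unfolding path_eq_def by blast
  obtain g where g: "qc_composite X s g (qc_id X x)" using kan_inverse(1)[OF X s] by blast
  obtain a b c where a: "edge X s a b" "edge X g b c" "edge X (qc_id X x) a c" using T_arr[OF g] by blast
  have "c = x" "b = y" using arr_unique[OF a(3) id_arr[OF s, THEN conjunct1]] arr_unique[OF a(1) s] by simp_all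
  thus ?thesis using a(2) unfolding path_eq_def by blast
qed

lemma path_eq_trans:
  assumes X: "kan_complex X" and p: "path_eq X x y" "path_eq X y z"
  shows "path_eq X x z"
proof -
  interpret hocat "\<lambda>x y f. edge X f x y" "qc_composite X" "qc_id X"
    by (rule hocat_sset[OF kan_complex_inner3[OF X]])
  obtain s t where st: "edge X s x y" "edge X t y z" using p unfolding path_eq_def by blast
  obtain h where h: "qc_composite X s t h" using T_ex[OF st] by blast
  show ?thesis unfolding path_eq_def using T_arrs(2)[OF h st] by blast
qed

lemma path_eq_map: "simplicial_map X Y f \<Longrightarrow> path_eq X x y \<Longrightarrow> path_eq Y (f 0 x) (f 0 y)"
  unfolding path_eq_def by (elim exE) (rule exI, rule simplicial_map_edge)

text \<open>The levelwise inverse is again simplicial, and both homotopies can be taken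
  constant.\<close>

lemma bij_kan_equivalence:
  assumes X: "simplicial_set X" and Y: "simplicial_set Y" and f: "simplicial_map X Y f"
    and bij: "\<And>n. bij_betw (f n) (Smp X n) (Smp Y n)"
  shows "kan_equivalence X Y f"
proof -
  define g where "g n = inv_into (Smp X n) (f n)" for n
  have gf: "g n (f n x) = x" if "x \<in> Smp X n" for n x
    unfolding g_def by (rule bij_betw_inv_into_left[OF bij that])
  have fg: "f n (g n y) = y" if "y \<in> Smp Y n" for n y
    unfolding g_def by (rule bij_betw_inv_into_right[OF bij that])
  have g_in: "g n y \<in> Smp X n" if "y \<in> Smp Y n" for n y
    using bij_betw_inv_into[OF bij, of n] that unfolding g_def bij_betw_def by blast
  have g: "simplicial_map Y X g" unfolding simplicial_map_def
  proof (intro conjI allI ballI g_in)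
    fix m n \<alpha> y assume a: "\<alpha> \<in> ord m n" and y: "y \<in> Smp Y n"
    have "g m (Act Y n \<alpha> y) = g m (f m (Act X n \<alpha> (g n y)))"
      using simplicial_map_act[OF f g_in[OF y] a] fg[OF y] by simp
    thus "g m (Act Y n \<alpha> y) = Act X n \<alpha> (g n y)" using gf[OF sset_act_in[OF X g_in[OF y] a]] by simp
  qed
  have hom: "homotopic Z Z h (\<lambda>n x. x)" if "\<And>n x. x \<in> Smp Z n \<Longrightarrow> h n x = x" for Z :: "'c sset" and h
    unfolding homotopic_def
    by (rule exI[of _ "\<lambda>n. fst"]) (use that in \<open>auto simp: simplicial_map_def\<close>)
  show ?thesis unfolding kan_equivalence_def
    by (intro conjI exI[of _ g] f g) (rule hom, rule gf, assumption, rule hom, rule fg, assumption)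
qed

section \<open>The homotopy category of a Kan enriched category\<close>

locale kan_cat =
  fixes K :: "('o, 'm) ecat"
  assumes kan: "kan_enriched K"
begin

lemma hom_kan: "X \<in> Objs K \<Longrightarrow> Y \<in> Objs K \<Longrightarrow> kan_complex (Hom K X Y)"
  using kan unfolding kan_enriched_def by simp

lemma hom_sset: "X \<in> Objs K \<Longrightarrow> Y \<in> Objs K \<Longrightarrow> simplicial_set (Hom K X Y)"
  using hom_kan unfolding kan_complex_def by simp

lemma Ident_in: "X \<in> Objs K \<Longrightarrow> Ident K X \<in> Smp (Hom K X X) 0"
  using kan unfolding kan_enriched_def by simp

lemma Comp_map: "X \<in> Objs K \<Longrightarrow> Y \<in> Objs K \<Longrightarrow> Z \<in> Objs K \<Longrightarrow>
    simplicial_map (sprod (Hom K Y Z) (Hom K X Y)) (Hom K X Z) (\<lambda>n (g, f). Comp K X Y Z n g f)"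
  using kan unfolding kan_enriched_def by simp

lemma Comp_in: "X \<in> Objs K \<Longrightarrow> Y \<in> Objs K \<Longrightarrow> Z \<in> Objs K \<Longrightarrow> g \<in> Smp (Hom K Y Z) n \<Longrightarrow> f \<in> Smp (Hom K X Y) n \<Longrightarrow>
    Comp K X Y Z n g f \<in> Smp (Hom K X Z) n"
  using simplicial_map_in[OF Comp_map, of X Y Z "(g, f)" n] by simp

lemma Comp_act: "X \<in> Objs K \<Longrightarrow> Y \<in> Objs K \<Longrightarrow> Z \<in> Objs K \<Longrightarrow> g \<in> Smp (Hom K Y Z) n \<Longrightarrow> f \<in> Smp (Hom K X Y) n \<Longrightarrow>
    \<alpha> \<in> ord m n \<Longrightarrow> Act (Hom K X Z) n \<alpha> (Comp K X Y Z n g f) = Comp K X Y Z m (Act (Hom K Y Z) n \<alpha> g) (Act (Hom K X Y) n \<alpha> f)"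
  using simplicial_map_act[OF Comp_map, of X Y Z "(g, f)" n \<alpha> m] by simp

lemma Comp_assoc: "W \<in> Objs K \<Longrightarrow> X \<in> Objs K \<Longrightarrow> Y \<in> Objs K \<Longrightarrow> Z \<in> Objs K \<Longrightarrow>
    h \<in> Smp (Hom K Y Z) n \<Longrightarrow> g \<in> Smp (Hom K X Y) n \<Longrightarrow> f \<in> Smp (Hom K W X) n \<Longrightarrow>
    Comp K W X Z n (Comp K X Y Z n h g) f = Comp K W Y Z n h (Comp K W X Y n g f)"
  using kan unfolding kan_enriched_def by simp

lemma Comp_id: "X \<in> Objs K \<Longrightarrow> Y \<in> Objs K \<Longrightarrow> f \<in> Smp (Hom K X Y) n \<Longrightarrow>
    Comp K X X Y n f (degs (Hom K X X) n (Ident K X)) = f"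
  "X \<in> Objs K \<Longrightarrow> Y \<in> Objs K \<Longrightarrow> f \<in> Smp (Hom K X Y) n \<Longrightarrow>
    Comp K X Y Y n (degs (Hom K Y Y) n (Ident K Y)) f = f"
  using kan unfolding kan_enriched_def by simp_all

lemma Comp_id0: "X \<in> Objs K \<Longrightarrow> Y \<in> Objs K \<Longrightarrow> f \<in> Smp (Hom K X Y) 0 \<Longrightarrow> Comp K X X Y 0 f (Ident K X) = f"
  "X \<in> Objs K \<Longrightarrow> Y \<in> Objs K \<Longrightarrow> f \<in> Smp (Hom K X Y) 0 \<Longrightarrow> Comp K X Y Y 0 (Ident K Y) f = f"
  using Comp_id[of X Y f 0] degs_simps(2)[OF hom_sset Ident_in] by simp_all

lemma Comp_degs:
  assumes "X \<in> Objs K" "Y \<in> Objs K" "Z \<in> Objs K" "g \<in> Smp (Hom K Y Z) 0" "f \<in> Smp (Hom K X Y) 0"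
  shows "Comp K X Y Z n (degs (Hom K Y Z) n g) (degs (Hom K X Y) n f) = degs (Hom K X Z) n (Comp K X Y Z 0 g f)"
  unfolding degs_def by (rule Comp_act[OF assms, symmetric]) simp

lemma Comp_path:
  assumes o: "X \<in> Objs K" "Y \<in> Objs K" "Z \<in> Objs K" and g: "path_eq (Hom K Y Z) g g'" and f: "path_eq (Hom K X Y) f f'"
  shows "path_eq (Hom K X Z) (Comp K X Y Z 0 g f) (Comp K X Y Z 0 g' f')"
proof -
  obtain s t where s: "edge (Hom K Y Z) s g g'" and t: "edge (Hom K X Y) t f f'"
    using g f unfolding path_eq_def by blast
  have st: "s \<in> Smp (Hom K Y Z) 1" "t \<in> Smp (Hom K X Y) 1" using s t by (simp_all add: edge_def)
  have "edge (Hom K X Z) (Comp K X Y Z 1 s t) (Comp K X Y Z 0 g f) (Comp K X Y Z 0 g' f')"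
    using Comp_in[OF o st] Comp_act[OF o st, of "[0]" 0] Comp_act[OF o st, of "[1]" 0] s t by (simp add: edge_def)
  thus ?thesis unfolding path_eq_def by blast
qed

text \<open>Arrows carry their source and target, because the mapping spaces of different pairs of
  objects may share elements while \<open>hocat\<close> requires unique ends.\<close>

definition karr :: "'o \<Rightarrow> 'o \<Rightarrow> 'o \<times> 'm \<times> 'o \<Rightarrow> bool" where
  "karr X Y f \<longleftrightarrow> X \<in> Objs K \<and> Y \<in> Objs K \<and> (\<exists>a\<in>Smp (Hom K X Y) 0. f = (X, a, Y))"

definition kT :: "'o \<times> 'm \<times> 'o \<Rightarrow> 'o \<times> 'm \<times> 'o \<Rightarrow> 'o \<times> 'm \<times> 'o \<Rightarrow> bool" where
  "kT f g h \<longleftrightarrow> (\<exists>X Y Z a b d. f = (X, a, Y) \<and> g = (Y, b, Z) \<and> h = (X, d, Z) \<and> karr X Y f \<and> karr Y Z g \<and> karr X Z h \<and>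
     path_eq (Hom K X Z) (Comp K X Y Z 0 b a) d)"

definition kid :: "'o \<Rightarrow> 'o \<times> 'm \<times> 'o" where
  "kid X = (X, Ident K X, X)"

lemma karr_iff: "karr X Y (X', a, Y') \<longleftrightarrow> X' = X \<and> Y' = Y \<and> X \<in> Objs K \<and> Y \<in> Objs K \<and> a \<in> Smp (Hom K X Y) 0"
  by (auto simp: karr_def)

lemma kT_iff: "kT (X, a, Y) (Y', b, Z) (X', d, Z') \<longleftrightarrow> Y' = Y \<and> X' = X \<and> Z' = Z \<and> X \<in> Objs K \<and> Y \<in> Objs K \<and> Z \<in> Objs K \<and>
    a \<in> Smp (Hom K X Y) 0 \<and> b \<in> Smp (Hom K Y Z) 0 \<and> d \<in> Smp (Hom K X Z) 0 \<and> path_eq (Hom K X Z) (Comp K X Y Z 0 b a) d"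
  by (auto simp: kT_def karr_iff)

text \<open>Composition is strict in the enriched category, so the axioms reduce to strict
  associativity and to compatibility of composition with paths. Symmetry and transitivity of paths
  come from the Kan property.\<close>

lemma ho_cat: "hocat karr kT kid"
proof
  show "x = x' \<and> y = y'" if "karr x y f" "karr x' y' f" for x y f x' y' using that by (auto simp: karr_def)
  show "\<exists>x y z. karr x y f \<and> karr y z g \<and> karr x z h" if "kT f g h" for f g h using that unfolding kT_def by blast
  show "\<exists>h. kT f g h" if "karr x y f" "karr y z g" for x y f z g
  proof -
    obtain a b where ab: "f = (x, a, y)" "g = (y, b, z)" "x \<in> Objs K" "y \<in> Objs K" "z \<in> Objs K"
      "a \<in> Smp (Hom K x y) 0" "b \<in> Smp (Hom K y z) 0" using \<open>karr x y f\<close> \<open>karr y z g\<close> unfolding karr_def by blast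
    note i = Comp_in[OF ab(3-5,7,6)]
    have "kT f g (x, Comp K x y z 0 b a, z)"
      unfolding ab(1,2) kT_iff using ab i path_eq_refl[OF hom_sset[OF ab(3,5)] i] by simp
    thus ?thesis by blast
  qed
  show "karr x x (kid x) \<and> karr y y (kid y)" if "karr x y f" for x y f
    using that Ident_in by (auto simp: karr_def kid_def)
  show "kT (kid x) f f" if k: "karr x y f" for x y f
  proof -
    obtain a where a: "f = (x, a, y)" "x \<in> Objs K" "y \<in> Objs K" "a \<in> Smp (Hom K x y) 0" using k[unfolded karr_def] by blast
    show ?thesis unfolding a(1) kid_def kT_iff
      using a Ident_in Comp_id0(1)[OF a(2-4)] path_eq_refl[OF hom_sset[OF a(2,3)] a(4)] by simp
  qed
  show "kT f (kid y) f" if k: "karr x y f" for x y f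
  proof -
    obtain a where a: "f = (x, a, y)" "x \<in> Objs K" "y \<in> Objs K" "a \<in> Smp (Hom K x y) 0" using k[unfolded karr_def] by blast
    show ?thesis unfolding a(1) kid_def kT_iff
      using a Ident_in Comp_id0(2)[OF a(2-4)] path_eq_refl[OF hom_sset[OF a(2,3)] a(4)] by simp
  qed
  show "kT f l m \<longleftrightarrow> kT h k m" if T: "kT f g h" "kT g k l" for f g h k l m
  proof -
    obtain W X Y a b d where 1: "f = (W, a, X)" "g = (X, b, Y)" "h = (W, d, Y)"
      using T(1) unfolding kT_def by blast
    obtain Z p r where 2: "k = (Y, p, Z)" "l = (X, r, Z)"
      using T(2) unfolding kT_def 1 by blast
    have o: "W \<in> Objs K" "X \<in> Objs K" "Y \<in> Objs K" "Z \<in> Objs K" and m: "a \<in> Smp (Hom K W X) 0" "b \<in> Smp (Hom K X Y) 0"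
      "d \<in> Smp (Hom K W Y) 0" "p \<in> Smp (Hom K Y Z) 0" "r \<in> Smp (Hom K X Z) 0"
      and P: "path_eq (Hom K W Y) (Comp K W X Y 0 b a) d" "path_eq (Hom K X Z) (Comp K X Y Z 0 p b) r"
      using T unfolding 1 2 kT_iff by simp_all
    note Kn = hom_kan[OF o(1,4)]
    have 3: "path_eq (Hom K W Z) (Comp K W Y Z 0 p (Comp K W X Y 0 b a)) (Comp K W X Z 0 r a)"
      unfolding Comp_assoc[OF o m(4,2,1), symmetric]
      by (rule Comp_path[OF o(1,2,4) P(2) path_eq_refl[OF hom_sset[OF o(1,2)] m(1)]])
    have 4: "path_eq (Hom K W Z) (Comp K W Y Z 0 p (Comp K W X Y 0 b a)) (Comp K W Y Z 0 p d)"
      by (rule Comp_path[OF o(1,3,4) path_eq_refl[OF hom_sset[OF o(3,4)] m(4)] P(1)])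
    note 5 = path_eq_trans[OF Kn path_eq_sym[OF Kn 3] 4]
    obtain W' z Z' where mm: "m = (W', z, Z')" by (cases m)
    have "path_eq (Hom K W Z) (Comp K W X Z 0 r a) z \<longleftrightarrow> path_eq (Hom K W Z) (Comp K W Y Z 0 p d) z"
      using path_eq_trans[OF Kn 5] path_eq_trans[OF Kn path_eq_sym[OF Kn 5]] by blast
    thus ?thesis unfolding 1 2 mm kT_iff using o m by auto
  qed
qed

sublocale hocat karr kT kid by (rule ho_cat)

definition q :: "'o \<Rightarrow> 'o \<Rightarrow> 'm \<Rightarrow> ('o \<times> 'm \<times> 'o) set" where
  "q X Y a = cl (X, a, Y)"

lemma hm_q: "X \<in> Objs K \<Longrightarrow> Y \<in> Objs K \<Longrightarrow> a \<in> Smp (Hom K X Y) 0 \<Longrightarrow> hm X Y (q X Y a)"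
  unfolding q_def by (rule hmI) (simp add: karr_iff)

lemma hm_D: "hm X Y A \<Longrightarrow> \<exists>a. X \<in> Objs K \<and> Y \<in> Objs K \<and> a \<in> Smp (Hom K X Y) 0 \<and> A = q X Y a"
  unfolding hm_def karr_def q_def by blast

lemma cmp_q:
  assumes "X \<in> Objs K" "Y \<in> Objs K" "Z \<in> Objs K" "a \<in> Smp (Hom K X Y) 0" "b \<in> Smp (Hom K Y Z) 0"
  shows "cmp (q X Y a) (q Y Z b) = q X Z (Comp K X Y Z 0 b a)"
proof -
  note i = Comp_in[OF assms(1-3,5,4)]
  show ?thesis unfolding q_def
    by (rule cmp_cl) (use assms i path_eq_refl[OF hom_sset[OF assms(1,3)] i] in \<open>simp add: kT_iff\<close>)
qed

lemma q_eq:
  assumes "X \<in> Objs K" "Y \<in> Objs K" "a \<in> Smp (Hom K X Y) 0" "b \<in> Smp (Hom K X Y) 0"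
  shows "q X Y a = q X Y b \<longleftrightarrow> path_eq (Hom K X Y) a b"
proof -
  have k: "karr X Y (X, a, Y)" using assms by (simp add: karr_iff)
  show ?thesis unfolding q_def cl_eq_iff[OF k] eqv_iff[OF k] kid_def kT_iff
    using assms Ident_in Comp_id0(2)[OF assms(1-3)] by simp
qed

lemma hid_q: "hid X = q X X (Ident K X)"
  by (simp add: hid_def q_def kid_def)

lemma ec_equiv_hiso:
  assumes o: "X \<in> Objs K" "Y \<in> Objs K" and f: "f \<in> Smp (Hom K X Y) 0"
  shows "ec_equiv K X Y f \<longleftrightarrow> hiso X Y (q X Y f)"
proof -
  have 1: "cmp (q X Y f) (q Y X g) = hid X \<longleftrightarrow> (\<exists>s. edge (Hom K X X) s (Comp K X Y X 0 g f) (Ident K X))"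
    "cmp (q Y X g) (q X Y f) = hid Y \<longleftrightarrow> (\<exists>s. edge (Hom K Y Y) s (Comp K Y X Y 0 f g) (Ident K Y))"
    if g: "g \<in> Smp (Hom K Y X) 0" for g
    unfolding hid_q cmp_q[OF o(1,2,1) f g] cmp_q[OF o(2,1,2) g f] path_eq_def[symmetric]
    by (rule q_eq[OF o(1,1) Comp_in[OF o(1,2,1) g f] Ident_in[OF o(1)]] q_eq[OF o(2,2) Comp_in[OF o(2,1,2) f g] Ident_in[OF o(2)]])+
  show ?thesis
  proof
    assume "ec_equiv K X Y f"
    then obtain g where g: "g \<in> Smp (Hom K Y X) 0" "\<exists>s. edge (Hom K X X) s (Comp K X Y X 0 g f) (Ident K X)"
      "\<exists>s. edge (Hom K Y Y) s (Comp K Y X Y 0 f g) (Ident K Y)" unfolding ec_equiv_def by blast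
    show "hiso X Y (q X Y f)" unfolding hiso_def
      by (intro conjI exI[of _ "q Y X g"] hm_q[OF o f] hm_q[OF o(2,1) g(1)] 1(1)[OF g(1), THEN iffD2] 1(2)[OF g(1), THEN iffD2] g)
  next
    assume "hiso X Y (q X Y f)"
    then obtain B where B: "hm Y X B" "cmp (q X Y f) B = hid X" "cmp B (q X Y f) = hid Y" unfolding hiso_def by blast
    obtain g where g: "g \<in> Smp (Hom K Y X) 0" "B = q Y X g" using hm_D[OF B(1)] by blast
    show "ec_equiv K X Y f" unfolding ec_equiv_def
      using f g(1) 1(1)[OF g(1)] 1(2)[OF g(1)] B(2,3) unfolding g(2) by blast
  qed
qed

lemma post_map:
  assumes o: "T \<in> Objs K" "A \<in> Objs K" "B \<in> Objs K" and f: "f \<in> Smp (Hom K A B) 0"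
  shows "simplicial_map (Hom K T A) (Hom K T B) (ec_post K T A B f)"
  unfolding simplicial_map_def ec_post_def
  using Comp_in[OF o degs_simps(1)[OF hom_sset[OF o(2,3)] f]] Comp_act[OF o degs_simps(1)[OF hom_sset[OF o(2,3)] f]]
    degs_simps(3)[OF hom_sset[OF o(2,3)] f] by simp

lemma post_0: "A \<in> Objs K \<Longrightarrow> B \<in> Objs K \<Longrightarrow> f \<in> Smp (Hom K A B) 0 \<Longrightarrow> ec_post K T A B f 0 x = Comp K T A B 0 f x"
  unfolding ec_post_def using degs_simps(2)[OF hom_sset] by simp

lemma strict_product_inj:
  assumes P: "ec_strict_product K P p r A B" and T: "T \<in> Objs K" and x: "x \<in> Smp (Hom K T P) n" "y \<in> Smp (Hom K T P) n"
    and e: "ec_post K T P A p n x = ec_post K T P A p n y" "ec_post K T P B r n x = ec_post K T P B r n y"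
  shows "x = y"
proof -
  have "inj_on (\<lambda>x. (ec_post K T P A p n x, ec_post K T P B r n x)) (Smp (Hom K T P) n)"
    using P T unfolding ec_strict_product_def bij_betw_def by blast
  from inj_onD[OF this _ x] show ?thesis using e by simp
qed

lemma strict_product_surj:
  assumes P: "ec_strict_product K P p r A B" and T: "T \<in> Objs K" and a: "a \<in> Smp (Hom K T A) n" "b \<in> Smp (Hom K T B) n"
  shows "\<exists>x\<in>Smp (Hom K T P) n. ec_post K T P A p n x = a \<and> ec_post K T P B r n x = b"
proof -
  have "(\<lambda>x. (ec_post K T P A p n x, ec_post K T P B r n x)) ` Smp (Hom K T P) n = Smp (Hom K T A) n \<times> Smp (Hom K T B) n"
    using P T unfolding ec_strict_product_def bij_betw_def by blast
  moreover have "(a, b) \<in> Smp (Hom K T A) n \<times> Smp (Hom K T B) n" using a by simp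
  ultimately have "(a, b) \<in> (\<lambda>x. (ec_post K T P A p n x, ec_post K T P B r n x)) ` Smp (Hom K T P) n" by simp
  thus ?thesis by (elim imageE) (auto intro!: bexI)
qed

text \<open>Bijectivity on vertices gives pairings. For uniqueness, paths between the two components
  form an edge of the product of mapping spaces; bijectivity on edges lifts it, and bijectivity on
  vertices identifies the ends of the lift.\<close>

lemma strict_product_hprod:
  assumes P: "ec_strict_product K P p r A B" and AB: "A \<in> Objs K" "B \<in> Objs K"
  shows "hprod P (q P A p) (q P B r) A B"
  unfolding hprod_def
proof (intro conjI allI impI; (elim conjE)?)
  have Po: "P \<in> Objs K" and pr: "p \<in> Smp (Hom K P A) 0" "r \<in> Smp (Hom K P B) 0"
    using P by (simp_all add: ec_strict_product_def)
  show "hm P A (q P A p)" "hm P B (q P B r)" using hm_q Po AB pr by auto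
  show "\<exists>k. hm Z P k \<and> cmp k (q P A p) = a \<and> cmp k (q P B r) = b" if ab: "hm Z A a" "hm Z B b" for Z a b
  proof -
    obtain a' where a: "Z \<in> Objs K" "a' \<in> Smp (Hom K Z A) 0" "a = q Z A a'" using hm_D[OF ab(1)] by blast
    obtain b' where b: "b' \<in> Smp (Hom K Z B) 0" "b = q Z B b'" using hm_D[OF ab(2)] by blast
    obtain x where x: "x \<in> Smp (Hom K Z P) 0" "ec_post K Z P A p 0 x = a'" "ec_post K Z P B r 0 x = b'"
      using strict_product_surj[OF P a(1,2) b(1)] by blast
    have "cmp (q Z P x) (q P A p) = a" "cmp (q Z P x) (q P B r) = b"
      using cmp_q[OF a(1) Po AB(1) x(1) pr(1)] cmp_q[OF a(1) Po AB(2) x(1) pr(2)] x(2,3) a b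
        post_0[OF Po AB(1) pr(1)] post_0[OF Po AB(2) pr(2)] by simp_all
    thus ?thesis using hm_q[OF a(1) Po x(1)] by blast
  qed
  show "k = k'" if k: "hm Z P k" "hm Z P k'" and e: "cmp k (q P A p) = cmp k' (q P A p)" "cmp k (q P B r) = cmp k' (q P B r)" for Z k k'
  proof -
    obtain x where x: "Z \<in> Objs K" "x \<in> Smp (Hom K Z P) 0" "k = q Z P x" using hm_D[OF k(1)] by blast
    obtain x' where x': "x' \<in> Smp (Hom K Z P) 0" "k' = q Z P x'" using hm_D[OF k(2)] by blast
    have pe: "path_eq (Hom K Z C) (ec_post K Z P C d 0 x) (ec_post K Z P C d 0 x')"
      if C: "C \<in> Objs K" "d \<in> Smp (Hom K P C) 0" and eq: "cmp k (q P C d) = cmp k' (q P C d)" for C d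
    proof -
      have "q Z C (Comp K Z P C 0 d x) = q Z C (Comp K Z P C 0 d x')"
        using eq unfolding x(3) x'(2) cmp_q[OF x(1) Po C(1) x(2) C(2)] cmp_q[OF x(1) Po C(1) x'(1) C(2)] .
      thus ?thesis unfolding post_0[OF Po C]
        using q_eq[OF x(1) C(1) Comp_in[OF x(1) Po C x(2)] Comp_in[OF x(1) Po C x'(1)]] by blast
    qed
    obtain s where s: "edge (Hom K Z A) s (ec_post K Z P A p 0 x) (ec_post K Z P A p 0 x')"
      using pe[OF AB(1) pr(1) e(1)] unfolding path_eq_def by blast
    obtain t where t: "edge (Hom K Z B) t (ec_post K Z P B r 0 x) (ec_post K Z P B r 0 x')"
      using pe[OF AB(2) pr(2) e(2)] unfolding path_eq_def by blast
    obtain z where z: "z \<in> Smp (Hom K Z P) 1" "ec_post K Z P A p 1 z = s" "ec_post K Z P B r 1 z = t"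
      using strict_product_surj[OF P x(1), of s 1 t] s t by (auto simp: edge_def)
    note hs = hom_sset[OF x(1) Po]
    have face: "Act (Hom K Z P) 1 [i] z = w"
      if i: "[i] \<in> ord 0 1" and w: "w \<in> Smp (Hom K Z P) 0" and st: "Act (Hom K Z A) 1 [i] s = ec_post K Z P A p 0 w"
        "Act (Hom K Z B) 1 [i] t = ec_post K Z P B r 0 w" for i w
    proof (rule strict_product_inj[OF P x(1) sset_act_in[OF hs z(1) i] w])
      show "ec_post K Z P A p 0 (Act (Hom K Z P) 1 [i] z) = ec_post K Z P A p 0 w"
        using simplicial_map_act[OF post_map[OF x(1) Po AB(1) pr(1)] z(1) i] z(2) st(1) by simp
      show "ec_post K Z P B r 0 (Act (Hom K Z P) 1 [i] z) = ec_post K Z P B r 0 w"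
        using simplicial_map_act[OF post_map[OF x(1) Po AB(2) pr(2)] z(1) i] z(3) st(2) by simp
    qed
    have "edge (Hom K Z P) z x x'"
      unfolding edge_def using z(1) face[of 0 x] face[of 1 x'] x(2) x'(1) s t by (simp add: edge_def)
    hence "path_eq (Hom K Z P) x x'" unfolding path_eq_def by (rule exI)
    thus ?thesis unfolding x(3) x'(2) using q_eq[OF x(1) Po x(2) x'(1)] by blast
  qed
qed

lemma sprod_simplicial:
  assumes "simplicial_set A" "simplicial_set B"
  shows "simplicial_set (sprod A B)"
  unfolding simplicial_set_def using sset_act_in[OF assms(1)] sset_act_in[OF assms(2)] sset_act_id[OF assms(1)]
    sset_act_id[OF assms(2)] sset_act_act[OF assms(1)] sset_act_act[OF assms(2)] by auto

text \<open>The filter is closed under homotopy products, while the diagram supplies strict ones;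
  this connects the two.\<close>

lemma strict_product_product:
  assumes P: "ec_strict_product K P p r A B" and AB: "A \<in> Objs K" "B \<in> Objs K"
  shows "ec_product K P p r A B"
proof -
  have Po: "P \<in> Objs K" and pr: "p \<in> Smp (Hom K P A) 0" "r \<in> Smp (Hom K P B) 0"
    using P by (simp_all add: ec_strict_product_def)
  show ?thesis unfolding ec_product_def
  proof (intro conjI ballI Po pr)
    fix T assume T: "T \<in> Objs K"
    note p = post_map[OF T Po AB(1) pr(1)] and r = post_map[OF T Po AB(2) pr(2)]
    show "kan_equivalence (Hom K T P) (sprod (Hom K T A) (Hom K T B)) (\<lambda>n x. (ec_post K T P A p n x, ec_post K T P B r n x))"
    proof (rule bij_kan_equivalence[OF hom_sset[OF T Po] sprod_simplicial[OF hom_sset[OF T AB(1)] hom_sset[OF T AB(2)]]])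
      show "simplicial_map (Hom K T P) (sprod (Hom K T A) (Hom K T B)) (\<lambda>n x. (ec_post K T P A p n x, ec_post K T P B r n x))"
        unfolding simplicial_map_def
        using simplicial_map_in[OF p] simplicial_map_in[OF r] simplicial_map_act[OF p] simplicial_map_act[OF r] by simp
      show "bij_betw (\<lambda>x. (ec_post K T P A p n x, ec_post K T P B r n x)) (Smp (Hom K T P) n) (Smp (sprod (Hom K T A) (Hom K T B)) n)" for n
        using P T by (simp add: ec_strict_product_def)
    qed
  qed
qed

lemma prism_act_val:
  assumes "\<theta> \<in> ord m n" "\<alpha> \<in> ord k m" "\<beta> \<in> ord k 1"
  shows "prism_act \<theta> \<phi> (\<alpha>, \<beta>) = \<phi> (ocomp \<theta> \<alpha>, \<beta>)"
proof -
  have "(\<alpha>, \<beta>) \<in> prism m" using assms prism_iff by blast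
  thus ?thesis by (simp add: prism_act_def ord_length[OF assms(1)])
qed

lemma prism_act_in:
  assumes p: "\<phi> \<in> prism_maps X n" and t: "\<theta> \<in> ord m n"
  shows "prism_act \<theta> \<phi> \<in> prism_maps X m"
  unfolding prism_maps_def
proof (intro CollectI conjI allI ballI)
  show "prism_act \<theta> \<phi> \<in> extensional (prism m)" by (simp add: prism_act_def ord_length[OF t])
  fix k \<alpha> \<beta> assume a: "\<alpha> \<in> ord k m" and b: "\<beta> \<in> ord k 1"
  note ta = ocomp_in_ord[OF t a]
  show "prism_act \<theta> \<phi> (\<alpha>, \<beta>) \<in> Smp X k" unfolding prism_act_val[OF t a b] by (rule prism_mapsD(2)[OF p ta b])
  fix j \<psi> assume s: "\<psi> \<in> ord j k"
  show "prism_act \<theta> \<phi> (ocomp \<alpha> \<psi>, ocomp \<beta> \<psi>) = Act X k \<psi> (prism_act \<theta> \<phi> (\<alpha>, \<beta>))"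
    unfolding prism_act_val[OF t a b] prism_act_val[OF t ocomp_in_ord[OF a s] ocomp_in_ord[OF b s]]
      ocomp_assoc[OF ord_length[OF a] s, symmetric] by (rule prism_mapsD(3)[OF p ta b s])
qed

lemma hpb_simplicial:
  assumes o: "T \<in> Objs K" "A \<in> Objs K" "B \<in> Objs K" "C \<in> Objs K" and f: "f \<in> Smp (Hom K A C) 0" "g \<in> Smp (Hom K B C) 0"
  shows "simplicial_set (ec_hpb K T A B C f g)"
proof -
  let ?H = "ec_hpb K T A B C f g"
  have mem: "(a, \<gamma>, b) \<in> Smp ?H n \<longleftrightarrow> a \<in> Smp (Hom K T A) n \<and> b \<in> Smp (Hom K T B) n \<and> \<gamma> \<in> prism_maps (Hom K T C) n \<and>
    \<gamma> (idl n, const_op n 0) = ec_post K T A C f n a \<and> \<gamma> (idl n, const_op n 1) = ec_post K T B C g n b" for a \<gamma> b n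
    by (simp add: ec_hpb_def)
  have act: "Act ?H n \<alpha> (a, \<gamma>, b) = (Act (Hom K T A) n \<alpha> a, prism_act \<alpha> \<gamma>, Act (Hom K T B) n \<alpha> b)" for n \<alpha> a \<gamma> b
    by (simp add: ec_hpb_def)
  note A = hom_sset[OF o(1,2)] and B = hom_sset[OF o(1,3)]
  note pA = simplicial_map_act[OF post_map[OF o(1,2,4) f(1)]] and pB = simplicial_map_act[OF post_map[OF o(1,3,4) f(2)]]
  show ?thesis unfolding simplicial_set_def
  proof (intro conjI allI ballI)
    fix m n \<alpha> x assume al: "\<alpha> \<in> ord m n" and "x \<in> Smp ?H n"
    then obtain a \<gamma> b where x: "x = (a, \<gamma>, b)" "a \<in> Smp (Hom K T A) n" "b \<in> Smp (Hom K T B) n" "\<gamma> \<in> prism_maps (Hom K T C) n"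
      "\<gamma> (idl n, const_op n 0) = ec_post K T A C f n a" "\<gamma> (idl n, const_op n 1) = ec_post K T B C g n b"
      using mem by (cases x) auto
    have ends: "prism_act \<alpha> \<gamma> (idl m, const_op m i) = Act (Hom K T C) n \<alpha> (\<gamma> (idl n, const_op n i))" if i: "i \<le> 1" for i
    proof -
      have c: "const_op m i \<in> ord m 1" "const_op n i \<in> ord n 1" using i by simp_all
      show ?thesis unfolding prism_act_val[OF al idl_ord c(1)] ocomp_idl_right[OF ord_length[OF al]]
        using prism_mapsD(3)[OF x(4) idl_ord c(2) al] by (simp add: ocomp_idl_left[OF al] ocomp_const_left[OF al])
    qed
    show "Act ?H n \<alpha> x \<in> Smp ?H m"
      unfolding x(1) act mem
      using sset_act_in[OF A x(2) al] sset_act_in[OF B x(3) al] prism_act_in[OF x(4) al] ends[of 0] ends[of 1]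
        pA[OF x(2) al] pB[OF x(3) al] x(5,6) by simp
    fix k \<beta> assume b: "\<beta> \<in> ord k m"
    have "prism_act \<beta> (prism_act \<alpha> \<gamma>) = prism_act (ocomp \<alpha> \<beta>) \<gamma>"
    proof (rule ext_pairI)
      note ab = ocomp_in_ord[OF al b]
      show "prism_act \<beta> (prism_act \<alpha> \<gamma>) \<in> extensional (prism k)" "prism_act (ocomp \<alpha> \<beta>) \<gamma> \<in> extensional (prism k)"
        using prism_mapsD(1)[OF prism_act_in[OF prism_act_in[OF x(4) al] b]] prism_mapsD(1)[OF prism_act_in[OF x(4) ab]] .
      fix j \<theta> \<eta> assume t: "\<theta> \<in> ord j k" "\<eta> \<in> ord j 1"
      show "prism_act \<beta> (prism_act \<alpha> \<gamma>) (\<theta>, \<eta>) = prism_act (ocomp \<alpha> \<beta>) \<gamma> (\<theta>, \<eta>)"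
        unfolding prism_act_val[OF b t] prism_act_val[OF al ocomp_in_ord[OF b t(1)] t(2)] prism_act_val[OF ab t]
          ocomp_assoc[OF ord_length[OF b] t(1)] ..
    qed
    thus "Act ?H m \<beta> (Act ?H n \<alpha> x) = Act ?H n (ocomp \<alpha> \<beta>) x"
      unfolding x(1) act using sset_act_act[OF A x(2) al b] sset_act_act[OF B x(3) al b] by simp
  next
    fix n x assume "x \<in> Smp ?H n"
    then obtain a \<gamma> b where x: "x = (a, \<gamma>, b)" "a \<in> Smp (Hom K T A) n" "b \<in> Smp (Hom K T B) n" "\<gamma> \<in> prism_maps (Hom K T C) n"
      using mem by (cases x) auto
    have "prism_act (idl n) \<gamma> = \<gamma>"
    proof (rule ext_pairI[OF _ prism_mapsD(1)[OF x(4)]])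
      show "prism_act (idl n) \<gamma> \<in> extensional (prism n)" by (rule prism_mapsD(1)[OF prism_act_in[OF x(4) idl_ord]])
      fix j \<theta> \<eta> assume t: "\<theta> \<in> ord j n" "\<eta> \<in> ord j 1"
      show "prism_act (idl n) \<gamma> (\<theta>, \<eta>) = \<gamma> (\<theta>, \<eta>)"
        unfolding prism_act_val[OF idl_ord t] ocomp_idl_left[OF t(1)] ..
    qed
    thus "Act ?H n (idl n) x = x" unfolding x(1) act using sset_act_id[OF A x(2)] sset_act_id[OF B x(3)] by simp
  qed
qed

text \<open>After composition with the monomorphism \<open>m\<close> into a final object, the two
  maps are joined by a path \<open>\<eta>\<close>. The triple of \<open>x\<close>,
  \<open>\<eta>\<close> and \<open>y\<close> is a vertex of the homotopy pullback of
  \<open>m\<close> with itself, and up to a path it comes from a single \<open>z\<close>; so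
  \<open>x\<close> and \<open>y\<close> are both joined to \<open>z\<close>.\<close>

lemma subobject_unique:
  assumes V: "V \<in> ec_subobjects K" and a: "hm Z V A" "hm Z V B"
  shows "A = B"
proof -
  obtain e m where e: "ec_final K e" and m: "ec_mono K V e m" using V unfolding ec_subobjects_def by blast
  have o: "V \<in> Objs K" "e \<in> Objs K" and m0: "m \<in> Smp (Hom K V e) 0"
    and pb: "ec_pullback K V (Ident K V) (Ident K V) (degs (Hom K V e) 1 m) V V e m m"
    using m by (simp_all add: ec_mono_def)
  obtain x where x: "Z \<in> Objs K" "x \<in> Smp (Hom K Z V) 0" "A = q Z V x" using hm_D[OF a(1)] by blast
  obtain y where y: "y \<in> Smp (Hom K Z V) 0" "B = q Z V y" using hm_D[OF a(2)] by blast
  have C: "contractible (Hom K Z e)" using e x(1) by (simp add: ec_final_def)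
  note S = hom_sset[OF x(1) o(2)]
  obtain \<eta> where eta: "edge (Hom K Z e) \<eta> (Comp K Z V e 0 m x) (Comp K Z V e 0 m y)"
    using contractible_edge[OF S C Comp_in[OF x(1) o m0 x(2)] Comp_in[OF x(1) o m0 y(1)]] by blast
  have eta1: "\<eta> \<in> Smp (Hom K Z e) 1" using eta by (simp add: edge_def)
  \<comment> \<open>The path \<open>\<eta>\<close> as a vertex of the path object: a prism over a
    point.\<close>
  define \<gamma> where "\<gamma> = restrict (\<lambda>(\<alpha> :: nat list, \<beta>). Act (Hom K Z e) 1 \<beta> \<eta>) (prism 0)"
  have gv: "\<gamma> (\<alpha>, \<beta>) = Act (Hom K Z e) 1 \<beta> \<eta>" if "\<alpha> \<in> ord k 0" "\<beta> \<in> ord k 1" for \<alpha> \<beta> k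
  proof -
    have "(\<alpha>, \<beta>) \<in> prism 0" using that prism_iff by blast
    thus ?thesis by (simp add: \<gamma>_def)
  qed
  have gP: "\<gamma> \<in> prism_maps (Hom K Z e) 0" unfolding prism_maps_def
  proof (intro CollectI conjI allI ballI)
    show "\<gamma> \<in> extensional (prism 0)" by (simp add: \<gamma>_def)
    fix k \<alpha> \<beta> assume al: "\<alpha> \<in> ord k 0" and b: "\<beta> \<in> ord k 1"
    show "\<gamma> (\<alpha>, \<beta>) \<in> Smp (Hom K Z e) k" unfolding gv[OF al b] by (rule sset_act_in[OF S eta1 b])
    fix j \<theta> assume t: "\<theta> \<in> ord j k"
    show "\<gamma> (ocomp \<alpha> \<theta>, ocomp \<beta> \<theta>) = Act (Hom K Z e) k \<theta> (\<gamma> (\<alpha>, \<beta>))"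
      unfolding gv[OF al b] gv[OF ocomp_in_ord[OF al t] ocomp_in_ord[OF b t]] by (rule sset_act_act[OF S eta1 b t, symmetric])
  qed
  let ?H = "ec_hpb K Z V V e m m"
  have "\<gamma> (idl 0, const_op 0 0) = ec_post K Z V e m 0 x" "\<gamma> (idl 0, const_op 0 1) = ec_post K Z V e m 0 y"
    using gv[of "idl 0" 0 "const_op 0 0"] gv[of "idl 0" 0 "const_op 0 1"] eta post_0[OF o m0]
    by (simp_all add: edge_def const_op_simps(1))
  hence h0: "(x, \<gamma>, y) \<in> Smp ?H 0" using x(2) y(1) gP by (simp add: ec_hpb_def)
  let ?phi = "\<lambda>n x. (ec_post K Z V V (Ident K V) n x,
              restrict (\<lambda>(\<alpha>, \<beta>). Comp K Z V e (length \<alpha> - 1)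
                 (Act (Hom K V e) 1 \<beta> (degs (Hom K V e) 1 m)) (Act (Hom K Z V) n \<alpha> x)) (prism n),
              ec_post K Z V V (Ident K V) n x)"
  have E: "kan_equivalence (Hom K Z V) ?H ?phi"
    using pb x(1) unfolding ec_pullback_def by blast
  obtain z w where z: "z \<in> Smp (Hom K Z V) 0" and w: "edge ?H w (?phi 0 z) (x, \<gamma>, y)"
    using kan_equivalence_surj[OF hpb_simplicial[OF x(1) o(1,1,2) m0 m0] E h0] by blast
  obtain w1 w2 w3 where ww: "w = (w1, w2, w3)" by (cases w)
  have pz: "ec_post K Z V V (Ident K V) 0 z = z"
    unfolding post_0[OF o(1,1) Ident_in[OF o(1)]] by (rule Comp_id0(2)[OF x(1) o(1) z])
  have "edge (Hom K Z V) w1 z x" "edge (Hom K Z V) w3 z y"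
    using w unfolding ww edge_def pz by (simp_all add: ec_hpb_def)
  hence p: "path_eq (Hom K Z V) z x" "path_eq (Hom K Z V) z y" unfolding path_eq_def by auto
  note Kn = hom_kan[OF x(1) o(1)]
  show ?thesis unfolding x(3) y(2) using q_eq[OF x(1) o(1) x(2) y(1)] path_eq_trans[OF Kn path_eq_sym[OF Kn p(1)] p(2)] by simp
qed

end

lemma (in dir_sset) path_stage:
  assumes v: "v \<in> I" "a \<in> Smp (D v) 0" "b \<in> Smp (D v) 0" and p: "path_eq Q (cln 0 v a) (cln 0 v b)"
  shows "evt (\<lambda>w. le w v \<and> path_eq (D w) (t v w 0 a) (t v w 0 b))"
proof -
  obtain s where s: "edge Q s (cln 0 v a) (cln 0 v b)" using p unfolding path_eq_def by blast
  hence "s \<in> Smp Q 1" by (simp add: edge_def)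
  then obtain u d where u: "u \<in> I" "d \<in> Smp (D u) 1" "s = cln 1 u d" unfolding Q_Smp by blast
  have d: "Act (D u) 1 [0] d \<in> Smp (D u) 0" "Act (D u) 1 [1] d \<in> Smp (D u) 0"
    by (rule sset_act_in[OF D_sset[OF u(1)] u(2)], simp)+
  have "cln 0 u (Act (D u) 1 [0] d) = cln 0 v a" "cln 0 u (Act (D u) 1 [1] d) = cln 0 v b"
    using s cln_act[OF u(1,2), of "[0]" 0] cln_act[OF u(1,2), of "[1]" 0] unfolding u(3) by (simp_all add: edge_def)
  note E = dirsys.cls_eqD[OF dirsys_level u(1) d(1) v(1,2) this(1)] dirsys.cls_eqD[OF dirsys_level u(1) d(2) v(1,3) this(2)]
  show ?thesis
  proof (rule evt_mono[OF evt_conj[OF E]], elim conjE)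
    fix w assume w: "w \<in> I" "le w u" "le w v" "t u w 0 (Act (D u) 1 [0] d) = t v w 0 a"
      "t u w 0 (Act (D u) 1 [1] d) = t v w 0 b"
    note m = t_map[OF u(1) w(1,2)]
    have "edge (D w) (t u w 1 d) (t v w 0 a) (t v w 0 b)"
      using simplicial_map_in[OF m u(2)] simplicial_map_act[OF m u(2), of "[0]" 0] simplicial_map_act[OF m u(2), of "[1]" 0] w(4,5)
      by (simp add: edge_def)
    thus "le w v \<and> path_eq (D w) (t v w 0 a) (t v w 0 b)" using w(3) unfolding path_eq_def by blast
  qed
qed

section \<open>The filter quotient of a Kan enriched category\<close>

locale kan_filter = kan_cat +
  fixes \<Phi> :: "'a set set" and c :: "('a, 'b) ec_choice"
  assumes F: "ec_filter K \<Phi>" and D: "ec_diagram K \<Phi> c"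
begin

abbreviation le :: "'a set \<Rightarrow> 'a set \<Rightarrow> bool" where "le \<equiv> sub_le (ec_map_exists K)"

abbreviation tm :: "'a \<Rightarrow> 'a set \<Rightarrow> 'a" where "tm \<equiv> etimes c"

lemma rep_in: "v \<in> \<Phi> \<Longrightarrow> erep c v \<in> v"
  using D unfolding ec_diagram_def by blast

lemma subobjects_Objs: "ec_subobjects K \<subseteq> Objs K"
  unfolding ec_subobjects_def ec_mono_def by blast

lemma rep_sub: "v \<in> \<Phi> \<Longrightarrow> erep c v \<in> ec_subobjects K"
proof -
  assume v: "v \<in> \<Phi>"
  have "\<Phi> \<subseteq> sub_poset (ec_subobjects K) (ec_map_exists K)"
    using F unfolding ec_filter_def product_closed_filter_def by (elim conjE)
  thus ?thesis using v rep_in[OF v] unfolding sub_poset_def sub_class_def by auto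
qed

lemma rep_obj: "v \<in> \<Phi> \<Longrightarrow> erep c v \<in> Objs K"
  using rep_sub subobjects_Objs by blast

lemma strict: "X \<in> Objs K \<Longrightarrow> v \<in> \<Phi> \<Longrightarrow> ec_strict_product K (tm X v) (pr1 c X v) (pr2 c X v) X (erep c v)"
  using D unfolding ec_diagram_def by blast

lemma strict_in:
  assumes "X \<in> Objs K" "v \<in> \<Phi>"
  shows "tm X v \<in> Objs K" "pr1 c X v \<in> Smp (Hom K (tm X v) X) 0" "pr2 c X v \<in> Smp (Hom K (tm X v) (erep c v)) 0"
  using strict[OF assms] unfolding ec_strict_product_def by simp_all

lemma incl_in: "v \<in> \<Phi> \<Longrightarrow> w \<in> \<Phi> \<Longrightarrow> le w v \<Longrightarrow> incl c w v \<in> Smp (Hom K (erep c w) (erep c v)) 0"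
  using D unfolding ec_diagram_def by blast

lemma incl_id: "v \<in> \<Phi> \<Longrightarrow> incl c v v = Ident K (erep c v)"
  using D unfolding ec_diagram_def by blast

lemma incl_comp: "v \<in> \<Phi> \<Longrightarrow> w \<in> \<Phi> \<Longrightarrow> x \<in> \<Phi> \<Longrightarrow> le w v \<Longrightarrow> le x w \<Longrightarrow>
    Comp K (erep c x) (erep c w) (erep c v) 0 (incl c w v) (incl c x w) = incl c x v"
  using D unfolding ec_diagram_def by blast

lemma directed_filter: "directed \<Phi> le"
proof (rule filter_directed(1)[OF F[unfolded ec_filter_def] subobjects_Objs, where rep = "erep c"])
  show "P \<in> Objs K" if "\<exists>p q. ec_product K P p q U V" for P U V using that unfolding ec_product_def by blast
  show "ec_map_exists K U U" if "U \<in> ec_subobjects K" for U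
    using Ident_in subobjects_Objs that unfolding ec_map_exists_def by blast
  show "ec_map_exists K U X" if o: "U \<in> Objs K" "V \<in> Objs K" "X \<in> Objs K" and m: "ec_map_exists K U V" "ec_map_exists K V X" for U V X
  proof -
    obtain f g where fg: "f \<in> Smp (Hom K U V) 0" "g \<in> Smp (Hom K V X) 0" using m unfolding ec_map_exists_def by blast
    show ?thesis using Comp_in[OF o fg(2,1)] unfolding ec_map_exists_def by blast
  qed
  show "erep c v \<in> v" if "v \<in> \<Phi>" for v by (rule rep_in[OF that])
  show "\<exists>P. (\<exists>p q. ec_product K P p q (erep c u) (erep c v)) \<and> ec_map_exists K P (erep c u) \<and> ec_map_exists K P (erep c v)"
    if u: "u \<in> \<Phi>" and v: "v \<in> \<Phi>" for u v
    using strict_product_product[OF strict[OF rep_obj[OF u] v] rep_obj[OF u] rep_obj[OF v]] strict_in(2,3)[OF rep_obj[OF u] v]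
    unfolding ec_map_exists_def by blast
qed

sublocale directed \<Phi> le by (rule directed_filter)

abbreviation cm :: "'a \<Rightarrow> 'a \<Rightarrow> 'a \<Rightarrow> 'b \<Rightarrow> 'b \<Rightarrow> 'b" where
  "cm X Y Z \<equiv> Comp K X Y Z 0"

abbreviation arrows :: "'a \<Rightarrow> 'a \<Rightarrow> 'b set" where
  "arrows X Y \<equiv> Smp (Hom K X Y) 0"

lemma pair_eq:
  assumes o: "T \<in> Objs K" "X \<in> Objs K" "v \<in> \<Phi>" and x: "x \<in> arrows T (tm X v)" "y \<in> arrows T (tm X v)"
    and e: "cm T (tm X v) X (pr1 c X v) x = cm T (tm X v) X (pr1 c X v) y"
      "cm T (tm X v) (erep c v) (pr2 c X v) x = cm T (tm X v) (erep c v) (pr2 c X v) y"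
  shows "x = y"
proof (rule strict_product_inj[OF strict[OF o(2,3)] o(1) x])
  note s = strict_in[OF o(2,3)]
  show "ec_post K T (tm X v) X (pr1 c X v) 0 x = ec_post K T (tm X v) X (pr1 c X v) 0 y"
    unfolding post_0[OF s(1) o(2) s(2)] by (rule e)
  show "ec_post K T (tm X v) (erep c v) (pr2 c X v) 0 x = ec_post K T (tm X v) (erep c v) (pr2 c X v) 0 y"
    unfolding post_0[OF s(1) rep_obj[OF o(3)] s(3)] by (rule e)
qed

lemma pair_props:
  assumes o: "T \<in> Objs K" "X \<in> Objs K" "v \<in> \<Phi>" and a: "a \<in> arrows T X" "b \<in> arrows T (erep c v)"
  shows "ec_pair K c T X v 0 a b \<in> arrows T (tm X v)"
    "cm T (tm X v) X (pr1 c X v) (ec_pair K c T X v 0 a b) = a"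
    "cm T (tm X v) (erep c v) (pr2 c X v) (ec_pair K c T X v 0 a b) = b"
proof -
  note s = strict_in[OF o(2,3)]
  let ?P = "\<lambda>x. x \<in> arrows T (tm X v) \<and> cm T (tm X v) X (pr1 c X v) x = a \<and> cm T (tm X v) (erep c v) (pr2 c X v) x = b"
  obtain x where x: "?P x"
    using strict_product_surj[OF strict[OF o(2,3)] o(1) a] unfolding post_0[OF s(1) o(2) s(2)] post_0[OF s(1) rep_obj[OF o(3)] s(3)]
    by blast
  have "y = x" if y: "?P y" for y by (rule pair_eq[OF o]) (use x y in simp_all)
  hence "?P (THE x. ?P x)" by (rule theI[of ?P, OF x])
  moreover have "ec_pair K c T X v 0 a b = (THE x. ?P x)"
    unfolding ec_pair_def post_0[OF s(1) o(2) s(2)] post_0[OF s(1) rep_obj[OF o(3)] s(3)] ..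
  ultimately show "ec_pair K c T X v 0 a b \<in> arrows T (tm X v)"
    "cm T (tm X v) X (pr1 c X v) (ec_pair K c T X v 0 a b) = a"
    "cm T (tm X v) (erep c v) (pr2 c X v) (ec_pair K c T X v 0 a b) = b" by simp_all
qed

definition times_incl :: "'a \<Rightarrow> 'a set \<Rightarrow> 'a set \<Rightarrow> 'b" where
  "times_incl X v w = ec_pair K c (tm X w) X v 0 (pr1 c X w) (cm (tm X w) (erep c w) (erep c v) (incl c w v) (pr2 c X w))"

lemma restrict_def: "ec_restrict K c X Y v w n f = Comp K (tm X w) (tm X v) Y n f (degs (Hom K (tm X w) (tm X v)) n (times_incl X v w))"
  by (simp add: ec_restrict_def times_incl_def Let_def)

lemma times_incl_props:
  assumes X: "X \<in> Objs K" and vw: "v \<in> \<Phi>" "w \<in> \<Phi>" "le w v"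
  shows "times_incl X v w \<in> arrows (tm X w) (tm X v)"
    "cm (tm X w) (tm X v) X (pr1 c X v) (times_incl X v w) = pr1 c X w"
    "cm (tm X w) (tm X v) (erep c v) (pr2 c X v) (times_incl X v w) = cm (tm X w) (erep c w) (erep c v) (incl c w v) (pr2 c X w)"
  unfolding times_incl_def
  by (rule pair_props[OF strict_in(1)[OF X vw(2)] X vw(1) strict_in(2)[OF X vw(2)]
        Comp_in[OF strict_in(1)[OF X vw(2)] rep_obj[OF vw(2)] rep_obj[OF vw(1)] incl_in[OF vw] strict_in(3)[OF X vw(2)]]])+

lemma times_incl_id:
  assumes X: "X \<in> Objs K" and v: "v \<in> \<Phi>"
  shows "times_incl X v v = Ident K (tm X v)"
proof (rule pair_eq[OF strict_in(1)[OF X v] X v])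
  note s = strict_in[OF X v] and i = times_incl_props[OF X v v le_refl[OF v]]
  show "times_incl X v v \<in> arrows (tm X v) (tm X v)" by (rule i)
  show "Ident K (tm X v) \<in> arrows (tm X v) (tm X v)" by (rule Ident_in[OF s(1)])
  show "cm (tm X v) (tm X v) X (pr1 c X v) (times_incl X v v) = cm (tm X v) (tm X v) X (pr1 c X v) (Ident K (tm X v))"
    unfolding i(2) Comp_id0(1)[OF s(1) X s(2)] ..
  show "cm (tm X v) (tm X v) (erep c v) (pr2 c X v) (times_incl X v v) = cm (tm X v) (tm X v) (erep c v) (pr2 c X v) (Ident K (tm X v))"
    unfolding i(3) incl_id[OF v] Comp_id0[OF s(1) rep_obj[OF v] s(3)] ..
qed

text \<open>Strict products determine a map by its components on the nose, and \<open>incl\<close>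
  composes strictly. The equality is therefore strict, as the colimit requires.\<close>

lemma times_incl_comp:
  assumes X: "X \<in> Objs K" and v: "v \<in> \<Phi>" and w: "w \<in> \<Phi>" and x: "x \<in> \<Phi>" and l: "le w v" "le x w"
  shows "cm (tm X x) (tm X w) (tm X v) (times_incl X v w) (times_incl X w x) = times_incl X v x"
proof (rule pair_eq[OF strict_in(1)[OF X x] X v])
  note sv = strict_in[OF X v] and sw = strict_in[OF X w] and sx = strict_in[OF X x]
  note xv = le_trans[OF x w v l(2,1)]
  note i = times_incl_props[OF X v w l(1)] and j = times_incl_props[OF X w x l(2)] and k = times_incl_props[OF X v x xv]
  note r = rep_obj[OF v] rep_obj[OF w] rep_obj[OF x]
  show "cm (tm X x) (tm X w) (tm X v) (times_incl X v w) (times_incl X w x) \<in> arrows (tm X x) (tm X v)"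
    by (rule Comp_in[OF sx(1) sw(1) sv(1) i(1) j(1)])
  show "times_incl X v x \<in> arrows (tm X x) (tm X v)" by (rule k)
  show "cm (tm X x) (tm X v) X (pr1 c X v) (cm (tm X x) (tm X w) (tm X v) (times_incl X v w) (times_incl X w x)) =
      cm (tm X x) (tm X v) X (pr1 c X v) (times_incl X v x)"
    unfolding Comp_assoc[OF sx(1) sw(1) sv(1) X sv(2) i(1) j(1), symmetric] i(2) j(2) k(2) ..
  show "cm (tm X x) (tm X v) (erep c v) (pr2 c X v) (cm (tm X x) (tm X w) (tm X v) (times_incl X v w) (times_incl X w x)) =
      cm (tm X x) (tm X v) (erep c v) (pr2 c X v) (times_incl X v x)"
    unfolding Comp_assoc[OF sx(1) sw(1) sv(1) r(1) sv(3) i(1) j(1), symmetric] i(3) k(3)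
      Comp_assoc[OF sx(1) sw(1) r(2,1) incl_in[OF v w l(1)] sw(3) j(1)] j(3)
      Comp_assoc[OF sx(1) r(3,2,1) incl_in[OF v w l(1)] incl_in[OF w x l(2)] sx(3), symmetric] incl_comp[OF v w x l] ..
qed

lemma restrict_0:
  assumes "X \<in> Objs K" "Y \<in> Objs K" "v \<in> \<Phi>" "w \<in> \<Phi>" "le w v"
  shows "ec_restrict K c X Y v w 0 f = cm (tm X w) (tm X v) Y f (times_incl X v w)"
  unfolding restrict_def
  using degs_simps(2)[OF hom_sset[OF strict_in(1)[OF assms(1,4)] strict_in(1)[OF assms(1,3)]] times_incl_props(1)[OF assms(1,3-5)]] by simp

lemma system:
  assumes X: "X \<in> Objs K" and Y: "Y \<in> Objs K"
  shows "dir_sset \<Phi> le (\<lambda>v. Hom K (tm X v) Y) (ec_restrict K c X Y)"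
proof
  note s = strict_in(1)[OF X]
  show "simplicial_set (Hom K (tm X v) Y)" if "v \<in> \<Phi>" for v by (rule hom_sset[OF s[OF that] Y])
  show "simplicial_map (Hom K (tm X v) Y) (Hom K (tm X w) Y) (ec_restrict K c X Y v w)"
    if v: "v \<in> \<Phi>" and w: "w \<in> \<Phi>" and l: "le w v" for v w
  proof -
    note d = degs_simps[OF hom_sset[OF s[OF w] s[OF v]] times_incl_props(1)[OF X v w l]]
    show ?thesis unfolding simplicial_map_def restrict_def
      using Comp_in[OF s[OF w] s[OF v] Y _ d(1)] Comp_act[OF s[OF w] s[OF v] Y _ d(1)] d(3) by simp
  qed
  show "ec_restrict K c X Y v v n a = a" if v: "v \<in> \<Phi>" and a: "a \<in> Smp (Hom K (tm X v) Y) n" for v a n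
    unfolding restrict_def times_incl_id[OF X v] by (rule Comp_id(1)[OF s[OF v] Y a])
  show "ec_restrict K c X Y w x n (ec_restrict K c X Y v w n a) = ec_restrict K c X Y v x n a"
    if v: "v \<in> \<Phi>" and w: "w \<in> \<Phi>" and x: "x \<in> \<Phi>" and l: "le w v" "le x w" and a: "a \<in> Smp (Hom K (tm X v) Y) n" for v w x a n
  proof -
    note i = times_incl_props(1)[OF X v w l(1)] and j = times_incl_props(1)[OF X w x l(2)]
    show ?thesis unfolding restrict_def
      Comp_assoc[OF s[OF x] s[OF w] s[OF v] Y a degs_simps(1)[OF hom_sset[OF s[OF w] s[OF v]] i] degs_simps(1)[OF hom_sset[OF s[OF x] s[OF w]] j]]
      Comp_degs[OF s[OF x] s[OF w] s[OF v] i j] times_incl_comp[OF X v w x l] ..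
  qed
qed

abbreviation over :: "'a \<Rightarrow> 'a \<Rightarrow> 'a set \<Rightarrow> 'b \<Rightarrow> 'b" where
  "over X Y v f \<equiv> ec_over K c X Y v 0 f"

abbreviation res :: "'a \<Rightarrow> 'a \<Rightarrow> 'a set \<Rightarrow> 'a set \<Rightarrow> 'b \<Rightarrow> 'b" where
  "res X Y v w f \<equiv> ec_restrict K c X Y v w 0 f"

lemma over_props:
  assumes X: "X \<in> Objs K" and Y: "Y \<in> Objs K" and v: "v \<in> \<Phi>" and f: "f \<in> arrows (tm X v) Y"
  shows "over X Y v f \<in> arrows (tm X v) (tm Y v)"
    "cm (tm X v) (tm Y v) Y (pr1 c Y v) (over X Y v f) = f"
    "cm (tm X v) (tm Y v) (erep c v) (pr2 c Y v) (over X Y v f) = pr2 c X v"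
proof -
  note s = strict_in[OF X v]
  have e: "degs (Hom K (tm X v) (erep c v)) 0 (pr2 c X v) = pr2 c X v"
    by (rule degs_simps(2)[OF hom_sset[OF s(1) rep_obj[OF v]] s(3)])
  show "over X Y v f \<in> arrows (tm X v) (tm Y v)"
    "cm (tm X v) (tm Y v) Y (pr1 c Y v) (over X Y v f) = f"
    "cm (tm X v) (tm Y v) (erep c v) (pr2 c Y v) (over X Y v f) = pr2 c X v"
    unfolding ec_over_def e by (rule pair_props[OF s(1) Y v f s(3)])+
qed

lemma res_in:
  assumes "X \<in> Objs K" "Y \<in> Objs K" "v \<in> \<Phi>" "w \<in> \<Phi>" "le w v" "f \<in> arrows (tm X v) Y"
  shows "res X Y v w f \<in> arrows (tm X w) Y"
  by (rule simplicial_map_in[OF dir_sset.t_map[OF system[OF assms(1,2)] assms(3-5)] assms(6)])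

lemma res_pr1:
  assumes "X \<in> Objs K" "v \<in> \<Phi>" "w \<in> \<Phi>" "le w v"
  shows "res X X v w (pr1 c X v) = pr1 c X w"
  unfolding restrict_0[OF assms(1,1,2-4)] by (rule times_incl_props(2)[OF assms])

lemma over_res:
  assumes X: "X \<in> Objs K" and Y: "Y \<in> Objs K" and v: "v \<in> \<Phi>" and w: "w \<in> \<Phi>" and l: "le w v" and f: "f \<in> arrows (tm X v) Y"
  shows "cm (tm X w) (tm X v) (tm Y v) (over X Y v f) (times_incl X v w) = cm (tm X w) (tm Y w) (tm Y v) (times_incl Y v w) (over X Y w (res X Y v w f))"
proof (rule pair_eq[OF strict_in(1)[OF X w] Y v])
  note Xv = strict_in[OF X v] and Xw = strict_in[OF X w] and Yv = strict_in[OF Y v] and Yw = strict_in[OF Y w]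
  note rf = res_in[OF X Y v w l f]
  note o = over_props[OF X Y v f] and o' = over_props[OF X Y w rf] and i = times_incl_props[OF X v w l] and j = times_incl_props[OF Y v w l]
  note r = rep_obj[OF v] rep_obj[OF w]
  show "cm (tm X w) (tm X v) (tm Y v) (over X Y v f) (times_incl X v w) \<in> arrows (tm X w) (tm Y v)"
    by (rule Comp_in[OF Xw(1) Xv(1) Yv(1) o(1) i(1)])
  show "cm (tm X w) (tm Y w) (tm Y v) (times_incl Y v w) (over X Y w (res X Y v w f)) \<in> arrows (tm X w) (tm Y v)"
    by (rule Comp_in[OF Xw(1) Yw(1) Yv(1) j(1) o'(1)])
  show "cm (tm X w) (tm Y v) Y (pr1 c Y v) (cm (tm X w) (tm X v) (tm Y v) (over X Y v f) (times_incl X v w)) =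
    cm (tm X w) (tm Y v) Y (pr1 c Y v) (cm (tm X w) (tm Y w) (tm Y v) (times_incl Y v w) (over X Y w (res X Y v w f)))"
    unfolding Comp_assoc[OF Xw(1) Xv(1) Yv(1) Y Yv(2) o(1) i(1), symmetric] o(2)
      Comp_assoc[OF Xw(1) Yw(1) Yv(1) Y Yv(2) j(1) o'(1), symmetric] j(2) o'(2)
    by (rule restrict_0[OF X Y v w l, symmetric])
  show "cm (tm X w) (tm Y v) (erep c v) (pr2 c Y v) (cm (tm X w) (tm X v) (tm Y v) (over X Y v f) (times_incl X v w)) =
    cm (tm X w) (tm Y v) (erep c v) (pr2 c Y v) (cm (tm X w) (tm Y w) (tm Y v) (times_incl Y v w) (over X Y w (res X Y v w f)))"
    unfolding Comp_assoc[OF Xw(1) Xv(1) Yv(1) r(1) Yv(3) o(1) i(1), symmetric] o(3) i(3)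
      Comp_assoc[OF Xw(1) Yw(1) Yv(1) r(1) Yv(3) j(1) o'(1), symmetric] j(3)
      Comp_assoc[OF Xw(1) Yw(1) r(2,1) incl_in[OF v w l] Yw(3) o'(1)] o'(3) ..
qed

text \<open>Restriction commutes with the composition of the quotient because \<open>f\<close>
  paired with the projection to \<open>V\<close> is natural in \<open>V\<close>; composition is thus
  independent of the stage.\<close>

lemma res_comp:
  assumes X: "X \<in> Objs K" and Y: "Y \<in> Objs K" and Z: "Z \<in> Objs K" and v: "v \<in> \<Phi>" and w: "w \<in> \<Phi>" and l: "le w v"
    and f: "f \<in> arrows (tm X v) Y" and g: "g \<in> arrows (tm Y v) Z"
  shows "res X Z v w (cm (tm X v) (tm Y v) Z g (over X Y v f)) = cm (tm X w) (tm Y w) Z (res Y Z v w g) (over X Y w (res X Y v w f))"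
proof -
  note Xv = strict_in[OF X v] and Xw = strict_in[OF X w] and Yv = strict_in[OF Y v] and Yw = strict_in[OF Y w]
  note rf = res_in[OF X Y v w l f]
  note o = over_props[OF X Y v f] and o' = over_props[OF X Y w rf] and i = times_incl_props[OF X v w l] and j = times_incl_props[OF Y v w l]
  show ?thesis
    unfolding restrict_0[OF X Z v w l] Comp_assoc[OF Xw(1) Xv(1) Yv(1) Z g o(1) i(1)] over_res[OF X Y v w l f]
      restrict_0[OF Y Z v w l, of g] Comp_assoc[OF Xw(1) Yw(1) Yv(1) Z g j(1) o'(1)] ..
qed

abbreviation kl :: "'a \<Rightarrow> 'a \<Rightarrow> 'a set \<Rightarrow> 'b \<Rightarrow> ('a set \<times> 'b) set" where
  "kl X Y \<equiv> ec_class K \<Phi> c X Y 0"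

abbreviation Qt :: "('a, ('a set \<times> 'b) set) ecat" where
  "Qt \<equiv> ec_quotient K \<Phi> c"

text \<open>The description by \<open>THE\<close> in the quotient determines a value: other
  representatives of the two classes agree with the given ones at a later stage, where
  \<open>res_comp\<close> compares the composites.\<close>

lemma Comp_class:
  assumes X: "X \<in> Objs K" and Y: "Y \<in> Objs K" and Z: "Z \<in> Objs K" and v: "v \<in> \<Phi>"
    and f: "f \<in> arrows (tm X v) Y" and g: "g \<in> arrows (tm Y v) Z"
  shows "Comp Qt X Y Z 0 (kl Y Z v g) (kl X Y v f) = kl X Z v (cm (tm X v) (tm Y v) Z g (over X Y v f))"
proof -
  interpret XY: dir_sset \<Phi> le "\<lambda>v. Hom K (tm X v) Y" "ec_restrict K c X Y" by (rule system[OF X Y])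
  interpret YZ: dir_sset \<Phi> le "\<lambda>v. Hom K (tm Y v) Z" "ec_restrict K c Y Z" by (rule system[OF Y Z])
  interpret XZ: dir_sset \<Phi> le "\<lambda>v. Hom K (tm X v) Z" "ec_restrict K c X Z" by (rule system[OF X Z])
  note xy = XY.dirsys_level[of 0] and yz = YZ.dirsys_level[of 0] and xz = XZ.dirsys_level[of 0]
  have uniq: "\<psi> = kl X Z v (cm (tm X v) (tm Y v) Z g (over X Y v f))"
    if m: "(u, f') \<in> kl X Y v f" "(u, g') \<in> kl Y Z v g" and e: "\<psi> = kl X Z u (cm (tm X u) (tm Y u) Z g' (over X Y u f'))"
    for \<psi> u f' g'
  proof -
    note mf = m(1)[unfolded ec_class_def] and mg = m(2)[unfolded ec_class_def]
    have u: "u \<in> \<Phi>" "f' \<in> arrows (tm X u) Y" "g' \<in> arrows (tm Y u) Z"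
      using dirsys.cls_mem_sym[OF xy v f mf] dirsys.cls_mem_sym[OF yz v g mg] by simp_all
    have ef: "evt (\<lambda>w. le w u \<and> le w v \<and> res X Y u w f' = res X Y v w f)"
      by (rule dirsys.cls_eqD[OF xy u(1,2) v f dirsys.cls_mem_eq[OF xy v f mf]])
    have eg: "evt (\<lambda>w. le w u \<and> le w v \<and> res Y Z u w g' = res Y Z v w g)"
      by (rule dirsys.cls_eqD[OF yz u(1,3) v g dirsys.cls_mem_eq[OF yz v g mg]])
    obtain w where w: "w \<in> \<Phi>" "le w u" "le w v" "res X Y u w f' = res X Y v w f" "res Y Z u w g' = res Y Z v w g"
      using evt_ex[OF evt_conj[OF ef eg]] by blast
    note s = strict_in(1)
    show ?thesis unfolding e ec_class_def
    proof (rule dirsys.cls_eqI[OF xz u(1) _ v _ w(1-3)])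
      show "cm (tm X u) (tm Y u) Z g' (over X Y u f') \<in> arrows (tm X u) Z"
        by (rule Comp_in[OF s[OF X u(1)] s[OF Y u(1)] Z u(3) over_props(1)[OF X Y u(1,2)]])
      show "cm (tm X v) (tm Y v) Z g (over X Y v f) \<in> arrows (tm X v) Z"
        by (rule Comp_in[OF s[OF X v] s[OF Y v] Z g over_props(1)[OF X Y v f]])
      show "res X Z u w (cm (tm X u) (tm Y u) Z g' (over X Y u f')) = res X Z v w (cm (tm X v) (tm Y v) Z g (over X Y v f))"
        unfolding res_comp[OF X Y Z u(1) w(1,2) u(2,3)] res_comp[OF X Y Z v w(1,3) f g] w(4,5) ..
    qed
  qed
  have self: "(v, f) \<in> kl X Y v f" "(v, g) \<in> kl Y Z v g"
    unfolding ec_class_def by (rule dirsys.cls_self[OF xy v f] dirsys.cls_self[OF yz v g])+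
  show ?thesis unfolding ec_quotient_def ecat.simps
  proof (rule the_equality)
    show "\<exists>u f' g'. (u, f') \<in> kl X Y v f \<and> (u, g') \<in> kl Y Z v g \<and>
        kl X Z v (cm (tm X v) (tm Y v) Z g (over X Y v f)) = kl X Z u (cm (tm X u) (tm Y u) Z g' (over X Y u f'))"
      by (rule exI[of _ v], rule exI[of _ f], rule exI[of _ g], intro conjI self refl)
    show "\<psi> = kl X Z v (cm (tm X v) (tm Y v) Z g (over X Y v f))"
      if ex: "\<exists>u f' g'. (u, f') \<in> kl X Y v f \<and> (u, g') \<in> kl Y Z v g \<and>
        \<psi> = kl X Z u (cm (tm X u) (tm Y u) Z g' (over X Y u f'))" for \<psi>
      using ex by (elim exE conjE) (rule uniq)
  qed
qed

lemma Ident_class: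
  assumes X: "X \<in> Objs K" and v: "v \<in> \<Phi>"
  shows "Ident Qt X = kl X X v (pr1 c X v)"
proof -
  interpret XX: dir_sset \<Phi> le "\<lambda>v. Hom K (tm X v) X" "ec_restrict K c X X" by (rule system[OF X X])
  have eq: "kl X X u (pr1 c X u) = kl X X v (pr1 c X v)" if u: "u \<in> \<Phi>" for u
  proof -
    obtain w where w: "w \<in> \<Phi>" "le w u" "le w v" using dir[OF u v] by blast
    show ?thesis unfolding ec_class_def
      by (rule dirsys.cls_eqI[OF XX.dirsys_level u strict_in(2)[OF X u] v strict_in(2)[OF X v] w])
        (simp only: res_pr1[OF X u w(1,2)] res_pr1[OF X v w(1,3)])
  qed
  show ?thesis unfolding ec_quotient_def ecat.simps
    by (rule the_equality, rule bexI[OF refl v], elim bexE) (simp only: eq)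
qed

lemma Hom_Qt: "Hom Qt X Y = colim_sset \<Phi> le (\<lambda>v. Hom K (tm X v) Y) (ec_restrict K c X Y)"
  by (simp add: ec_quotient_def)

abbreviation P1 :: "'a \<Rightarrow> 'a set \<Rightarrow> ('a \<times> 'b \<times> 'a) set" where
  "P1 X v \<equiv> q (tm X v) X (pr1 c X v)"

abbreviation P2 :: "'a \<Rightarrow> 'a set \<Rightarrow> ('a \<times> 'b \<times> 'a) set" where
  "P2 X v \<equiv> q (tm X v) (erep c v) (pr2 c X v)"

abbreviation Ov :: "'a \<Rightarrow> 'a \<Rightarrow> 'a set \<Rightarrow> 'b \<Rightarrow> ('a \<times> 'b \<times> 'a) set" where
  "Ov X Y v f \<equiv> q (tm X v) (tm Y v) (over X Y v f)"

lemma times_hprod: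
  assumes "X \<in> Objs K" "v \<in> \<Phi>"
  shows "hprod (tm X v) (P1 X v) (P2 X v) X (erep c v)"
  by (rule strict_product_hprod[OF strict[OF assms] assms(1) rep_obj[OF assms(2)]])

lemma over_q:
  assumes X: "X \<in> Objs K" and Y: "Y \<in> Objs K" and w: "w \<in> \<Phi>" and f: "f \<in> arrows (tm X w) Y"
  shows "hm (tm X w) (tm Y w) (Ov X Y w f)"
    "cmp (Ov X Y w f) (P1 Y w) = q (tm X w) Y f"
    "cmp (Ov X Y w f) (P2 Y w) = P2 X w"
proof -
  note Xw = strict_in[OF X w] and Yw = strict_in[OF Y w]
  note o = over_props[OF X Y w f]
  show "hm (tm X w) (tm Y w) (Ov X Y w f)" by (rule hm_q[OF Xw(1) Yw(1) o(1)])
  show "cmp (Ov X Y w f) (P1 Y w) = q (tm X w) Y f"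
    unfolding cmp_q[OF Xw(1) Yw(1) Y o(1) Yw(2)] o(2) ..
  show "cmp (Ov X Y w f) (P2 Y w) = P2 X w"
    unfolding cmp_q[OF Xw(1) Yw(1) rep_obj[OF w] o(1) Yw(3)] o(3) ..
qed

text \<open>Maps built by \<open>ec_over\<close> preserve the coordinate in \<open>V\<close>, so
  being inverse has to be tested only on the first coordinate, where it becomes the path required in
  the quotient.\<close>

lemma over_inverse:
  assumes X: "X \<in> Objs K" and Y: "Y \<in> Objs K" and w: "w \<in> \<Phi>" and f: "f \<in> arrows (tm X w) Y" and g: "g \<in> arrows (tm Y w) X"
  shows "cmp (Ov X Y w f) (Ov Y X w g) = hid (tm X w) \<longleftrightarrow>
    path_eq (Hom K (tm X w) X) (cm (tm X w) (tm Y w) X g (over X Y w f)) (pr1 c X w)"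
proof -
  note Xw = strict_in[OF X w] and Yw = strict_in[OF Y w]
  note oF = over_props(1)[OF X Y w f]
  let ?A = "Ov X Y w f" and ?B = "Ov Y X w g"
  let ?p = "P1 X w" and ?r = "P2 X w"
  note A = over_q[OF X Y w f] and B = over_q[OF Y X w g] and H = times_hprod[OF X w]
  have gf: "cmp (cmp ?A ?B) ?p = q (tm X w) X (cm (tm X w) (tm Y w) X g (over X Y w f))"
    unfolding cmp_assoc_all B(2) by (rule cmp_q[OF Xw(1) Yw(1) X oF g])
  have "cmp ?A ?B = hid (tm X w) \<longleftrightarrow> cmp (cmp ?A ?B) ?p = ?p"
  proof
    assume "cmp ?A ?B = hid (tm X w)"
    thus "cmp (cmp ?A ?B) ?p = ?p" by (simp only: cmp_id(1)[OF hprod_hm(1)[OF H]])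
  next
    assume e: "cmp (cmp ?A ?B) ?p = ?p"
    show "cmp ?A ?B = hid (tm X w)"
    proof (rule hprod_eq[OF H hm_cmp[OF A(1) B(1)] hid_hm(1)[OF A(1)]])
      show "cmp (cmp ?A ?B) ?p = cmp (hid (tm X w)) ?p" unfolding e cmp_id(1)[OF hprod_hm(1)[OF H]] ..
      show "cmp (cmp ?A ?B) ?r = cmp (hid (tm X w)) ?r"
        unfolding cmp_assoc_all B(3) A(3) cmp_id(1)[OF hprod_hm(2)[OF H]] ..
    qed
  qed
  thus ?thesis unfolding gf q_eq[OF Xw(1) X Comp_in[OF Xw(1) Yw(1) X g oF] Xw(2)] .
qed

text \<open>An arbitrary inverse in the homotopy category automatically preserves the coordinate in
  \<open>V\<close>. It is therefore the class of \<open>over Y X w g\<close> for its own first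
  component \<open>g\<close>, the kind of inverse that a map of the quotient has.\<close>

lemma over_hiso:
  assumes X: "X \<in> Objs K" and Y: "Y \<in> Objs K" and w: "w \<in> \<Phi>" and f: "f \<in> arrows (tm X w) Y"
  shows "hiso (tm X w) (tm Y w) (Ov X Y w f) \<longleftrightarrow>
    (\<exists>g\<in>arrows (tm Y w) X. path_eq (Hom K (tm X w) X) (cm (tm X w) (tm Y w) X g (over X Y w f)) (pr1 c X w) \<and>
       path_eq (Hom K (tm Y w) Y) (cm (tm Y w) (tm X w) Y f (over Y X w g)) (pr1 c Y w))"
    (is "?L \<longleftrightarrow> (\<exists>g\<in>_. ?R g)")
proof
  note Xw = strict_in[OF X w] and Yw = strict_in[OF Y w]
  assume ?L
  then obtain B where B: "hm (tm Y w) (tm X w) B" "cmp (Ov X Y w f) B = hid (tm X w)"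
    "cmp B (Ov X Y w f) = hid (tm Y w)" unfolding hiso_def by blast
  obtain G where G: "G \<in> arrows (tm Y w) (tm X w)" "B = q (tm Y w) (tm X w) G" using hm_D[OF B(1)] by blast
  define g where "g = cm (tm Y w) (tm X w) X (pr1 c X w) G"
  have g: "g \<in> arrows (tm Y w) X" unfolding g_def by (rule Comp_in[OF Yw(1) Xw(1) X Xw(2) G(1)])
  let ?A = "Ov X Y w f" and ?r = "P2 X w" and
    ?s = "P2 Y w"
  \<comment> \<open>The second projection of \<open>X\<close> is the composite of \<open>?A\<close>
    with that of \<open>Y\<close>, and \<open>B\<close> cancels \<open>?A\<close>.\<close>
  have Br: "cmp B ?r = ?s"
  proof -
    have "cmp B ?r = cmp (cmp B ?A) ?s" unfolding cmp_assoc_all over_q(3)[OF X Y w f] ..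
    thus ?thesis unfolding B(3) using cmp_id(1)[OF hprod_hm(2)[OF times_hprod[OF Y w]]] by simp
  qed
  have "Ov Y X w g = B"
  proof (rule hprod_eq[OF times_hprod[OF X w] over_q(1)[OF Y X w g] B(1)])
    show "cmp (Ov Y X w g) (P1 X w) = cmp B (P1 X w)"
      unfolding over_q(2)[OF Y X w g] unfolding G(2) cmp_q[OF Yw(1) Xw(1) X G(1) Xw(2)] g_def ..
    show "cmp (Ov Y X w g) ?r = cmp B ?r" unfolding over_q(3)[OF Y X w g] Br ..
  qed
  note e = this
  have "?R g"
    by (intro conjI over_inverse[OF X Y w f g, THEN iffD1] over_inverse[OF Y X w g f, THEN iffD1]) (simp_all only: e B)
  thus "\<exists>g\<in>arrows (tm Y w) X. ?R g" using g by (intro bexI)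
next
  assume "\<exists>g\<in>arrows (tm Y w) X. ?R g"
  then obtain g where g: "g \<in> arrows (tm Y w) X" "?R g" by (elim bexE)
  show ?L unfolding hiso_def
    by (intro conjI exI[of _ "Ov Y X w g"] over_q(1)[OF X Y w f] over_q(1)[OF Y X w g(1)]
        over_inverse[OF X Y w f g(1), THEN iffD2] over_inverse[OF Y X w g(1) f, THEN iffD2] g(2)[THEN conjunct1] g(2)[THEN conjunct2])
qed

text \<open>An inverse in the quotient and its two paths are represented at one stage, where by
  \<open>over_hiso\<close> they say that the restricted map over that stage is invertible;
  conversely the data at a stage map to the colimit.\<close>

lemma quotient_stage:
  assumes X: "X \<in> Objs K" and Y: "Y \<in> Objs K" and v: "v \<in> \<Phi>" and f: "f \<in> arrows (tm X v) Y"
  shows "ec_equiv Qt X Y (kl X Y v f) \<longleftrightarrow>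
    (\<exists>w\<in>\<Phi>. le w v \<and> hiso (tm X w) (tm Y w) (Ov X Y w (res X Y v w f)))"
proof -
  interpret XX: dir_sset \<Phi> le "\<lambda>v. Hom K (tm X v) X" "ec_restrict K c X X" by (rule system[OF X X])
  interpret XY: dir_sset \<Phi> le "\<lambda>v. Hom K (tm X v) Y" "ec_restrict K c X Y" by (rule system[OF X Y])
  interpret YX: dir_sset \<Phi> le "\<lambda>v. Hom K (tm Y v) X" "ec_restrict K c Y X" by (rule system[OF Y X])
  interpret YY: dir_sset \<Phi> le "\<lambda>v. Hom K (tm Y v) Y" "ec_restrict K c Y Y" by (rule system[OF Y Y])
  have equiv: "ec_equiv Qt X Y (kl X Y u h) \<longleftrightarrow> (\<exists>k\<in>Smp (Hom Qt Y X) 0.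
      path_eq (Hom Qt X X) (Comp Qt X Y X 0 k (kl X Y u h)) (Ident Qt X) \<and>
      path_eq (Hom Qt Y Y) (Comp Qt Y X Y 0 (kl X Y u h) k) (Ident Qt Y))"
    if u: "u \<in> \<Phi>" and h: "h \<in> arrows (tm X u) Y" for u h
  proof -
    have "kl X Y u h \<in> Smp (Hom Qt X Y) 0" unfolding Hom_Qt XY.Q_Smp ec_class_def using u h by blast
    thus ?thesis unfolding ec_equiv_def path_eq_def by blast
  qed
  have kl_eq: "kl X Y w (res X Y v w f) = kl X Y v f" if w: "w \<in> \<Phi>" "le w v" for w
    unfolding ec_class_def by (rule dirsys.cls_restrict[OF XY.dirsys_level v f w])
  show ?thesis
  proof
    assume "ec_equiv Qt X Y (kl X Y v f)"
    then obtain k where k: "k \<in> Smp (Hom Qt Y X) 0"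
      "path_eq (Hom Qt X X) (Comp Qt X Y X 0 k (kl X Y v f)) (Ident Qt X)"
      "path_eq (Hom Qt Y Y) (Comp Qt Y X Y 0 (kl X Y v f) k) (Ident Qt Y)"
      unfolding equiv[OF v f] by (elim bexE conjE)
    obtain u g where u: "u \<in> \<Phi>" "g \<in> arrows (tm Y u) X" and kg: "k = kl Y X u g"
      using k(1) unfolding Hom_Qt YX.Q_Smp ec_class_def by blast
    obtain w where w: "w \<in> \<Phi>" and l: "le w v" "le w u" using dir[OF v u(1)] by blast
    define f0 where "f0 = res X Y v w f"
    define g0 where "g0 = res Y X u w g"
    have f0: "f0 \<in> arrows (tm X w) Y" unfolding f0_def by (rule res_in[OF X Y v w l(1) f])
    have g0: "g0 \<in> arrows (tm Y w) X" unfolding g0_def by (rule res_in[OF Y X u(1) w l(2) u(2)])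
    have kf: "kl X Y v f = kl X Y w f0" unfolding f0_def by (rule kl_eq[OF w l(1), symmetric])
    have kg0: "k = kl Y X w g0" unfolding kg g0_def ec_class_def
      by (rule dirsys.cls_restrict[OF YX.dirsys_level u w l(2), symmetric])
    note Xw = strict_in[OF X w] and Yw = strict_in[OF Y w]
    let ?a = "cm (tm X w) (tm Y w) X g0 (over X Y w f0)" and ?b = "cm (tm Y w) (tm X w) Y f0 (over Y X w g0)"
    have a: "?a \<in> arrows (tm X w) X" by (rule Comp_in[OF Xw(1) Yw(1) X g0 over_props(1)[OF X Y w f0]])
    have b: "?b \<in> arrows (tm Y w) Y" by (rule Comp_in[OF Yw(1) Xw(1) Y f0 over_props(1)[OF Y X w g0]])
    have "path_eq (Hom Qt X X) (kl X X w ?a) (kl X X w (pr1 c X w))" "path_eq (Hom Qt Y Y) (kl Y Y w ?b) (kl Y Y w (pr1 c Y w))"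
      using k(2,3) unfolding kf kg0 Comp_class[OF X Y X w f0 g0] Comp_class[OF Y X Y w g0 f0] Ident_class[OF X w] Ident_class[OF Y w] .
    note E = XX.path_stage[OF w a Xw(2) this(1)[unfolded Hom_Qt ec_class_def]]
      YY.path_stage[OF w b Yw(2) this(2)[unfolded Hom_Qt ec_class_def]]
    obtain x where x: "x \<in> \<Phi>" "le x w"
      "path_eq (Hom K (tm X x) X) (res X X w x ?a) (res X X w x (pr1 c X w))"
      "path_eq (Hom K (tm Y x) Y) (res Y Y w x ?b) (res Y Y w x (pr1 c Y w))"
      using evt_ex[OF evt_conj[OF E]] by blast
    note xv = le_trans[OF x(1) w v x(2) l(1)]
    have fx: "res X Y w x f0 = res X Y v x f"
      unfolding f0_def by (rule XY.t_comp[OF v w x(1) l(1) x(2) f])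
    have fin: "res X Y v x f \<in> arrows (tm X x) Y" by (rule res_in[OF X Y v x(1) xv f])
    have gin: "res Y X w x g0 \<in> arrows (tm Y x) X" by (rule res_in[OF Y X w x(1,2) g0])
    note x(3)[unfolded res_comp[OF X Y X w x(1,2) f0 g0] fx res_pr1[OF X w x(1,2)]]
      x(4)[unfolded res_comp[OF Y X Y w x(1,2) g0 f0] fx res_pr1[OF Y w x(1,2)]]
    hence "hiso (tm X x) (tm Y x) (Ov X Y x (res X Y v x f))"
      unfolding over_hiso[OF X Y x(1) fin] by (intro bexI[OF _ gin] conjI)
    thus "\<exists>w\<in>\<Phi>. le w v \<and> hiso (tm X w) (tm Y w) (Ov X Y w (res X Y v w f))"
      using x(1) xv by blast
  next
    assume "\<exists>w\<in>\<Phi>. le w v \<and> hiso (tm X w) (tm Y w) (Ov X Y w (res X Y v w f))"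
    then obtain w where w: "w \<in> \<Phi>" "le w v" and
      iso: "hiso (tm X w) (tm Y w) (Ov X Y w (res X Y v w f))" by blast
    define f0 where "f0 = res X Y v w f"
    have f0: "f0 \<in> arrows (tm X w) Y" unfolding f0_def by (rule res_in[OF X Y v w f])
    obtain g where g: "g \<in> arrows (tm Y w) X"
      "path_eq (Hom K (tm X w) X) (cm (tm X w) (tm Y w) X g (over X Y w f0)) (pr1 c X w)"
      "path_eq (Hom K (tm Y w) Y) (cm (tm Y w) (tm X w) Y f0 (over Y X w g)) (pr1 c Y w)"
      using iso[folded f0_def, unfolded over_hiso[OF X Y w(1) f0]] by (elim bexE conjE)
    have gQ: "kl Y X w g \<in> Smp (Hom Qt Y X) 0" unfolding Hom_Qt YX.Q_Smp ec_class_def using w g by blast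
    have "ec_equiv Qt X Y (kl X Y w f0)"
      unfolding equiv[OF w(1) f0] Ident_class[OF X w(1)] Ident_class[OF Y w(1)]
    proof (rule bexI[OF _ gQ], unfold Comp_class[OF X Y X w(1) f0 g(1)] Comp_class[OF Y X Y w(1) g(1) f0], rule conjI)
      show "path_eq (Hom Qt X X) (kl X X w (cm (tm X w) (tm Y w) X g (over X Y w f0))) (kl X X w (pr1 c X w))"
        unfolding Hom_Qt ec_class_def by (rule path_eq_map[OF XX.cln_map[OF w(1)] g(2)])
      show "path_eq (Hom Qt Y Y) (kl Y Y w (cm (tm Y w) (tm X w) Y f0 (over Y X w g))) (kl Y Y w (pr1 c Y w))"
        unfolding Hom_Qt ec_class_def by (rule path_eq_map[OF YY.cln_map[OF w(1)] g(3)])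
    qed
    thus "ec_equiv Qt X Y (kl X Y v f)" unfolding f0_def kl_eq[OF w] .
  qed
qed

lemma square:
  assumes X: "X \<in> Objs K" and Y: "Y \<in> Objs K" and v: "v \<in> \<Phi>" and f: "f \<in> arrows (tm X v) Y" and w: "w \<in> \<Phi>" "le w v"
  shows "over_square karr kT kid X Y (erep c v) (erep c w) (tm X v) (tm Y v) (tm X w) (tm Y w)
    (P1 X v) (P2 X v) (P1 Y v) (P2 Y v)
    (P1 X w) (P2 X w) (P1 Y w) (P2 Y w)
    (q (erep c w) (erep c v) (incl c w v)) (q (tm X w) (tm X v) (times_incl X v w)) (q (tm X v) Y f)
    (Ov X Y v f) (Ov X Y w (res X Y v w f))"
proof
  note Xv = strict_in[OF X v] and Xw = strict_in[OF X w(1)]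
  note r = rep_obj[OF v] rep_obj[OF w(1)] and i = times_incl_props[OF X v w] and inc = incl_in[OF v w]
  note rf = res_in[OF X Y v w f]
  show "hprod (tm X v) (P1 X v) (P2 X v) X (erep c v)" by (rule times_hprod[OF X v])
  show "hprod (tm Y v) (P1 Y v) (P2 Y v) Y (erep c v)" by (rule times_hprod[OF Y v])
  show "hprod (tm X w) (P1 X w) (P2 X w) X (erep c w)" by (rule times_hprod[OF X w(1)])
  show "hprod (tm Y w) (P1 Y w) (P2 Y w) Y (erep c w)" by (rule times_hprod[OF Y w(1)])
  show "hm (erep c w) (erep c v) (q (erep c w) (erep c v) (incl c w v))" by (rule hm_q[OF r(2,1) inc])
  show "hm (tm X w) (tm X v) (q (tm X w) (tm X v) (times_incl X v w))" by (rule hm_q[OF Xw(1) Xv(1) i(1)])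
  show "cmp (q (tm X w) (tm X v) (times_incl X v w)) (P1 X v) = P1 X w"
    unfolding cmp_q[OF Xw(1) Xv(1) X i(1) Xv(2)] i(2) ..
  show "cmp (q (tm X w) (tm X v) (times_incl X v w)) (P2 X v) =
      cmp (P2 X w) (q (erep c w) (erep c v) (incl c w v))"
    unfolding cmp_q[OF Xw(1) Xv(1) r(1) i(1) Xv(3)] cmp_q[OF Xw(1) r(2,1) Xw(3) inc] i(3) ..
  show "hm (tm X v) Y (q (tm X v) Y f)" by (rule hm_q[OF Xv(1) Y f])
  show "hm (tm X v) (tm Y v) (Ov X Y v f)" by (rule over_q[OF X Y v f])
  show "cmp (Ov X Y v f) (P1 Y v) = q (tm X v) Y f" by (rule over_q[OF X Y v f])
  show "cmp (Ov X Y v f) (P2 Y v) = P2 X v"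
    by (rule over_q[OF X Y v f])
  show "hm (tm X w) (tm Y w) (Ov X Y w (res X Y v w f))" by (rule over_q[OF X Y w(1) rf])
  show "cmp (Ov X Y w (res X Y v w f)) (P1 Y w) =
      cmp (q (tm X w) (tm X v) (times_incl X v w)) (q (tm X v) Y f)"
    unfolding over_q(2)[OF X Y w(1) rf] cmp_q[OF Xw(1) Xv(1) Y i(1) f] unfolding restrict_0[OF X Y v w] ..
  show "cmp (Ov X Y w (res X Y v w f)) (P2 Y w) =
      P2 X w"
    by (rule over_q[OF X Y w(1) rf])
qed

text \<open>The map compared with is a product with \<open>u\<close> of a map that already lives
  over \<open>v\<close>. A stage \<open>w\<close> with invertible restriction serves as
  \<open>u\<close> itself, while a given \<open>u\<close> is first replaced by an element below both
  \<open>v\<close> and \<open>u\<close>.\<close>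

lemma ec_quotient_equiv:
  assumes X: "X \<in> Objs K" and Y: "Y \<in> Objs K" and f: "f \<in> Smp (Hom Qt X Y) 0" and m: "(v, fv) \<in> f"
  shows "ec_equiv Qt X Y f \<longleftrightarrow>
    (\<exists>u\<in>\<Phi>. ec_equiv K (tm (tm X v) u) (tm (tm Y v) u) (ec_times_id K c (tm X v) (tm Y v) (over X Y v fv) u))"
proof -
  interpret XY: dir_sset \<Phi> le "\<lambda>v. Hom K (tm X v) Y" "ec_restrict K c X Y" by (rule system[OF X Y])
  obtain v0 a0 where a0: "v0 \<in> \<Phi>" "a0 \<in> arrows (tm X v0) Y" and fa: "f = kl X Y v0 a0"
    using f unfolding Hom_Qt XY.Q_Smp ec_class_def by blast
  note m' = m[unfolded fa ec_class_def]
  have v: "v \<in> \<Phi>" and fv: "fv \<in> arrows (tm X v) Y"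
    using dirsys.cls_mem_sym[OF XY.dirsys_level a0 m'] by simp_all
  have fk: "f = kl X Y v fv"
    unfolding fa ec_class_def by (rule dirsys.cls_mem_eq[OF XY.dirsys_level a0 m', symmetric])
  let ?XU = "tm (tm X v)" and ?YU = "tm (tm Y v)"
  let ?E = "\<lambda>u. ec_times_id K c (tm X v) (tm Y v) (over X Y v fv) u"
  let ?G = "\<lambda>u. q (?XU u) (?YU u) (?E u)"
  note Xv = strict_in[OF X v] and Yv = strict_in[OF Y v]
  note ov = over_props[OF X Y v fv]
  let ?F = "Ov X Y v fv"
  have E: "?E u \<in> arrows (?XU u) (?YU u)"
    "cmp (?G u) (P1 (tm Y v) u) = cmp (P1 (tm X v) u) ?F"
    "cmp (?G u) (P2 (tm Y v) u) = P2 (tm X v) u" if u: "u \<in> \<Phi>" for u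
  proof -
    note U = strict_in[OF Xv(1) u] and U' = strict_in[OF Yv(1) u]
    note c = Comp_in[OF U(1) Xv(1) Yv(1) ov(1) U(2)]
    note p = pair_props[OF U(1) Yv(1) u c U(3), folded ec_times_id_def]
    show "?E u \<in> arrows (?XU u) (?YU u)" by (rule p)
    show "cmp (?G u) (P1 (tm Y v) u) = cmp (P1 (tm X v) u) ?F"
      unfolding cmp_q[OF U(1) U'(1) Yv(1) p(1) U'(2)] p(2) cmp_q[OF U(1) Xv(1) Yv(1) U(2) ov(1)] ..
    show "cmp (?G u) (P2 (tm Y v) u) = P2 (tm X v) u"
      unfolding cmp_q[OF U(1) U'(1) rep_obj[OF u] p(1) U'(3)] p(3) ..
  qed
  have eq: "ec_equiv K (?XU u) (?YU u) (?E u) \<longleftrightarrow> hiso (?XU u) (?YU u) (?G u)" if u: "u \<in> \<Phi>" for u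
    by (rule ec_equiv_hiso[OF strict_in(1)[OF Xv(1) u] strict_in(1)[OF Yv(1) u] E(1)[OF u]])
  show ?thesis unfolding fk quotient_stage[OF X Y v fv]
  proof
    assume "\<exists>w\<in>\<Phi>. le w v \<and> hiso (tm X w) (tm Y w) (Ov X Y w (res X Y v w fv))"
    then obtain w where w: "w \<in> \<Phi>" "le w v" and
      iso: "hiso (tm X w) (tm Y w) (Ov X Y w (res X Y v w fv))" by blast
    note hE = hm_q[OF strict_in(1)[OF Xv(1) w(1)] strict_in(1)[OF Yv(1) w(1)] E(1)[OF w(1)]]
    have "hiso (?XU w) (?YU w) (?G w)"
      by (rule over_square.iso_extend[OF square[OF X Y v fv w] times_hprod[OF Xv(1) w(1)] times_hprod[OF Yv(1) w(1)] hE E(2,3)[OF w(1)] iso])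
        (rule subobject_unique[OF rep_sub[OF v]])
    thus "\<exists>u\<in>\<Phi>. ec_equiv K (?XU u) (?YU u) (?E u)"
      using w(1) eq by blast
  next
    assume "\<exists>u\<in>\<Phi>. ec_equiv K (?XU u) (?YU u) (?E u)"
    then obtain u where u: "u \<in> \<Phi>" and
      "ec_equiv K (?XU u) (?YU u) (?E u)" by (elim bexE)
    hence iso: "hiso (?XU u) (?YU u) (?G u)"
      by (simp only: eq)
    obtain w where w: "w \<in> \<Phi>" "le w v" and wu: "le w u" using dir[OF v u] by blast
    have "hiso (tm X w) (tm Y w) (Ov X Y w (res X Y v w fv))"
      by (rule over_square.iso_restrict[OF square[OF X Y v fv w] times_hprod[OF Xv(1) u] times_hprod[OF Yv(1) u]
            hm_q[OF rep_obj[OF w(1)] rep_obj[OF u] incl_in[OF u w(1) wu]] iso E(2,3)[OF u]])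
    thus "\<exists>w\<in>\<Phi>. le w v \<and> hiso (tm X w) (tm Y w) (Ov X Y w (res X Y v w fv))" using w by blast
  qed
qed

end

theorem theorem4p6:
  fixes C :: "'a sset" and \<Phi>\<^sub>C :: "'a set set" and rep\<^sub>C :: "'a set \<Rightarrow> 'a"
    and t\<^sub>C :: "'a set \<Rightarrow> 'a set \<Rightarrow> nat \<Rightarrow> 'a \<Rightarrow> 'a"
    and K :: "('o, 'm) ecat" and \<Phi>\<^sub>K :: "'o set set" and c :: "('o, 'm) ec_choice"
    and W :: "'b bsset" and \<Phi>\<^sub>W :: "'b set set" and rep\<^sub>W :: "'b set \<Rightarrow> 'b"
    and t\<^sub>W :: "'b set \<Rightarrow> 'b set \<Rightarrow> nat \<Rightarrow> nat \<Rightarrow> (nat list \<times> nat list \<Rightarrow> 'b) \<Rightarrow> (nat list \<times> nat list \<Rightarrow> 'b)"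
  shows
    "(quasi_category C \<and> qc_finitely_complete C \<and> qc_filter C \<Phi>\<^sub>C \<and> qc_diagram C \<Phi>\<^sub>C rep\<^sub>C t\<^sub>C \<longrightarrow>
        (\<forall>f\<in>Smp (qc_quotient C \<Phi>\<^sub>C rep\<^sub>C t\<^sub>C) 1. \<forall>(v, f\<^sub>v)\<in>f.
           qc_equiv (qc_quotient C \<Phi>\<^sub>C rep\<^sub>C t\<^sub>C) f \<longleftrightarrow>
           (\<exists>u\<in>\<Phi>\<^sub>C. \<exists>h. qc_times_id C (qc_forget C 1 f\<^sub>v) (rep\<^sub>C u) h \<and> qc_equiv C h))) \<and>
     (kan_enriched K \<and> ec_finitely_complete K \<and> ec_filter K \<Phi>\<^sub>K \<and> ec_diagram K \<Phi>\<^sub>K c \<longrightarrow>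
        (\<forall>X\<in>Objs K. \<forall>Y\<in>Objs K. \<forall>f\<in>Smp (Hom (ec_quotient K \<Phi>\<^sub>K c) X Y) 0. \<forall>(v, f\<^sub>v)\<in>f.
           ec_equiv (ec_quotient K \<Phi>\<^sub>K c) X Y f \<longleftrightarrow>
           (\<exists>u\<in>\<Phi>\<^sub>K. ec_equiv K (etimes c (etimes c X v) u) (etimes c (etimes c Y v) u)
              (ec_times_id K c (etimes c X v) (etimes c Y v) (ec_over K c X Y v 0 f\<^sub>v) u)))) \<and>
     (complete_segal_space W \<and> css_finitely_complete W \<and> css_filter W \<Phi>\<^sub>W \<and>
        css_diagram W \<Phi>\<^sub>W rep\<^sub>W t\<^sub>W \<longrightarrow>
        (\<forall>f\<in>BSmp (css_quotient W \<Phi>\<^sub>W rep\<^sub>W t\<^sub>W) 1 0. \<forall>(v, f\<^sub>v)\<in>f.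
           css_equiv (css_quotient W \<Phi>\<^sub>W rep\<^sub>W t\<^sub>W) f \<longleftrightarrow>
           (\<exists>u\<in>\<Phi>\<^sub>W. \<exists>h. css_times_id W (css_forget 1 f\<^sub>v) (rep\<^sub>W u) h \<and> css_equiv W h)))"
proof (intro conjI impI ballI; (elim conjE)?; (clarify)?)
  fix f v f\<^sub>v
  assume "quasi_category C" "qc_finitely_complete C" "qc_filter C \<Phi>\<^sub>C" "qc_diagram C \<Phi>\<^sub>C rep\<^sub>C t\<^sub>C"
    "f \<in> Smp (qc_quotient C \<Phi>\<^sub>C rep\<^sub>C t\<^sub>C) 1" "(v, f\<^sub>v) \<in> f"
  thus "qc_equiv (qc_quotient C \<Phi>\<^sub>C rep\<^sub>C t\<^sub>C) f \<longleftrightarrow>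
    (\<exists>u\<in>\<Phi>\<^sub>C. \<exists>h. qc_times_id C (qc_forget C 1 f\<^sub>v) (rep\<^sub>C u) h \<and> qc_equiv C h)"
    by (intro quasicat.qc_quotient_equiv quasicat.intro)
next
  fix X Y f v f\<^sub>v
  assume K: "kan_enriched K" "ec_filter K \<Phi>\<^sub>K" "ec_diagram K \<Phi>\<^sub>K c"
    and f: "X \<in> Objs K" "Y \<in> Objs K" "f \<in> Smp (Hom (ec_quotient K \<Phi>\<^sub>K c) X Y) 0" "(v, f\<^sub>v) \<in> f"
  interpret kan_filter K \<Phi>\<^sub>K c
    using K by unfold_locales
  show "ec_equiv (ec_quotient K \<Phi>\<^sub>K c) X Y f \<longleftrightarrow>
    (\<exists>u\<in>\<Phi>\<^sub>K. ec_equiv K (etimes c (etimes c X v) u) (etimes c (etimes c Y v) u)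
      (ec_times_id K c (etimes c X v) (etimes c Y v) (ec_over K c X Y v 0 f\<^sub>v) u))"
    by (rule ec_quotient_equiv[OF f])
next
  fix f v f\<^sub>v
  assume "complete_segal_space W" "css_finitely_complete W" "css_filter W \<Phi>\<^sub>W" "css_diagram W \<Phi>\<^sub>W rep\<^sub>W t\<^sub>W"
    "f \<in> BSmp (css_quotient W \<Phi>\<^sub>W rep\<^sub>W t\<^sub>W) 1 0" "(v, f\<^sub>v) \<in> f"
  thus "css_equiv (css_quotient W \<Phi>\<^sub>W rep\<^sub>W t\<^sub>W) f \<longleftrightarrow>
    (\<exists>u\<in>\<Phi>\<^sub>W. \<exists>h. css_times_id W (css_forget 1 f\<^sub>v) (rep\<^sub>W u) h \<and> css_equiv W h)"
    by (intro segal.css_quotient_equiv segal.intro) (simp_all add: complete_segal_space_def)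
qed

end
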